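(* Let $X_n$ be the number of catastrophes of a random excursion with catastrophes of length $n$, i.e. $\Pr(X_n=k)=[z^nv^k]C(z,v)/[z^n]C(z,1)$ where $C(z,v)=\frac{E(z)}{1-vQ(z)}$. Then: (1) If $\rho_0<\rho$, then with $\mu=\frac{1}{\rho_0Q'(\rho_0)}$ and $\sigma^2=\frac{\rho_0Q''(\rho_0)+Q'(\rho_0)-\rho_0Q'(\rho_0)^2}{\rho_0^2Q'(\rho_0)^3}$, the variable $\frac{X_n-\mu n}{\sigma\sqrt n}$ converges in law to a standard Gaussian $\mathcal N(0,1)$. (2) If $\rho_0=\rho$, then $\frac{X_n}{\vartheta\sqrt n}$ with $\vartheta=\frac{\sqrt2}{\eta}$ converges in law to a Rayleigh distribution, i.e. $\lim_{n\to\infty}\Pr\big(\frac{X_n}{\vartheta\sqrt n}\le x\big)=1-e^{-x^2/2}$; in particular $\mathbb E(X_n)\sim\frac1\eta\sqrt{\pi n}$. (3) If $\rho_0$ does not exist, then \[\Pr(X_n=k)=\frac{(k\eta/\lambda+C/\tau)\lambda^k}{\eta D(\rho)^2+(C/\tau)D(\rho)}\Big(1+O\big(\tfrac1n\big)\Big),\] where $\lambda=Q(\rho)$ and $C=\sqrt{2P(\tau)/P''(\tau)}$.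
   Context: Fix integers $c,d\ge1$ and non-negative real weights $p_{-c},\dots,p_d$ with $p_{-c}\neq0\neq p_d$; jump set $\mathcal J=\{i: p_i\neq0\}$, jump polynomial $P(u)=\sum_{i=-c}^dp_iu^i$. Standing assumption: $P$ is aperiodic (there are no integer $b$, integer $p\ge2$ and Laurent polynomial $H$ with $P(u)=u^bH(u^p)$). A catastrophe is a step from an altitude $h>0$ with $-h\notin\mathcal J$ directly to altitude $0$, of weight $q>0$. Paths start at altitude $0$; each step is a jump $i\in\mathcal J$ (weight $p_i$) or a catastrophe; the weight of a path is the product of its step weights; random paths are drawn with probability proportional to weight. Meanders never go below $0$; excursions are meanders ending at $0$. Let $M(z,u)=\sum m_{n,k}z^nu^k$, with $m_{n,k}$ the total weight of catastrophe-free meanders of length $n$ ending at altitude $k$; $M_k(z)=[u^k]M(z,u)$, $M(z)=M(z,1)$, $E(z)=M_0(z)$. Let $Q(z)=zq\big(M(z)-E(z)-\sum_{j>0,-j\in\mathcal J}M_j(z)\big)$ and $D(z)=1/(1-Q(z))$. Let $\tau>0$ be the minimal positive real solution of $P'(\tau)=0$ and $\rho=1/P(\tau)$. Let $\rho_0$ be the smallest positive real zero of $1-Q(z)$ satisfying $\rho_0\le\rho$, if it exists ("$\rho_0$ does not exist" otherwise). In the cases $\rho_0=\rho$ or $\rho_0$ nonexistent, $\eta$ is defined by the Puiseux expansion $Q(z)=Q(\rho)-\eta\sqrt{1-z/\rho}+O(1-z/\rho)$ as $z\to\rho$. *)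

theory Defs
  imports "HOL-Analysis.Analysis" "HOL-Probability.Distributions"
    "HOL-Computational_Algebra.Formal_Power_Series" "HOL-Library.Landau_Symbols"
begin

text \<open>Jump weights are a function p :: int => real (p i = weight of jump i).\<close>

definition jump_set :: "(int \<Rightarrow> real) \<Rightarrow> int set" where
  "jump_set p = {i. p i \<noteq> 0}"

definition jump_poly :: "nat \<Rightarrow> nat \<Rightarrow> (int \<Rightarrow> real) \<Rightarrow> real \<Rightarrow> real" where
  "jump_poly c d p u = (\<Sum>i\<in>{- int c..int d}. p i * u powi i)"

text \<open>Aperiodicity: there are no integer b, integer per >= 2 and Laurent polynomial H
  (finitely supported coefficient function h) with P(u) = u^b H(u^per), written
  coefficientwise.\<close>
definition aperiodic :: "(int \<Rightarrow> real) \<Rightarrow> bool" where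
  "aperiodic p \<longleftrightarrow> \<not> (\<exists>(b::int) (per::int) (h::int \<Rightarrow> real).
      per \<ge> 2 \<and> finite {j. h j \<noteq> 0} \<and>
      (\<forall>i. p i = (if per dvd (i - b) then h ((i - b) div per) else 0)))"

definition is_meander :: "(int \<Rightarrow> real) \<Rightarrow> int list \<Rightarrow> bool" where
  "is_meander p xs \<longleftrightarrow> set xs \<subseteq> jump_set p \<and> (\<forall>j\<le>length xs. 0 \<le> sum_list (take j xs))"

definition meanders :: "(int \<Rightarrow> real) \<Rightarrow> nat \<Rightarrow> int list set" where
  "meanders p n = {xs. length xs = n \<and> is_meander p xs}"

definition mcoef :: "(int \<Rightarrow> real) \<Rightarrow> nat \<Rightarrow> nat \<Rightarrow> real" where
  "mcoef p n k = (\<Sum>xs\<in>{xs\<in>meanders p n. sum_list xs = int k}. prod_list (map p xs))"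

definition Mtot :: "(int \<Rightarrow> real) \<Rightarrow> nat \<Rightarrow> real" where
  "Mtot p n = (\<Sum>xs\<in>meanders p n. prod_list (map p xs))"

definition Ecoef :: "(int \<Rightarrow> real) \<Rightarrow> nat \<Rightarrow> real" where
  "Ecoef p n = mcoef p n 0"

text \<open>[z^n] Q(z), with Q(z) = z q (M(z) - E(z) - sum_{j>0, -j in J} M_j(z)).\<close>
definition Qcoef :: "(int \<Rightarrow> real) \<Rightarrow> real \<Rightarrow> nat \<Rightarrow> real" where
  "Qcoef p q n = (case n of 0 \<Rightarrow> 0
     | Suc m \<Rightarrow> q * (Mtot p m - Ecoef p m
                    - (\<Sum>j\<in>{j::nat. j > 0 \<and> - int j \<in> jump_set p}. mcoef p m j)))"

definition Efps :: "(int \<Rightarrow> real) \<Rightarrow> real fps" where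
  "Efps p = Abs_fps (Ecoef p)"

definition Qfps :: "(int \<Rightarrow> real) \<Rightarrow> real \<Rightarrow> real fps" where
  "Qfps p q = Abs_fps (Qcoef p q)"

definition Qfun :: "(int \<Rightarrow> real) \<Rightarrow> real \<Rightarrow> real \<Rightarrow> real" where
  "Qfun p q z = (\<Sum>n. Qcoef p q n * z ^ n)"

text \<open>Pr(X_n = k) = [z^n v^k] C(z,v) / [z^n] C(z,1), C(z,v) = E(z)/(1 - v Q(z)),
  i.e. [z^n v^k] C(z,v) = [z^n] E(z) Q(z)^k.\<close>
definition cat_prob :: "(int \<Rightarrow> real) \<Rightarrow> real \<Rightarrow> nat \<Rightarrow> nat \<Rightarrow> real" where
  "cat_prob p q n k = fps_nth (Efps p * Qfps p q ^ k) n
                      / fps_nth (Efps p * inverse (1 - Qfps p q)) n"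

definition tau :: "nat \<Rightarrow> nat \<Rightarrow> (int \<Rightarrow> real) \<Rightarrow> real" where
  "tau c d p = (THE t. 0 < t \<and> deriv (jump_poly c d p) t = 0 \<and>
                 (\<forall>s. 0 < s \<and> s < t \<longrightarrow> deriv (jump_poly c d p) s \<noteq> 0))"

definition rho :: "nat \<Rightarrow> nat \<Rightarrow> (int \<Rightarrow> real) \<Rightarrow> real" where
  "rho c d p = 1 / jump_poly c d p (tau c d p)"

definition is_rho0 :: "nat \<Rightarrow> nat \<Rightarrow> (int \<Rightarrow> real) \<Rightarrow> real \<Rightarrow> real \<Rightarrow> bool" where
  "is_rho0 c d p q r \<longleftrightarrow> 0 < r \<and> r \<le> rho c d p \<and> 1 - Qfun p q r = 0 \<and>
      (\<forall>z. 0 < z \<and> z < r \<longrightarrow> 1 - Qfun p q z \<noteq> 0)"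

definition eta :: "nat \<Rightarrow> nat \<Rightarrow> (int \<Rightarrow> real) \<Rightarrow> real \<Rightarrow> real" where
  "eta c d p q = (THE e. (\<lambda>z. Qfun p q z - (Qfun p q (rho c d p) - e * sqrt (1 - z / rho c d p)))
                     \<in> O[at_left (rho c d p)](\<lambda>z. 1 - z / rho c d p))"

definition std_gauss_cdf :: "real \<Rightarrow> real" where
  "std_gauss_cdf x = measure (density lborel std_normal_density) {..x}"

end

theory Submission
  imports Defs "HOL-Complex_Analysis.Complex_Analysis" "HOL-Probability.Probability"
    "HOL-Computational_Algebra.Formal_Laurent_Series"
begin

text \<open>
  Tilting the weights to \<open>p\<^sub>i \<tau>\<^sup>i / P(\<tau>)\<close> turns the walk into an aperiodic centred one and moves \<open>\<rho>\<close> to 1.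
  By a differentiated Spitzer identity, the series \<open>M\<^sub>k\<close> solve a triangular system of linear differential
  equations whose coefficients are generating functions of unrestricted walks. The latter are Cauchy integrals, and aperiodicity
  makes the square root branch point at 1 their only singularity on the closed unit disc; so \<open>E\<close> and, if \<open>\<tau> > 1\<close>, also \<open>Q\<close>
  are analytic in \<open>s = \<surd>(1 - z)\<close> up to the boundary.

  If \<open>\<tau> \<le> 1\<close>, then \<open>Q\<close> diverges at \<open>1/P(1) \<le> \<rho>\<close> and therefore \<open>\<rho>\<^sub>0 < 1/P(1)\<close>: only the Gaussian law occurs.
  The three regimes are then statements about \<open>E/(1 - v Q)\<close>. If \<open>\<rho>\<^sub>0\<close> does not exist, the coefficients of \<open>E Q\<^sup>k\<close> and
  \<open>E/(1 - Q)\<close> are read off their square root expansions. If \<open>\<rho>\<^sub>0 = \<rho>\<close>, the factorial moments converge to those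
  of the Rayleigh law. If \<open>\<rho>\<^sub>0 < \<rho>\<close>, then \<open>1 - v Q\<close> has a simple zero that moves analytically with \<open>v = e\<^sup>i\<^sup>t\<close>, and the
  characteristic functions converge.
\<close>

subsection \<open>Functions analytic up to the boundary\<close>

text \<open>The kernel method proper would need the small roots of 1 = z P(u) one by one, with their
  continuation and domination properties. Here only the two roots meeting at w = 1 are ever
  isolated: the circle of integration is shrunk across the inner one, and its residue shows that the
  coefficients of the differential equations behave like 1/s. As dz = -2 s ds, the equations become
  regular in s, and a linear equation passes regularity of its coefficients on to its solutions.
  Analyticity up to the boundary is a local notion: near each point of the closure some holomorphic
  function agrees with the given one on S. These extensions need not fit together, because the
  transfer to coefficients only uses that enough derivatives are bounded in the open disc. Tilting
  turns u = 1 into u = 1/\<tau>. If \<tau> > 1, then the kernel 1 - z P(u) of the tilted walk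
  vanishes at this u only strictly inside the disc, where M(z,u) converges anyway; so no further
  singularity of Q arises on the circle.\<close>

definition analytic_upto :: "complex set \<Rightarrow> (complex \<Rightarrow> complex) \<Rightarrow> bool" where
  "analytic_upto S F \<longleftrightarrow> (\<forall>x\<in>closure S. \<exists>e>0. \<exists>g. g holomorphic_on ball x e \<and> (\<forall>s\<in>ball x e \<inter> S. F s = g s))"

lemma analytic_uptoI:
  assumes "\<And>x. x \<in> closure S \<Longrightarrow> \<exists>e>0. \<exists>g. g holomorphic_on ball x e \<and> (\<forall>s\<in>ball x e \<inter> S. F s = g s)"
  shows "analytic_upto S F"
  using assms unfolding analytic_upto_def by blast

lemma analytic_uptoD:
  assumes "analytic_upto S F" "x \<in> closure S"
  obtains e g where "e > 0" "g holomorphic_on ball x e" "\<And>s. s \<in> ball x e \<Longrightarrow> s \<in> S \<Longrightarrow> F s = g s"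
  using assms unfolding analytic_upto_def by (metis IntI)

lemma analytic_upto_cong:
  assumes "analytic_upto S F" "\<And>s. s \<in> S \<Longrightarrow> F s = G s"
  shows "analytic_upto S G"
  using assms unfolding analytic_upto_def by (metis IntD2)

lemma analytic_upto_holomorphic:
  assumes "open U" "closure S \<subseteq> U" "F holomorphic_on U"
  shows "analytic_upto S F"
proof (rule analytic_uptoI)
  fix x assume "x \<in> closure S"
  then obtain e where "e > 0" "ball x e \<subseteq> U"
    using assms open_contains_ball by blast
  thus "\<exists>e>0. \<exists>g. g holomorphic_on ball x e \<and> (\<forall>s\<in>ball x e \<inter> S. F s = g s)"
    using assms(3) holomorphic_on_subset by blast
qed

lemma analytic_upto_const [simp]: "analytic_upto S (\<lambda>_. c)"
  by (rule analytic_upto_holomorphic[of UNIV]) auto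

lemma analytic_upto_ident [simp]: "analytic_upto S (\<lambda>s. s)"
  by (rule analytic_upto_holomorphic[of UNIV]) auto

lemma analytic_upto_combine:
  assumes F: "analytic_upto S F" and G: "analytic_upto S G"
    and op: "\<And>f g X. open X \<Longrightarrow> f holomorphic_on X \<Longrightarrow> g holomorphic_on X \<Longrightarrow> (\<lambda>z. h (f z) (g z)) holomorphic_on X"
  shows "analytic_upto S (\<lambda>s. h (F s) (G s))"
proof (rule analytic_uptoI)
  fix x assume x: "x \<in> closure S"
  obtain e f where 1: "e > 0" "f holomorphic_on ball x e" "\<And>s. s \<in> ball x e \<Longrightarrow> s \<in> S \<Longrightarrow> F s = f s"
    using analytic_uptoD[OF F x] by metis
  obtain e' g where 2: "e' > 0" "g holomorphic_on ball x e'" "\<And>s. s \<in> ball x e' \<Longrightarrow> s \<in> S \<Longrightarrow> G s = g s"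
    using analytic_uptoD[OF G x] by metis
  have "(\<lambda>z. h (f z) (g z)) holomorphic_on ball x (min e e')"
    by (rule op) (use 1 2 in \<open>auto intro: holomorphic_on_subset\<close>)
  thus "\<exists>e>0. \<exists>k. k holomorphic_on ball x e \<and> (\<forall>s\<in>ball x e \<inter> S. h (F s) (G s) = k s)"
    using 1 2 by (intro exI[of _ "min e e'"] conjI exI[of _ "\<lambda>z. h (f z) (g z)"]) auto
qed

lemma analytic_upto_add:
  "analytic_upto S F \<Longrightarrow> analytic_upto S G \<Longrightarrow> analytic_upto S (\<lambda>s. F s + G s)"
  by (rule analytic_upto_combine[where h = "(+)"]) (auto intro: holomorphic_intros)

lemma analytic_upto_diff:
  "analytic_upto S F \<Longrightarrow> analytic_upto S G \<Longrightarrow> analytic_upto S (\<lambda>s. F s - G s)"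
  by (rule analytic_upto_combine[where h = "(-)"]) (auto intro: holomorphic_intros)

lemma analytic_upto_mult:
  "analytic_upto S F \<Longrightarrow> analytic_upto S G \<Longrightarrow> analytic_upto S (\<lambda>s. F s * G s)"
  by (rule analytic_upto_combine[where h = "(*)"]) (auto intro: holomorphic_intros)

lemma analytic_upto_power: "analytic_upto S F \<Longrightarrow> analytic_upto S (\<lambda>s. F s ^ n)"
  by (induction n) (auto intro: analytic_upto_mult)

lemma analytic_upto_sum:
  "(\<And>i. i \<in> I \<Longrightarrow> analytic_upto S (F i)) \<Longrightarrow> analytic_upto S (\<lambda>s. \<Sum>i\<in>I. F i s)"
  by (induction I rule: infinite_finite_induct) (auto intro: analytic_upto_add)

lemma analytic_upto_imp_holomorphic:
  assumes "analytic_upto S F" "open S"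
  shows "F holomorphic_on S"
proof -
  have "F field_differentiable at x" if xS: "x \<in> S" for x
  proof -
    obtain e g where eg: "e > 0" "g holomorphic_on ball x e" "\<And>s. s \<in> ball x e \<Longrightarrow> s \<in> S \<Longrightarrow> F s = g s"
      using analytic_uptoD[OF assms(1) subsetD[OF closure_subset xS]] by metis
    have "g field_differentiable at x"
      using eg holomorphic_on_imp_differentiable_at[of g "ball x e" x] by auto
    then obtain D where "(g has_field_derivative D) (at x)"
      by (auto simp: field_differentiable_def)
    hence "(F has_field_derivative D) (at x)"
      by (rule has_field_derivative_transform_within_open[of _ _ _ "ball x e \<inter> S"])
         (use eg xS assms(2) in auto)
    thus ?thesis by (auto simp: field_differentiable_def)
  qed
  thus ?thesis using assms(2) by (simp add: holomorphic_on_open field_differentiable_def)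
qed

lemma analytic_upto_deriv:
  assumes F: "analytic_upto S F" and S: "open S"
  shows "analytic_upto S (deriv F)"
proof (rule analytic_uptoI)
  fix x assume x: "x \<in> closure S"
  obtain e f where 1: "e > 0" "f holomorphic_on ball x e" "\<And>s. s \<in> ball x e \<Longrightarrow> s \<in> S \<Longrightarrow> F s = f s"
    using analytic_uptoD[OF F x] by metis
  have "deriv F s = deriv f s" if "s \<in> ball x e \<inter> S" for s
    by (rule complex_derivative_transform_within_open[of _ "ball x e \<inter> S"])
       (use that 1 S analytic_upto_imp_holomorphic[OF F S] in \<open>auto intro: holomorphic_on_subset\<close>)
  moreover have "deriv f holomorphic_on ball x e"
    using 1 by (auto intro: holomorphic_intros)
  ultimately show "\<exists>e>0. \<exists>g. g holomorphic_on ball x e \<and> (\<forall>s\<in>ball x e \<inter> S. deriv F s = g s)"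
    using 1 by blast
qed

text \<open>Having no zero in S would not be enough, as the extension could vanish at a boundary
  point. The bound passes to the limit at x because x lies in the closure of S. One \<delta> serves
  as radius and as bound, since both may be shrunk.\<close>

lemma analytic_upto_inverse:
  assumes F: "analytic_upto S F"
    and lower: "\<And>x. x \<in> closure S \<Longrightarrow> \<exists>\<delta>>0. \<forall>s\<in>S \<inter> ball x \<delta>. \<delta> \<le> norm (F s)"
  shows "analytic_upto S (\<lambda>s. inverse (F s))"
proof (rule analytic_uptoI)
  fix x assume x: "x \<in> closure S"
  obtain e f where 1: "e > 0" "f holomorphic_on ball x e" "\<And>s. s \<in> ball x e \<Longrightarrow> s \<in> S \<Longrightarrow> F s = f s"
    using analytic_uptoD[OF F x] by metis
  obtain \<delta> where \<delta>: "\<delta> > 0" "\<And>s. s \<in> S \<Longrightarrow> s \<in> ball x \<delta> \<Longrightarrow> \<delta> \<le> norm (F s)"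
    using lower[OF x] by (metis IntI)
  have cont: "isCont f x"
    using holomorphic_on_imp_continuous_on[OF 1(2)] 1(1) by (simp add: continuous_on_eq_continuous_at)
  have "f x \<noteq> 0"
  proof
    assume "f x = 0"
    hence "\<forall>\<^sub>F s in at x. norm (f s) < \<delta>"
      using cont \<delta>(1) unfolding isCont_def by (auto simp: tendsto_iff)
    then obtain d where d: "d > 0" "\<And>s. s \<noteq> x \<Longrightarrow> dist s x < d \<Longrightarrow> norm (f s) < \<delta>"
      unfolding eventually_at by auto
    obtain s where s: "s \<in> S" "dist s x < min d (min \<delta> e)"
      using x d(1) \<delta>(1) 1(1) by (auto simp: closure_approachable dest!: spec[of _ "min d (min \<delta> e)"])
    have "norm (f s) < \<delta>" using d s \<open>f x = 0\<close> \<delta> by (cases "s = x") auto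
    moreover have "\<delta> \<le> norm (f s)" using \<delta> 1 s by (metis dist_commute mem_ball min_less_iff_conj)
    ultimately show False by simp
  qed
  then obtain e' where e': "e' > 0" "\<And>s. s \<in> ball x e' \<Longrightarrow> f s \<noteq> 0"
    using continuous_at_avoid[OF cont, of 0] by (metis dist_commute mem_ball)
  have "(\<lambda>s. inverse (f s)) holomorphic_on ball x (min e e')"
    using 1 e' by (intro holomorphic_intros) (auto intro: holomorphic_on_subset)
  thus "\<exists>e>0. \<exists>g. g holomorphic_on ball x e \<and> (\<forall>s\<in>ball x e \<inter> S. inverse (F s) = g s)"
    using 1 e' by (intro exI[of _ "min e e'"] conjI exI[of _ "\<lambda>s. inverse (f s)"]) auto
qed

text \<open>Each local extension is bounded on a smaller ball, and finitely many such balls cover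
  the compact closure.\<close>

lemma analytic_upto_bounded:
  assumes F: "analytic_upto S F" and "bounded S"
  shows "\<exists>B. \<forall>s\<in>S. norm (F s) \<le> B"
proof -
  have "\<exists>e>0. \<exists>B. \<forall>s\<in>ball x e \<inter> S. norm (F s) \<le> B" if x: "x \<in> closure S" for x
  proof -
    obtain e f where 1: "e > 0" "f holomorphic_on ball x e" "\<And>s. s \<in> ball x e \<Longrightarrow> s \<in> S \<Longrightarrow> F s = f s"
      using analytic_uptoD[OF F x] by metis
    have "continuous_on (cball x (e/2)) f"
      using 1 by (intro holomorphic_on_imp_continuous_on) (auto intro: holomorphic_on_subset)
    hence "bounded (f ` cball x (e/2))"
      by (intro compact_imp_bounded compact_continuous_image) auto
    then obtain B where B: "\<And>s. s \<in> cball x (e/2) \<Longrightarrow> norm (f s) \<le> B" unfolding bounded_iff by (metis imageI)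
    have "norm (F s) \<le> B" if "s \<in> ball x (e/2) \<inter> S" for s using that B[of s] 1 by simp
    thus ?thesis using 1(1) by (meson half_gt_zero)
  qed
  then obtain e B where eB: "\<And>x. x \<in> closure S \<Longrightarrow> e x > 0"
    "\<And>x s. x \<in> closure S \<Longrightarrow> s \<in> ball x (e x) \<inter> S \<Longrightarrow> norm (F s) \<le> B x" by metis
  have "compact (closure S)" using assms(2) by (simp add: compact_closure)
  from compactE_image[OF this, of "closure S" "\<lambda>x. ball x (e x)"]
  obtain C where C: "C \<subseteq> closure S" "finite C" "closure S \<subseteq> (\<Union>x\<in>C. ball x (e x))"
    by (metis (no_types, lifting) UN_I centre_in_ball eB(1) open_ball subsetI)
  show ?thesis
  proof (intro exI ballI)
    fix s assume s: "s \<in> S"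
    then obtain x where x: "x \<in> C" "s \<in> ball x (e x)" using C closure_subset by blast
    hence "norm (F s) \<le> B x" using eB s C by blast
    also have "\<dots> \<le> (\<Sum>x\<in>C. \<bar>B x\<bar>)" using x C by (meson abs_ge_self abs_ge_zero member_le_sum order_trans)
    finally show "norm (F s) \<le> (\<Sum>x\<in>C. \<bar>B x\<bar>)" .
  qed
qed

text \<open>Solutions of a linear equation live wherever its coefficients do. With an integrating
  factor built from primitives of the extended coefficients on a ball, F becomes explicit up to a
  constant. The ball meets the convex set S in a convex set, so there is one constant for the whole
  intersection.\<close>

lemma analytic_upto_linear_ode:
  assumes S: "open S" "convex S" and A: "analytic_upto S A" and B: "analytic_upto S B"
    and ode: "\<And>s. s \<in> S \<Longrightarrow> (F has_field_derivative (A s * F s + B s)) (at s)"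
  shows "analytic_upto S F"
proof (rule analytic_uptoI)
  fix x assume x: "x \<in> closure S"
  obtain e a where 1: "e > 0" "a holomorphic_on ball x e" "\<And>s. s \<in> ball x e \<Longrightarrow> s \<in> S \<Longrightarrow> A s = a s"
    using analytic_uptoD[OF A x] by metis
  obtain e' b where 2: "e' > 0" "b holomorphic_on ball x e'" "\<And>s. s \<in> ball x e' \<Longrightarrow> s \<in> S \<Longrightarrow> B s = b s"
    using analytic_uptoD[OF B x] by metis
  define d where "d = min e e'"
  define U where "U = ball x d"
  have d: "d > 0" using 1 2 by (simp add: d_def)
  have U: "open U" "convex U" by (auto simp: U_def)
  have a: "a holomorphic_on U" and b: "b holomorphic_on U"
    using 1 2 by (auto simp: U_def d_def intro: holomorphic_on_subset)
  obtain \<Phi> where \<Phi>: "\<And>s. s \<in> U \<Longrightarrow> (\<Phi> has_field_derivative a s) (at s)"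
    using holomorphic_convex_primitive'[OF U(2,1) a] U at_within_open by metis
  have \<Phi>h: "\<Phi> holomorphic_on U" using \<Phi> U by (auto simp: holomorphic_on_open)
  have bh: "(\<lambda>s. b s * exp (- \<Phi> s)) holomorphic_on U" using b \<Phi>h by (auto intro!: holomorphic_intros)
  obtain \<Psi> where \<Psi>: "\<And>s. s \<in> U \<Longrightarrow> (\<Psi> has_field_derivative (b s * exp (- \<Phi> s))) (at s)"
    using holomorphic_convex_primitive'[OF U(2,1) bh] U at_within_open by metis
  have \<Psi>h: "\<Psi> holomorphic_on U" using \<Psi> U by (auto simp: holomorphic_on_open)
  have "\<exists>k. \<forall>s\<in>U\<inter>S. F s * exp (- \<Phi> s) - \<Psi> s = k"
  proof (rule has_field_derivative_zero_constant)
    show "convex (U \<inter> S)" using U S convex_Int by blast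
    fix s assume s: "s \<in> U \<inter> S"
    have eq: "A s = a s" "B s = b s" using s 1 2 by (auto simp: U_def d_def)
    have "((\<lambda>s. F s * exp (- \<Phi> s) - \<Psi> s) has_field_derivative
        ((A s * F s + B s) * exp (- \<Phi> s) + F s * (exp (- \<Phi> s) * (- a s)) - b s * exp (- \<Phi> s))) (at s)"
      using s by (auto intro!: derivative_eq_intros ode \<Phi> \<Psi>)
    thus "((\<lambda>s. F s * exp (- \<Phi> s) - \<Psi> s) has_field_derivative 0) (at s within U \<inter> S)"
      by (simp add: eq algebra_simps has_field_derivative_at_within)
  qed
  then obtain k where k: "\<And>s. s \<in> U \<inter> S \<Longrightarrow> F s * exp (- \<Phi> s) - \<Psi> s = k" by blast
  have "F s = exp (\<Phi> s) * (\<Psi> s + k)" if "s \<in> U \<inter> S" for s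
  proof -
    have "F s * exp (- \<Phi> s) = \<Psi> s + k" using k[OF that] by (simp add: algebra_simps)
    hence "F s * (exp (- \<Phi> s) * exp (\<Phi> s)) = exp (\<Phi> s) * (\<Psi> s + k)"
      by (simp add: mult.assoc[symmetric] mult.commute)
    thus ?thesis by (simp add: exp_minus)
  qed
  moreover have "(\<lambda>s. exp (\<Phi> s) * (\<Psi> s + k)) holomorphic_on U" using \<Phi>h \<Psi>h by (auto intro!: holomorphic_intros)
  ultimately show "\<exists>e>0. \<exists>g. g holomorphic_on ball x e \<and> (\<forall>s\<in>ball x e \<inter> S. F s = g s)"
    using d unfolding U_def by blast
qed

text \<open>Division by s is harmless away from 0, and at the boundary point 0 the difference
  quotient of the local extension has a removable singularity.\<close>

lemma analytic_upto_divide_zero: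
  assumes F: "analytic_upto S F" and S: "open S" "0 \<notin> S" "0 \<in> closure S"
  shows "\<exists>a G. analytic_upto S G \<and> (F \<longlongrightarrow> a) (at 0 within S) \<and> (\<forall>s\<in>S. F s = a + s * G s)"
proof -
  obtain e f where 1: "e > 0" "f holomorphic_on ball 0 e" "\<And>s. s \<in> ball 0 e \<Longrightarrow> s \<in> S \<Longrightarrow> F s = f s"
    using analytic_uptoD[OF F S(3)] by metis
  define G where "G = (\<lambda>s. (F s - f 0) / s)"
  have "analytic_upto S G"
  proof (rule analytic_uptoI)
    fix x assume x: "x \<in> closure S"
    show "\<exists>e>0. \<exists>g. g holomorphic_on ball x e \<and> (\<forall>s\<in>ball x e \<inter> S. G s = g s)"
    proof (cases "x = 0")
      case True
      define g where "g = (\<lambda>s. if s = 0 then deriv f 0 else (f s - f 0) / (s - 0))"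
      have "g holomorphic_on ball 0 e"
        unfolding g_def using pole_lemma[OF 1(2), of 0] 1(1) by simp
      moreover have "G s = g s" if "s \<in> ball 0 e \<inter> S" for s
        using that 1(3)[of s] S(2) by (auto simp: G_def g_def)
      ultimately show ?thesis using True 1(1) by blast
    next
      case False
      obtain e' h where 2: "e' > 0" "h holomorphic_on ball x e'" "\<And>s. s \<in> ball x e' \<Longrightarrow> s \<in> S \<Longrightarrow> F s = h s"
        using analytic_uptoD[OF F x] by metis
      define d where "d = min e' (norm x)"
      have "(\<lambda>s. (h s - f 0) / s) holomorphic_on ball x d"
        using 2(2) by (intro holomorphic_intros) (auto simp: d_def intro: holomorphic_on_subset)
      thus ?thesis using 2 False
        by (intro exI[of _ d] conjI exI[of _ "\<lambda>s. (h s - f 0) / s"]) (auto simp: d_def G_def)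
    qed
  qed
  moreover have "(F \<longlongrightarrow> f 0) (at 0 within S)"
  proof -
    have "(f \<longlongrightarrow> f 0) (at 0)"
      using 1 by (metis centre_in_ball continuous_on_eq_continuous_at holomorphic_on_imp_continuous_on isCont_def open_ball)
    hence "(f \<longlongrightarrow> f 0) (at 0 within S)" using at_le tendsto_mono subset_UNIV by metis
    moreover have "\<forall>\<^sub>F s in at 0 within S. f s = F s"
      unfolding eventually_at using 1 by (intro exI[of _ e]) auto
    ultimately show ?thesis using tendsto_cong by fast
  qed
  moreover have "\<forall>s\<in>S. F s = f 0 + s * G s" using S(2) by (auto simp: G_def)
  ultimately show ?thesis by blast
qed

lemma analytic_upto_expand:
  assumes F: "analytic_upto S F" and S: "open S" "0 \<notin> S" "0 \<in> closure S"
  shows "\<exists>h G. analytic_upto S G \<and> (\<forall>s\<in>S. F s = (\<Sum>j<N. h j * s ^ j) + s ^ N * G s)"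
proof (induction N)
  case 0
  show ?case using F by (intro exI[of _ "\<lambda>_. 0"] exI[of _ F]) auto
next
  case (Suc N)
  then obtain h G where G: "analytic_upto S G" "\<And>s. s \<in> S \<Longrightarrow> F s = (\<Sum>j<N. h j * s ^ j) + s ^ N * G s" by blast
  obtain a G' where G': "analytic_upto S G'" "\<And>s. s \<in> S \<Longrightarrow> G s = a + s * G' s"
    using analytic_upto_divide_zero[OF G(1) S] by blast
  have "F s = (\<Sum>j<Suc N. (h(N := a)) j * s ^ j) + s ^ Suc N * G' s" if "s \<in> S" for s
    using G(2)[OF that] G'(2)[OF that] by (simp add: algebra_simps)
  thus ?case using G'(1) by blast
qed

subsection \<open>Transfer at a square root singularity\<close>

text \<open>The image of the open unit disc under the principal root s = csqrt (1 - z). The branch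
  point z = 1 becomes the boundary point s = 0, and functions of sqrt(1 - z) become ordinary
  functions of s.\<close>

definition lens :: "complex set" where
  "lens = {s. 0 < Re s \<and> norm (1 - s\<^sup>2) < 1}"

lemma less_iff_power2_less_nonneg: "0 \<le> (x::real) \<Longrightarrow> 0 \<le> y \<Longrightarrow> x < y \<longleftrightarrow> x\<^sup>2 < y\<^sup>2"
  by (metis power2_less_imp_less power_strict_mono zero_less_numeral)

text \<open>Squaring turns the second condition of the definition into |s|^4 + 2 (Im s)^2 < 2 (Re
  s)^2. In the form given here the left side is a convex function of s and the right side is linear,
  which is what the convexity proof needs.\<close>

lemma lens_iff:
  "s \<in> lens \<longleftrightarrow> 0 < Re s \<and> cmod (Complex ((cmod s)\<^sup>2) (sqrt 2 * Im s)) < sqrt 2 * Re s"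
proof -
  have 1: "cmod (1 - s\<^sup>2) < 1 \<longleftrightarrow> (cmod (1 - s\<^sup>2))\<^sup>2 < 1"
    by (simp add: power_less_one_iff abs_square_less_1)
  have 2: "cmod (Complex ((cmod s)\<^sup>2) (sqrt 2 * Im s)) < sqrt 2 * Re s \<longleftrightarrow>
      (cmod (Complex ((cmod s)\<^sup>2) (sqrt 2 * Im s)))\<^sup>2 < (sqrt 2 * Re s)\<^sup>2" if "Re s > 0"
    using that by (intro less_iff_power2_less_nonneg) auto
  have 3: "(cmod (1 - s\<^sup>2))\<^sup>2 = 1 - 2 * ((Re s)\<^sup>2 - (Im s)\<^sup>2) + ((Re s)\<^sup>2 + (Im s)\<^sup>2)\<^sup>2"
    unfolding cmod_power2 by (simp add: power2_eq_square algebra_simps)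
  have 4: "(cmod (Complex ((cmod s)\<^sup>2) (sqrt 2 * Im s)))\<^sup>2 = ((Re s)\<^sup>2 + (Im s)\<^sup>2)\<^sup>2 + 2 * (Im s)\<^sup>2"
    by (simp add: cmod_power2 power_mult_distrib)
  show ?thesis unfolding lens_def using 1 2 3 4 by (auto simp: power_mult_distrib)
qed

lemma open_lens: "open lens"
proof -
  have eq: "lens = {s. 0 < Re s} \<inter> {s. norm (1 - s\<^sup>2) < 1}" by (auto simp: lens_def)
  have "open {s. 0 < Re s}" "open {s::complex. norm (1 - s\<^sup>2) < 1}"
    by (intro open_Collect_less continuous_intros)+
  thus ?thesis unfolding eq by (rule open_Int)
qed

text \<open>The boundary of \<^const>\<open>lens\<close> is one loop of the lemniscate, which is convex.\<close>

lemma convex_lens: "convex lens"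
proof (rule convexI)
  fix a b :: complex and u v :: real
  assume ab: "a \<in> lens" "b \<in> lens" and uv: "0 \<le> u" "0 \<le> v" "u + v = 1"
  let ?w = "u *\<^sub>R a + v *\<^sub>R b"
  let ?V = "\<lambda>s. Complex ((cmod s)\<^sup>2) (sqrt 2 * Im s)"
  have "cmod ?w \<le> u * cmod a + v * cmod b"
    using norm_triangle_ineq[of "u *\<^sub>R a" "v *\<^sub>R b"] uv by simp
  hence "(cmod ?w)\<^sup>2 \<le> (u * cmod a + v * cmod b)\<^sup>2" by (intro power_mono) auto
  also have "\<dots> \<le> u * (cmod a)\<^sup>2 + v * (cmod b)\<^sup>2"
  proof -
    have "u * (cmod a)\<^sup>2 + v * (cmod b)\<^sup>2 - (u * cmod a + v * cmod b)\<^sup>2 = u * v * (cmod a - cmod b)\<^sup>2"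
      using uv(3) by (simp add: eq_diff_eq[symmetric, of v 1 u] power2_eq_square algebra_simps)
        (algebra)
    moreover have "u * v * (cmod a - cmod b)\<^sup>2 \<ge> 0" using uv by simp
    ultimately show ?thesis by linarith
  qed
  finally have X: "(cmod ?w)\<^sup>2 \<le> u * (cmod a)\<^sup>2 + v * (cmod b)\<^sup>2" .
  have "cmod (?V ?w) \<le> cmod (u *\<^sub>R ?V a + v *\<^sub>R ?V b)"
  proof -
    have "((cmod ?w)\<^sup>2)\<^sup>2 \<le> (u * (cmod a)\<^sup>2 + v * (cmod b)\<^sup>2)\<^sup>2" by (intro power_mono X) auto
    moreover have "sqrt 2 * Im ?w = u * (sqrt 2 * Im a) + v * (sqrt 2 * Im b)" by (simp add: algebra_simps)
    ultimately have "(cmod (?V ?w))\<^sup>2 \<le> (cmod (u *\<^sub>R ?V a + v *\<^sub>R ?V b))\<^sup>2"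
      unfolding cmod_power2 by simp
    thus ?thesis using power2_le_imp_le norm_ge_zero by blast
  qed
  also have "\<dots> \<le> u * cmod (?V a) + v * cmod (?V b)"
    using norm_triangle_ineq[of "u *\<^sub>R ?V a" "v *\<^sub>R ?V b"] uv by simp
  also have "\<dots> < u * (sqrt 2 * Re a) + v * (sqrt 2 * Re b)"
  proof (cases "u = 0")
    case True thus ?thesis using ab uv by (simp add: lens_iff)
  next
    case False
    thus ?thesis using ab uv
      by (intro add_less_le_mono mult_left_mono mult_strict_left_mono) (auto simp: lens_iff)
  qed
  also have "\<dots> = sqrt 2 * Re ?w" by (simp add: algebra_simps)
  finally have 1: "cmod (?V ?w) < sqrt 2 * Re ?w" .
  have "Re ?w > 0" using le_less_trans[OF norm_ge_zero 1] by (simp add: zero_less_mult_iff)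
  with 1 show "?w \<in> lens" by (simp add: lens_iff)
qed

lemma bounded_lens: "bounded lens"
proof (rule boundedI)
  fix s assume "s \<in> lens"
  hence "norm (1 - s\<^sup>2) < 1" by (simp add: lens_def)
  hence "norm (s\<^sup>2) \<le> 2" using norm_triangle_ineq2[of "s\<^sup>2" 1] by (simp add: norm_minus_commute)
  hence "(norm s)\<^sup>2 \<le> 2\<^sup>2" by (simp add: norm_power)
  thus "norm s \<le> 2" by (rule power2_le_imp_le) simp
qed

lemma zero_notin_lens: "0 \<notin> lens" by (simp add: lens_def)

lemma lens_real: "0 < x \<Longrightarrow> x < 1 \<Longrightarrow> complex_of_real x \<in> lens"
proof -
  assume x: "0 < x" "x < 1"
  have "norm (1 - (complex_of_real x)\<^sup>2) = \<bar>1 - x\<^sup>2\<bar>"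
    by (metis norm_of_real of_real_1 of_real_diff of_real_power)
  moreover have "x\<^sup>2 < 1" "x\<^sup>2 > 0" using x by (auto simp: power_less_one_iff)
  ultimately show ?thesis using x by (simp add: lens_def)
qed

lemma zero_in_closure_lens: "0 \<in> closure lens"
  unfolding closure_approachable
proof (intro allI impI)
  fix e :: real assume "e > 0"
  thus "\<exists>y\<in>lens. dist y 0 < e"
    by (intro bexI[of _ "of_real (min (e/2) (1/2))"] lens_real) auto
qed

text \<open>Points of the closure correspond to z = 1 - x^2 in the closed disc, and z = 1 is hit at
  x = 0 only. Singularities at s \<noteq> 0 can therefore be excluded by looking at a single z
  \<noteq> 1.\<close>

lemma closure_lensD:
  assumes "x \<in> closure lens"
  shows "Re x \<ge> 0" "norm (1 - x\<^sup>2) \<le> 1" "x = 0 \<or> 1 - x\<^sup>2 \<noteq> 1"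
proof -
  have "closed ({s. 0 \<le> Re s} \<inter> {s. norm (1 - s\<^sup>2) \<le> 1})"
    by (intro closed_Int closed_halfspace_Re_ge closed_Collect_le continuous_intros)
  moreover have "lens \<subseteq> {s. 0 \<le> Re s} \<inter> {s. norm (1 - s\<^sup>2) \<le> 1}" by (auto simp: lens_def)
  ultimately have "closure lens \<subseteq> {s. 0 \<le> Re s} \<inter> {s. norm (1 - s\<^sup>2) \<le> 1}" by (rule closure_minimal[rotated])
  thus "Re x \<ge> 0" "norm (1 - x\<^sup>2) \<le> 1" using assms by auto
  show "x = 0 \<or> 1 - x\<^sup>2 \<noteq> 1" by auto
qed

lemma csqrt_in_lens: "norm z < 1 \<Longrightarrow> csqrt (1 - z) \<in> lens"
proof -
  assume z: "norm z < 1"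
  have "Re z < 1" using z complex_Re_le_cmod[of z] by linarith
  hence "Re (csqrt (1 - z)) > 0"
    by (simp add: add_nonneg_pos)
  thus ?thesis using z by (simp add: lens_def)
qed

section \<open>Coefficient bounds and transfer from the lens to the disc\<close>

lemma coeff_bound_of_bounded:
  fixes A :: "complex fps"
  assumes A: "fps_conv_radius A \<ge> 1" and B: "\<And>z. norm z < 1 \<Longrightarrow> norm (eval_fps A z) \<le> B"
  shows "norm (fps_nth A n) \<le> B"
proof -
  have rad: "eball 0 (fps_conv_radius A) \<supseteq> ball 0 1"
    using A by (auto simp: in_eball_iff) (metis ereal_less(3) less_ereal.simps(1) one_ereal_def order_less_le_trans)
  have holo: "eval_fps A holomorphic_on ball 0 1" by (intro holomorphic_intros rad)
  have pos: "fps_conv_radius A > 0" using A order_less_le_trans[of 0 1 "fps_conv_radius A"] by simp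
  \<comment> \<open>Cauchy's inequality on a circle of radius r < 1; letting r tend to 1 removes the
    factor r^n.\<close>
  have le: "norm (fps_nth A n) * r ^ n \<le> B" if r: "0 < r" "r < 1" for r :: real
  proof -
    have "norm ((deriv ^^ n) (eval_fps A) 0) \<le> fact n * B / r ^ n"
    proof (rule Cauchy_inequality)
      show "eval_fps A holomorphic_on ball 0 r" using holo r by (auto intro: holomorphic_on_subset)
      show "continuous_on (cball 0 r) (eval_fps A)"
        using holo r by (auto intro!: holomorphic_on_imp_continuous_on intro: holomorphic_on_subset)
    qed (use r B in auto)
    thus ?thesis using r unfolding fps_nth_conv_deriv[OF pos]
      by (simp add: norm_divide divide_simps mult.commute)
  qed
  have "((\<lambda>r. norm (fps_nth A n) * r ^ n) \<longlongrightarrow> norm (fps_nth A n) * 1 ^ n) (at_left 1)"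
    by (intro tendsto_intros)
  moreover have "\<forall>\<^sub>F r in at_left (1::real). norm (fps_nth A n) * r ^ n \<le> B"
    using eventually_at_left_real[OF zero_less_one] by eventually_elim (auto intro: le)
  ultimately show ?thesis using tendsto_upperbound[of _ _ "at_left (1::real)"] by fastforce
qed

lemma eval_fps_lens_deriv:
  assumes A: "fps_conv_radius A \<ge> 1" and s: "s \<in> lens"
  shows "((\<lambda>s. eval_fps A (1 - s\<^sup>2)) has_field_derivative - 2 * s * eval_fps (fps_deriv A) (1 - s\<^sup>2)) (at s)"
proof -
  have "norm (1 - s\<^sup>2) < 1" using s by (simp add: lens_def)
  hence "ereal (norm (1 - s\<^sup>2)) < fps_conv_radius A"
    using A by (metis less_ereal.simps(1) one_ereal_def order_less_le_trans)
  from has_field_derivative_eval_fps[OF this, of UNIV]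
  have "(eval_fps A has_field_derivative eval_fps (fps_deriv A) (1 - s\<^sup>2)) (at (1 - s\<^sup>2))" by simp
  hence "((\<lambda>s. eval_fps A (1 - s\<^sup>2)) has_field_derivative eval_fps (fps_deriv A) (1 - s\<^sup>2) * (- 2 * s)) (at s)"
    by (rule DERIV_chain2[where g = "\<lambda>s. 1 - s\<^sup>2"]) (auto intro!: derivative_eq_intros)
  thus ?thesis by (simp add: mult_ac)
qed

text \<open>Since d/dz = -1/(2 s) d/ds, one derivative in z costs a factor s^2. A factor s^(2 K)
  thus leaves K derivatives bounded in the whole disc, and the coefficients of the K-th derivative
  are those of A, shifted, times about n^K.\<close>

lemma coeff_bound_of_lens:
  assumes "fps_conv_radius A \<ge> 1" "analytic_upto lens G"
    and "\<And>s. s \<in> lens \<Longrightarrow> eval_fps A (1 - s\<^sup>2) = s ^ (2 * K) * G s"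
  shows "\<exists>B. \<forall>n. norm (fps_nth A n) * (real n + 1) ^ K \<le> B"
  using assms
proof (induction K arbitrary: A G)
  case 0
  obtain B where B: "\<And>s. s \<in> lens \<Longrightarrow> norm (G s) \<le> B"
    using analytic_upto_bounded[OF 0(2) bounded_lens] by blast
  have "norm (eval_fps A z) \<le> B" if "norm z < 1" for z
    using 0(3)[OF csqrt_in_lens[OF that]] B[OF csqrt_in_lens[OF that]] by simp
  from coeff_bound_of_bounded[OF 0(1) this] show ?case by auto
next
  case (Suc K)
  \<comment> \<open>Read off from -2 s A'(1 - s^2) = d/ds (s^(2 K + 2) G(s)) by splitting off -2
    s^(2 K + 1).\<close>
  define G' where "G' = (\<lambda>s. - (1/2) * (of_nat (2 * K + 2) * G s + s * deriv G s))"
  have G': "analytic_upto lens G'"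
    unfolding G'_def by (intro analytic_upto_mult analytic_upto_add analytic_upto_const analytic_upto_ident
        Suc.prems analytic_upto_deriv open_lens)
  have "eval_fps (fps_deriv A) (1 - s\<^sup>2) = s ^ (2 * K) * G' s" if s: "s \<in> lens" for s
  proof -
    have s0: "s \<noteq> 0" using s zero_notin_lens by blast
    have dG: "(G has_field_derivative deriv G s) (at s)"
      using analytic_upto_imp_holomorphic[OF Suc.prems(2) open_lens] s
      by (simp add: holomorphic_derivI open_lens)
    have "((\<lambda>s. s ^ (2 * Suc K) * G s) has_field_derivative
            (of_nat (2 * K + 2) * s ^ (2 * K + 1) * G s + s ^ (2 * K + 2) * deriv G s)) (at s)"
      by (rule DERIV_cong[OF DERIV_mult[OF DERIV_power[OF DERIV_ident] dG]]) (simp add: algebra_simps)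
    moreover have "((\<lambda>s. s ^ (2 * Suc K) * G s) has_field_derivative
        - 2 * s * eval_fps (fps_deriv A) (1 - s\<^sup>2)) (at s)"
      by (rule has_field_derivative_transform_within_open[OF eval_fps_lens_deriv[OF Suc.prems(1) s] open_lens s])
         (simp add: Suc.prems(3))
    ultimately have "- 2 * s * eval_fps (fps_deriv A) (1 - s\<^sup>2) =
        of_nat (2 * K + 2) * s ^ (2 * K + 1) * G s + s ^ (2 * K + 2) * deriv G s"
      using DERIV_unique by blast
    also have "\<dots> = - 2 * s * (s ^ (2 * K) * G' s)" by (simp add: G'_def algebra_simps)
    finally show ?thesis using s0 by simp
  qed
  moreover have "fps_conv_radius (fps_deriv A) \<ge> 1"
    by (rule order_trans[OF Suc.prems(1) fps_conv_radius_deriv])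
  ultimately obtain B where B: "\<And>n. norm (fps_nth (fps_deriv A) n) * (real n + 1) ^ K \<le> B"
    using Suc.IH[OF _ G'] by blast
  show ?case
  proof (intro exI allI)
    fix n
    \<comment> \<open>The derivative forgets the coefficient 0, hence the maximum; the factor 2 ^
      Suc K pays for n + 1 \<le> 2 n when n \<ge> 1.\<close>
    show "norm (fps_nth A n) * (real n + 1) ^ Suc K \<le> max (norm (fps_nth A 0)) (2 ^ Suc K * B)"
    proof (cases n)
      case (Suc m)
      have "norm (fps_nth A n) * (real n + 1) ^ Suc K \<le> norm (fps_nth A n) * (2 * (real m + 1)) ^ Suc K"
        by (intro mult_left_mono power_mono) (auto simp: Suc)
      also have "\<dots> = 2 ^ Suc K * (norm (fps_nth (fps_deriv A) m) * (real m + 1) ^ K)"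
        unfolding power_mult_distrib by (simp add: Suc norm_mult del: of_nat_Suc)
      also have "\<dots> \<le> 2 ^ Suc K * B" by (intro mult_left_mono B) auto
      finally show ?thesis by simp
    qed auto
  qed
qed

text \<open>The binomial series of (1 - z)^(e/2), that is, of s^e. Negative e are included for poles
  in s.\<close>

definition halfpow_fps :: "int \<Rightarrow> complex fps" where
  "halfpow_fps e = Abs_fps (\<lambda>n. (of_int e / 2 gchoose n) * (-1) ^ n)"

lemma fps_conv_radius_halfpow: "fps_conv_radius (halfpow_fps e) \<ge> 1"
proof -
  have "conv_radius (\<lambda>n. (of_int e / 2 gchoose n) * (-1) ^ n :: complex) = conv_radius (\<lambda>n. (of_int e / 2 gchoose n) :: complex)"
    unfolding conv_radius_def by (simp add: norm_mult norm_power)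
  thus ?thesis unfolding fps_conv_radius_def halfpow_fps_def by (simp add: conv_radius_gchoose)
qed

lemma eval_halfpow:
  assumes s: "s \<in> lens"
  shows "eval_fps (halfpow_fps e) (1 - s\<^sup>2) = s powi e"
proof -
  have s1: "Re s > 0" "norm (1 - s\<^sup>2) < 1" "s \<noteq> 0" using s by (auto simp: lens_def)
  have "(\<lambda>n. (of_int e / 2 gchoose n) * (- (1 - s\<^sup>2)) ^ n) sums (1 + - (1 - s\<^sup>2)) powr (of_int e / 2)"
    using s1 by (intro gen_binomial_complex) (simp add: norm_minus_commute)
  hence "eval_fps (halfpow_fps e) (1 - s\<^sup>2) = (s\<^sup>2) powr (of_int e / 2)"
    unfolding eval_fps_def halfpow_fps_def fps_nth_Abs_fps
    by (simp only: sums_iff power_minus[of "1 - s\<^sup>2"] mult.assoc) simp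
  also have "\<dots> = exp (of_int e / 2 * Ln (s\<^sup>2))" using s1 by (simp add: powr_def)
  \<comment> \<open>In the right half-plane the argument of s stays below pi/2 in modulus, so
    doubling it does not leave the principal branch.\<close>
  also have "Ln (s\<^sup>2) = 2 * Ln s"
  proof -
    have "\<bar>Im (Ln s)\<bar> < pi / 2" using s1 Re_Ln_pos_lt by blast
    hence "Ln (exp (2 * Ln s)) = 2 * Ln s" by (intro Ln_exp) auto
    thus ?thesis using s1 by (simp add: exp_double)
  qed
  also have "exp (of_int e / 2 * (2 * Ln s)) = s powi e"
    using s1 complex_powr_of_int[of s e] by (simp add: powr_def)
  finally show ?thesis .
qed

text \<open>The entire function \<open>rGamma\<close> is used in place of 1/Gamma: for even e \<ge>
  0 it vanishes at -e/2, in agreement with the series being a polynomial in z.\<close>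

lemma halfpow_asymp:
  "(\<lambda>n. fps_nth (halfpow_fps e) n * of_real (real n powr (of_int e / 2 + 1))) \<longlonglongrightarrow> rGamma (- (of_int e / 2))"
proof -
  have "(\<lambda>n. (of_int e / 2 gchoose n) / ((-1)^n / exp ((of_int e / 2+1) * of_real (ln (real n))))) \<longlonglongrightarrow>
           inverse (Gamma (- (of_int e / 2 :: complex)))"
    by (rule gbinomial_asymptotic)
  moreover have "\<forall>\<^sub>F n in at_top. (of_int e / 2 gchoose n) / ((-1)^n / exp ((of_int e / 2+1) * of_real (ln (real n))))
     = fps_nth (halfpow_fps e) n * of_real (real n powr (of_int e / 2 + 1))"
    using eventually_gt_at_top[of 0]
  proof eventually_elim
    case (elim n)
    have "exp ((of_int e / 2+1) * of_real (ln (real n))) = complex_of_real (exp ((of_int e / 2+1) * ln (real n)))"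
      by (simp add: exp_of_real[symmetric])
    thus ?case using elim
      by (cases "even n") (simp_all add: halfpow_fps_def powr_def)
  qed
  ultimately show ?thesis
    by (simp add: rGamma_inverse_Gamma tendsto_cong)
qed

text \<open>Singularity analysis without a Delta-domain: the remainder has enough bounded derivatives in the open disc.\<close>

lemma coeff_transfer:
  assumes A: "fps_conv_radius A \<ge> 1" and G: "analytic_upto lens G"
    and eq: "\<And>s. s \<in> lens \<Longrightarrow> s ^ m * eval_fps A (1 - s\<^sup>2) = (\<Sum>j<m + 2 * K. h j * s ^ j) + s ^ (m + 2 * K) * G s"
  shows "\<exists>B. \<forall>n. norm (fps_nth A n - (\<Sum>j<m + 2 * K. h j * fps_nth (halfpow_fps (int j - int m)) n)) * (real n + 1) ^ K \<le> B"
proof -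
  \<comment> \<open>The singular part: each s^(j - m) is replaced by its own binomial series, so
    that A - R is left with the factor s^(2 K) required by
    \<open>coeff_bound_of_lens\<close>.\<close>
  define R where "R = (\<Sum>j<m + 2 * K. fps_const (h j) * halfpow_fps (int j - int m))"
  have "fps_conv_radius (\<Sum>j\<in>I. fps_const (h j) * halfpow_fps (int j - int m)) \<ge> 1 \<and>
       (\<forall>s\<in>lens. eval_fps (\<Sum>j\<in>I. fps_const (h j) * halfpow_fps (int j - int m)) (1 - s\<^sup>2) = (\<Sum>j\<in>I. h j * s powi (int j - int m)))"
    if "finite I" for I :: "nat set"
    using that
  proof (induction I rule: finite_induct)
    case (insert i I)
    have 1: "fps_conv_radius (fps_const (h i) * halfpow_fps (int i - int m)) \<ge> 1"
      using fps_conv_radius_mult[of "fps_const (h i)" "halfpow_fps (int i - int m)"] fps_conv_radius_halfpow[of "int i - int m"]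
      by (simp add: min_def split: if_splits)
    have 2: "ereal (norm (1 - s\<^sup>2)) < r" if "s \<in> lens" "r \<ge> 1" for s r
      using that by (metis (mono_tags, lifting) lens_def less_ereal.simps(1) mem_Collect_eq one_ereal_def order_less_le_trans)
    show ?case using insert 1 fps_conv_radius_halfpow[of "int i - int m"]
      by (auto intro!: fps_conv_radius_add_ge simp: eval_fps_add eval_fps_mult 2 eval_halfpow)
  qed auto
  from this[of "{..<m + 2 * K}"] have R: "fps_conv_radius R \<ge> 1"
    "\<And>s. s \<in> lens \<Longrightarrow> eval_fps R (1 - s\<^sup>2) = (\<Sum>j<m + 2 * K. h j * s powi (int j - int m))"
    by (auto simp: R_def)
  have AR: "fps_conv_radius (A - R) \<ge> 1"
    using fps_conv_radius_diff[of A R] A R(1) by (simp add: min_def split: if_splits)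
  have "\<exists>B. \<forall>n. norm (fps_nth (A - R) n) * (real n + 1) ^ K \<le> B"
  proof (rule coeff_bound_of_lens[OF AR G])
    fix s assume s: "s \<in> lens"
    have s0: "s \<noteq> 0" using s zero_notin_lens by blast
    have rad: "ereal (norm (1 - s\<^sup>2)) < r" if "r \<ge> 1" for r
      using that s by (metis (mono_tags, lifting) lens_def less_ereal.simps(1) mem_Collect_eq one_ereal_def order_less_le_trans)
    have "s ^ m * (\<Sum>j<m + 2 * K. h j * s powi (int j - int m)) = (\<Sum>j<m + 2 * K. h j * s ^ j)"
      unfolding sum_distrib_left using s0
      by (intro sum.cong) (auto simp: power_int_diff)
    hence "s ^ m * eval_fps (A - R) (1 - s\<^sup>2) = s ^ m * (s ^ (2 * K) * G s)"
      using eq[OF s] A R s rad by (simp add: eval_fps_diff right_diff_distrib power_add)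
    thus "eval_fps (A - R) (1 - s\<^sup>2) = s ^ (2 * K) * G s" using s0 by simp
  qed
  moreover have "fps_nth (A - R) n = fps_nth A n - (\<Sum>j<m + 2 * K. h j * fps_nth (halfpow_fps (int j - int m)) n)" for n
    by (simp add: R_def fps_sum_nth)
  ultimately show ?thesis by simp
qed

section \<open>Two-term expansions in s and their coefficient asymptotics\<close>

definition cfps :: "real fps \<Rightarrow> complex fps" where
  "cfps a = Abs_fps (\<lambda>n. of_real (fps_nth a n))"

lemma cfps_nth [simp]: "fps_nth (cfps a) n = of_real (fps_nth a n)"
  by (simp add: cfps_def)

lemma cfps_mult: "cfps (a * b) = cfps a * cfps b"
  by (rule fps_ext) (simp add: fps_mult_nth)

lemma cfps_one: "cfps 1 = 1"
  by (rule fps_ext) simp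

lemma cfps_diff: "cfps (a - b) = cfps a - cfps b"
  by (rule fps_ext) simp

lemma cfps_power: "cfps (a ^ n) = cfps a ^ n"
  by (induction n) (simp_all add: cfps_one cfps_mult)

lemma cfps_inverse:
  assumes "fps_nth a 0 \<noteq> 0"
  shows "cfps (inverse a) = inverse (cfps a)"
proof -
  have "cfps (inverse a) * cfps a = 1"
    using assms by (simp flip: cfps_mult add: inverse_mult_eq_1 cfps_one)
  thus ?thesis using assms by (metis fps_inverse_unique mult.commute)
qed

lemma norm_less_radius: "r \<ge> 1 \<Longrightarrow> norm z < 1 \<Longrightarrow> ereal (norm z) < r"
  using less_le_trans[of "ereal (norm z)" 1 r] by (simp add: one_ereal_def)

lemma lens_norm: "s \<in> lens \<Longrightarrow> norm (1 - s\<^sup>2) < 1"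
  by (simp add: lens_def)

text \<open>Here a is the value at z = 1 and b the coefficient of sqrt(1 - z). The constant a leaves
  no trace in large coefficients, so their leading order is governed by b.\<close>

definition sqrt_expansion :: "complex fps \<Rightarrow> complex \<Rightarrow> complex \<Rightarrow> bool" where
  "sqrt_expansion A a b \<longleftrightarrow> fps_conv_radius A \<ge> 1 \<and>
     (\<exists>G. analytic_upto lens G \<and> (\<forall>s\<in>lens. eval_fps A (1 - s\<^sup>2) = a + b * s + s\<^sup>2 * G s))"

lemma sqrt_expansion_analytic:
  assumes "sqrt_expansion A a b"
  shows "fps_conv_radius A \<ge> 1" "analytic_upto lens (\<lambda>s. eval_fps A (1 - s\<^sup>2))"
proof -
  obtain G where G: "analytic_upto lens G" "\<And>s. s \<in> lens \<Longrightarrow> eval_fps A (1 - s\<^sup>2) = a + b * s + s\<^sup>2 * G s"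
    using assms unfolding sqrt_expansion_def by blast
  have "analytic_upto lens (\<lambda>s. a + b * s + s\<^sup>2 * G s)"
    by (intro analytic_upto_add analytic_upto_mult analytic_upto_power analytic_upto_const analytic_upto_ident G)
  thus "analytic_upto lens (\<lambda>s. eval_fps A (1 - s\<^sup>2))" by (rule analytic_upto_cong) (simp add: G)
  show "fps_conv_radius A \<ge> 1" using assms unfolding sqrt_expansion_def by blast
qed

lemma sqrt_expansion_exists:
  assumes "fps_conv_radius A \<ge> 1" "analytic_upto lens (\<lambda>s. eval_fps A (1 - s\<^sup>2))"
  shows "\<exists>a b. sqrt_expansion A a b"
proof -
  obtain h G where "analytic_upto lens G"
    "\<forall>s\<in>lens. eval_fps A (1 - s\<^sup>2) = (\<Sum>j<2. h j * s ^ j) + s ^ 2 * G s"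
    using analytic_upto_expand[OF assms(2) open_lens zero_notin_lens zero_in_closure_lens, of 2] by blast
  hence "sqrt_expansion A (h 0) (h 1)"
    unfolding sqrt_expansion_def using assms(1) by (auto simp: numeral_2_eq_2)
  thus ?thesis by blast
qed

lemma at_zero_lens_nontrivial: "at 0 within lens \<noteq> bot"
  using zero_in_closure_lens zero_notin_lens by (simp add: at_within_eq_bot_iff)

lemma analytic_upto_mult_tendsto_zero:
  assumes "analytic_upto lens G"
  shows "((\<lambda>s. s * G s) \<longlongrightarrow> 0) (at 0 within lens)"
proof -
  obtain B where B: "\<And>s. s \<in> lens \<Longrightarrow> norm (G s) \<le> B" using analytic_upto_bounded[OF assms bounded_lens] by blast
  have 1: "((\<lambda>s. norm s * B) \<longlongrightarrow> norm (0::complex) * B) (at 0 within lens)" by (intro tendsto_intros)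
  have "\<forall>\<^sub>F s in at 0 within lens. norm (s * G s) \<le> norm s * B"
    by (auto simp: eventually_at_filter norm_mult intro!: always_eventually mult_left_mono B)
  from Lim_null_comparison[OF this] 1 show ?thesis by simp
qed

lemma sqrt_expansion_limits:
  assumes "sqrt_expansion A a b"
  shows "((\<lambda>s. eval_fps A (1 - s\<^sup>2)) \<longlongrightarrow> a) (at 0 within lens)"
        "((\<lambda>s. (eval_fps A (1 - s\<^sup>2) - a) / s) \<longlongrightarrow> b) (at 0 within lens)"
proof -
  obtain G where G: "analytic_upto lens G" "\<And>s. s \<in> lens \<Longrightarrow> eval_fps A (1 - s\<^sup>2) = a + b * s + s\<^sup>2 * G s"
    using assms unfolding sqrt_expansion_def by blast
  have z: "((\<lambda>s. s * G s) \<longlongrightarrow> 0) (at 0 within lens)" by (rule analytic_upto_mult_tendsto_zero[OF G(1)])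
  have "((\<lambda>s. a + b * s + s * (s * G s)) \<longlongrightarrow> a + b * 0 + 0 * 0) (at 0 within lens)"
    by (intro tendsto_intros z)
  moreover have "\<forall>\<^sub>F s in at 0 within lens. a + b * s + s * (s * G s) = eval_fps A (1 - s\<^sup>2)"
    by (auto simp: eventually_at_filter G power2_eq_square[of "_::complex", symmetric] mult.assoc[symmetric] intro!: always_eventually)
  ultimately show "((\<lambda>s. eval_fps A (1 - s\<^sup>2)) \<longlongrightarrow> a) (at 0 within lens)"
    by (simp add: tendsto_cong)
  have "((\<lambda>s. b + s * G s) \<longlongrightarrow> b + 0) (at 0 within lens)"
    by (intro tendsto_intros z)
  moreover have "\<forall>\<^sub>F s in at 0 within lens. b + s * G s = (eval_fps A (1 - s\<^sup>2) - a) / s"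
    by (auto simp: eventually_at_filter G add_divide_distrib power2_eq_square[of "_::complex", symmetric] intro!: always_eventually)
       (simp add: power2_eq_square)
  ultimately show "((\<lambda>s. (eval_fps A (1 - s\<^sup>2) - a) / s) \<longlongrightarrow> b) (at 0 within lens)"
    by (simp add: tendsto_cong)
qed

lemma sqrt_expansion_unique:
  assumes "sqrt_expansion A a b" "sqrt_expansion A a' b'"
  shows "a = a'" "b = b'"
proof -
  show "a = a'" using assms[THEN sqrt_expansion_limits(1)] at_zero_lens_nontrivial tendsto_unique by blast
  with assms[THEN sqrt_expansion_limits(2)] show "b = b'"
    using at_zero_lens_nontrivial tendsto_unique by blast
qed

lemma sqrt_expansion_const: "sqrt_expansion (fps_const c) c 0"
  unfolding sqrt_expansion_def by (auto intro!: exI[of _ "\<lambda>_. 0"])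

lemma sqrt_expansion_one: "sqrt_expansion 1 1 0"
  using sqrt_expansion_const[of 1] by simp

lemma sqrt_expansion_X: "sqrt_expansion fps_X 1 0"
  unfolding sqrt_expansion_def by (auto intro!: exI[of _ "\<lambda>_. -1"])

lemma sqrt_expansion_add:
  assumes "sqrt_expansion A a b" "sqrt_expansion A' a' b'"
  shows "sqrt_expansion (A + A') (a + a') (b + b')"
proof -
  obtain G where G: "analytic_upto lens G" "\<And>s. s \<in> lens \<Longrightarrow> eval_fps A (1 - s\<^sup>2) = a + b * s + s\<^sup>2 * G s"
    and r: "fps_conv_radius A \<ge> 1" using assms(1) unfolding sqrt_expansion_def by blast
  obtain G' where G': "analytic_upto lens G'" "\<And>s. s \<in> lens \<Longrightarrow> eval_fps A' (1 - s\<^sup>2) = a' + b' * s + s\<^sup>2 * G' s"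
    and r': "fps_conv_radius A' \<ge> 1" using assms(2) unfolding sqrt_expansion_def by blast
  have "analytic_upto lens (\<lambda>s. G s + G' s)" by (intro analytic_upto_add G G')
  moreover have "eval_fps (A + A') (1 - s\<^sup>2) = (a + a') + (b + b') * s + s\<^sup>2 * (G s + G' s)" if "s \<in> lens" for s
    using that G(2)[OF that] G'(2)[OF that] norm_less_radius[OF r lens_norm[OF that]] norm_less_radius[OF r' lens_norm[OF that]]
    by (simp add: eval_fps_add algebra_simps)
  ultimately show ?thesis
    unfolding sqrt_expansion_def using fps_conv_radius_add_ge[OF r r'] by blast
qed

lemma sqrt_expansion_mult:
  assumes "sqrt_expansion A a b" "sqrt_expansion A' a' b'"
  shows "sqrt_expansion (A * A') (a * a') (a * b' + b * a')"
proof -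
  obtain G where G: "analytic_upto lens G" "\<And>s. s \<in> lens \<Longrightarrow> eval_fps A (1 - s\<^sup>2) = a + b * s + s\<^sup>2 * G s"
    and r: "fps_conv_radius A \<ge> 1" using assms(1) unfolding sqrt_expansion_def by blast
  obtain G' where G': "analytic_upto lens G'" "\<And>s. s \<in> lens \<Longrightarrow> eval_fps A' (1 - s\<^sup>2) = a' + b' * s + s\<^sup>2 * G' s"
    and r': "fps_conv_radius A' \<ge> 1" using assms(2) unfolding sqrt_expansion_def by blast
  define H where "H = (\<lambda>s. b * b' + a * G' s + b * s * G' s + G s * (a' + b' * s + s\<^sup>2 * G' s))"
  have "analytic_upto lens H" unfolding H_def
    by (intro analytic_upto_add analytic_upto_mult analytic_upto_power analytic_upto_const analytic_upto_ident G G')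
  moreover have "eval_fps (A * A') (1 - s\<^sup>2) = a * a' + (a * b' + b * a') * s + s\<^sup>2 * H s" if "s \<in> lens" for s
    using that G(2)[OF that] G'(2)[OF that] norm_less_radius[OF r lens_norm[OF that]] norm_less_radius[OF r' lens_norm[OF that]]
    by (simp add: eval_fps_mult H_def algebra_simps power2_eq_square)
  moreover have "fps_conv_radius (A * A') \<ge> 1"
    using fps_conv_radius_mult[of A A'] r r' by (simp add: min_def split: if_splits)
  ultimately show ?thesis unfolding sqrt_expansion_def by blast
qed

lemma sqrt_expansion_cmult: "sqrt_expansion A a b \<Longrightarrow> sqrt_expansion (fps_const c * A) (c * a) (c * b)"
  using sqrt_expansion_mult[OF sqrt_expansion_const[of c], of A a b] by simp

lemma sqrt_expansion_diff:
  assumes "sqrt_expansion A a b" "sqrt_expansion A' a' b'"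
  shows "sqrt_expansion (A - A') (a - a') (b - b')"
  using sqrt_expansion_add[OF assms(1) sqrt_expansion_cmult[OF assms(2), of "-1"]]
  by (simp flip: fps_const_neg)

lemma sqrt_expansion_sum:
  assumes "\<And>i. i \<in> I \<Longrightarrow> sqrt_expansion (A i) (a i) (b i)"
  shows "sqrt_expansion (\<Sum>i\<in>I. A i) (\<Sum>i\<in>I. a i) (\<Sum>i\<in>I. b i)"
  using assms
proof (induction I rule: infinite_finite_induct)
  case (insert x F)
  thus ?case by (simp add: sqrt_expansion_add)
qed (use sqrt_expansion_const[of 0] in simp_all)

lemma sqrt_expansion_power:
  "sqrt_expansion A a b \<Longrightarrow> sqrt_expansion (A ^ n) (a ^ n) (of_nat n * a ^ (n - 1) * b)"
proof (induction n)
  case 0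
  thus ?case using sqrt_expansion_one by simp
next
  case (Suc n)
  have "sqrt_expansion (A * A ^ n) (a * a ^ n) (a * (of_nat n * a ^ (n - 1) * b) + b * a ^ n)"
    by (rule sqrt_expansion_mult) (use Suc in auto)
  moreover have "a * (of_nat n * a ^ (n - 1) * b) + b * a ^ n = of_nat (Suc n) * a ^ (Suc n - 1) * b"
    by (cases n) (simp_all add: algebra_simps)
  ultimately show ?case by simp
qed

text \<open>The lower bound yields some expansion of the inverse; its two coefficients then follow
  from uniqueness, applied to the product \<open>inverse A * A = 1\<close>.\<close>

lemma sqrt_expansion_inverse:
  assumes A: "sqrt_expansion A a b" and \<delta>: "\<delta> > 0" and lower: "\<And>z. norm z < 1 \<Longrightarrow> \<delta> \<le> norm (eval_fps A z)"
  shows "sqrt_expansion (inverse A) (inverse a) (- b / a\<^sup>2)"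
proof -
  note r = sqrt_expansion_analytic[OF A]
  have nz: "eval_fps A z \<noteq> 0" if "ereal (norm z) < 1" for z
    using lower[of z] \<delta> that by (auto simp: one_ereal_def)
  have r': "fps_conv_radius (inverse A) \<ge> 1"
    using fps_conv_radius_inverse[of 1 A] nz r(1) by (auto simp: min_def split: if_splits)
  have ev: "eval_fps (inverse A) z = inverse (eval_fps A z)" if "norm z < 1" for z
    using that norm_less_radius[OF r(1) that] by (intro eval_fps_inverse[of 1] nz) (auto simp: one_ereal_def)
  have "analytic_upto lens (\<lambda>s. inverse (eval_fps A (1 - s\<^sup>2)))"
    by (rule analytic_upto_inverse[OF r(2)])
       (use \<delta> lower lens_norm in \<open>auto intro!: exI[of _ \<delta>]\<close>)
  hence "analytic_upto lens (\<lambda>s. eval_fps (inverse A) (1 - s\<^sup>2))"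
    by (rule analytic_upto_cong) (simp add: ev lens_norm)
  then obtain c d where cd: "sqrt_expansion (inverse A) c d"
    using sqrt_expansion_exists r' by blast
  have "fps_nth A 0 \<noteq> 0" using nz[of 0] by (simp add: eval_fps_at_0)
  hence "inverse A * A = 1" by (rule inverse_mult_eq_1)
  with sqrt_expansion_mult[OF cd A] have "sqrt_expansion 1 (c * a) (c * b + d * a)" by simp
  from sqrt_expansion_unique[OF this sqrt_expansion_one] have "c * a = 1" "c * b + d * a = 0" by auto
  hence a: "a \<noteq> 0" and c: "c = inverse a" using inverse_unique[of a c] by (auto simp: mult.commute)
  have "d * a = - (c * b)" using \<open>c * b + d * a = 0\<close> by (simp add: add_eq_0_iff2)
  hence "d = - b / a\<^sup>2" using a c by (simp add: field_simps power2_eq_square)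
  thus ?thesis using cd c by simp
qed

lemma halfpow_1_lower:
  "\<exists>\<delta>>0. \<forall>\<^sub>F n in sequentially. \<delta> / real n powr (3/2) \<le> norm (fps_nth (halfpow_fps 1) n)"
proof -
  define L where "L = norm (rGamma (- (of_int 1 / 2 :: complex)))"
  have "rGamma (- (1 / 2) :: complex) = - (1/2) * rGamma (1/2)"
    using rGamma_plus1[of "- (1/2) :: complex"] by simp
  hence L: "L > 0" by (simp add: L_def rGamma_inverse_Gamma Gamma_one_half_complex)
  have "(\<lambda>n. norm (fps_nth (halfpow_fps 1) n * of_real (real n powr (of_int 1 / 2 + 1)))) \<longlonglongrightarrow> L"
    unfolding L_def by (intro tendsto_norm halfpow_asymp)
  hence "\<forall>\<^sub>F n in sequentially. L / 2 < norm (fps_nth (halfpow_fps 1) n * of_real (real n powr (of_int 1 / 2 + 1)))"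
    by (rule order_tendstoD(1)) (use L in simp)
  hence "\<forall>\<^sub>F n in sequentially. (L / 2) / real n powr (3/2) \<le> norm (fps_nth (halfpow_fps 1) n)"
    using eventually_gt_at_top[of 0]
  proof eventually_elim
    case (elim n)
    thus ?case by (simp add: norm_mult divide_simps)
  qed
  thus ?thesis using L by (meson half_gt_zero)
qed

lemma halfpow_upper:
  "\<exists>K. \<forall>\<^sub>F n in sequentially. norm (fps_nth (halfpow_fps e) n) \<le> K / real n powr (of_int e / 2 + 1)"
proof -
  have "Bseq (\<lambda>n. fps_nth (halfpow_fps e) n * of_real (real n powr (of_int e / 2 + 1)))"
    by (rule convergent_imp_Bseq[OF convergentI[OF halfpow_asymp]])
  then obtain K where K: "\<And>n. norm (fps_nth (halfpow_fps e) n * of_real (real n powr (of_int e / 2 + 1))) \<le> K"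
    by (auto simp: Bseq_def)
  have "\<forall>\<^sub>F n in sequentially. norm (fps_nth (halfpow_fps e) n) \<le> K / real n powr (of_int e / 2 + 1)"
    using eventually_gt_at_top[of 0]
  proof eventually_elim
    case (elim n)
    thus ?case using K[of n] by (simp add: norm_mult divide_simps)
  qed
  thus ?thesis by blast
qed

text \<open>Even powers of s are polynomials in z. Hence s^2 and s^4 drop out of large coefficients,
  and the relative error after the term s is of order 1/n rather than 1/sqrt n.\<close>

lemma halfpow_even_zero: "n > k \<Longrightarrow> fps_nth (halfpow_fps (2 * int k)) n = 0"
  using binomial_gbinomial[of k n, where 'a = complex]
  by (simp add: halfpow_fps_def binomial_eq_0)

lemma sqrt_expansion_coeff:
  assumes "sqrt_expansion A a b"
  shows "\<exists>K. \<forall>\<^sub>F n in sequentially. norm (fps_nth A n / fps_nth (halfpow_fps 1) n - b) \<le> K / real n"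
proof -
  obtain G where G: "analytic_upto lens G" "\<And>s. s \<in> lens \<Longrightarrow> eval_fps A (1 - s\<^sup>2) = a + b * s + s\<^sup>2 * G s"
    and r: "fps_conv_radius A \<ge> 1" using assms(1) unfolding sqrt_expansion_def by blast
  obtain g G' where G': "analytic_upto lens G'" "\<And>s. s \<in> lens \<Longrightarrow> G s = (\<Sum>j<4. g j * s ^ j) + s ^ 4 * G' s"
    using analytic_upto_expand[OF G(1) open_lens zero_notin_lens zero_in_closure_lens, of 4] by blast
  define h where "h = (\<lambda>j. if j = 0 then a else if j = 1 then b else g (j - 2))"
  \<comment> \<open>Six terms are expanded so that the remainder is O(1/n^3). Four would only give
    O(1/n^2), which is not small enough against n^(-5/2), the order of the first neglected term
    s^3.\<close>
  have "s ^ 0 * eval_fps A (1 - s\<^sup>2) = (\<Sum>j<0 + 2 * 3. h j * s ^ j) + s ^ (0 + 2 * 3) * G' s" if "s \<in> lens" for s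
    using G(2)[OF that] G'(2)[OF that]
    by (simp add: h_def eval_nat_numeral algebra_simps)
  from coeff_transfer[OF r G'(1) this] obtain B where
    B: "\<And>n. norm (fps_nth A n - (\<Sum>j<6. h j * fps_nth (halfpow_fps (int j)) n)) * (real n + 1) ^ 3 \<le> B"
    by auto
  let ?c = "\<lambda>e n. fps_nth (halfpow_fps e) n"
  obtain \<delta> where \<delta>: "\<delta> > 0" "\<forall>\<^sub>F n in sequentially. \<delta> / real n powr (3/2) \<le> norm (?c 1 n)"
    using halfpow_1_lower by blast
  obtain K3 where K3: "\<forall>\<^sub>F n in sequentially. norm (?c 3 n) \<le> K3 / real n powr (5/2)"
    using halfpow_upper[of 3] by auto
  obtain K5 where K5: "\<forall>\<^sub>F n in sequentially. norm (?c 5 n) \<le> K5 / real n powr (7/2)"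
    using halfpow_upper[of 5] by auto
  have "\<forall>\<^sub>F n in sequentially. norm (fps_nth A n / ?c 1 n - b) \<le> ((norm (g 1) * \<bar>K3\<bar> + norm (g 3) * \<bar>K5\<bar> + \<bar>B\<bar>) / \<delta>) / real n"
    using \<delta>(2) K3 K5 eventually_gt_at_top[of 3]
  proof eventually_elim
    case (elim n)
    define N where "N = real n powr (1/2)"
    have n: "real n = N ^ 2" "real n powr (3/2) = N ^ 3" "real n powr (5/2) = N ^ 5" "real n powr (7/2) = N ^ 7"
      unfolding N_def using elim by (simp_all add: powr_powr powr_realpow[symmetric] flip: powr_numeral)
    have N: "N > 1"
    proof -
      have "N ^ 2 > 1 ^ 2" using n(1) elim(4) by simp
      thus ?thesis using power2_less_imp_less[of 1 N] by (simp add: N_def)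
    qed
    have c1: "?c 1 n \<noteq> 0" using elim(1) \<delta>(1) N n(2) by (auto simp: divide_le_0_iff)
    have z: "?c 0 n = 0" "?c 2 n = 0" "?c 4 n = 0"
      using halfpow_even_zero[of 0 n] halfpow_even_zero[of 1 n] halfpow_even_zero[of 2 n] elim(4) by auto
    have sum6: "(\<Sum>j<6. h j * ?c (int j) n) = b * ?c 1 n + g 1 * ?c 3 n + g 3 * ?c 5 n"
      using z by (simp add: h_def eval_nat_numeral)
    have "norm (fps_nth A n - (\<Sum>j<6. h j * ?c (int j) n)) \<le> \<bar>B\<bar> / (real n + 1) ^ 3"
      using B[of n] by (simp add: divide_simps)
    also have "\<dots> \<le> \<bar>B\<bar> / N ^ 5"
    proof (rule divide_left_mono)
      have "N ^ 5 \<le> N ^ 6" using N by (intro power_increasing) auto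
      also have "\<dots> = (N ^ 2) ^ 3" by simp
      also have "\<dots> \<le> (real n + 1) ^ 3" unfolding n(1) by (intro power_mono) auto
      finally show "N ^ 5 \<le> (real n + 1) ^ 3" .
    qed (use N in auto)
    finally have b1: "norm (fps_nth A n - (b * ?c 1 n + g 1 * ?c 3 n + g 3 * ?c 5 n)) \<le> \<bar>B\<bar> / N ^ 5"
      unfolding sum6 .
    have b2: "norm (g 1 * ?c 3 n) \<le> norm (g 1) * \<bar>K3\<bar> / N ^ 5"
    proof -
      have "norm (?c 3 n) \<le> \<bar>K3\<bar> / N ^ 5" using elim(2) N unfolding n(2-4)
        by (meson abs_ge_self divide_right_mono less_le_trans less_imp_le order_trans zero_less_one zero_le_power)
      from mult_left_mono[OF this, of "norm (g 1)"] show ?thesis by (simp add: norm_mult)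
    qed
    have b3: "norm (g 3 * ?c 5 n) \<le> norm (g 3) * \<bar>K5\<bar> / N ^ 5"
    proof -
      have "norm (?c 5 n) \<le> \<bar>K5\<bar> / N ^ 5"
      proof (rule order_trans[OF elim(3)])
        have "K5 / N ^ 7 \<le> \<bar>K5\<bar> / N ^ 7" using N by (auto intro!: divide_right_mono)
        also have "\<dots> \<le> \<bar>K5\<bar> / N ^ 5" using N by (intro divide_left_mono power_increasing) auto
        finally show "K5 / real n powr (7/2) \<le> \<bar>K5\<bar> / N ^ 5" unfolding n(2-4) .
      qed
      from mult_left_mono[OF this, of "norm (g 3)"] show ?thesis by (simp add: norm_mult)
    qed
    have "norm (fps_nth A n - b * ?c 1 n) =
       norm ((fps_nth A n - (b * ?c 1 n + g 1 * ?c 3 n + g 3 * ?c 5 n)) + g 1 * ?c 3 n + g 3 * ?c 5 n)"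
      by (simp add: algebra_simps)
    also have "\<dots> \<le> \<bar>B\<bar> / N ^ 5 + norm (g 1) * \<bar>K3\<bar> / N ^ 5 + norm (g 3) * \<bar>K5\<bar> / N ^ 5"
      by (intro norm_triangle_le add_mono b1 b2 b3)
    also have "\<dots> = (norm (g 1) * \<bar>K3\<bar> + norm (g 3) * \<bar>K5\<bar> + \<bar>B\<bar>) / N ^ 5" by (simp add: add_divide_distrib)
    finally have up: "norm (fps_nth A n - b * ?c 1 n) \<le> (norm (g 1) * \<bar>K3\<bar> + norm (g 3) * \<bar>K5\<bar> + \<bar>B\<bar>) / N ^ 5" .
    have "norm (fps_nth A n / ?c 1 n - b) = norm (fps_nth A n - b * ?c 1 n) / norm (?c 1 n)"
      using c1 by (simp add: norm_divide[symmetric] diff_divide_distrib)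
    also have "\<dots> \<le> ((norm (g 1) * \<bar>K3\<bar> + norm (g 3) * \<bar>K5\<bar> + \<bar>B\<bar>) / N ^ 5) / (\<delta> / N ^ 3)"
      using up elim(1) \<delta>(1) N unfolding n(2-4) by (intro frac_le) auto
    also have "\<dots> = ((norm (g 1) * \<bar>K3\<bar> + norm (g 3) * \<bar>K5\<bar> + \<bar>B\<bar>) / \<delta>) / real n"
      using N \<delta>(1) unfolding n(1) by (simp add: field_simps eval_nat_numeral)
    finally show ?case .
  qed
  thus ?thesis by blast
qed

text \<open>Both coefficients are compared with that of sqrt(1 - z), which cancels in the
  quotient.\<close>

lemma sqrt_expansion_coeff_ratio:
  fixes a b :: "real fps" and a1 b1 :: real
  assumes a: "sqrt_expansion (cfps a) a0 (of_real a1)" and b: "sqrt_expansion (cfps b) b0 (of_real b1)"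
    and nz: "a1 \<noteq> 0" "b1 \<noteq> 0"
  shows "\<exists>g. g \<in> O(\<lambda>n. 1 / real n) \<and> (\<forall>\<^sub>F n in at_top. fps_nth a n / fps_nth b n = a1 / b1 * (1 + g n))"
proof -
  let ?c = "\<lambda>n. fps_nth (halfpow_fps 1) n"
  obtain K where K: "\<forall>\<^sub>F n in sequentially. norm (of_real (fps_nth a n) / ?c n - of_real a1) \<le> K / real n"
    using sqrt_expansion_coeff[OF a] by auto
  obtain L where L: "\<forall>\<^sub>F n in sequentially. norm (of_real (fps_nth b n) / ?c n - of_real b1) \<le> L / real n"
    using sqrt_expansion_coeff[OF b] by auto
  define g where "g = (\<lambda>n. (fps_nth a n / fps_nth b n) * (b1 / a1) - 1)"
  have "(\<lambda>n. L / real n) \<longlonglongrightarrow> 0" by (rule lim_const_over_n)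
  hence "\<forall>\<^sub>F n in sequentially. L / real n < \<bar>b1\<bar> / 2" by (rule order_tendstoD(2)) (use nz in simp)
  hence "\<forall>\<^sub>F n in sequentially. norm (g n) \<le> ((K * \<bar>b1\<bar> + L * \<bar>a1\<bar>) / (\<bar>b1\<bar> / 2 * \<bar>a1\<bar>)) * norm (1 / real n)"
    using K L eventually_gt_at_top[of 0]
  proof eventually_elim
    case (elim n)
    define x y where "x = of_real (fps_nth a n) / ?c n" and "y = of_real (fps_nth b n) / ?c n"
    have y: "norm y \<ge> \<bar>b1\<bar> / 2"
    proof -
      have "\<bar>b1\<bar> \<le> norm y + norm (y - of_real b1)"
        using norm_triangle_ineq[of y "of_real b1 - y"] by (simp add: norm_minus_commute)
      thus ?thesis using elim(1,3) unfolding y_def by linarith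
    qed
    have c: "?c n \<noteq> 0" "y \<noteq> 0" using y nz unfolding y_def by auto
    have "complex_of_real (g n) = x / y * (of_real b1 / of_real a1) - 1"
      unfolding g_def x_def y_def using c by simp
    also have "\<dots> = ((x - of_real a1) * of_real b1 - (y - of_real b1) * of_real a1) / (y * of_real a1)"
      using c nz by (simp add: field_simps)
    finally have "norm (complex_of_real (g n)) = norm ((x - of_real a1) * of_real b1 - (y - of_real b1) * of_real a1) / (norm y * \<bar>a1\<bar>)"
      by (simp add: norm_divide norm_mult)
    also have "\<dots> \<le> (K / real n * \<bar>b1\<bar> + L / real n * \<bar>a1\<bar>) / (\<bar>b1\<bar> / 2 * \<bar>a1\<bar>)"
    proof (rule frac_le)
      have "norm ((x - of_real a1) * of_real b1 - (y - of_real b1) * of_real a1) \<le> norm ((x - of_real a1) * of_real b1) + norm ((y - of_real b1) * of_real a1)"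
        by (rule norm_triangle_ineq4)
      also have "\<dots> \<le> K / real n * \<bar>b1\<bar> + L / real n * \<bar>a1\<bar>"
        unfolding norm_mult norm_of_real
        by (intro add_mono mult_right_mono elim(2)[folded x_def] elim(3)[folded y_def]) auto
      finally show "norm ((x - of_real a1) * of_real b1 - (y - of_real b1) * of_real a1) \<le> K / real n * \<bar>b1\<bar> + L / real n * \<bar>a1\<bar>" .
      thus "0 \<le> K / real n * \<bar>b1\<bar> + L / real n * \<bar>a1\<bar>" by (rule order_trans[OF norm_ge_zero])
      show "\<bar>b1\<bar> / 2 * \<bar>a1\<bar> \<le> norm y * \<bar>a1\<bar>" using y by (intro mult_right_mono) auto
    qed (use nz in auto)
    also have "\<dots> = ((K * \<bar>b1\<bar> + L * \<bar>a1\<bar>) / (\<bar>b1\<bar> / 2 * \<bar>a1\<bar>)) * norm (1 / real n)"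
      using elim(4) nz by (simp add: field_simps)
    finally show ?case by simp
  qed
  hence "g \<in> O(\<lambda>n. 1 / real n)" by (rule bigoI)
  moreover have "fps_nth a n / fps_nth b n = a1 / b1 * (1 + g n)" for n
    unfolding g_def using nz by simp
  ultimately show ?thesis by (intro exI[of _ g]) simp
qed

lemma norm_eval_cfps_le:
  assumes "\<And>n. fps_nth f n \<ge> 0" "fps_nth f sums l" "norm z \<le> 1"
  shows "summable (\<lambda>n. norm (of_real (fps_nth f n) * z ^ n))" "norm (eval_fps (cfps f) z) \<le> l"
proof -
  have le: "norm (of_real (fps_nth f n) * z ^ n) \<le> fps_nth f n" for n
    using assms(1)[of n] power_le_one[OF norm_ge_zero assms(3), of n]
    by (simp add: norm_mult norm_power mult_left_le)
  show *: "summable (\<lambda>n. norm (of_real (fps_nth f n) * z ^ n))"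
    by (rule summable_comparison_test'[OF sums_summable[OF assms(2)]]) (use le in auto)
  have "norm (eval_fps (cfps f) z) \<le> (\<Sum>n. norm (of_real (fps_nth f n) * z ^ n))"
    unfolding eval_fps_def cfps_nth by (rule summable_norm[OF *])
  also have "\<dots> \<le> (\<Sum>n. fps_nth f n)" by (rule suminf_le[OF le * sums_summable[OF assms(2)]])
  finally show "norm (eval_fps (cfps f) z) \<le> l" using assms(2) by (simp add: sums_iff)
qed

text \<open>Since |f| \<le> l < 1 on the disc, 1/(1 - f) adds no singularity, and both series keep a
  square root singularity. By the product rule their coefficients of s are -E1 l^k (k \<eta>/l +
  \<kappa>) and -E1 (\<eta> D^2 + \<kappa> D), whose quotient is the claimed constant.\<close>

theorem subcritical_composition:
  fixes e f :: "real fps"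
  assumes e: "sqrt_expansion (cfps e) (of_real E1) (- of_real (E1 * \<kappa>))" "E1 > 0" "\<kappa> > 0"
    and f: "sqrt_expansion (cfps f) (of_real l) (- of_real \<eta>)" "0 < l" "l < 1" "\<eta> \<ge> 0"
    and f_nonneg: "\<And>n. fps_nth f n \<ge> 0" and f_sum: "fps_nth f sums l" and f0: "fps_nth f 0 = 0"
    and D_def: "D = 1 / (1 - l)"
  shows "\<exists>g. g \<in> O(\<lambda>n. 1 / real n) \<and> (\<forall>\<^sub>F n in at_top.
     fps_nth (e * f ^ k) n / fps_nth (e * inverse (1 - f)) n =
       (real k * \<eta> / l + \<kappa>) * l ^ k / (\<eta> * D\<^sup>2 + \<kappa> * D) * (1 + g n))"
proof -
  have D: "D > 0" using f D_def by simp
  define a1 where "a1 = - E1 * (l ^ k * (real k * \<eta> / l + \<kappa>))"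
  define b1 where "b1 = - E1 * (\<eta> * D\<^sup>2 + \<kappa> * D)"
  have "sqrt_expansion (cfps e * cfps f ^ k) (of_real E1 * of_real l ^ k)
     (of_real E1 * (of_nat k * of_real l ^ (k - 1) * - of_real \<eta>) + - of_real (E1 * \<kappa>) * of_real l ^ k)"
    by (intro sqrt_expansion_mult sqrt_expansion_power e f)
  moreover have "of_real E1 * (of_nat k * of_real l ^ (k - 1) * - of_real \<eta>) + - of_real (E1 * \<kappa>) * of_real l ^ k = complex_of_real a1"
    using f(2) by (cases k) (simp_all add: a1_def field_simps)
  ultimately have A: "sqrt_expansion (cfps (e * f ^ k)) (of_real E1 * of_real l ^ k) (of_real a1)"
    by (simp add: cfps_mult cfps_power)
  have "sqrt_expansion (1 - cfps f) (1 - of_real l) (0 - - of_real \<eta>)"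
    by (intro sqrt_expansion_diff sqrt_expansion_one f)
  from sqrt_expansion_inverse[OF this, of "1 - l"]
  have inv: "sqrt_expansion (inverse (1 - cfps f)) (inverse (1 - of_real l)) (- of_real \<eta> / (1 - of_real l)\<^sup>2)"
  proof -
    have ev: "1 - l \<le> norm (eval_fps (1 - cfps f) z)" if "norm z < 1" for z
    proof -
      have "eval_fps (1 - cfps f) z = 1 - eval_fps (cfps f) z"
        using norm_less_radius[OF sqrt_expansion_analytic(1)[OF f(1)] that] by (subst eval_fps_diff) auto
      thus ?thesis using norm_eval_cfps_le(2)[OF f_nonneg f_sum, of z] that
          norm_triangle_ineq2[of 1 "eval_fps (cfps f) z"] by simp
    qed
    show ?thesis using sqrt_expansion_inverse[OF \<open>sqrt_expansion (1 - cfps f) _ _\<close>, of "1 - l"] ev f(3) by simp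
  qed
  have "inverse (1 - cfps f) = cfps (inverse (1 - f))"
    using f0 by (simp add: cfps_inverse cfps_diff cfps_one)
  with sqrt_expansion_mult[OF e(1) inv]
  have "sqrt_expansion (cfps (e * inverse (1 - f))) (of_real E1 * inverse (1 - of_real l))
     (of_real E1 * (- of_real \<eta> / (1 - of_real l)\<^sup>2) + - of_real (E1 * \<kappa>) * inverse (1 - of_real l))"
    by (simp add: cfps_mult)
  moreover have "of_real E1 * (- of_real \<eta> / (1 - of_real l)\<^sup>2) + - of_real (E1 * \<kappa>) * inverse (1 - of_real l) = complex_of_real b1"
  proof -
    have D': "complex_of_real D = inverse (1 - of_real l)" by (simp add: D_def divide_inverse)
    have "- of_real \<eta> / (1 - complex_of_real l)\<^sup>2 = - of_real \<eta> * (of_real D)\<^sup>2"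
      unfolding D' by (simp add: divide_inverse power_inverse)
    thus ?thesis unfolding D'[symmetric] b1_def by (simp add: algebra_simps)
  qed
  ultimately have B: "sqrt_expansion (cfps (e * inverse (1 - f))) (of_real E1 * inverse (1 - of_real l)) (of_real b1)"
    by simp
  have "real k * \<eta> / l + \<kappa> > 0" using f e by (intro add_nonneg_pos) auto
  hence "a1 \<noteq> 0" using e f by (simp add: a1_def)
  moreover have "\<eta> * D\<^sup>2 + \<kappa> * D > 0" using f e D by (intro add_nonneg_pos) auto
  hence "b1 \<noteq> 0" using e by (simp add: b1_def)
  moreover have "a1 / b1 = (real k * \<eta> / l + \<kappa>) * l ^ k / (\<eta> * D\<^sup>2 + \<kappa> * D)"
    using e by (simp add: a1_def b1_def)
  ultimately show ?thesis using sqrt_expansion_coeff_ratio[OF A B] by simp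
qed

text \<open>The leading term h s^(-m) yields h n^(m/2 - 1)/Gamma(m/2), and every further term is
  smaller by at least n^(-1/2). A remainder O(1/n) is negligible because m \<ge> 1.\<close>

lemma inverse_sqrt_power_coeff:
  assumes r: "fps_conv_radius A \<ge> 1" and H: "analytic_upto lens H"
    and eq: "\<And>s. s \<in> lens \<Longrightarrow> s ^ m * eval_fps A (1 - s\<^sup>2) = H s"
    and lim: "(H \<longlongrightarrow> h) (at 0 within lens)" and m: "m \<ge> 1"
  shows "(\<lambda>n. fps_nth A n * of_real (real n powr (1 - real m / 2))) \<longlonglongrightarrow> h * rGamma (of_nat m / 2)"
proof -
  obtain g G where G: "analytic_upto lens G" "\<And>s. s \<in> lens \<Longrightarrow> H s = (\<Sum>j<m + 2 * 1. g j * s ^ j) + s ^ (m + 2 * 1) * G s"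
    using analytic_upto_expand[OF H open_lens zero_notin_lens zero_in_closure_lens, of "m + 2 * 1"] by blast
  have g0: "g 0 = h"
  proof -
    have "((\<lambda>s. (\<Sum>j<m + 2 * 1. g j * s ^ j) + s ^ (m + 1) * (s * G s)) \<longlongrightarrow> (\<Sum>j<m + 2 * 1. g j * 0 ^ j) + 0 ^ (m + 1) * 0) (at 0 within lens)"
      by (intro tendsto_intros analytic_upto_mult_tendsto_zero G)
    moreover have "(\<Sum>j<m + 2 * 1. g j * 0 ^ j) = g 0"
      using sum.remove[of "{..<m + 2 * 1}" 0 "\<lambda>j. g j * 0 ^ j"] by (simp add: power_0_left)
    moreover have "\<forall>\<^sub>F s in at 0 within lens. (\<Sum>j<m + 2 * 1. g j * s ^ j) + s ^ (m + 1) * (s * G s) = H s"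
      by (auto simp: eventually_at_filter G intro!: always_eventually)
    ultimately have "(H \<longlongrightarrow> g 0) (at 0 within lens)" by (simp add: tendsto_cong)
    thus ?thesis using lim tendsto_unique at_zero_lens_nontrivial by blast
  qed
  let ?c = "\<lambda>j n. fps_nth (halfpow_fps (int j - int m)) n"
  let ?p = "\<lambda>n::nat. complex_of_real (real n powr (1 - real m / 2))"
  have "s ^ m * eval_fps A (1 - s\<^sup>2) = (\<Sum>j<m + 2 * 1. g j * s ^ j) + s ^ (m + 2 * 1) * G s" if "s \<in> lens" for s
    using eq[OF that] G(2)[OF that] by simp
  from coeff_transfer[OF r G(1) this] obtain B where
    B: "\<And>n. norm (fps_nth A n - (\<Sum>j<m + 2. g j * ?c j n)) * (real n + 1) \<le> B" by auto
  have cj: "(\<lambda>n. ?c j n * ?p n) \<longlonglongrightarrow> (if j = 0 then rGamma (of_nat m / 2) else 0)" for j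
  proof -
    have "(\<lambda>n. ?c j n * of_real (real n powr (of_int (int j - int m) / 2 + 1)) * of_real (real n powr (- real j / 2)))
       \<longlonglongrightarrow> rGamma (- (of_int (int j - int m) / 2)) * of_real (if j = 0 then 1 else 0)"
    proof (intro tendsto_mult halfpow_asymp tendsto_of_real)
      show "(\<lambda>n. real n powr (- real j / 2)) \<longlonglongrightarrow> (if j = 0 then 1 else 0)"
      proof (cases "j = 0")
        case False
        thus ?thesis using tendsto_neg_powr[of "- real j / 2" real sequentially] filterlim_real_sequentially by simp
      next
        case True
        have "\<forall>\<^sub>F n in sequentially. real n powr (- real j / 2) = 1"
          using eventually_gt_at_top[of 0] by eventually_elim (use True in auto)
        thus ?thesis using True by (simp add: tendsto_eventually)
      qed
    qed
    moreover have "of_real (real n powr (of_int (int j - int m) / 2 + 1)) * of_real (real n powr (- real j / 2)) = ?p n" for n :: nat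
      unfolding of_real_mult[symmetric] powr_add[symmetric]
      by (rule arg_cong[of _ _ "\<lambda>x. complex_of_real (real n powr x)"]) (simp add: field_simps)
    moreover have "rGamma (- (of_int (int j - int m) / 2)) * complex_of_real (if j = 0 then 1 else 0) = (if j = 0 then rGamma (of_nat m / 2) else 0)"
      by simp
    ultimately show ?thesis by (simp only: mult.assoc)
  qed
  have main: "(\<lambda>n. \<Sum>j<m + 2. g j * (?c j n * ?p n)) \<longlonglongrightarrow> (\<Sum>j<m + 2. g j * (if j = 0 then rGamma (of_nat m / 2) else 0))"
    by (intro tendsto_sum tendsto_mult tendsto_const cj)
  have "(\<Sum>j<m + 2. g j * (if j = 0 then rGamma (of_nat m / 2) else 0)) = h * rGamma (of_nat m / 2)"
    using g0 sum.remove[of "{..<m + 2}" 0 "\<lambda>j. g j * (if j = 0 then rGamma (of_nat m / 2) else 0 :: complex)"] by simp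
  with main have main': "(\<lambda>n. \<Sum>j<m + 2. g j * (?c j n * ?p n)) \<longlonglongrightarrow> h * rGamma (of_nat m / 2)" by simp
  have rem: "(\<lambda>n. (fps_nth A n - (\<Sum>j<m + 2. g j * ?c j n)) * ?p n) \<longlonglongrightarrow> 0"
  proof (rule Lim_null_comparison)
    have m0: "- (real m / 2) < 0" using m by simp
    have "(\<lambda>n. \<bar>B\<bar> * real n powr (- (real m / 2))) \<longlonglongrightarrow> \<bar>B\<bar> * 0"
      by (intro tendsto_mult tendsto_const tendsto_neg_powr[OF m0] filterlim_real_sequentially)
    thus "(\<lambda>n. \<bar>B\<bar> * real n powr (- (real m / 2))) \<longlonglongrightarrow> 0" by simp
    show "\<forall>\<^sub>F n in sequentially. norm ((fps_nth A n - (\<Sum>j<m + 2. g j * ?c j n)) * ?p n) \<le> \<bar>B\<bar> * real n powr (- (real m / 2))"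
      using eventually_gt_at_top[of 0]
    proof eventually_elim
      case (elim n)
      have "norm (fps_nth A n - (\<Sum>j<m + 2. g j * ?c j n)) * real n \<le> norm (fps_nth A n - (\<Sum>j<m + 2. g j * ?c j n)) * (real n + 1)"
        by (intro mult_left_mono) auto
      also have "\<dots> \<le> \<bar>B\<bar>" using B[of n] by simp
      finally have "norm (fps_nth A n - (\<Sum>j<m + 2. g j * ?c j n)) * real n * real n powr (- (real m / 2)) \<le> \<bar>B\<bar> * real n powr (- (real m / 2))"
        by (intro mult_right_mono) auto
      moreover have "real n powr (1 - real m / 2) = real n * real n powr (- (real m / 2))"
        using elim powr_add[of "real n" 1 "- (real m / 2)"] by simp
      ultimately show ?case by (simp add: norm_mult mult.assoc)
    qed
  qed
  have "(fps_nth A n - (\<Sum>j<m + 2. g j * ?c j n)) * ?p n + (\<Sum>j<m + 2. g j * (?c j n * ?p n)) = fps_nth A n * ?p n" for n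
  proof -
    have "(\<Sum>j<m + 2. g j * (?c j n * ?p n)) = (\<Sum>j<m + 2. g j * ?c j n) * ?p n"
      unfolding sum_distrib_right by (simp only: mult.assoc)
    thus ?thesis by (simp only: left_diff_distrib) simp
  qed
  with tendsto_add[OF rem main'] show ?thesis by simp
qed

section \<open>Binomially weighted sums of powers\<close>

lemma weighted_power_sum_mult:
  fixes e f :: "'a::comm_ring_1 fps"
  assumes f0: "fps_nth f 0 = 0"
  shows "Abs_fps (\<lambda>n. \<Sum>k\<le>n. w k * fps_nth (e * f ^ k) n) * (1 - f) =
     Abs_fps (\<lambda>n. \<Sum>k\<le>n. (w k - (if k = 0 then 0 else w (k - 1))) * fps_nth (e * f ^ k) n)"
proof (rule fps_ext)
  fix n
  \<comment> \<open>As f has no constant term, powers beyond n do not reach the coefficient n. All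
    sums over k are therefore finite, and multiplying by 1 - f becomes a summation by parts.\<close>
  have van: "fps_nth (g * f ^ k) i = 0" if "i < k" for g i k
  proof -
    have "fps_nth (f ^ k) j = 0" if "j < k" for j using that f0
      by (metis fps_nth_power_0 startsby_zero_power_prefix that)
    thus ?thesis using that by (simp add: fps_mult_nth)
  qed
  have "(\<Sum>i=0..n. (\<Sum>k\<le>i. w k * fps_nth (e * f ^ k) i) * fps_nth f (n - i))
     = (\<Sum>i=0..n. \<Sum>k\<le>n. w k * (fps_nth (e * f ^ k) i * fps_nth f (n - i)))"
  proof (rule sum.cong)
    fix i assume i: "i \<in> {0..n}"
    have "(\<Sum>k\<le>i. w k * fps_nth (e * f ^ k) i) = (\<Sum>k\<le>n. w k * fps_nth (e * f ^ k) i)"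
      by (rule sum.mono_neutral_left) (use i van in auto)
    thus "(\<Sum>k\<le>i. w k * fps_nth (e * f ^ k) i) * fps_nth f (n - i) = (\<Sum>k\<le>n. w k * (fps_nth (e * f ^ k) i * fps_nth f (n - i)))"
      by (simp add: sum_distrib_right mult.assoc)
  qed simp
  also have "\<dots> = (\<Sum>k\<le>n. w k * fps_nth (e * f ^ k * f) n)"
    by (subst sum.swap) (simp add: fps_mult_nth[of "e * f ^ _" f] sum_distrib_left)
  also have "\<dots> = (\<Sum>k\<le>n. w k * fps_nth (e * f ^ Suc k) n)" by (simp add: mult_ac)
  also have "\<dots> = (\<Sum>k\<le>n. (if k = 0 then 0 else w (k - 1)) * fps_nth (e * f ^ k) n)"
  proof -
    have "(\<Sum>k\<le>n. w k * fps_nth (e * f ^ Suc k) n) = (\<Sum>k<n. w k * fps_nth (e * f ^ Suc k) n)"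
      using van[of n "Suc n" e] by (simp add: lessThan_Suc_atMost[symmetric] del: power_Suc)
    also have "\<dots> = (\<Sum>k<Suc n. (if k = 0 then 0 else w (k - 1)) * fps_nth (e * f ^ k) n)"
      unfolding sum.lessThan_Suc_shift by (simp del: power_Suc)
    finally show ?thesis by (simp add: lessThan_Suc_atMost)
  qed
  finally have *: "fps_nth (Abs_fps (\<lambda>n. \<Sum>k\<le>n. w k * fps_nth (e * f ^ k) n) * f) n =
     (\<Sum>k\<le>n. (if k = 0 then 0 else w (k - 1)) * fps_nth (e * f ^ k) n)"
    by (simp add: fps_mult_nth[of _ f])
  show "fps_nth (Abs_fps (\<lambda>n. \<Sum>k\<le>n. w k * fps_nth (e * f ^ k) n) * (1 - f)) n =
     fps_nth (Abs_fps (\<lambda>n. \<Sum>k\<le>n. (w k - (if k = 0 then 0 else w (k - 1))) * fps_nth (e * f ^ k) n)) n"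
    using * by (simp add: right_diff_distrib left_diff_distrib sum_subtractf)
qed

text \<open>The coefficientwise form of 1/(1 - f)^(r+1) = sum_k binomial(k + r, r) f^k.
  Multiplication by 1 - f differences the weights, and Pascal's rule then lowers r by one. These
  weights are the ones whose averages have a closed generating function.\<close>

lemma binomial_weighted_power_sum:
  fixes e f :: "'a::field_char_0 fps"
  assumes f0: "fps_nth f 0 = 0"
  shows "(\<Sum>k\<le>n. of_nat (k + r choose r) * fps_nth (e * f ^ k) n) = fps_nth (e * inverse (1 - f) ^ (r + 1)) n"
proof -
  have nz: "fps_nth (1 - f) 0 \<noteq> 0" using f0 by simp
  have inv: "inverse (1 - f) * (1 - f) = 1" by (rule inverse_mult_eq_1[OF nz])
  have "Abs_fps (\<lambda>n. \<Sum>k\<le>n. of_nat (k + r choose r) * fps_nth (e * f ^ k) n) = e * inverse (1 - f) ^ (r + 1)"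
  proof (induction r)
    case 0
    have "(\<Sum>k\<le>n. (1 - (if k = 0 then 0 else 1)) * fps_nth (e * f ^ k) n) = fps_nth e n" for n
    proof -
      have "(\<Sum>k\<le>n. (1 - (if k = 0 then 0 else 1)) * fps_nth (e * f ^ k) n) = (\<Sum>k\<in>{0}. (1 - (if k = 0 then 0 else 1)) * fps_nth (e * f ^ k) n)"
        by (rule sum.mono_neutral_right) auto
      thus ?thesis by simp
    qed
    with weighted_power_sum_mult[OF f0, of "\<lambda>_. 1" e]
    have "Abs_fps (\<lambda>n. \<Sum>k\<le>n. 1 * fps_nth (e * f ^ k) n) * (1 - f) = e" by (simp add: fps_eq_iff)
    hence "Abs_fps (\<lambda>n. \<Sum>k\<le>n. 1 * fps_nth (e * f ^ k) n) * ((1 - f) * inverse (1 - f)) = e * inverse (1 - f)"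
      by (simp add: mult.assoc[symmetric])
    thus ?case using inv by (simp add: mult.commute[of "1 - f"])
  next
    case (Suc r)
    have bin: "of_nat (k + Suc r choose Suc r) - (if k = 0 then 0 else of_nat (k - 1 + Suc r choose Suc r)) = (of_nat (k + r choose r) :: 'a)" for k
      by (cases k) simp_all
    have "Abs_fps (\<lambda>n. \<Sum>k\<le>n. of_nat (k + Suc r choose Suc r) * fps_nth (e * f ^ k) n) * (1 - f) = e * inverse (1 - f) ^ (r + 1)"
      unfolding weighted_power_sum_mult[OF f0] bin by (rule Suc.IH)
    hence "Abs_fps (\<lambda>n. \<Sum>k\<le>n. of_nat (k + Suc r choose Suc r) * fps_nth (e * f ^ k) n) * ((1 - f) * inverse (1 - f)) = e * inverse (1 - f) ^ (r + 1) * inverse (1 - f)"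
      by (simp add: mult.assoc[symmetric])
    moreover have "(1 - f) * inverse (1 - f) = 1" using inv by (simp add: mult.commute)
    ultimately show ?case by (simp add: mult.assoc mult.commute[of "inverse (1 - f)" "inverse (1 - f) ^ r"])
  qed
  thus ?thesis by (simp add: fps_eq_iff)
qed

section \<open>Limit laws for triangular arrays, and the Rayleigh law\<close>

lemma weak_conv_array:
  fixes w :: "nat \<Rightarrow> nat \<Rightarrow> real" and Y :: "nat \<Rightarrow> nat \<Rightarrow> real"
  assumes prob: "\<forall>\<^sub>F n in sequentially. (\<forall>k\<le>n. w n k \<ge> 0) \<and> (\<Sum>k\<le>n. w n k) = 1"
    and M: "real_distribution M"
    and char: "\<And>t. (\<lambda>n. \<Sum>k\<le>n. of_real (w n k) * iexp (t * Y n k)) \<longlonglongrightarrow> char M t"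
    and cont: "isCont (cdf M) x"
  shows "(\<lambda>n. \<Sum>k\<in>{k. k \<le> n \<and> Y n k \<le> x}. w n k) \<longlonglongrightarrow> cdf M x"
proof -
  define good where "good = (\<lambda>n. (\<forall>k\<le>n. w n k \<ge> 0) \<and> (\<Sum>k\<le>n. w n k) = 1)"
  \<comment> \<open>Rows are probability vectors only for large n; the other rows get a point mass,
    so that Levy's continuity theorem sees a sequence of distributions.\<close>
  define P where "P = (\<lambda>n. if good n then embed_pmf (\<lambda>k. if k \<le> n then w n k else 0) else return_pmf 0)"
  have P: "pmf (P n) k = (if k \<le> n then w n k else 0)" if "good n" for n k
  proof -
    have nn: "(\<integral>\<^sup>+x. ennreal (if x \<le> n then w n x else 0) \<partial>count_space UNIV) = 1"
    proof -
      have "(\<integral>\<^sup>+x. ennreal (if x \<le> n then w n x else 0) \<partial>count_space UNIV) = (\<Sum>x\<le>n. ennreal (if x \<le> n then w n x else 0))"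
        by (rule nn_integral_count_space'[of "{..n}"]) auto
      also have "\<dots> = ennreal (\<Sum>x\<le>n. w n x)"
        using that by (subst sum_ennreal[symmetric]) (auto simp: good_def)
      finally show ?thesis using that by (simp add: good_def)
    qed
    have "pmf (embed_pmf (\<lambda>k. if k \<le> n then w n k else 0)) k = (if k \<le> n then w n k else 0)"
      by (rule pmf_embed_pmf) (use nn that in \<open>auto simp: good_def\<close>)
    thus ?thesis using that by (simp only: P_def if_True)
  qed
  define D where "D = (\<lambda>n. distr (measure_pmf (P n)) borel (Y n))"
  have D: "real_distribution (D n)" for n
    unfolding D_def by (intro prob_space.real_distribution_distr measure_pmf.prob_space_axioms) simp
  have supp: "set_pmf (P n) \<subseteq> {..n}" if "good n" for n using P[OF that] by (auto simp: set_pmf_eq split: if_splits)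
  have ev: "\<forall>\<^sub>F n in sequentially. good n" using prob by (simp add: good_def)
  have "(\<lambda>n. char (D n) t) \<longlonglongrightarrow> char M t" for t
  proof -
    have "char (D n) t = (\<Sum>k\<le>n. of_real (w n k) * iexp (t * Y n k))" if "good n" for n
    proof -
      have "char (D n) t = (CLINT k|measure_pmf (P n). iexp (t * Y n k))"
        unfolding char_def D_def by (subst integral_distr) auto
      also have "\<dots> = (\<Sum>k\<le>n. pmf (P n) k *\<^sub>R iexp (t * Y n k))"
        by (rule integral_measure_pmf) (use supp[OF that] in auto)
      also have "\<dots> = (\<Sum>k\<le>n. of_real (w n k) * iexp (t * Y n k))"
        by (rule sum.cong) (simp_all add: P[OF that] scaleR_conv_of_real)
      finally show ?thesis .
    qed
    hence "\<forall>\<^sub>F n in sequentially. (\<Sum>k\<le>n. of_real (w n k) * iexp (t * Y n k)) = char (D n) t"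
      using ev by (auto elim: eventually_mono)
    thus ?thesis using char[of t] by (simp add: tendsto_cong)
  qed
  from levy_continuity[OF D M this] have "weak_conv_m D M" .
  hence lim: "(\<lambda>n. cdf (D n) x) \<longlonglongrightarrow> cdf M x" using cont by (simp add: weak_conv_m_def weak_conv_def)
  have "cdf (D n) x = (\<Sum>k\<in>{k. k \<le> n \<and> Y n k \<le> x}. w n k)" if "good n" for n
  proof -
    have "cdf (D n) x = measure (measure_pmf (P n)) {k. Y n k \<le> x}"
      unfolding cdf_def D_def by (subst measure_distr) (auto simp: vimage_def)
    also have "\<dots> = measure (measure_pmf (P n)) {k. k \<le> n \<and> Y n k \<le> x}"
      using supp[OF that] by (intro measure_pmf.finite_measure_eq_AE) (auto simp: AE_measure_pmf_iff)
    also have "\<dots> = (\<Sum>k\<in>{k. k \<le> n \<and> Y n k \<le> x}. pmf (P n) k)"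
      by (rule measure_measure_pmf_finite) auto
    also have "\<dots> = (\<Sum>k\<in>{k. k \<le> n \<and> Y n k \<le> x}. w n k)" by (rule sum.cong) (auto simp: P[OF that])
    finally show ?thesis .
  qed
  hence "\<forall>\<^sub>F n in sequentially. cdf (D n) x = (\<Sum>k\<in>{k. k \<le> n \<and> Y n k \<le> x}. w n k)"
    using ev by (auto elim: eventually_mono)
  thus ?thesis using lim by (simp add: tendsto_cong)
qed

text \<open>The degree N Taylor remainder of exp(i x) is at most 2 |x|^N / N!, so both
  characteristic functions are close to Taylor polynomials as soon as the N-th absolute moment is
  under control. Non-negativity makes absolute moments equal to moments, and \<open>small\<close>
  allows N to be fixed before n tends to infinity.\<close>

lemma moments_imp_char_tendsto:
  fixes w Y :: "nat \<Rightarrow> nat \<Rightarrow> real"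
  assumes w: "\<forall>\<^sub>F n in sequentially. \<forall>k\<le>n. w n k \<ge> 0" and Y: "\<And>n k. Y n k \<ge> 0"
    and mom: "\<And>r. (\<lambda>n. \<Sum>k\<le>n. w n k * Y n k ^ r) \<longlonglongrightarrow> R r"
    and M: "real_distribution M" "\<And>r. integrable M (\<lambda>x. x ^ r)" "\<And>r. (\<integral>x. x ^ r \<partial>M) = R r" "\<And>r. (\<integral>x. \<bar>x\<bar> ^ r \<partial>M) = R r"
    and small: "(\<lambda>N. \<bar>t\<bar> ^ N / fact N * R N) \<longlonglongrightarrow> 0"
  shows "(\<lambda>n. \<Sum>k\<le>n. of_real (w n k) * iexp (t * Y n k)) \<longlonglongrightarrow> char M t"
proof (rule tendstoI)
  fix \<epsilon> :: real assume \<epsilon>: "\<epsilon> > 0"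
  interpret real_distribution M by fact
  have "\<forall>\<^sub>F N in sequentially. \<bar>t\<bar> ^ N / fact N * R N < \<epsilon> / 8" by (rule order_tendstoD(2)[OF small]) (use \<epsilon> in simp)
  then obtain N where N: "\<bar>t\<bar> ^ N / fact N * R N < \<epsilon> / 8" by (meson eventually_happens' sequentially_bot)
  let ?m = "\<lambda>r n. \<Sum>k\<le>n. w n k * Y n k ^ r"
  let ?T = "\<Sum>j\<le>N. (\<i> * of_real t) ^ j / fact j * of_real (R j)"
  have 1: "norm (char M t - ?T) < \<epsilon> / 4"
  proof -
    have "norm (char M t - ?T) \<le> 2 * \<bar>t\<bar> ^ N / fact N * R N"
      using char_approx1[of N t, OF M(2)] unfolding M(3,4) .
    also have "\<dots> = 2 * (\<bar>t\<bar> ^ N / fact N * R N)" by simp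
    finally show ?thesis using N by linarith
  qed
  have "(\<lambda>n. 2 * \<bar>t\<bar> ^ N / fact N * ?m N n) \<longlonglongrightarrow> 2 * \<bar>t\<bar> ^ N / fact N * R N" by (intro tendsto_intros mom)
  hence 2: "\<forall>\<^sub>F n in sequentially. 2 * \<bar>t\<bar> ^ N / fact N * ?m N n < \<epsilon> / 4"
    by (rule order_tendstoD(2)) (use N in \<open>simp add: mult_ac\<close>)
  have "(\<lambda>n. \<Sum>j\<le>N. (\<i> * of_real t) ^ j / fact j * of_real (?m j n)) \<longlonglongrightarrow> ?T"
    by (intro tendsto_intros mom)
  hence 3: "\<forall>\<^sub>F n in sequentially. norm ((\<Sum>j\<le>N. (\<i> * of_real t) ^ j / fact j * of_real (?m j n)) - ?T) < \<epsilon> / 4"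
    using \<epsilon> by (auto simp: tendsto_iff dist_norm dest!: spec[of _ "\<epsilon> / 4"])
  show "\<forall>\<^sub>F n in sequentially. dist (\<Sum>k\<le>n. of_real (w n k) * iexp (t * Y n k)) (char M t) < \<epsilon>"
    using w 2 3
  proof eventually_elim
    case (elim n)
    have eq: "(\<Sum>j\<le>N. (\<i> * of_real t) ^ j / fact j * of_real (?m j n)) =
       (\<Sum>k\<le>n. of_real (w n k) * (\<Sum>j\<le>N. (\<i> * of_real (t * Y n k)) ^ j / fact j))"
      by (simp add: sum_distrib_left sum_distrib_right power_mult_distrib mult_ac) (rule sum.swap)
    have "norm ((\<Sum>k\<le>n. of_real (w n k) * iexp (t * Y n k)) - (\<Sum>j\<le>N. (\<i> * of_real t) ^ j / fact j * of_real (?m j n)))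
       = norm (\<Sum>k\<le>n. of_real (w n k) * (iexp (t * Y n k) - (\<Sum>j\<le>N. (\<i> * of_real (t * Y n k)) ^ j / fact j)))"
      unfolding eq by (simp add: sum_subtractf right_diff_distrib)
    also have "\<dots> \<le> (\<Sum>k\<le>n. w n k * (2 * \<bar>t * Y n k\<bar> ^ N / fact N))"
    proof (rule sum_norm_le)
      fix k assume "k \<in> {..n}"
      hence "w n k \<ge> 0" using elim by simp
      thus "norm (of_real (w n k) * (iexp (t * Y n k) - (\<Sum>j\<le>N. (\<i> * of_real (t * Y n k)) ^ j / fact j))) \<le> w n k * (2 * \<bar>t * Y n k\<bar> ^ N / fact N)"
        unfolding norm_mult norm_of_real using iexp_approx2[of "t * Y n k" N]
        by (intro mult_mono) auto
    qed
    also have "\<dots> = 2 * \<bar>t\<bar> ^ N / fact N * ?m N n"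
      using Y by (simp add: sum_distrib_left abs_mult power_mult_distrib mult_ac)
    finally have 4: "norm ((\<Sum>k\<le>n. of_real (w n k) * iexp (t * Y n k)) - (\<Sum>j\<le>N. (\<i> * of_real t) ^ j / fact j * of_real (?m j n))) < \<epsilon> / 4"
      using elim by linarith
    have "dist (\<Sum>k\<le>n. of_real (w n k) * iexp (t * Y n k)) (char M t) < \<epsilon> / 4 + (\<epsilon> / 4 + \<epsilon> / 4)"
      unfolding dist_norm
      by (rule norm_diff_triangle_less[OF 4 norm_diff_triangle_less[OF elim(3)]])
         (use 1 in \<open>simp add: norm_minus_commute\<close>)
    thus ?case using \<epsilon> by simp
  qed
qed

text \<open>The law of sqrt(2 X) for an exponential variable X: its moments are Gamma integrals, and
  its distribution function at x \<ge> 0 is that of X at x^2/2.\<close>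

definition rayleigh :: "real measure" where
  "rayleigh = distr (density lborel (exponential_density 1)) borel (\<lambda>x. sqrt (2 * x))"

lemma rayleigh_real_distribution: "real_distribution rayleigh"
proof -
  interpret prob_space "density lborel (exponential_density 1)" by (rule prob_space_exponential_density) simp
  show ?thesis unfolding rayleigh_def by (rule real_distribution_distr) measurable
qed

lemma rayleigh_moment:
  "has_bochner_integral rayleigh (\<lambda>x. x ^ r) (2 powr (real r / 2) * Gamma (1 + real r / 2))"
proof -
  let ?E = "exponential_density 1"
  have pos: "Gamma (1 + real r / 2) > 0" by (intro Gamma_real_pos) (simp add: add_pos_nonneg)
  have "(\<integral>\<^sup>+x. ennreal (?E x * sqrt (2 * x) ^ r) \<partial>lborel) =
      (\<integral>\<^sup>+x. ennreal (2 powr (real r / 2)) * ennreal (indicator {0..} x * x powr (1 + real r / 2 - 1) / exp x) \<partial>lborel)"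
  proof (rule nn_integral_cong_AE)
    have "AE x::real in lborel. x \<noteq> 0" by (rule AE_lborel_singleton)
    thus "AE x in lborel. ennreal (?E x * sqrt (2 * x) ^ r) =
       ennreal (2 powr (real r / 2)) * ennreal (indicator {0..} x * x powr (1 + real r / 2 - 1) / exp x)"
    proof eventually_elim
      case (elim x)
      show ?case
      proof (cases "x < 0")
        case True
        thus ?thesis by (simp add: exponential_density_def)
      next
        case False
        hence x: "x > 0" using elim by simp
        have "sqrt (2 * x) ^ r = (2 * x) powr (real r / 2)"
          using x by (simp add: powr_half_sqrt[symmetric] powr_powr flip: powr_realpow)
        also have "\<dots> = 2 powr (real r / 2) * x powr (real r / 2)" using x by (simp add: powr_mult)
        finally have S: "sqrt (2 * x) ^ r = 2 powr (real r / 2) * x powr (real r / 2)" .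
        have E: "?E x = 1 / exp x" and I: "indicator {0..} x = (1::real)"
          using x by (simp_all add: exponential_density_def exp_minus divide_inverse)
        have "?E x * sqrt (2 * x) ^ r = 2 powr (real r / 2) * (indicator {0..} x * x powr (1 + real r / 2 - 1) / exp x)"
          unfolding E I S add_diff_cancel_left' by simp
        thus ?thesis by (simp only: ennreal_mult' powr_ge_zero)
      qed
    qed
  qed
  also have "\<dots> = ennreal (2 powr (real r / 2)) * ennreal (Gamma (1 + real r / 2))"
    by (subst nn_integral_cmult) (simp_all add: Gamma_conv_nn_integral_real add_pos_nonneg)
  also have "\<dots> = ennreal (2 powr (real r / 2) * Gamma (1 + real r / 2))"
    using pos by (simp add: ennreal_mult)
  finally have nn: "(\<integral>\<^sup>+x. ennreal (?E x * sqrt (2 * x) ^ r) \<partial>lborel) = ennreal (2 powr (real r / 2) * Gamma (1 + real r / 2))" .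
  have nonneg: "?E x * sqrt (2 * x) ^ r \<ge> 0" for x by (simp add: exponential_density_def)
  have "has_bochner_integral lborel (\<lambda>x. ?E x *\<^sub>R sqrt (2 * x) ^ r) (2 powr (real r / 2) * Gamma (1 + real r / 2))"
    using nn nonneg pos by (intro has_bochner_integral_nn_integral) auto
  hence "has_bochner_integral (density lborel ?E) (\<lambda>x. sqrt (2 * x) ^ r) (2 powr (real r / 2) * Gamma (1 + real r / 2))"
    by (rule has_bochner_integral_density[rotated 3]) (auto simp: exponential_density_nonneg)
  thus ?thesis unfolding rayleigh_def
    by (intro has_bochner_integral_distr[where f = "\<lambda>x. x ^ r" and g = "\<lambda>x. sqrt (2 * x)"]) auto
qed

lemma rayleigh_nonneg: "AE x in rayleigh. x \<ge> 0"
proof -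
  have "AE x in density lborel (exponential_density 1). sqrt (2 * x) \<ge> 0"
    by (subst AE_density) (auto simp: exponential_density_def)
  thus ?thesis unfolding rayleigh_def by (subst AE_distr_iff) auto
qed

lemma rayleigh_cdf:
  assumes "x \<ge> 0"
  shows "cdf rayleigh x = 1 - exp (- x\<^sup>2 / 2)" "isCont (cdf rayleigh) x"
proof -
  let ?D = "density lborel (exponential_density 1)"
  interpret prob_space ?D by (rule prob_space_exponential_density) simp
  have dist: "distributed ?D lborel (\<lambda>x. x) (exponential_density 1)"
    unfolding distributed_def by (auto simp: distr_id2 exponential_density_nonneg)
  have "cdf rayleigh x = measure ?D {y. sqrt (2 * y) \<le> x}"
    unfolding cdf_def rayleigh_def by (subst measure_distr) (auto simp: vimage_def)
  also have "{y. sqrt (2 * y) \<le> x} = {y. y \<le> x\<^sup>2 / 2}"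
    using assms by (auto simp: real_sqrt_le_iff' real_le_lsqrt sqrt_le_D field_simps)
  also have "measure ?D {y. y \<le> x\<^sup>2 / 2} = 1 - exp (- x\<^sup>2 / 2)"
    using exponential_distributedD_le[OF dist, of "x\<^sup>2 / 2"] by simp
  finally show "cdf rayleigh x = 1 - exp (- x\<^sup>2 / 2)" .
  interpret R: real_distribution rayleigh by (rule rayleigh_real_distribution)
  have "emeasure rayleigh {x} = emeasure ?D {y. sqrt (2 * y) = x}"
    unfolding rayleigh_def by (subst emeasure_distr) (auto simp: vimage_def)
  also have "\<dots> = 0"
  proof -
    have "{y. sqrt (2 * y) = x} \<subseteq> {x\<^sup>2 / 2}" using assms by auto
    hence "AE y in lborel. y \<notin> {y. sqrt (2 * y) = x}"
      using AE_lborel_singleton[of "x\<^sup>2 / 2"] by (auto elim!: eventually_mono)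
    hence "AE y in ?D. y \<notin> {y. sqrt (2 * y) = x}" by (subst AE_density) auto
    thus ?thesis by (subst (asm) AE_iff_measurable[where N = "{y. sqrt (2 * y) = x}"]) auto
  qed
  finally show "isCont (cdf rayleigh) x" by (simp add: R.isCont_cdf measure_def)
qed

text \<open>The variance of x^N is non-negative, so the square of the N-th moment is at most the
  2N-th moment, which is 2^N N!. The square of the term is thus at most (2 t^2)^N / N!.\<close>

lemma rayleigh_moment_small:
  "(\<lambda>N. \<bar>t\<bar> ^ N / fact N * (2 powr (real N / 2) * Gamma (1 + real N / 2))) \<longlonglongrightarrow> 0"
proof -
  interpret real_distribution rayleigh by (rule rayleigh_real_distribution)
  define R where "R = (\<lambda>r. 2 powr (real r / 2) * Gamma (1 + real r / 2))"
  have R: "integrable rayleigh (\<lambda>x. x ^ r)" "expectation (\<lambda>x. x ^ r) = R r" for r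
    using rayleigh_moment[of r] unfolding R_def by (auto simp: has_bochner_integral_iff)
  have R0: "R r \<ge> 0" for r unfolding R_def by (intro mult_nonneg_nonneg less_imp_le[OF Gamma_real_pos]) (auto simp: add_pos_nonneg)
  have sq: "(R N)\<^sup>2 \<le> 2 ^ N * fact N" for N
  proof -
    have i2: "integrable rayleigh (\<lambda>x. (x ^ N)\<^sup>2)" using R(1)[of "2 * N"] by (simp add: power_mult[symmetric] mult.commute)
    have "variance (\<lambda>x. x ^ N) = expectation (\<lambda>x. (x ^ N)\<^sup>2) - (R N)\<^sup>2"
      using variance_eq[OF R(1)[of N] i2] R(2)[of N] by simp
    hence "(R N)\<^sup>2 \<le> expectation (\<lambda>x. (x ^ N)\<^sup>2)" using variance_positive[of "\<lambda>x. x ^ N"] by linarith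
    also have "\<dots> = R (2 * N)" using R(2)[of "2 * N"] by (simp add: power_mult[symmetric] mult.commute)
    also have "\<dots> = 2 ^ N * fact N" unfolding R_def by (simp add: powr_realpow Gamma_fact[symmetric])
    finally show ?thesis .
  qed
  have "(\<lambda>N. (2 * t\<^sup>2) ^ N / fact N) \<longlonglongrightarrow> 0"
    using summable_exp_generic[of "2 * t\<^sup>2"] summable_LIMSEQ_zero by (auto simp: divide_inverse mult.commute)
  hence lim: "(\<lambda>N. sqrt ((2 * t\<^sup>2) ^ N / fact N)) \<longlonglongrightarrow> 0" using tendsto_real_sqrt by fastforce
  have "norm (\<bar>t\<bar> ^ N / fact N * R N) \<le> sqrt ((2 * t\<^sup>2) ^ N / fact N)" for N
  proof (rule real_le_rsqrt)
    have "(\<bar>t\<bar> ^ N / fact N * R N)\<^sup>2 = (t\<^sup>2) ^ N / (fact N)\<^sup>2 * (R N)\<^sup>2"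
      by (simp add: power_mult_distrib power_divide power_even_abs power_mult[symmetric] mult.commute)
    also have "\<dots> \<le> (t\<^sup>2) ^ N / (fact N)\<^sup>2 * (2 ^ N * fact N)" by (intro mult_left_mono sq) auto
    also have "\<dots> = (2 * t\<^sup>2) ^ N / fact N" by (simp add: power_mult_distrib power2_eq_square)
    finally show "(norm (\<bar>t\<bar> ^ N / fact N * R N))\<^sup>2 \<le> (2 * t\<^sup>2) ^ N / fact N"
      unfolding real_norm_def power2_abs .
  qed
  hence "(\<lambda>N. \<bar>t\<bar> ^ N / fact N * R N) \<longlonglongrightarrow> 0" by (intro Lim_null_comparison[OF _ lim] always_eventually) auto
  thus ?thesis by (simp add: R_def)
qed

text \<open>The real part of 1 - f(z) is the sum of f_n (1 - Re z^n), and all terms are non-negative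
  in the closed disc. Keeping two consecutive ones gives a bound that is continuous in z and, for
  positive weights, vanishes at z = 1 only.\<close>

lemma one_minus_eval_lower:
  fixes f :: "real fps"
  assumes f: "\<And>n. fps_nth f n \<ge> 0" "fps_nth f sums 1" and z: "norm z \<le> 1" and N: "N \<ge> 1"
  shows "fps_nth f N * (1 - Re (z ^ N)) + fps_nth f (Suc N) * (1 - Re (z ^ Suc N)) \<le> norm (1 - eval_fps (cfps f) z)"
proof -
  have s: "summable (\<lambda>n. of_real (fps_nth f n) * z ^ n)"
    using norm_eval_cfps_le(1)[OF f z] by (rule summable_norm_cancel)
  have "(\<lambda>n. of_real (fps_nth f n) * z ^ n) sums eval_fps (cfps f) z"
    using s unfolding eval_fps_def cfps_nth by (rule summable_sums)
  hence "(\<lambda>n. Re (of_real (fps_nth f n) * z ^ n)) sums Re (eval_fps (cfps f) z)" by (rule sums_Re)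
  from sums_diff[OF f(2) this]
  have sm: "(\<lambda>n. fps_nth f n * (1 - Re (z ^ n))) sums (1 - Re (eval_fps (cfps f) z))" by (simp add: algebra_simps)
  have "Re (z ^ n) \<le> 1" for n
    using complex_Re_le_cmod[of "z ^ n"] power_le_one[OF norm_ge_zero z, of n] by (simp add: norm_power)
  hence nn: "fps_nth f n * (1 - Re (z ^ n)) \<ge> 0" for n using f(1) by simp
  have "(\<Sum>n\<in>{N, Suc N}. fps_nth f n * (1 - Re (z ^ n))) \<le> 1 - Re (eval_fps (cfps f) z)"
    using sum_le_suminf[OF sums_summable[OF sm], of "{N, Suc N}"] nn sm by (simp add: sums_iff)
  also have "\<dots> \<le> norm (1 - eval_fps (cfps f) z)" using complex_Re_le_cmod[of "1 - eval_fps (cfps f) z"] by simp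
  finally show ?thesis by simp
qed

text \<open>If z^N and z^(N+1) both equal 1, so does z. Two consecutive positive coefficients
  therefore separate f(z) from f(1) at every other point of the closed disc.\<close>

lemma two_powers_lower_pos:
  assumes "norm (z::complex) \<le> 1" "z \<noteq> 1" "a > 0" "b > 0"
  shows "a * (1 - Re (z ^ N)) + b * (1 - Re (z ^ Suc N)) > 0"
proof -
  have le: "Re (z ^ n) \<le> 1" for n
    using complex_Re_le_cmod[of "z ^ n"] power_le_one[OF norm_ge_zero assms(1), of n] by (simp add: norm_power)
  have one: "z ^ n = 1" if "Re (z ^ n) = 1" for n
  proof -
    have "norm (z ^ n) \<le> 1" using power_le_one[OF norm_ge_zero assms(1), of n] by (simp add: norm_power)
    hence "(Re (z ^ n))\<^sup>2 + (Im (z ^ n))\<^sup>2 \<le> 1" by (metis cmod_power2 norm_ge_zero power_le_one)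
    thus ?thesis using that by (simp add: complex_eq_iff)
  qed
  show ?thesis
  proof (rule ccontr)
    assume "\<not> ?thesis"
    moreover have "a * (1 - Re (z ^ N)) \<ge> 0" "b * (1 - Re (z ^ Suc N)) \<ge> 0"
      using le[of N] le[of "Suc N"] assms by (auto intro!: mult_nonneg_nonneg simp del: power_Suc)
    ultimately have "a * (1 - Re (z ^ N)) = 0" "b * (1 - Re (z ^ Suc N)) = 0" by linarith+
    hence "z ^ N = 1" "z ^ Suc N = 1" using one assms by (auto simp del: power_Suc)
    thus False using assms by simp
  qed
qed

text \<open>Legendre duplication at (r + 1)/2. The left side is what coefficient asymptotics
  produce; the right side is, up to a power of sqrt 2, the Rayleigh moment.\<close>

lemma Gamma_half_duplication:
  "fact r * sqrt pi * rGamma ((real r + 1) / 2) = 2 ^ r * Gamma (1 + real r / 2)"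
proof -
  define z where "z = (real r + 1) / 2"
  have z: "z > 0" by (simp add: z_def)
  have nz: "of_real x \<notin> (\<int>\<^sub>\<le>\<^sub>0 :: complex set)" if "x > 0" for x :: real
    using that by (auto elim!: nonpos_Ints_cases simp: complex_eq_iff)
  have "Gamma (of_real z) * Gamma (of_real z + 1/2) =
             exp ((1 - 2 * of_real z) * of_real (ln 2)) * of_real (sqrt pi) * Gamma (2 * complex_of_real z)"
    using nz[OF z] nz[of "z + 1/2"] z by (intro Gamma_legendre_duplication) auto
  also have "complex_of_real z + 1/2 = of_real (z + 1/2)" by simp
  also have "(1 - 2 * of_real z) * of_real (ln 2) = complex_of_real ((1 - 2 * z) * ln 2)" by simp
  also have "2 * complex_of_real z = of_real (2 * z)" by simp
  finally have "complex_of_real (Gamma z * Gamma (z + 1/2)) = of_real (exp ((1 - 2 * z) * ln 2) * sqrt pi * Gamma (2 * z))"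
    unfolding Gamma_complex_of_real exp_of_real of_real_mult[symmetric] .
  hence "Gamma z * Gamma (z + 1/2) = exp ((1 - 2 * z) * ln 2) * sqrt pi * Gamma (2 * z)"
    by (simp only: of_real_eq_iff)
  moreover have "exp ((1 - 2 * z) * ln 2) = 1 / 2 ^ r"
  proof -
    have "(1 - 2 * z) * ln 2 = - (real r * ln 2)" by (simp add: z_def field_simps)
    thus ?thesis by (simp add: exp_minus divide_inverse exp_of_nat_mult)
  qed
  moreover have "Gamma (2 * z) = fact r" 
  proof -
    have "2 * z = 1 + real r" by (simp add: z_def)
    thus ?thesis using Gamma_fact[of r, where 'a = real] by simp
  qed
  moreover have "z + 1/2 = 1 + real r / 2" by (simp add: z_def field_simps)
  ultimately have "Gamma z * Gamma (1 + real r / 2) = 1 / 2 ^ r * sqrt pi * fact r" by simp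
  moreover have "Gamma z > 0" using z by (rule Gamma_real_pos)
  ultimately show ?thesis unfolding z_def[symmetric] rGamma_inverse_Gamma by (simp add: field_simps)
qed

subsection \<open>Critical composition\<close>

locale critical_composition =
  fixes e f :: "real fps" and E1 \<eta> :: real and e1 :: complex and N :: nat
  assumes e: "sqrt_expansion (cfps e) (of_real E1) e1" "E1 > 0" "\<And>n. fps_nth e n \<ge> 0"
    and f: "sqrt_expansion (cfps f) 1 (- of_real \<eta>)" "\<eta> > 0"
    and f_nonneg: "\<And>n. fps_nth f n \<ge> 0" and f_sum: "fps_nth f sums 1" and f0: "fps_nth f 0 = 0"
    and f_pos: "\<And>n. n \<ge> N \<Longrightarrow> fps_nth f n > 0"
begin

definition pr :: "nat \<Rightarrow> nat \<Rightarrow> real" where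
  "pr n k = fps_nth (e * f ^ k) n / fps_nth (e * inverse (1 - f)) n"

text \<open>Write 1 - f = s Y, where Y tends to \<eta> at s = 0. Then e/(1 - f)^m is s^(-m) times a
  function that is analytic up to the boundary and tends to E1/\<eta>^m, provided that Y stays away
  from 0.\<close>

lemma inverse_power_limit:
  assumes m: "m \<ge> 1"
  shows "(\<lambda>n. fps_nth (e * inverse (1 - f) ^ m) n * real n powr (1 - real m / 2)) \<longlonglongrightarrow> E1 / \<eta> ^ m * rGamma (real m / 2)"
proof -
  obtain G where G: "analytic_upto lens G" "\<And>s. s \<in> lens \<Longrightarrow> eval_fps (cfps f) (1 - s\<^sup>2) = 1 + (- of_real \<eta>) * s + s\<^sup>2 * G s"
    and r: "fps_conv_radius (cfps f) \<ge> 1" using f(1) unfolding sqrt_expansion_def by blast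
  define Y where "Y = (\<lambda>s. of_real \<eta> - s * G s)"
  have Y: "analytic_upto lens Y" unfolding Y_def
    by (intro analytic_upto_diff analytic_upto_mult analytic_upto_const analytic_upto_ident G)
  have fY: "1 - eval_fps (cfps f) (1 - s\<^sup>2) = s * Y s" if "s \<in> lens" for s
    using G(2)[OF that] by (simp add: Y_def algebra_simps power2_eq_square)
  have Ylim: "(Y \<longlongrightarrow> of_real \<eta> - 0) (at 0 within lens)"
    unfolding Y_def by (intro tendsto_intros analytic_upto_mult_tendsto_zero G)
  define n0 where "n0 = Suc N"
  define L where "L = (\<lambda>z. fps_nth f n0 * (1 - Re (z ^ n0)) + fps_nth f (Suc n0) * (1 - Re (z ^ Suc n0)))"
  have Lpos: "L z > 0" if "norm z \<le> 1" "z \<noteq> 1" for z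
    unfolding L_def using that f_pos by (intro two_powers_lower_pos) (auto simp: n0_def)
  have Lle: "L z \<le> norm (1 - eval_fps (cfps f) z)" if "norm z \<le> 1" for z
    unfolding L_def by (rule one_minus_eval_lower[OF f_nonneg f_sum that]) (simp add: n0_def)
  \<comment> \<open>Near s = 0 the lower bound comes from the limit \<eta>, elsewhere from
    \<open>L\<close>, which is continuous and positive off z = 1.\<close>
  have invY: "analytic_upto lens (\<lambda>s. inverse (Y s))"
  proof (rule analytic_upto_inverse[OF Y])
    fix x assume x: "x \<in> closure lens"
    show "\<exists>\<delta>>0. \<forall>s\<in>lens \<inter> ball x \<delta>. \<delta> \<le> norm (Y s)"
    proof (cases "x = 0")
      case True
      have "\<forall>\<^sub>F s in at 0 within lens. norm (Y s) > \<eta> / 2"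
        using tendsto_norm[OF Ylim] f(2) by (intro order_tendstoD(1)[where y = "norm (of_real \<eta> - 0 :: complex)"]) auto
      then obtain d where d: "d > 0" "\<And>s. s \<in> lens \<Longrightarrow> s \<noteq> 0 \<Longrightarrow> dist s 0 < d \<Longrightarrow> norm (Y s) > \<eta> / 2"
        by (auto simp: eventually_at)
      have "min d (\<eta>/2) \<le> norm (Y s)" if "s \<in> lens \<inter> ball x (min d (\<eta>/2))" for s
        using d(2)[of s] that zero_notin_lens True by (cases "s = 0") (auto simp: dist_commute)
      thus ?thesis using d(1) f(2) by (intro exI[of _ "min d (\<eta>/2)"]) auto
    next
      case False
      define z0 where "z0 = 1 - x\<^sup>2"
      have z0: "norm z0 \<le> 1" "z0 \<noteq> 1" using closure_lensD[OF x] False by (auto simp: z0_def)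
      have "isCont (\<lambda>s. L (1 - s\<^sup>2)) x" 
      proof -
        have "continuous_on UNIV (\<lambda>s. L (1 - s\<^sup>2))" unfolding L_def by (intro continuous_intros)
        thus ?thesis by (simp add: continuous_on_eq_continuous_at)
      qed
      hence "((\<lambda>s. L (1 - s\<^sup>2)) \<longlongrightarrow> L z0) (at x)" unfolding isCont_def z0_def .
      hence "\<forall>\<^sub>F s in at x. L (1 - s\<^sup>2) > L z0 / 2" using Lpos[OF z0] by (intro order_tendstoD(1)) auto
      then obtain d where d: "d > 0" "\<And>s. s \<noteq> x \<Longrightarrow> dist s x < d \<Longrightarrow> L (1 - s\<^sup>2) > L z0 / 2"
        by (auto simp: eventually_at)
      \<comment> \<open>The product \<open>s * Y s\<close> has norm at least L z0 / 2 near x, and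
        |s| \<le> 2 in the lens, so |Y s| is at least L z0 / 4.\<close>
      define \<delta> where "\<delta> = min d (L z0 / 4)"
      have "\<delta> \<le> norm (Y s)" if s: "s \<in> lens \<inter> ball x \<delta>" for s
      proof -
        have "L (1 - s\<^sup>2) > L z0 / 2"
          using d(2)[of s] s Lpos[OF z0] by (cases "s = x") (auto simp: dist_commute \<delta>_def z0_def)
        hence "L z0 / 2 \<le> norm (s * Y s)"
          using Lle[of "1 - s\<^sup>2"] lens_norm[of s] fY[of s] s by auto
        moreover have "norm s \<le> 2"
        proof -
          have "norm (s\<^sup>2) \<le> 2" using lens_norm[of s] s norm_triangle_ineq2[of "s\<^sup>2" 1] by (simp add: norm_minus_commute)
          hence "(norm s)\<^sup>2 \<le> 2\<^sup>2" by (simp add: norm_power)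
          thus ?thesis by (rule power2_le_imp_le) simp
        qed
        ultimately have "L z0 / 2 \<le> 2 * norm (Y s)"
          using mult_right_mono[of "norm s" 2 "norm (Y s)"] by (simp add: norm_mult)
        thus ?thesis by (simp add: \<delta>_def)
      qed
      thus ?thesis using d(1) Lpos[OF z0] by (intro exI[of _ \<delta>]) (auto simp: \<delta>_def)
    qed
  qed
  have nz: "eval_fps (1 - cfps f) z \<noteq> 0" if "ereal (norm z) < 1" for z
  proof -
    have z: "norm z < 1" using that by (simp add: one_ereal_def)
    hence "L z \<le> norm (1 - eval_fps (cfps f) z)" "L z > 0" by (auto intro!: Lle Lpos)
    moreover have "eval_fps (1 - cfps f) z = 1 - eval_fps (cfps f) z"
      using norm_less_radius[OF r z] by (subst eval_fps_diff) auto
    ultimately show ?thesis by auto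
  qed
  have r1: "fps_conv_radius (1 - cfps f) \<ge> 1"
    using fps_conv_radius_diff[of 1 "cfps f"] r by simp
  have r2: "fps_conv_radius (inverse (1 - cfps f)) \<ge> 1"
    using fps_conv_radius_inverse[of 1 "1 - cfps f"] nz r1 by (auto simp: min_def split: if_splits)
  have r3: "fps_conv_radius (inverse (1 - cfps f) ^ m) \<ge> 1"
    using fps_conv_radius_power[of "inverse (1 - cfps f)" m] r2 by simp
  define A where "A = cfps e * inverse (1 - cfps f) ^ m"
  note re = sqrt_expansion_analytic[OF e(1)]
  have r4: "fps_conv_radius A \<ge> 1" unfolding A_def
    using fps_conv_radius_mult[of "cfps e" "inverse (1 - cfps f) ^ m"] re(1) r3 by (simp add: min_def split: if_splits)
  define H where "H = (\<lambda>s. eval_fps (cfps e) (1 - s\<^sup>2) * inverse (Y s) ^ m)"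
  have H: "analytic_upto lens H" unfolding H_def
    by (intro analytic_upto_mult analytic_upto_power re invY)
  have Hlim: "(H \<longlongrightarrow> of_real E1 * inverse (of_real \<eta> - 0) ^ m) (at 0 within lens)"
    unfolding H_def using f(2) by (intro tendsto_intros sqrt_expansion_limits(1)[OF e(1)] Ylim) auto
  have eq: "s ^ m * eval_fps A (1 - s\<^sup>2) = H s" if s: "s \<in> lens" for s
  proof -
    have s0: "s \<noteq> 0" using s zero_notin_lens by blast
    have z: "norm (1 - s\<^sup>2) < 1" by (rule lens_norm[OF s])
    have "eval_fps (inverse (1 - cfps f)) (1 - s\<^sup>2) = inverse (eval_fps (1 - cfps f) (1 - s\<^sup>2))"
      using norm_less_radius[OF r1 z] z by (intro eval_fps_inverse[of 1] nz) (auto simp: one_ereal_def)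
    also have "eval_fps (1 - cfps f) (1 - s\<^sup>2) = s * Y s"
      using norm_less_radius[OF r z] fY[OF s] by (subst eval_fps_diff) auto
    finally have i: "eval_fps (inverse (1 - cfps f)) (1 - s\<^sup>2) = inverse (s * Y s)" .
    have "eval_fps A (1 - s\<^sup>2) = eval_fps (cfps e) (1 - s\<^sup>2) * inverse (s * Y s) ^ m"
      unfolding A_def using norm_less_radius[OF re(1) z] norm_less_radius[OF r3 z] norm_less_radius[OF r2 z]
      by (simp add: eval_fps_mult eval_fps_power i)
    thus ?thesis using s0 by (simp add: H_def power_mult_distrib power_inverse field_simps)
  qed
  have "(\<lambda>n. fps_nth A n * of_real (real n powr (1 - real m / 2))) \<longlonglongrightarrow> of_real E1 * inverse (of_real \<eta> - 0) ^ m * rGamma (of_nat m / 2)"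
    by (rule inverse_sqrt_power_coeff[OF r4 H eq Hlim m])
  moreover have "A = cfps (e * inverse (1 - f) ^ m)"
    unfolding A_def using f0 by (simp add: cfps_mult cfps_power cfps_inverse cfps_diff cfps_one)
  moreover have "complex_of_real E1 * inverse (of_real \<eta> - 0) ^ m * rGamma (of_nat m / 2) = of_real (E1 / \<eta> ^ m * rGamma (real m / 2))"
  proof -
    have rG: "rGamma (of_nat m / 2) = complex_of_real (rGamma (real m / 2))"
      using rGamma_complex_of_real[of "real m / 2"] by (simp only: of_real_divide of_real_of_nat_eq of_real_numeral)
    show ?thesis unfolding rG by (simp only: diff_zero divide_inverse of_real_mult of_real_inverse of_real_power power_inverse)
  qed
  ultimately have "(\<lambda>n. complex_of_real (fps_nth (e * inverse (1 - f) ^ m) n * real n powr (1 - real m / 2))) \<longlonglongrightarrow> of_real (E1 / \<eta> ^ m * rGamma (real m / 2))"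
    by simp
  thus ?thesis by (simp only: tendsto_of_real_iff)
qed

lemma u_pos: "\<forall>\<^sub>F n in sequentially. fps_nth (e * inverse (1 - f)) n > 0"
proof -
  have "E1 / \<eta> ^ 1 * rGamma (real 1 / 2) > 0"
    using e f by (simp add: rGamma_inverse_Gamma Gamma_one_half_real)
  from order_tendstoD(1)[OF inverse_power_limit[of 1] this] show ?thesis
    by (auto elim!: eventually_mono simp: zero_less_mult_iff)
qed

lemma coeff_nonneg: "fps_nth (e * f ^ k) n \<ge> 0"
proof -
  have "fps_nth (f ^ k) n \<ge> 0" for n k
    by (induction k arbitrary: n) (auto simp: fps_mult_nth f_nonneg intro!: sum_nonneg)
  thus ?thesis by (auto simp: fps_mult_nth e(3) intro!: sum_nonneg)
qed

lemma pr_prob: "\<forall>\<^sub>F n in sequentially. (\<forall>k\<le>n. pr n k \<ge> 0) \<and> (\<Sum>k\<le>n. pr n k) = 1"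
  using u_pos
proof eventually_elim
  case (elim n)
  have "(\<Sum>k\<le>n. fps_nth (e * f ^ k) n) = fps_nth (e * inverse (1 - f)) n"
    using binomial_weighted_power_sum[OF f0, of 0 e n] by simp
  thus ?case using elim coeff_nonneg by (auto simp: pr_def simp flip: sum_divide_distrib)
qed

text \<open>The limit of the mean of binomial(X_n + i, i), divided by n^(i/2): the quotient of the
  constants in \<open>inverse_power_limit\<close> for m = i + 1 and m = 1, with Gamma(1/2) = sqrt
  pi.\<close>

definition ell :: "nat \<Rightarrow> real" where
  "ell i = sqrt pi * rGamma ((real i + 1) / 2) / \<eta> ^ i"

lemma binomial_moment:
  "(\<lambda>n. (\<Sum>k\<le>n. real (k + r choose r) * pr n k) / real n powr (real r / 2)) \<longlonglongrightarrow> ell r"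
proof -
  have pos: "E1 / \<eta> ^ 1 * rGamma (real 1 / 2) \<noteq> 0"
    using e f by (simp add: rGamma_inverse_Gamma Gamma_one_half_real)
  have "(\<lambda>n. (fps_nth (e * inverse (1 - f) ^ (r + 1)) n * real n powr (1 - real (r + 1) / 2)) /
             (fps_nth (e * inverse (1 - f) ^ 1) n * real n powr (1 - real 1 / 2)))
     \<longlonglongrightarrow> (E1 / \<eta> ^ (r + 1) * rGamma (real (r + 1) / 2)) / (E1 / \<eta> ^ 1 * rGamma (real 1 / 2))"
    by (intro tendsto_divide inverse_power_limit pos) auto
  moreover have "(E1 / \<eta> ^ (r + 1) * rGamma (real (r + 1) / 2)) / (E1 / \<eta> ^ 1 * rGamma (real 1 / 2)) = ell r"
    using e f by (simp add: ell_def rGamma_inverse_Gamma Gamma_one_half_real add.commute field_simps)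
  moreover have "\<forall>\<^sub>F n in sequentially. (fps_nth (e * inverse (1 - f) ^ (r + 1)) n * real n powr (1 - real (r + 1) / 2)) /
             (fps_nth (e * inverse (1 - f) ^ 1) n * real n powr (1 - real 1 / 2)) =
     (\<Sum>k\<le>n. real (k + r choose r) * pr n k) / real n powr (real r / 2)"
    using eventually_gt_at_top[of 0]
  proof eventually_elim
    case (elim n)
    have "(\<Sum>k\<le>n. real (k + r choose r) * pr n k) = fps_nth (e * inverse (1 - f) ^ (r + 1)) n / fps_nth (e * inverse (1 - f)) n"
      unfolding binomial_weighted_power_sum[OF f0, symmetric] pr_def by (simp add: sum_divide_distrib)
    moreover have "real n powr (1 - real 1 / 2) = real n powr (1 - real (r + 1) / 2) * real n powr (real r / 2)"
      by (simp add: powr_add[symmetric] field_simps)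
    ultimately show ?case using elim by simp
  qed
  ultimately show ?thesis by (simp only: tendsto_cong)
qed

text \<open>Powers of k are traded for binomials one at a time: k binomial(k+j, j) equals j + 1
  times binomial(k+j+1, j+1) - binomial(k+j, j), and the subtracted term is of lower order. Mixing a
  power with a binomial is what lets the induction on r run through all j.\<close>

lemma power_binomial_moment:
  "(\<lambda>n. (\<Sum>k\<le>n. real k ^ r * real (k + j choose j) * pr n k) / real n powr (real (r + j) / 2))
     \<longlonglongrightarrow> fact (r + j) / fact j * ell (r + j)"
proof (induction r arbitrary: j)
  case 0
  show ?case using binomial_moment[of j] by simp
next
  case (Suc r)
  let ?S = "\<lambda>r j n. \<Sum>k\<le>n. real k ^ r * real (k + j choose j) * pr n k"
  have bin: "real k * real (k + j choose j) = (real j + 1) * (real (k + Suc j choose Suc j) - real (k + j choose j))" for k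
  proof -
    have "Suc j * (k + Suc j choose Suc j) = (k + Suc j) * (k + j choose j)"
      using Suc_times_binomial[of j "k + j"] by simp
    hence "real (Suc j) * real (k + Suc j choose Suc j) = real (k + Suc j) * real (k + j choose j)"
      by (metis of_nat_mult)
    thus ?thesis by (simp add: algebra_simps)
  qed
  have S: "?S (Suc r) j n = (real j + 1) * (?S r (Suc j) n - ?S r j n)" for n
  proof -
    have "?S (Suc r) j n = (\<Sum>k\<le>n. real k ^ r * (real k * real (k + j choose j)) * pr n k)"
      by (simp add: mult_ac)
    also have "\<dots> = (real j + 1) * (?S r (Suc j) n - ?S r j n)"
      unfolding bin sum_subtractf[symmetric] sum_distrib_left by (intro sum.cong refl) (simp only: algebra_simps)
    finally show ?thesis .
  qed
  have 1: "(\<lambda>n. ?S r (Suc j) n / real n powr (real (r + Suc j) / 2)) \<longlonglongrightarrow> fact (r + Suc j) / fact (Suc j) * ell (r + Suc j)"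
    by (rule Suc.IH)
  have "(\<lambda>n. ?S r j n / real n powr (real (r + j) / 2) * real n powr (- (1/2))) \<longlonglongrightarrow> fact (r + j) / fact j * ell (r + j) * 0"
    by (intro tendsto_mult Suc.IH tendsto_neg_powr filterlim_real_sequentially) simp
  moreover have "?S r j n / real n powr (real (r + j) / 2) * real n powr (- (1/2)) = ?S r j n / real n powr (real (r + Suc j) / 2)" for n
  proof -
    have "real n powr (real (r + Suc j) / 2) = real n powr (real (r + j) / 2) * real n powr (1/2)"
      by (simp add: powr_add[symmetric] field_simps)
    thus ?thesis by (simp only: powr_minus divide_inverse inverse_mult_distrib mult.assoc)
  qed
  ultimately have 2: "(\<lambda>n. ?S r j n / real n powr (real (r + Suc j) / 2)) \<longlonglongrightarrow> 0" by simp
  have "(\<lambda>n. (real j + 1) * (?S r (Suc j) n / real n powr (real (r + Suc j) / 2) - ?S r j n / real n powr (real (r + Suc j) / 2)))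
     \<longlonglongrightarrow> (real j + 1) * (fact (r + Suc j) / fact (Suc j) * ell (r + Suc j) - 0)"
    by (intro tendsto_intros 1 2)
  moreover have "(real j + 1) * (fact (r + Suc j) / fact (Suc j) * ell (r + Suc j) - 0) = fact (Suc r + j) / fact j * ell (Suc r + j)"
  proof -
    have "fact (Suc j) = (real j + 1) * (fact j :: real)" by simp
    moreover have "r + Suc j = Suc r + j" by simp
    moreover have "real j + 1 \<noteq> 0" by simp
    ultimately show ?thesis by (simp only: diff_zero times_divide_eq_left times_divide_eq_right nonzero_mult_divide_mult_cancel_left mult.assoc not_False_eq_True)
  qed
  moreover have "(real j + 1) * (?S r (Suc j) n / real n powr (real (r + Suc j) / 2) - ?S r j n / real n powr (real (r + Suc j) / 2)) =
      ?S (Suc r) j n / real n powr (real (Suc r + j) / 2)" for n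
    unfolding S by (simp only: right_diff_distrib diff_divide_distrib times_divide_eq_right add_Suc add_Suc_right)
  ultimately show ?case by simp
qed

lemma scaled_moment:
  "(\<lambda>n. \<Sum>k\<le>n. pr n k * (real k / (sqrt 2 / \<eta> * sqrt (real n))) ^ r) \<longlonglongrightarrow> 2 powr (real r / 2) * Gamma (1 + real r / 2)"
proof -
  have "(\<lambda>n. (\<Sum>k\<le>n. real k ^ r * real (k + 0 choose 0) * pr n k) / real n powr (real (r + 0) / 2) * (1 / (sqrt 2 / \<eta>) ^ r))
     \<longlonglongrightarrow> fact (r + 0) / fact 0 * ell (r + 0) * (1 / (sqrt 2 / \<eta>) ^ r)"
    by (intro tendsto_mult power_binomial_moment tendsto_const)
  moreover have "fact (r + 0) / fact 0 * ell (r + 0) * (1 / (sqrt 2 / \<eta>) ^ r) = 2 powr (real r / 2) * Gamma (1 + real r / 2)"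
  proof -
    have "fact (r + 0) / fact 0 * ell (r + 0) * (1 / (sqrt 2 / \<eta>) ^ r) = fact r * sqrt pi * rGamma ((real r + 1) / 2) / sqrt 2 ^ r"
      using f(2) by (simp add: ell_def power_divide)
    also have "\<dots> = 2 ^ r / sqrt 2 ^ r * Gamma (1 + real r / 2)" unfolding Gamma_half_duplication by simp
    also have "2 ^ r / sqrt 2 ^ r = sqrt 2 ^ r" by (simp add: power_divide[symmetric] real_div_sqrt)
    also have "sqrt 2 ^ r = 2 powr (real r / 2)" by (simp add: powr_half_sqrt[symmetric] powr_powr flip: powr_realpow)
    finally show ?thesis .
  qed
  moreover have "\<forall>\<^sub>F n in sequentially. (\<Sum>k\<le>n. real k ^ r * real (k + 0 choose 0) * pr n k) / real n powr (real (r + 0) / 2) * (1 / (sqrt 2 / \<eta>) ^ r)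
     = (\<Sum>k\<le>n. pr n k * (real k / (sqrt 2 / \<eta> * sqrt (real n))) ^ r)"
    using eventually_gt_at_top[of 0]
  proof eventually_elim
    case (elim n)
    have "real n powr (real r / 2) = sqrt (real n) ^ r"
      using elim by (simp add: powr_half_sqrt[symmetric] powr_powr flip: powr_realpow)
    thus ?case unfolding sum_divide_distrib sum_distrib_right
      by (intro sum.cong refl) (simp add: power_divide power_mult_distrib mult_ac)
  qed
  ultimately show ?thesis by (simp only: tendsto_cong)
qed

theorem rayleigh_limit:
  assumes "x \<ge> 0"
  shows "(\<lambda>n. \<Sum>k\<in>{k. k \<le> n \<and> real k / (sqrt 2 / \<eta> * sqrt (real n)) \<le> x}. pr n k) \<longlonglongrightarrow> 1 - exp (- x\<^sup>2 / 2)"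
proof -
  have ae: "(\<integral>x. \<bar>x\<bar> ^ r \<partial>rayleigh) = (\<integral>x. x ^ r \<partial>rayleigh)" for r
  proof (rule integral_cong_AE)
    show "AE x in rayleigh. \<bar>x\<bar> ^ r = x ^ r" using rayleigh_nonneg by eventually_elim simp
  qed (auto simp: rayleigh_def)
  have "(\<lambda>n. \<Sum>k\<le>n. of_real (pr n k) * iexp (t * (real k / (sqrt 2 / \<eta> * sqrt (real n))))) \<longlonglongrightarrow> char rayleigh t" for t
  proof (rule moments_imp_char_tendsto[where R = "\<lambda>r. 2 powr (real r / 2) * Gamma (1 + real r / 2)"])
    show "\<forall>\<^sub>F n in sequentially. \<forall>k\<le>n. pr n k \<ge> 0" using pr_prob by eventually_elim simp
    show "real k / (sqrt 2 / \<eta> * sqrt (real n)) \<ge> 0" for n k using f(2) by simp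
    show "(\<integral>x. \<bar>x\<bar> ^ r \<partial>rayleigh) = 2 powr (real r / 2) * Gamma (1 + real r / 2)"
      "(\<integral>x. x ^ r \<partial>rayleigh) = 2 powr (real r / 2) * Gamma (1 + real r / 2)" "integrable rayleigh (\<lambda>x. x ^ r)" for r
      using rayleigh_moment[of r] ae[of r] by (auto simp: has_bochner_integral_iff)
  qed (use scaled_moment rayleigh_real_distribution rayleigh_moment_small in auto)
  from weak_conv_array[OF pr_prob rayleigh_real_distribution this rayleigh_cdf(2)[OF assms]]
  show ?thesis by (simp add: rayleigh_cdf(1)[OF assms])
qed

text \<open>Weak convergence alone would not give the mean; the convergence of moments contains it
  as the case r = 1.\<close>

theorem mean_asymp: "(\<lambda>n. \<Sum>k\<le>n. real k * pr n k) \<sim>[at_top] (\<lambda>n. sqrt (pi * real n) / \<eta>)"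
proof (rule asymp_equivI')
  have "(\<lambda>n. (\<Sum>k\<le>n. pr n k * (real k / (sqrt 2 / \<eta> * sqrt (real n))) ^ 1) * (sqrt 2 / sqrt pi)) \<longlonglongrightarrow> (2 powr (real 1 / 2) * Gamma (1 + real 1 / 2)) * (sqrt 2 / sqrt pi)"
    by (intro tendsto_mult scaled_moment tendsto_const)
  moreover have "(2 powr (real 1 / 2) * Gamma (1 + real 1 / 2)) * (sqrt 2 / sqrt pi) = 1"
  proof -
    have "Gamma (1 + real 1 / 2) = sqrt pi / 2" using Gamma_half_duplication[of 1] by simp
    thus ?thesis by (simp only: powr_half_sqrt) (simp add: powr_half_sqrt)
  qed
  moreover have "\<forall>\<^sub>F n in sequentially. (\<Sum>k\<le>n. pr n k * (real k / (sqrt 2 / \<eta> * sqrt (real n))) ^ 1) * (sqrt 2 / sqrt pi) =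
     (\<Sum>k\<le>n. real k * pr n k) / (sqrt (pi * real n) / \<eta>)"
    using eventually_gt_at_top[of 0]
  proof eventually_elim
    case (elim n)
    have "(\<Sum>k\<le>n. pr n k * (real k / (sqrt 2 / \<eta> * sqrt (real n))) ^ 1) = (\<Sum>k\<le>n. real k * pr n k) / (sqrt 2 / \<eta> * sqrt (real n))"
      unfolding sum_divide_distrib power_one_right by (intro sum.cong refl) simp
    thus ?case using elim f(2) by (simp add: real_sqrt_mult field_simps)
  qed
  ultimately show "(\<lambda>n. (\<Sum>k\<le>n. real k * pr n k) / (sqrt (pi * real n) / \<eta>)) \<longlonglongrightarrow> 1"
    by (simp only: tendsto_cong)
qed

end

section \<open>Simple poles and second-order expansions\<close>

lemma cfps_deriv: "cfps (fps_deriv a) = fps_deriv (cfps a)"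
  by (rule fps_ext) simp

text \<open>The mean value inequality is applied to f minus the quadratic polynomial, whose
  derivative at y is o(|y|) by differentiability of f1 at 0.\<close>

lemma taylor2_tendsto:
  fixes f f1 :: "complex \<Rightarrow> complex"
  assumes e: "e > 0" and f: "\<And>y. norm y < e \<Longrightarrow> (f has_field_derivative f1 y) (at y)"
    and f1: "(f1 has_field_derivative f2) (at 0)"
  shows "((\<lambda>y. (f y - f 0 - f1 0 * y) / y\<^sup>2) \<longlongrightarrow> f2 / 2) (at 0)"
proof (rule LIM_I)
  fix r :: real assume r: "r > 0"
  have "((\<lambda>h. (f1 (0 + h) - f1 0) / h) \<longlongrightarrow> f2) (at 0)" using f1 by (simp add: DERIV_def)
  from LIM_D[OF this half_gt_zero[OF r]] obtain d where d: "d > 0"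
    "\<And>h. h \<noteq> 0 \<Longrightarrow> norm h < d \<Longrightarrow> norm ((f1 h - f1 0) / h - f2) < r / 2" by auto
  have d': "norm (f1 h - f1 0 - f2 * h) \<le> r / 2 * norm h" if "norm h < d" for h
  proof (cases "h = 0")
    case False
    have "f1 h - f1 0 - f2 * h = ((f1 h - f1 0) / h - f2) * h" using False by (simp add: field_simps)
    thus ?thesis using mult_right_mono[OF less_imp_le[OF d(2)[OF False that]] norm_ge_zero[of h]]
      by (simp only: norm_mult)
  qed simp
  show "\<exists>s>0. \<forall>x. x \<noteq> 0 \<and> norm (x - 0) < s \<longrightarrow> norm ((f x - f 0 - f1 0 * x) / x\<^sup>2 - f2 / 2) < r"
  proof (intro exI[of _ "min d e"] conjI allI impI)
    fix x :: complex assume x: "x \<noteq> 0 \<and> norm (x - 0) < min d e"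
    define g where "g = (\<lambda>y. f y - f1 0 * y - f2 / 2 * y\<^sup>2)"
    have dg: "(g has_field_derivative (f1 y - f1 0 - f2 * y)) (at y within cball 0 (norm x))" if "y \<in> cball 0 (norm x)" for y
      unfolding g_def using that x
      by (auto intro!: derivative_eq_intros has_field_derivative_at_within[OF f])
    have "norm (g x - g 0) \<le> (r / 2 * norm x) * norm (x - 0)"
    proof (rule field_differentiable_bound[OF _ dg])
      fix z :: complex assume z: "z \<in> cball 0 (norm x)"
      hence "norm (f1 z - f1 0 - f2 * z) \<le> r / 2 * norm z" using x by (intro d') auto
      also have "\<dots> \<le> r / 2 * norm x" using z r by (intro mult_left_mono) auto
      finally show "norm (f1 z - f1 0 - f2 * z) \<le> r / 2 * norm x" .
    qed (use x in auto)
    moreover have "(f x - f 0 - f1 0 * x) / x\<^sup>2 - f2 / 2 = (g x - g 0) / x\<^sup>2"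
      using x by (simp add: g_def field_simps)
    moreover have "norm (g x - g 0) / (norm x)\<^sup>2 \<le> r / 2" if "norm (g x - g 0) \<le> (r / 2 * norm x) * norm (x - 0)"
      using that x by (simp add: pos_divide_le_eq power2_eq_square)
    ultimately have "norm ((f x - f 0 - f1 0 * x) / x\<^sup>2 - f2 / 2) \<le> r / 2"
      by (simp only: norm_divide norm_power)
    thus "norm ((f x - f 0 - f1 0 * x) / x\<^sup>2 - f2 / 2) < r" using r by simp
  qed (use d e in auto)
qed

text \<open>Once the polar part at a is removed, the rest is holomorphic on the larger disc and
  Cauchy's estimate on the circle of radius r applies. B refers to that circle only, so the bound
  can be made uniform in parameters on which W and a depend.\<close>

lemma pole_coeff_bound:
  fixes A :: "complex fps" and h F Q :: "complex \<Rightarrow> complex"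
  assumes r: "1 < r" "r < r'" and F: "F holomorphic_on ball 0 r'" and W: "W holomorphic_on ball 0 r'"
    and a: "norm a < r" "a \<noteq> 0" "W a = 0" "deriv W a \<noteq> 0" and nz: "\<And>z. norm z < r' \<Longrightarrow> z \<noteq> a \<Longrightarrow> W z \<noteq> 0"
    and A: "(\<lambda>z. F z / W z) has_fps_expansion A"
    and B: "\<And>z. norm z = r \<Longrightarrow> norm (F z / W z) + norm (F a / deriv W a) / norm (z - a) \<le> B"
  shows "norm (fps_nth A n + F a / deriv W a * (1 / a) ^ Suc n) \<le> B / r ^ n"
proof -
  define q where "q = (\<lambda>z. if z = a then deriv W a else (W z - W a) / (z - a))"
  have q: "q holomorphic_on ball 0 r'" unfolding q_def by (intro pole_lemma_open W open_ball)
  have qnz: "q z \<noteq> 0" if "z \<in> ball 0 r'" for z using that nz[of z] a by (auto simp: q_def)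
  define w where "w = (\<lambda>z. F z / q z)"
  have w: "w holomorphic_on ball 0 r'" unfolding w_def by (intro holomorphic_on_divide F q qnz)
  \<comment> \<open>The first difference quotient q divides out the zero of W; the second one,
    formed with F/q, is the function without its pole.\<close>
  define k where "k = (\<lambda>z. if z = a then deriv w a else (w z - w a) / (z - a))"
  have k: "k holomorphic_on ball 0 r'" unfolding k_def by (intro pole_lemma_open w open_ball)
  have wa: "w a = F a / deriv W a" by (simp add: w_def q_def)
  have keq: "k z = F z / W z - w a / (z - a)" if "z \<noteq> a" for z
    using that a(3) by (simp add: k_def w_def q_def diff_divide_distrib)
  define C where "C = fps_const (w a / a) * inverse (1 - fps_const (1 / a) * fps_X)"
  have "(\<lambda>z. w a / a * inverse (1 - 1 / a * z)) has_fps_expansion C"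
    unfolding C_def by (intro fps_expansion_intros) auto
  from has_fps_expansion_add[OF A this]
  have "(\<lambda>z. F z / W z + w a / a * inverse (1 - 1 / a * z)) has_fps_expansion A + C" .
  moreover have "\<forall>\<^sub>F z in nhds 0. F z / W z + w a / a * inverse (1 - 1 / a * z) = k z"
  proof -
    have "\<forall>\<^sub>F z in nhds 0. z \<noteq> a" using a(2) by (metis t1_space_nhds)
    thus ?thesis
    proof eventually_elim
      case (elim z)
      have "1 - 1 / a * z = (a - z) / a" using a(2) by (simp add: field_simps)
      hence "w a / a * inverse (1 - 1 / a * z) = w a / (a - z)" using a(2) by simp
      also have "\<dots> = - (w a / (z - a))" by (metis minus_diff_eq minus_divide_right)
      finally show ?case using keq[OF elim] by simp
    qed
  qed
  ultimately have exp: "k has_fps_expansion A + C" by (simp add: has_fps_expansion_cong)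
  have "fps_nth (A + C) n = fps_nth A n + F a / deriv W a * (1 / a) ^ Suc n"
  proof -
    have "inverse (1 - fps_const (1 / a) * fps_X) = Abs_fps (\<lambda>n. (1 / a) ^ n)"
    proof (rule fps_inverse_unique)
      show "(1 - fps_const (1 / a) * fps_X) * Abs_fps (\<lambda>n. (1 / a) ^ n) = 1"
        by (rule fps_ext) (auto simp: left_diff_distrib mult.assoc power_eq_if)
    qed
    thus ?thesis by (simp add: C_def wa)
  qed
  moreover have bd: "norm ((deriv ^^ n) k 0) \<le> fact n * B / r ^ n"
  proof (rule Cauchy_inequality)
    show "k holomorphic_on ball 0 r" using k r by (auto intro: holomorphic_on_subset)
    show "continuous_on (cball 0 r) k"
      using k r by (auto intro!: holomorphic_on_imp_continuous_on intro: holomorphic_on_subset)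
    show "norm (k x) \<le> B" if "norm (0 - x) = r" for x
    proof -
      have x: "norm x = r" using that by simp
      hence "x \<noteq> a" using a(1) by auto
      hence "norm (k x) \<le> norm (F x / W x) + norm (w a) / norm (x - a)"
        using keq[of x] norm_triangle_ineq4[of "F x / W x" "w a / (x - a)"] by (simp add: norm_divide)
      also have "\<dots> \<le> B" using B[OF x] by (simp add: wa)
      finally show ?thesis .
    qed
  qed (use r in auto)
  moreover have "fps_nth (A + C) n = (deriv ^^ n) k 0 / fact n" by (rule fps_nth_fps_expansion[OF exp])
  moreover have "norm ((deriv ^^ n) k 0 / fact n) \<le> B / r ^ n"
    using divide_right_mono[OF bd, of "fact n"] by (simp add: norm_divide)
  ultimately show ?thesis by metis
qed

lemma std_gauss_cdf_cont: "isCont (cdf std_normal_distribution) x"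
proof -
  interpret real_distribution std_normal_distribution by (rule real_dist_normal_dist)
  have "AE y in lborel. y \<notin> {x}" using AE_lborel_singleton[of x] by simp
  hence "AE y in std_normal_distribution. y \<notin> {x}" by (subst AE_density) auto
  hence "emeasure std_normal_distribution {x} = 0"
    by (subst (asm) AE_iff_measurable[where N = "{x}"]) auto
  thus ?thesis by (simp add: isCont_cdf measure_def)
qed

text \<open>In the application L(y) = Q(exp y), and \<kappa> is the logarithm of the pole that
  belongs to the weight exp(i \<theta>). Comparing second-order expansions of both sides of
  \<open>eq\<close> gives \<kappa> = -i \<theta>/a + (b - a^2)/(2 a^3) \<theta>^2 +
  o(\<theta>^2).\<close>

lemma renewal_char_exponent:
  fixes \<kappa> :: "nat \<Rightarrow> complex" and \<theta> :: "nat \<Rightarrow> real" and L :: "complex \<Rightarrow> complex" and a b :: real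
  assumes a: "a > 0" and \<kappa>0: "\<kappa> \<longlonglongrightarrow> 0" and \<theta>0: "\<theta> \<longlonglongrightarrow> 0" and \<theta>nz: "\<forall>\<^sub>F n in sequentially. \<theta> n \<noteq> 0"
    and L: "((\<lambda>y. (L y - 1 - of_real a * y) / y\<^sup>2) \<longlongrightarrow> of_real (b / 2)) (at 0)" and L0: "L 0 = 1"
    and eq: "\<forall>\<^sub>F n in sequentially. L (\<kappa> n) = exp (- \<i> * of_real (\<theta> n))"
  shows "(\<lambda>n. (\<kappa> n + \<i> * of_real (\<theta> n / a)) / (of_real (\<theta> n))\<^sup>2) \<longlonglongrightarrow> of_real ((b - a\<^sup>2) / (2 * a ^ 3))"
proof -
  \<comment> \<open>M and T are second-order quotients completed continuously at 0, so that
    vanishing arguments need no separate treatment.\<close>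
  define M where "M = (\<lambda>y. if y = 0 then of_real (b / 2) else (L y - 1 - of_real a * y) / y\<^sup>2)"
  have "\<forall>\<^sub>F y in at 0. (L y - 1 - of_real a * y) / y\<^sup>2 = M y"
    by (auto simp: eventually_at_filter M_def)
  hence Mc: "isCont M 0" unfolding isCont_def using L by (simp add: tendsto_cong) (simp add: M_def)
  have Leq: "L y = 1 + of_real a * y + M y * y\<^sup>2" for y using L0 by (simp add: M_def)
  define T where "T = (\<lambda>x::complex. if x = 0 then - (1/2) else (exp (- \<i> * x) - 1 + \<i> * x) / x\<^sup>2)"
  have "((\<lambda>y. (exp (- \<i> * y) - exp (- \<i> * 0) - - \<i> * exp (- \<i> * 0) * y) / y\<^sup>2) \<longlongrightarrow> - 1 / 2) (at 0)"
    by (rule taylor2_tendsto[of 1, where ?f1.0 = "\<lambda>y. - \<i> * exp (- \<i> * y)"]) (auto intro!: derivative_eq_intros)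
  hence "((\<lambda>x. (exp (- \<i> * x) - 1 + \<i> * x) / x\<^sup>2) \<longlongrightarrow> - (1/2)) (at 0)" by simp
  moreover have "\<forall>\<^sub>F x in at 0. (exp (- \<i> * x) - 1 + \<i> * x) / x\<^sup>2 = T x"
    by (auto simp: eventually_at_filter T_def)
  ultimately have Tc: "isCont T 0" unfolding isCont_def by (simp add: tendsto_cong) (simp add: T_def)
  have Teq: "exp (- \<i> * x) = 1 - \<i> * x + T x * x\<^sup>2" for x by (simp add: T_def)
  have Ml: "(\<lambda>n. M (\<kappa> n)) \<longlonglongrightarrow> of_real (b / 2)"
    using isCont_tendsto_compose[OF Mc \<kappa>0] by (simp add: M_def)
  have Tl: "(\<lambda>n. T (of_real (\<theta> n))) \<longlonglongrightarrow> - (1/2)"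
    using isCont_tendsto_compose[OF Tc, of "\<lambda>n. of_real (\<theta> n)" sequentially] tendsto_of_real[OF \<theta>0] by (simp add: T_def)
  have key: "\<forall>\<^sub>F n in sequentially. of_real a * \<kappa> n + M (\<kappa> n) * (\<kappa> n)\<^sup>2 = - \<i> * of_real (\<theta> n) + T (of_real (\<theta> n)) * (of_real (\<theta> n))\<^sup>2"
    using eq
  proof eventually_elim
    case (elim n)
    thus ?case unfolding Leq Teq by (simp add: algebra_simps)
  qed
  \<comment> \<open>The first-order term has to be known first, since (\<kappa>/\<theta>)^2 enters
    the second-order one.\<close>
  have ratio: "(\<lambda>n. \<kappa> n / of_real (\<theta> n)) \<longlonglongrightarrow> - \<i> / of_real a"
  proof -
    have "(\<lambda>n. (- \<i> + T (of_real (\<theta> n)) * of_real (\<theta> n)) / (of_real a + M (\<kappa> n) * \<kappa> n)) \<longlonglongrightarrow> (- \<i> + - (1/2) * of_real 0) / (of_real a + of_real (b / 2) * 0)"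
      using a by (intro tendsto_intros Ml Tl \<kappa>0 \<theta>0) auto
    moreover have "\<forall>\<^sub>F n in sequentially. (- \<i> + T (of_real (\<theta> n)) * of_real (\<theta> n)) / (of_real a + M (\<kappa> n) * \<kappa> n) = \<kappa> n / of_real (\<theta> n)"
    proof -
      have "(\<lambda>n. of_real a + M (\<kappa> n) * \<kappa> n) \<longlonglongrightarrow> of_real a + of_real (b / 2) * 0" by (intro tendsto_intros Ml \<kappa>0)
      hence "\<forall>\<^sub>F n in sequentially. of_real a + M (\<kappa> n) * \<kappa> n \<noteq> 0" using a by (intro tendsto_imp_eventually_ne) auto
      thus ?thesis using key \<theta>nz
      proof eventually_elim
        case (elim n)
        have "\<kappa> n * (of_real a + M (\<kappa> n) * \<kappa> n) = of_real (\<theta> n) * (- \<i> + T (of_real (\<theta> n)) * of_real (\<theta> n))"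
          using elim(2) by (simp add: algebra_simps power2_eq_square)
        thus ?case using elim(1,3) by (simp add: frac_eq_eq mult.commute)
      qed
    qed
    ultimately show ?thesis by (simp add: tendsto_cong)
  qed
  have "(\<lambda>n. (T (of_real (\<theta> n)) - M (\<kappa> n) * (\<kappa> n / of_real (\<theta> n))\<^sup>2) / of_real a) \<longlonglongrightarrow> (- (1/2) - of_real (b / 2) * (- \<i> / of_real a)\<^sup>2) / of_real a"
    using a by (intro tendsto_intros Ml Tl ratio) auto
  moreover have "(- (1/2) - of_real (b / 2) * (- \<i> / of_real a)\<^sup>2) / of_real a = complex_of_real ((b - a\<^sup>2) / (2 * a ^ 3))"
    using a by (simp add: power_divide field_simps power2_eq_square power3_eq_cube)
  moreover have "\<forall>\<^sub>F n in sequentially. (T (of_real (\<theta> n)) - M (\<kappa> n) * (\<kappa> n / of_real (\<theta> n))\<^sup>2) / of_real a = (\<kappa> n + \<i> * of_real (\<theta> n / a)) / (of_real (\<theta> n))\<^sup>2"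
    using key \<theta>nz
  proof eventually_elim
    case (elim n)
    have "of_real a * (\<kappa> n + \<i> * of_real (\<theta> n / a)) = of_real a * \<kappa> n + \<i> * of_real (\<theta> n)"
      using a by (simp add: distrib_left)
    also have "\<dots> = T (of_real (\<theta> n)) * (of_real (\<theta> n))\<^sup>2 - M (\<kappa> n) * (\<kappa> n)\<^sup>2"
      using elim(1) by (simp add: algebra_simps)
    finally have "(\<kappa> n + \<i> * of_real (\<theta> n / a)) = (T (of_real (\<theta> n)) * (of_real (\<theta> n))\<^sup>2 - M (\<kappa> n) * (\<kappa> n)\<^sup>2) / of_real a"
      using a by (simp add: nonzero_eq_divide_eq mult.commute)
    thus ?case using elim(2) by (simp add: power_divide diff_divide_distrib mult.commute)
  qed
  ultimately show ?thesis by (simp only: tendsto_cong)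
qed

lemma fps_conv_radius_cfps: "fps_conv_radius (cfps a) = fps_conv_radius a"
  unfolding fps_conv_radius_def conv_radius_def by simp

lemma eval_cfps_of_real:
  assumes "ereal \<bar>x\<bar> < fps_conv_radius a"
  shows "eval_fps (cfps a) (of_real x) = of_real (eval_fps a x)"
proof -
  have "summable (\<lambda>n. fps_nth a n * x ^ n)"
    using assms unfolding fps_conv_radius_def by (intro summable_in_conv_radius) simp
  thus ?thesis by (simp add: eval_fps_def suminf_of_real)
qed

subsection \<open>Supercritical composition\<close>

text \<open>Normalised so that the root of f = 1 is at 1, inside both discs of convergence. In
  renewal terms, f is then an aperiodic distribution of waiting times with mean Q1.\<close>

locale supercritical_composition =
  fixes e f :: "real fps" and N :: nat
  assumes e_nonneg: "\<And>n. fps_nth e n \<ge> 0" and e0: "fps_nth e 0 > 0"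
    and f_nonneg: "\<And>n. fps_nth f n \<ge> 0" and f_sum: "fps_nth f sums 1" and f0: "fps_nth f 0 = 0"
    and f_pos: "\<And>n. n \<ge> N \<Longrightarrow> fps_nth f n > 0"
    and rad_e: "fps_conv_radius e > 1" and rad_f: "fps_conv_radius f > 1"
begin

definition Q1 :: real where "Q1 = eval_fps (fps_deriv f) 1"
definition Q2 :: real where "Q2 = eval_fps (fps_deriv (fps_deriv f)) 1"
definition Q :: "complex \<Rightarrow> complex" where "Q = eval_fps (cfps f)"
definition F :: "complex \<Rightarrow> complex" where "F = eval_fps (cfps e)"
definition A :: "complex \<Rightarrow> complex fps" where "A v = cfps e * inverse (1 - fps_const v * cfps f)"

lemma deriv_radius: "fps_conv_radius (fps_deriv f) > 1" "fps_conv_radius (fps_deriv (fps_deriv f)) > 1"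
  using rad_f fps_conv_radius_deriv[of f] fps_conv_radius_deriv[of "fps_deriv f"] by (meson order_less_le_trans)+

lemma sums_eval_one:
  assumes "fps_conv_radius a > 1"
  shows "fps_nth a sums eval_fps a (1::real)"
proof -
  have "summable (\<lambda>n. fps_nth a n * 1 ^ n)"
    using assms unfolding fps_conv_radius_def by (intro summable_in_conv_radius) (simp add: one_ereal_def)
  thus ?thesis by (simp add: eval_fps_def summable_sums)
qed

lemma sums_Q1: "(\<lambda>n. real n * fps_nth f n) sums Q1"
proof -
  have "(\<lambda>n. real (Suc n) * fps_nth f (Suc n)) sums Q1"
  proof -
    have "fps_nth (fps_deriv f) = (\<lambda>n. real (Suc n) * fps_nth f (Suc n))" by (rule ext) simp
    thus ?thesis using sums_eval_one[OF deriv_radius(1)] by (simp only: Q1_def)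
  qed
  thus ?thesis by (subst (asm) sums_Suc_iff) simp
qed

lemma sums_Q2: "(\<lambda>n. real n * (real n - 1) * fps_nth f n) sums Q2"
proof -
  have "(\<lambda>n. real (Suc (Suc n)) * (real (Suc (Suc n)) - 1) * fps_nth f (Suc (Suc n))) sums Q2"
  proof -
    have "fps_nth (fps_deriv (fps_deriv f)) = (\<lambda>n. real (Suc (Suc n)) * (real (Suc (Suc n)) - 1) * fps_nth f (Suc (Suc n)))"
      by (rule ext) (simp add: mult_ac)
    thus ?thesis using sums_eval_one[OF deriv_radius(2)] by (simp only: Q2_def)
  qed
  from this[unfolded sums_Suc_iff[of "\<lambda>n. real (Suc n) * (real (Suc n) - 1) * fps_nth f (Suc n)"]]
  have "(\<lambda>n. real (Suc n) * (real (Suc n) - 1) * fps_nth f (Suc n)) sums Q2" by simp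
  from this[unfolded sums_Suc_iff[of "\<lambda>n. real n * (real n - 1) * fps_nth f n"]]
  show ?thesis by simp
qed

lemma Q1_pos: "Q1 > 0"
proof -
  have "(\<Sum>n\<in>{Suc N}. real n * fps_nth f n) \<le> Q1"
    using sum_le_suminf[OF sums_summable[OF sums_Q1], of "{Suc N}"] sums_Q1 f_nonneg by (simp add: sums_iff)
  moreover have "(\<Sum>n\<in>{Suc N}. real n * fps_nth f n) > 0" using f_pos[of "Suc N"] by simp
  ultimately show ?thesis by linarith
qed

text \<open>This is the variance of the distribution with weights f_n, whose support contains two
  consecutive integers.\<close>

lemma variance_pos: "Q2 + Q1 - Q1\<^sup>2 > 0"
proof -
  have "(\<lambda>n. real n * (real n - 1) * fps_nth f n + real n * fps_nth f n - 2 * Q1 * (real n * fps_nth f n) + Q1\<^sup>2 * fps_nth f n)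
     sums (Q2 + Q1 - 2 * Q1 * Q1 + Q1\<^sup>2 * 1)"
    by (intro sums_add sums_diff sums_mult sums_Q1 sums_Q2 f_sum)
  hence s: "(\<lambda>n. fps_nth f n * (real n - Q1)\<^sup>2) sums (Q2 + Q1 - Q1\<^sup>2)"
    by (simp add: power2_eq_square algebra_simps)
  have "(\<Sum>n\<in>{N, Suc N}. fps_nth f n * (real n - Q1)\<^sup>2) \<le> Q2 + Q1 - Q1\<^sup>2"
    using sum_le_suminf[OF sums_summable[OF s], of "{N, Suc N}"] s f_nonneg by (simp add: sums_iff)
  moreover have "(\<Sum>n\<in>{N, Suc N}. fps_nth f n * (real n - Q1)\<^sup>2) > 0"
  proof (cases "real N = Q1")
    case True
    thus ?thesis using f_pos[of "Suc N"] by simp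
  next
    case False
    hence "fps_nth f N * (real N - Q1)\<^sup>2 > 0" using f_pos[of N] by simp
    thus ?thesis using f_nonneg[of "Suc N"] by (simp add: add_pos_nonneg)
  qed
  ultimately show ?thesis by linarith
qed

lemma Q_one: "Q 1 = 1" "deriv Q 1 = of_real Q1" "F 1 = of_real (eval_fps e 1)" "eval_fps e 1 > 0"
proof -
  have 1: "ereal \<bar>1\<bar> < fps_conv_radius f" "ereal \<bar>1\<bar> < fps_conv_radius e" "ereal \<bar>1\<bar> < fps_conv_radius (fps_deriv f)"
    using rad_f rad_e deriv_radius by (simp_all add: one_ereal_def)
  show "Q 1 = 1" using eval_cfps_of_real[OF 1(1)] sums_eval_one[OF rad_f] f_sum by (simp add: Q_def sums_iff)
  show "F 1 = of_real (eval_fps e 1)" using eval_cfps_of_real[OF 1(2)] by (simp add: F_def)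
  have "(Q has_field_derivative eval_fps (fps_deriv (cfps f)) 1) (at 1)"
    unfolding Q_def using rad_f by (intro has_field_derivative_eval_fps) (simp add: fps_conv_radius_cfps one_ereal_def)
  thus "deriv Q 1 = of_real Q1"
    using eval_cfps_of_real[OF 1(3)] by (simp add: DERIV_imp_deriv cfps_deriv Q1_def)
  have "(\<Sum>n\<in>{0}. fps_nth e n) \<le> eval_fps e 1"
    using sum_le_suminf[OF sums_summable[OF sums_eval_one[OF rad_e]], of "{0}"] sums_eval_one[OF rad_e] e_nonneg by (simp add: sums_iff)
  thus "eval_fps e 1 > 0" using e0 by simp
qed

lemma Q_unique: "norm z \<le> 1 \<Longrightarrow> Q z = 1 \<Longrightarrow> z = 1"
proof (rule ccontr)
  assume z: "norm z \<le> 1" "Q z = 1" "z \<noteq> 1"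
  have "fps_nth f (Suc N) * (1 - Re (z ^ Suc N)) + fps_nth f (Suc (Suc N)) * (1 - Re (z ^ Suc (Suc N))) > 0"
    using z f_pos by (intro two_powers_lower_pos) auto
  also have "\<dots> \<le> norm (1 - eval_fps (cfps f) z)" by (rule one_minus_eval_lower[OF f_nonneg f_sum z(1)]) simp
  finally show False using z by (simp add: Q_def)
qed

text \<open>For v near 1, the function 1 - v Q has exactly one zero a(v) in a fixed disc of radius
  beyond 1, namely the local inverse of Q at 1/v. That K and r do not depend on v is essential,
  because v will vary with n.\<close>

lemma coeff_uniform:
  obtains a :: "complex \<Rightarrow> complex" and K r :: real
  where "r > 1" "isCont a 1" "a 1 = 1" "isCont (\<lambda>v. F (a v) / (v * deriv Q (a v))) 1"
    "\<forall>\<^sub>F v in nhds 1. v \<noteq> 0 \<and> a v \<noteq> 0 \<and> Q (a v) = 1 / v \<and>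
       (\<forall>n. norm (fps_nth (A v) n - F (a v) / (v * deriv Q (a v)) * (1 / a v) ^ Suc n) \<le> K / r ^ n)"
proof -
  obtain R where R: "1 < R" "ereal R < fps_conv_radius f" "ereal R < fps_conv_radius e"
  proof -
    have "1 < min (fps_conv_radius f) (fps_conv_radius e)" using rad_e rad_f by simp
    from ereal_dense2[OF this] obtain R where "1 < ereal R" "ereal R < min (fps_conv_radius f) (fps_conv_radius e)" by blast
    thus ?thesis by (intro that[of R]) (auto simp: one_ereal_def)
  qed
  have sub: "ball 0 R \<subseteq> eball 0 (fps_conv_radius (cfps f))" "ball 0 R \<subseteq> eball 0 (fps_conv_radius (cfps e))"
    unfolding fps_conv_radius_cfps using R by (auto simp: in_eball_iff) (metis less_ereal.simps(1) order_less_trans)+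
  have Qh: "Q holomorphic_on ball 0 R" and Fh: "F holomorphic_on ball 0 R"
    unfolding Q_def F_def by (intro holomorphic_on_eval_fps sub)+
  have dnz: "deriv Q 1 \<noteq> 0" using Q_one(2) Q1_pos by simp
  have oneR: "(1::complex) \<in> ball 0 R" using R by simp
  obtain \<epsilon>0 where \<epsilon>0: "\<epsilon>0 > 0" "ball (1::complex) \<epsilon>0 \<subseteq> ball 0 R" "inj_on Q (ball 1 \<epsilon>0)"
    using has_complex_derivative_locally_injective[OF Qh oneR open_ball dnz] by metis
  define \<epsilon> where "\<epsilon> = min \<epsilon>0 1"
  have \<epsilon>: "\<epsilon> > 0" "\<epsilon> \<le> 1" "ball (1::complex) \<epsilon> \<subseteq> ball 0 R" "inj_on Q (ball 1 \<epsilon>)"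
    using \<epsilon>0 by (auto simp: \<epsilon>_def intro: inj_on_subset)
  have Qc: "continuous_on (ball 0 R) Q" and Fc: "continuous_on (ball 0 R) F"
    using Qh Fh by (auto intro: holomorphic_on_imp_continuous_on)
  define R1 where "R1 = (1 + R) / 2"
  have R1: "1 < R1" "R1 < R" using R by (auto simp: R1_def)
  obtain r' where r': "1 < r'" "r' \<le> R1" "\<And>z. norm z < r' \<Longrightarrow> Q z = 1 \<Longrightarrow> z = 1"
  proof -
    \<comment> \<open>The other solutions of Q = 1 keep a distance from 1 by local injectivity and
      lie outside the closed unit disc by \<open>Q_unique\<close>; compactness turns this into a
      radius above 1 free of them.\<close>
    define Z where "Z = {z \<in> cball 0 R1. Q z = 1} - ball 1 \<epsilon>"
    have "closed {z \<in> cball 0 R1. Q z = 1}"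
      by (intro continuous_closed_preimage_constant continuous_on_subset[OF Qc]) (use R1 in auto)
    hence "closed Z" unfolding Z_def by (intro closed_Diff) auto
    moreover have "Z \<subseteq> cball 0 R1" by (auto simp: Z_def)
    ultimately have cZ: "compact Z" by (metis compact_Int_closed compact_cball inf.absorb2 Int_commute)
    show ?thesis
    proof (cases "Z = {}")
      case True
      show ?thesis
      proof (rule that[of R1])
        fix z assume "norm z < R1" "Q z = 1"
        hence "z \<in> {z \<in> cball 0 R1. Q z = 1}" by simp
        hence "z \<in> ball 1 \<epsilon>" using True unfolding Z_def by blast
        thus "z = 1" using inj_onD[OF \<epsilon>(4), of z 1] \<open>Q z = 1\<close> Q_one(1) \<epsilon>(1) by simp
      qed (use R1 in auto)
    next
      case False
      obtain m where m: "m \<in> Z" "\<And>z. z \<in> Z \<Longrightarrow> norm m \<le> norm z"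
        using continuous_attains_inf[OF cZ False, of norm] by (auto intro: continuous_intros)
      have "norm m > 1"
      proof (rule ccontr)
        assume "\<not> norm m > 1"
        hence "m = 1" using m Q_unique[of m] by (auto simp: Z_def)
        thus False using m \<epsilon> by (auto simp: Z_def)
      qed
      show ?thesis
      proof (rule that[of "min R1 (norm m)"])
        fix z assume z: "norm z < min R1 (norm m)" "Q z = 1"
        hence "z \<notin> Z" using m(2)[of z] by auto
        hence "z \<in> ball 1 \<epsilon>" using z by (auto simp: Z_def)
        thus "z = 1" using inj_onD[OF \<epsilon>(4), of z 1] \<open>Q z = 1\<close> Q_one(1) \<epsilon>(1) by simp
      qed (use R1 \<open>norm m > 1\<close> in auto)
    qed
  qed
  define r where "r = (2 + r') / 3"
  define r2 where "r2 = (1 + 2 * r') / 3"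
  have r: "1 < r" "r < r2" "r2 < r'" "r2 < R" "r < R" using r' R1 by (auto simp: r_def r2_def)
  \<comment> \<open>The set on which 1 - v Q needs a lower bound: off a neighbourhood of 1, to
    exclude further zeros, and on the whole circle of radius r, for Cauchy's estimate.\<close>
  define C where "C = (cball (0::complex) r2 - ball 1 \<epsilon>) \<union> sphere 0 r"
  have C: "compact C" "C \<noteq> {}" "C \<subseteq> ball 0 R"
  proof -
    show "compact C" unfolding C_def by (intro compact_Un compact_diff) auto
    have "0 \<in> C" using \<epsilon> r by (auto simp: C_def dist_norm)
    thus "C \<noteq> {}" by blast
    show "C \<subseteq> ball 0 R" using r by (auto simp: C_def)
  qed
  have Q1C: "Q z \<noteq> 1" if "z \<in> C" for z
  proof
    assume "Q z = 1"
    moreover have "norm z < r'" using that r by (auto simp: C_def)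
    ultimately have "z = 1" using r'(3) by blast
    thus False using that \<epsilon> r by (auto simp: C_def)
  qed
  obtain zm where zm: "zm \<in> C" "\<And>z. z \<in> C \<Longrightarrow> norm (1 - Q zm) \<le> norm (1 - Q z)"
  proof -
    have "continuous_on C (\<lambda>z. norm (1 - Q z))" by (intro continuous_intros continuous_on_subset[OF Qc C(3)])
    from continuous_attains_inf[OF C(1,2) this] show ?thesis using that by blast
  qed
  define \<delta> where "\<delta> = norm (1 - Q zm)"
  have \<delta>: "\<delta> > 0" using Q1C[OF zm(1)] by (simp add: \<delta>_def)
  have "bounded (Q ` C)" by (intro compact_imp_bounded compact_continuous_image C continuous_on_subset[OF Qc C(3)])
  then obtain B where B: "B > 0" "\<And>z. z \<in> C \<Longrightarrow> norm (Q z) \<le> B" by (auto simp: bounded_pos)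
  have "bounded (F ` sphere 0 r)"
    by (intro compact_imp_bounded compact_continuous_image continuous_on_subset[OF Fc]) (use r in auto)
  then obtain BF where BF: "BF > 0" "\<And>z. norm z = r \<Longrightarrow> norm (F z) \<le> BF" by (auto simp: bounded_pos)
  have Qh': "Q holomorphic_on ball 1 \<epsilon>" using Qh \<epsilon>(3) holomorphic_on_subset by blast
  obtain g where g: "g holomorphic_on (Q ` ball 1 \<epsilon>)" "\<And>z. z \<in> ball 1 \<epsilon> \<Longrightarrow> deriv Q z * deriv g (Q z) = 1"
    "\<And>z. z \<in> ball 1 \<epsilon> \<Longrightarrow> g (Q z) = z"
    using holomorphic_has_inverse[OF Qh' open_ball \<epsilon>(4)] by blast
  have op: "open (Q ` ball 1 \<epsilon>)" by (rule open_mapping_thm3[OF Qh' open_ball \<epsilon>(4)])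
  have in1: "1 \<in> Q ` ball 1 \<epsilon>" using Q_one(1) \<epsilon>(1) by (metis centre_in_ball image_eqI)
  define a where "a = (\<lambda>v. g (1 / v))"
  have gc: "isCont g 1" using g(1) op in1 by (metis continuous_on_eq_continuous_at holomorphic_on_imp_continuous_on)
  have a1: "a 1 = 1" using g(3)[of 1] Q_one(1) \<epsilon>(1) by (simp add: a_def)
  have ac: "isCont a 1" 
  proof -
    have "((\<lambda>v::complex. 1 / v) \<longlongrightarrow> 1 / 1) (at 1)" by (intro tendsto_intros) auto
    hence "((\<lambda>v. g (1 / v)) \<longlongrightarrow> g 1) (at 1)" by (intro isCont_tendsto_compose[OF gc]) simp
    thus ?thesis by (simp add: isCont_def a_def)
  qed
  define c where "c = (\<lambda>v. F (a v) / (v * deriv Q (a v)))"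
  have cc: "isCont c 1"
  proof -
    have "isCont F (a 1)" using Fc a1 R by (simp add: continuous_on_eq_continuous_at)
    moreover have "continuous_on (ball 0 R) (deriv Q)"
      using Qh by (intro holomorphic_on_imp_continuous_on holomorphic_deriv) auto
    hence "isCont (deriv Q) (a 1)" using a1 R by (simp add: continuous_on_eq_continuous_at)
    moreover have "deriv Q (a 1) \<noteq> 0" using a1 Q_one(2) Q1_pos by simp
    moreover have al: "(a \<longlongrightarrow> a 1) (at 1)" using ac by (simp add: isCont_def)
    ultimately have "(c \<longlongrightarrow> F (a 1) / (1 * deriv Q (a 1))) (at 1)" unfolding c_def
      by (intro tendsto_intros isCont_tendsto_compose[OF _ al]) auto
    thus ?thesis by (simp add: isCont_def c_def)
  qed
  \<comment> \<open>The summands bound F/W and the polar part on the circle of radius r: there |W|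
    \<ge> \<delta>/2, and a(v) keeps the distance (r - 1)/2 from the circle.\<close>
  define K where "K = BF / (\<delta> / 2) + (norm (c 1) + 1) / ((r - 1) / 2)"
  have al: "(a \<longlongrightarrow> 1) (nhds 1)" using ac a1 by (simp add: isCont_def tendsto_nhds_iff)
  have e1: "\<forall>\<^sub>F v in nhds (1::complex). norm (v - 1) < \<delta> / (2 * B)"
    using \<delta> B(1) by (auto simp: eventually_nhds_metric dist_norm intro!: exI[of _ "\<delta> / (2 * B)"])
  have e2: "\<forall>\<^sub>F v in nhds 1. v \<noteq> (0::complex)" by (metis t1_space_nhds zero_neq_one)
  have e3: "\<forall>\<^sub>F v in nhds 1. 1 / v \<in> Q ` ball 1 \<epsilon>"
  proof -
    have "((\<lambda>v::complex. 1 / v) \<longlongrightarrow> 1 / 1) (nhds 1)" by (intro tendsto_intros filterlim_ident) auto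
    from topological_tendstoD[OF this op] in1 show ?thesis by simp
  qed
  have e4: "\<forall>\<^sub>F v in nhds 1. dist (a v) 1 < min 1 ((r - 1) / 2)"
    using tendstoD[OF al, of "min 1 ((r - 1) / 2)"] r by simp
  have e5: "\<forall>\<^sub>F v in nhds 1. norm (c v) < norm (c 1) + 1"
  proof -
    have "(c \<longlongrightarrow> c 1) (nhds 1)" using cc by (simp add: isCont_def tendsto_nhds_iff)
    from order_tendstoD(2)[OF tendsto_norm[OF this], of "norm (c 1) + 1"] show ?thesis by simp
  qed
  have main: "\<forall>\<^sub>F v in nhds 1. v \<noteq> 0 \<and> a v \<noteq> 0 \<and> Q (a v) = 1 / v \<and>
       (\<forall>n. norm (fps_nth (A v) n - c v * (1 / a v) ^ Suc n) \<le> K / r ^ n)"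
    using e1 e2 e3 e4 e5
  proof eventually_elim
    case (elim v)
    obtain y where y: "y \<in> ball 1 \<epsilon>" "1 / v = Q y" using elim(3) by blast
    hence ay: "a v = y" using g(3) by (simp add: a_def)
    hence Qa: "Q (a v) = 1 / v" using y by simp
    have anz: "a v \<noteq> 0" using elim(4) by auto
    have dQ: "deriv Q (a v) \<noteq> 0" using g(2)[OF y(1)] ay by auto
    have na: "norm (a v) < r" "norm (a v - 1) < (r - 1) / 2"
    proof -
      show *: "norm (a v - 1) < (r - 1) / 2" using elim(4) by (simp add: dist_norm)
      have "norm (a v) \<le> norm (a v - 1) + 1" using norm_triangle_ineq[of "a v - 1" 1] by simp
      thus "norm (a v) < r" using * r by argo
    qed
    define W where "W = (\<lambda>z. 1 - v * Q z)"
    have Wh: "W holomorphic_on ball 0 r2" unfolding W_def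
      using r by (intro holomorphic_intros holomorphic_on_subset[OF Qh]) auto
    have aR: "a v \<in> ball 0 R" using ay y \<epsilon> by auto
    have "(Q has_field_derivative deriv Q (a v)) (at (a v))"
      using Qh aR by (simp add: holomorphic_derivI)
    hence "(W has_field_derivative - (v * deriv Q (a v))) (at (a v))"
      unfolding W_def by (auto intro!: derivative_eq_intros)
    hence dW: "deriv W (a v) = - (v * deriv Q (a v))" by (rule DERIV_imp_deriv)
    have low: "norm (W z) \<ge> \<delta> / 2" if "z \<in> C" for z
    proof -
      have "norm ((v - 1) * Q z) \<le> \<delta> / (2 * B) * B"
        unfolding norm_mult using elim(1) B that \<delta> by (intro mult_mono) auto
      hence "norm ((v - 1) * Q z) \<le> \<delta> / 2" using B by simp
      moreover have "\<delta> \<le> norm (1 - Q z)" using zm(2)[OF that] by (simp add: \<delta>_def)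
      moreover have "norm (1 - Q z) \<le> norm (W z) + norm ((v - 1) * Q z)"
        using norm_triangle_ineq[of "W z" "(v - 1) * Q z"] by (simp add: W_def algebra_simps)
      ultimately show ?thesis by argo
    qed
    have Wnz: "W z \<noteq> 0" if "norm z < r2" "z \<noteq> a v" for z
    proof (cases "z \<in> ball 1 \<epsilon>")
      case True
      have "Q z \<noteq> Q (a v)" using inj_onD[OF \<epsilon>(4), of z "a v"] True y ay that by auto
      thus ?thesis using Qa elim(2) by (auto simp: W_def field_simps)
    next
      case False
      hence "z \<in> C" using that by (auto simp: C_def)
      thus ?thesis using low \<delta> by fastforce
    qed
    have expQ: "Q has_fps_expansion cfps f" "F has_fps_expansion cfps e"
      unfolding Q_def F_def using rad_f rad_e
      by (auto intro!: eval_fps_has_fps_expansion simp: fps_conv_radius_cfps intro: order_less_trans[of 0 1])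
    have "(\<lambda>z. F z * inverse (1 - v * Q z)) has_fps_expansion A v"
      unfolding A_def by (intro fps_expansion_intros expQ) (use f0 in auto)
    hence expA: "(\<lambda>z. F z / W z) has_fps_expansion A v" by (simp add: W_def divide_inverse)
    have bound: "norm (F z / W z) + norm (F (a v) / deriv W (a v)) / norm (z - a v) \<le> K" if z: "norm z = r" for z
    proof -
      have zC: "z \<in> C" using z by (auto simp: C_def)
      have "norm (F z / W z) \<le> BF / (\<delta> / 2)"
        unfolding norm_divide using BF z low[OF zC] \<delta> by (intro frac_le) auto
      moreover have "norm (F (a v) / deriv W (a v)) / norm (z - a v) \<le> (norm (c 1) + 1) / ((r - 1) / 2)"
      proof (rule frac_le)
        show "norm (F (a v) / deriv W (a v)) \<le> norm (c 1) + 1"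
          using elim(5) unfolding dW c_def by (simp add: norm_divide)
        have "norm z \<le> norm (z - a v) + norm (a v - 1) + 1"
          using norm_triangle_ineq[of "z - a v" "a v"] norm_triangle_ineq[of "a v - 1" 1] by simp
        thus "(r - 1) / 2 \<le> norm (z - a v)" using z na(2) by argo
      qed (use r in auto)
      ultimately show ?thesis unfolding K_def by (rule add_mono)
    qed
    have "norm (fps_nth (A v) n + F (a v) / deriv W (a v) * (1 / a v) ^ Suc n) \<le> K / r ^ n" for n
    proof (rule pole_coeff_bound[OF r(1,2) _ Wh na(1) anz _ _ Wnz expA bound])
      show "F holomorphic_on ball 0 r2" using Fh r by (auto intro: holomorphic_on_subset)
      show "W (a v) = 0" using Qa elim(2) by (simp add: W_def)
      show "deriv W (a v) \<noteq> 0" using dQ elim(2) dW by simp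
    qed auto
    moreover have "F (a v) / deriv W (a v) = - c v" unfolding dW c_def by simp
    ultimately show ?case using elim(2) anz Qa by simp
  qed
  show ?thesis by (rule that[OF r(1) ac a1 cc[unfolded c_def] main[unfolded c_def]])
qed

definition pr :: "nat \<Rightarrow> nat \<Rightarrow> real" where
  "pr n k = fps_nth (e * f ^ k) n / fps_nth (e * inverse (1 - f)) n"

text \<open>Coefficient n of \<open>A v\<close> is thus the unnormalised probability generating
  function, at v, of the variable with weights \<open>pr n\<close>.\<close>

lemma A_nth: "fps_nth (A v) n = (\<Sum>k\<le>n. v ^ k * of_real (fps_nth (e * f ^ k) n))"
proof -
  have "fps_nth (cfps e * (fps_const v * cfps f) ^ k) n = v ^ k * of_real (fps_nth (e * f ^ k) n)" for k
  proof -
    have "cfps e * (fps_const v * cfps f) ^ k = fps_const (v ^ k) * cfps (e * f ^ k)"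
      by (simp add: power_mult_distrib fps_const_power cfps_mult cfps_power mult_ac)
    thus ?thesis by simp
  qed
  moreover have "(\<Sum>k\<le>n. of_nat (k + 0 choose 0) * fps_nth (cfps e * (fps_const v * cfps f) ^ k) n) =
     fps_nth (cfps e * inverse (1 - fps_const v * cfps f) ^ (0 + 1)) n"
    by (rule binomial_weighted_power_sum) (simp add: f0)
  ultimately show ?thesis by (simp add: A_def)
qed

lemma A_one: "fps_nth (A 1) n = of_real (fps_nth (e * inverse (1 - f)) n)"
proof -
  have "A 1 = cfps (e * inverse (1 - f))"
    using f0 by (simp add: A_def cfps_mult cfps_inverse cfps_diff cfps_one)
  thus ?thesis by simp
qed

lemma coeff_nonneg: "fps_nth (e * f ^ k) n \<ge> 0"
proof -
  have "fps_nth (f ^ k) n \<ge> 0" for n k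
    by (induction k arbitrary: n) (auto simp: fps_mult_nth f_nonneg intro!: sum_nonneg)
  thus ?thesis by (auto simp: fps_mult_nth e_nonneg intro!: sum_nonneg)
qed

lemma A_one_limit: "(\<lambda>n. fps_nth (e * inverse (1 - f)) n) \<longlonglongrightarrow> eval_fps e 1 / Q1"
proof -
  obtain a K r where a: "r > 1" "isCont a 1" "a 1 = 1" "isCont (\<lambda>v. F (a v) / (v * deriv Q (a v))) 1"
    "\<forall>\<^sub>F v in nhds 1. v \<noteq> 0 \<and> a v \<noteq> 0 \<and> Q (a v) = 1 / v \<and>
       (\<forall>n. norm (fps_nth (A v) n - F (a v) / (v * deriv Q (a v)) * (1 / a v) ^ Suc n) \<le> K / r ^ n)"
    by (rule coeff_uniform)
  have bd: "norm (fps_nth (A 1) n - F 1 / deriv Q 1) \<le> K * (1 / r) ^ n" for n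
    using eventually_nhds_x_imp_x[OF a(5)] a(3) by (simp add: power_one_over)
  have "(\<lambda>n. fps_nth (A 1) n - F 1 / deriv Q 1) \<longlonglongrightarrow> 0"
  proof (rule Lim_null_comparison)
    have "(\<lambda>n. K * (1 / r) ^ n) \<longlonglongrightarrow> K * 0" using a(1) by (intro tendsto_mult tendsto_const LIMSEQ_power_zero) auto
    thus "(\<lambda>n. K * (1 / r) ^ n) \<longlonglongrightarrow> 0" by simp
  qed (use bd in auto)
  hence "(\<lambda>n. fps_nth (A 1) n) \<longlonglongrightarrow> F 1 / deriv Q 1" by (simp only: LIM_zero_iff)
  hence "(\<lambda>n. complex_of_real (fps_nth (e * inverse (1 - f)) n)) \<longlonglongrightarrow> of_real (eval_fps e 1 / Q1)"
    unfolding A_one using Q_one by simp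
  thus ?thesis by (simp only: tendsto_of_real_iff)
qed

lemma limit_pos: "eval_fps e 1 / Q1 > 0"
  using Q_one(4) Q1_pos by simp

lemma pr_prob: "\<forall>\<^sub>F n in sequentially. (\<forall>k\<le>n. pr n k \<ge> 0) \<and> (\<Sum>k\<le>n. pr n k) = 1"
  using order_tendstoD(1)[OF A_one_limit limit_pos]
proof eventually_elim
  case (elim n)
  have "(\<Sum>k\<le>n. fps_nth (e * f ^ k) n) = fps_nth (e * inverse (1 - f)) n"
    using binomial_weighted_power_sum[OF f0, of 0 e n] by simp
  thus ?case using elim coeff_nonneg by (auto simp: pr_def simp flip: sum_divide_distrib)
qed

text \<open>The constant of the renewal central limit theorem: variance of a waiting time over the
  cube of its mean.\<close>

definition sig :: real where "sig = sqrt ((Q2 + Q1 - Q1\<^sup>2) / Q1 ^ 3)"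

lemma sig_pos: "sig > 0" "sig\<^sup>2 = (Q2 + Q1 - Q1\<^sup>2) / Q1 ^ 3"
  using variance_pos Q1_pos by (auto simp: sig_def)

lemma Q_exp_taylor: "((\<lambda>y. (Q (exp y) - 1 - of_real Q1 * y) / y\<^sup>2) \<longlongrightarrow> of_real ((Q2 + Q1) / 2)) (at 0)"
proof -
  obtain R where R: "1 < R" "ereal R < fps_conv_radius f"
    using ereal_dense2[OF rad_f] by (auto simp: one_ereal_def)
  have rad: "ereal (norm z) < fps_conv_radius (cfps f)" "ereal (norm z) < fps_conv_radius (fps_deriv (cfps f))" if "norm z < R" for z :: complex
  proof -
    have "ereal (norm z) < ereal R" using that by simp
    thus *: "ereal (norm z) < fps_conv_radius (cfps f)" using R(2) unfolding fps_conv_radius_cfps by (rule order_less_trans)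
    show "ereal (norm z) < fps_conv_radius (fps_deriv (cfps f))" by (rule order_less_le_trans[OF * fps_conv_radius_deriv])
  qed
  define f1 where "f1 = (\<lambda>y. eval_fps (fps_deriv (cfps f)) (exp y) * exp y)"
  have ev: "eval_fps (fps_deriv (cfps f)) 1 = of_real Q1" "eval_fps (fps_deriv (fps_deriv (cfps f))) 1 = of_real Q2"
    using eval_cfps_of_real[of 1 "fps_deriv f"] eval_cfps_of_real[of 1 "fps_deriv (fps_deriv f)"] deriv_radius
    unfolding Q1_def Q2_def cfps_deriv[symmetric] by (simp_all add: one_ereal_def)
  have "((\<lambda>y. (Q (exp y) - Q (exp 0) - f1 0 * y) / y\<^sup>2) \<longlongrightarrow> (of_real Q2 + of_real Q1) / 2) (at 0)"
  proof (rule taylor2_tendsto)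
    show "ln R > 0" using R by simp
    fix y :: complex assume y: "norm y < ln R"
    have "norm (exp y) \<le> exp (norm y)" by (rule norm_exp)
    also have "\<dots> < R" using y R by (metis exp_less_cancel_iff exp_ln order_less_trans zero_less_one)
    finally have "norm (exp y) < R" .
    from has_field_derivative_eval_fps[OF rad(1)[OF this], of UNIV]
    have "(Q has_field_derivative eval_fps (fps_deriv (cfps f)) (exp y)) (at (exp y))" by (simp add: Q_def)
    thus "((\<lambda>y. Q (exp y)) has_field_derivative f1 y) (at y)"
      unfolding f1_def by (rule DERIV_chain2[OF _ DERIV_exp])
  next
    have "norm (exp 0 :: complex) < R" using R by simp
    from has_field_derivative_eval_fps[OF rad(2)[OF this], of UNIV]
    have "(eval_fps (fps_deriv (cfps f)) has_field_derivative of_real Q2) (at (exp 0))" using ev by simp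
    from DERIV_chain2[OF this DERIV_exp]
    have d: "((\<lambda>y. eval_fps (fps_deriv (cfps f)) (exp y)) has_field_derivative of_real Q2 * exp 0) (at 0)" .
    show "(f1 has_field_derivative (of_real Q2 + of_real Q1)) (at 0)"
      unfolding f1_def by (rule DERIV_cong[OF DERIV_mult[OF d DERIV_exp]]) (use ev in simp)
  qed
  thus ?thesis using Q_one(1) ev by (simp add: f1_def)
qed

text \<open>With v = exp(i \<theta>) and \<theta> = t/(sig sqrt n), the characteristic function is
  coefficient n of \<open>A v\<close> over that of \<open>A 1\<close>, times a centring phase. The
  pole contributes exp(-n (\<kappa> + i \<theta>/Q1)) in the limit, and n \<theta>^2 = t^2/sig^2
  sends this exponent to -t^2/2.\<close>

lemma char_limit:
  "(\<lambda>n. \<Sum>k\<le>n. of_real (pr n k) * iexp (t * ((real k - 1 / Q1 * real n) / (sig * sqrt (real n))))) \<longlonglongrightarrow> of_real (exp (- t\<^sup>2 / 2))"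
proof (cases "t = 0")
  case True
  have "\<forall>\<^sub>F n in sequentially. (\<Sum>k\<le>n. of_real (pr n k) * iexp (t * ((real k - 1 / Q1 * real n) / (sig * sqrt (real n))))) = of_real (exp (- t\<^sup>2 / 2))"
    using pr_prob by eventually_elim (use True in \<open>simp flip: of_real_sum\<close>)
  thus ?thesis by (rule tendsto_eventually)
next
  case False
  obtain a K r where a: "r > 1" "isCont a 1" "a 1 = 1" "isCont (\<lambda>v. F (a v) / (v * deriv Q (a v))) 1"
    "\<forall>\<^sub>F v in nhds 1. v \<noteq> 0 \<and> a v \<noteq> 0 \<and> Q (a v) = 1 / v \<and>
       (\<forall>n. norm (fps_nth (A v) n - F (a v) / (v * deriv Q (a v)) * (1 / a v) ^ Suc n) \<le> K / r ^ n)"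
    by (rule coeff_uniform)
  define c where "c = (\<lambda>v. F (a v) / (v * deriv Q (a v)))"
  define \<theta> where "\<theta> = (\<lambda>n::nat. t / (sig * sqrt (real n)))"
  define v where "v = (\<lambda>n. exp (\<i> * of_real (\<theta> n)))"
  have \<theta>0: "\<theta> \<longlonglongrightarrow> 0"
  proof -
    have "(\<lambda>n. t / sig * inverse (sqrt (real n))) \<longlonglongrightarrow> t / sig * 0"
      by (intro tendsto_mult tendsto_const tendsto_inverse_0_at_top filterlim_compose[OF sqrt_at_top] filterlim_real_sequentially)
    thus ?thesis by (simp add: \<theta>_def divide_inverse mult.assoc)
  qed
  have v1: "v \<longlonglongrightarrow> 1"
  proof -
    have "v \<longlonglongrightarrow> exp (\<i> * of_real 0)" unfolding v_def by (intro tendsto_intros \<theta>0)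
    thus ?thesis by simp
  qed
  have av: "(\<lambda>n. a (v n)) \<longlonglongrightarrow> 1" using isCont_tendsto_compose[OF a(2) v1] a(3) by simp
  have cv: "(\<lambda>n. c (v n)) \<longlonglongrightarrow> of_real (eval_fps e 1 / Q1)"
    using isCont_tendsto_compose[OF a(4) v1] a(3) Q_one by (simp add: c_def)
  have good: "\<forall>\<^sub>F n in sequentially. v n \<noteq> 0 \<and> a (v n) \<noteq> 0 \<and> Q (a (v n)) = 1 / v n \<and>
       (\<forall>m. norm (fps_nth (A (v n)) m - c (v n) * (1 / a (v n)) ^ Suc m) \<le> K / r ^ m)"
    using eventually_compose_filterlim[OF a(5) v1] by (simp add: c_def)
  define \<kappa> where "\<kappa> = (\<lambda>n. Ln (a (v n)))"
  have \<kappa>0: "\<kappa> \<longlonglongrightarrow> 0"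
  proof -
    have "\<kappa> \<longlonglongrightarrow> Ln 1" unfolding \<kappa>_def by (rule tendsto_Ln[OF av]) auto
    thus ?thesis by simp
  qed
  have \<theta>nz: "\<forall>\<^sub>F n in sequentially. \<theta> n \<noteq> 0"
    using eventually_gt_at_top[of 0] by eventually_elim (use False sig_pos in \<open>auto simp: \<theta>_def\<close>)
  have "(\<lambda>n. (\<kappa> n + \<i> * of_real (\<theta> n / Q1)) / (of_real (\<theta> n))\<^sup>2) \<longlonglongrightarrow> of_real (((Q2 + Q1) - Q1\<^sup>2) / (2 * Q1 ^ 3))"
  proof (rule renewal_char_exponent[OF Q1_pos \<kappa>0 \<theta>0 \<theta>nz Q_exp_taylor])
    show "Q (exp 0) = 1" using Q_one by simp
    show "\<forall>\<^sub>F n in sequentially. Q (exp (\<kappa> n)) = exp (- \<i> * of_real (\<theta> n))"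
      using good
    proof eventually_elim
      case (elim n)
      thus ?case by (simp add: \<kappa>_def v_def exp_minus divide_inverse)
    qed
  qed
  hence lim: "(\<lambda>n. (\<kappa> n + \<i> * of_real (\<theta> n / Q1)) / (of_real (\<theta> n))\<^sup>2) \<longlonglongrightarrow> of_real (sig\<^sup>2 / 2)"
    by (simp add: sig_pos(2) mult.commute)
  have "(\<lambda>n. exp (- of_real (t\<^sup>2 / sig\<^sup>2) * ((\<kappa> n + \<i> * of_real (\<theta> n / Q1)) / (of_real (\<theta> n))\<^sup>2))) \<longlonglongrightarrow>
     exp (- of_real (t\<^sup>2 / sig\<^sup>2) * of_real (sig\<^sup>2 / 2))"
    by (intro tendsto_intros lim)
  moreover have "exp (- of_real (t\<^sup>2 / sig\<^sup>2) * of_real (sig\<^sup>2 / 2)) = complex_of_real (exp (- t\<^sup>2 / 2))"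
    using sig_pos(1) by (simp add: exp_of_real[symmetric])
  ultimately have explim: "(\<lambda>n. exp (- of_real (t\<^sup>2 / sig\<^sup>2) * ((\<kappa> n + \<i> * of_real (\<theta> n / Q1)) / (of_real (\<theta> n))\<^sup>2))) \<longlonglongrightarrow> complex_of_real (exp (- t\<^sup>2 / 2))"
    by simp
  \<comment> \<open>The centring phase; being of modulus 1, it does not disturb the error
    estimate.\<close>
  define ph where "ph = (\<lambda>n::nat. exp (- \<i> * of_real (real n * \<theta> n / Q1)))"
  have ph1: "norm (ph n) = 1" for n unfolding ph_def
    using norm_exp_i_times[of "- (real n * \<theta> n / Q1)"] by simp
  have main: "(\<lambda>n. c (v n) * (1 / a (v n)) ^ Suc n * ph n) \<longlonglongrightarrow> of_real (eval_fps e 1 / Q1) * (1 / 1) * of_real (exp (- t\<^sup>2 / 2))"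
  proof -
    have "(\<lambda>n. c (v n) * (1 / a (v n)) * exp (- of_real (t\<^sup>2 / sig\<^sup>2) * ((\<kappa> n + \<i> * of_real (\<theta> n / Q1)) / (of_real (\<theta> n))\<^sup>2)))
       \<longlonglongrightarrow> of_real (eval_fps e 1 / Q1) * (1 / 1) * of_real (exp (- t\<^sup>2 / 2))"
      by (intro tendsto_intros cv av explim) auto
    moreover have "\<forall>\<^sub>F n in sequentially. c (v n) * (1 / a (v n)) * exp (- of_real (t\<^sup>2 / sig\<^sup>2) * ((\<kappa> n + \<i> * of_real (\<theta> n / Q1)) / (of_real (\<theta> n))\<^sup>2))
       = c (v n) * (1 / a (v n)) ^ Suc n * ph n"
      using good \<theta>nz eventually_gt_at_top[of 0]
    proof eventually_elim
      case (elim n)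
      have "real n * (\<theta> n)\<^sup>2 = t\<^sup>2 / sig\<^sup>2" using elim sig_pos by (simp add: \<theta>_def power_divide power_mult_distrib)
      hence "complex_of_real (t\<^sup>2 / sig\<^sup>2) = of_nat n * (of_real (\<theta> n))\<^sup>2" by (metis of_real_mult of_real_of_nat_eq of_real_power)
      hence "- of_real (t\<^sup>2 / sig\<^sup>2) * ((\<kappa> n + \<i> * of_real (\<theta> n / Q1)) / (of_real (\<theta> n))\<^sup>2) = of_nat n * (- \<kappa> n) + - \<i> * of_real (real n * \<theta> n / Q1)"
        using elim(2) by (simp add: field_simps)
      hence "exp (- of_real (t\<^sup>2 / sig\<^sup>2) * ((\<kappa> n + \<i> * of_real (\<theta> n / Q1)) / (of_real (\<theta> n))\<^sup>2)) = exp (- \<kappa> n) ^ n * ph n"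
        by (simp only: exp_add exp_of_nat_mult ph_def)
      moreover have "exp (- \<kappa> n) = 1 / a (v n)" using elim(1) by (simp add: \<kappa>_def exp_minus divide_inverse)
      ultimately show ?case by simp
    qed
    ultimately show ?thesis by (simp only: tendsto_cong)
  qed
  have err: "(\<lambda>n. (fps_nth (A (v n)) n - c (v n) * (1 / a (v n)) ^ Suc n) * ph n) \<longlonglongrightarrow> 0"
  proof (rule Lim_null_comparison)
    have "(\<lambda>n. K * (1 / r) ^ n) \<longlonglongrightarrow> K * 0" using a(1) by (intro tendsto_mult tendsto_const LIMSEQ_power_zero) auto
    thus "(\<lambda>n. K * (1 / r) ^ n) \<longlonglongrightarrow> 0" by simp
    show "\<forall>\<^sub>F n in sequentially. norm ((fps_nth (A (v n)) n - c (v n) * (1 / a (v n)) ^ Suc n) * ph n) \<le> K * (1 / r) ^ n"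
      using good
    proof eventually_elim
      case (elim n)
      have "norm (fps_nth (A (v n)) n - c (v n) * (1 / a (v n)) ^ Suc n) \<le> K / r ^ n" using elim by blast
      thus ?case unfolding norm_mult ph1 by (simp add: power_one_over)
    qed
  qed
  have "(\<lambda>n. fps_nth (A (v n)) n * ph n) \<longlonglongrightarrow> of_real (eval_fps e 1 / Q1) * of_real (exp (- t\<^sup>2 / 2))"
    using tendsto_add[OF err main] by (simp add: left_diff_distrib)
  hence "(\<lambda>n. fps_nth (A (v n)) n * ph n / of_real (fps_nth (e * inverse (1 - f)) n)) \<longlonglongrightarrow>
      of_real (eval_fps e 1 / Q1) * of_real (exp (- t\<^sup>2 / 2)) / of_real (eval_fps e 1 / Q1)"
    using limit_pos by (intro tendsto_divide tendsto_of_real A_one_limit) auto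
  moreover have "complex_of_real (eval_fps e 1 / Q1) * of_real (exp (- t\<^sup>2 / 2)) / of_real (eval_fps e 1 / Q1) = of_real (exp (- t\<^sup>2 / 2))"
    using Q_one(4) Q1_pos by simp
  moreover have "\<forall>\<^sub>F n in sequentially. fps_nth (A (v n)) n * ph n / of_real (fps_nth (e * inverse (1 - f)) n) =
     (\<Sum>k\<le>n. of_real (pr n k) * iexp (t * ((real k - 1 / Q1 * real n) / (sig * sqrt (real n)))))"
    using eventually_gt_at_top[of 0]
  proof eventually_elim
    case (elim n)
    have vph: "v n ^ k * ph n = iexp (t * ((real k - 1 / Q1 * real n) / (sig * sqrt (real n))))" for k
    proof -
      have "v n ^ k * ph n = exp (of_nat k * (\<i> * of_real (\<theta> n)) + - \<i> * of_real (real n * \<theta> n / Q1))"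
        unfolding v_def ph_def exp_add exp_of_nat_mult ..
      also have "of_nat k * (\<i> * of_real (\<theta> n)) + - \<i> * of_real (real n * \<theta> n / Q1) = \<i> * of_real (real k * \<theta> n - real n * \<theta> n / Q1)"
        by (simp add: algebra_simps)
      also have "real k * \<theta> n - real n * \<theta> n / Q1 = t * ((real k - 1 / Q1 * real n) / (sig * sqrt (real n)))"
        by (simp add: \<theta>_def diff_divide_distrib right_diff_distrib mult_ac)
      finally show ?thesis .
    qed
    have "of_real (pr n k) * iexp (t * ((real k - 1 / Q1 * real n) / (sig * sqrt (real n)))) =
        v n ^ k * of_real (fps_nth (e * f ^ k) n) * ph n / of_real (fps_nth (e * inverse (1 - f)) n)" for k
      unfolding vph[symmetric] pr_def by (simp add: mult_ac)
    thus ?case unfolding A_nth sum_distrib_right sum_divide_distrib by simp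
  qed
  ultimately show ?thesis by (simp only: tendsto_cong)
qed

theorem gaussian_limit:
  "(\<lambda>n. \<Sum>k\<in>{k. k \<le> n \<and> (real k - 1 / Q1 * real n) / (sig * sqrt (real n)) \<le> x}. pr n k) \<longlonglongrightarrow> cdf std_normal_distribution x"
  by (rule weak_conv_array[OF pr_prob real_dist_normal_dist _ std_gauss_cdf_cont])
     (use char_limit in \<open>simp add: char_std_normal_distribution\<close>)

end

subsection \<open>Meanders with bounded jumps\<close>

fun walk_weight :: "(int \<Rightarrow> real) \<Rightarrow> int set \<Rightarrow> nat \<Rightarrow> int \<Rightarrow> real" where
  "walk_weight p I 0 k = (if k = 0 then 1 else 0)"
| "walk_weight p I (Suc n) k = (\<Sum>l\<in>I. p l * walk_weight p I n (k - l))"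

fun meander_weight :: "(int \<Rightarrow> real) \<Rightarrow> int set \<Rightarrow> nat \<Rightarrow> int \<Rightarrow> real" where
  "meander_weight p I 0 k = (if k = 0 then 1 else 0)"
| "meander_weight p I (Suc n) k = (if k < 0 then 0 else \<Sum>l\<in>I. p l * meander_weight p I n (k - l))"

lemma meander_weight_neg: "k < 0 \<Longrightarrow> meander_weight p I n k = 0"
  by (cases n) auto

text \<open>The tilt of a path depends on its length and end point only, because the exponents of t
  add up along it.\<close>

lemma meander_weight_scale:
  assumes "t \<noteq> 0"
  shows "meander_weight (\<lambda>l. p l * t powi l * r) I n k = meander_weight p I n k * r ^ n * t powi k"
proof (induction n arbitrary: k)
  case (Suc n)
  have "t powi l * t powi (k - l) = t powi k" for l using assms by (simp flip: power_int_add)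
  moreover have "p l * t powi l * r * (meander_weight p I n (k - l) * r ^ n * t powi (k - l)) =
     p l * meander_weight p I n (k - l) * (r * r ^ n) * (t powi l * t powi (k - l))" for l
    by (simp only: mult_ac)
  ultimately have eq: "p l * t powi l * r * (meander_weight p I n (k - l) * r ^ n * t powi (k - l)) =
     p l * meander_weight p I n (k - l) * r ^ Suc n * t powi k" for l by (simp only: power_Suc)
  show ?case
  proof (cases "k < 0")
    case False
    thus ?thesis unfolding meander_weight.simps Suc.IH eq by (simp add: sum_distrib_right)
  qed simp
qed simp

lemma is_meander_snoc:
  "is_meander p (ys @ [x]) \<longleftrightarrow> is_meander p ys \<and> x \<in> jump_set p \<and> 0 \<le> sum_list ys + x"
proof -
  have "(\<forall>j\<le>Suc (length ys). 0 \<le> sum_list (take j (ys @ [x]))) \<longleftrightarrow>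
     (\<forall>j\<le>length ys. 0 \<le> sum_list (take j ys)) \<and> 0 \<le> sum_list ys + x"
    by (auto simp: le_Suc_eq)
  thus ?thesis by (auto simp: is_meander_def)
qed

lemma finite_meanders: "finite (jump_set p) \<Longrightarrow> finite (meanders p n)"
  by (rule finite_subset[OF _ finite_lists_length_eq[of "jump_set p" n]])
     (auto simp: meanders_def is_meander_def)

lemma meander_sum_eq:
  assumes I: "finite I" "jump_set p \<subseteq> I"
  shows "(\<Sum>xs\<in>{xs\<in>meanders p n. sum_list xs = k}. prod_list (map p xs)) = meander_weight p I n k"
proof (induction n arbitrary: k)
  case 0
  have "meanders p 0 = {[]}" by (auto simp: meanders_def is_meander_def)
  thus ?case by (auto simp: Collect_conv_if)
next
  case (Suc n)
  have J: "finite (jump_set p)" using I finite_subset by blast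
  show ?case
  proof (cases "k < 0")
    case True
    have "sum_list xs \<ge> 0" if "xs \<in> meanders p (Suc n)" for xs
      using that by (force simp: meanders_def is_meander_def)
    hence E: "{xs\<in>meanders p (Suc n). sum_list xs = k} = {}" using True by force
    show ?thesis unfolding E using True by simp
  next
    case False
    let ?S = "SIGMA x:jump_set p. {ys\<in>meanders p n. sum_list ys = k - x}"
    have eq: "{xs\<in>meanders p (Suc n). sum_list xs = k} = (\<lambda>(x,ys). ys @ [x]) ` ?S"
    proof (intro equalityI subsetI)
      fix xs assume xs: "xs \<in> {xs\<in>meanders p (Suc n). sum_list xs = k}"
      then obtain ys x where ysx: "xs = ys @ [x]" by (cases xs rule: rev_cases) (auto simp: meanders_def)
      have "(x, ys) \<in> ?S" using xs ysx by (auto simp: meanders_def is_meander_snoc)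
      thus "xs \<in> (\<lambda>(x,ys). ys @ [x]) ` ?S" using ysx by force
    next
      fix xs assume "xs \<in> (\<lambda>(x,ys). ys @ [x]) ` ?S"
      thus "xs \<in> {xs\<in>meanders p (Suc n). sum_list xs = k}"
        using False by (auto simp: meanders_def is_meander_snoc)
    qed
    have inj: "inj_on (\<lambda>(x,ys). ys @ [x]) ?S" by (auto simp: inj_on_def)
    have "(\<Sum>xs\<in>{xs\<in>meanders p (Suc n). sum_list xs = k}. prod_list (map p xs)) = (\<Sum>(x,ys)\<in>?S. prod_list (map p (ys @ [x])))"
      unfolding eq by (subst sum.reindex[OF inj]) (simp add: case_prod_unfold)
    also have "\<dots> = (\<Sum>x\<in>jump_set p. \<Sum>ys\<in>{ys\<in>meanders p n. sum_list ys = k - x}. prod_list (map p (ys @ [x])))"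
      using J finite_meanders[OF J] by (subst sum.Sigma) auto
    also have "\<dots> = (\<Sum>x\<in>jump_set p. p x * meander_weight p I n (k - x))"
      by (simp add: Suc.IH[symmetric] sum_distrib_left mult_ac)
    also have "\<dots> = (\<Sum>x\<in>I. p x * meander_weight p I n (k - x))"
      using I by (intro sum.mono_neutral_left) (auto simp: jump_set_def)
    finally show ?thesis using False by simp
  qed
qed

lemma mcoef_eq:
  assumes "finite I" "jump_set p \<subseteq> I"
  shows "mcoef p n k = meander_weight p I n (int k)"
  unfolding mcoef_def by (rule meander_sum_eq[OF assms])

locale bounded_walk =
  fixes c d :: nat and p :: "int \<Rightarrow> real"
  assumes c_pos: "c \<ge> 1" and d_pos: "d \<ge> 1" and p_nonneg: "\<And>l. p l \<ge> 0"
begin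

abbreviation I :: "int set" where "I \<equiv> {- int c..int d}"
abbreviation mw :: "nat \<Rightarrow> int \<Rightarrow> real" where "mw \<equiv> meander_weight p I"
abbreviation ww :: "nat \<Rightarrow> int \<Rightarrow> real" where "ww \<equiv> walk_weight p I"

lemma mw_nonneg: "mw n k \<ge> 0"
  by (induction n arbitrary: k) (auto intro!: sum_nonneg mult_nonneg_nonneg p_nonneg)

lemma mw_above: "k > int d * int n \<Longrightarrow> mw n k = 0"
proof (induction n arbitrary: k)
  case (Suc n)
  have "mw n (k - l) = 0" if "l \<in> I" for l
    using that Suc.prems by (intro Suc.IH) (auto simp: algebra_simps)
  thus ?case by simp
qed simp

lemma mw_step_up: "k \<ge> 0 \<Longrightarrow> mw (Suc n) (k + int d) \<ge> p (int d) * mw n k"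
  using member_le_sum[of "int d" I "\<lambda>l. p l * mw n (k + int d - l)"] mw_nonneg p_nonneg by simp

lemma mw_up: "mw (n + m) (int (d * m)) \<ge> p (int d) ^ m * mw n 0"
proof (induction m)
  case (Suc m)
  have "p (int d) ^ Suc m * mw n 0 \<le> p (int d) * mw (n + m) (int (d * m))"
    using mult_left_mono[OF Suc.IH p_nonneg[of "int d"]] by (simp add: mult.assoc)
  also have "\<dots> \<le> mw (Suc (n + m)) (int (d * m) + int d)" by (rule mw_step_up) simp
  finally show ?case by (simp add: algebra_simps)
qed simp

text \<open>The part of u^k P(u) with negative exponents: the steps by which a path at altitude k
  would leave the half-line.\<close>

definition rneg :: "'a::real_normed_field \<Rightarrow> int \<Rightarrow> 'a" where
  "rneg u k = (\<Sum>l\<in>{l\<in>I. k + l < 0}. of_real (p l) * u powi (k + l))"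

definition mpoly :: "'a::real_normed_field \<Rightarrow> nat \<Rightarrow> 'a" where
  "mpoly u n = (\<Sum>k\<in>{0..int d * int n}. of_real (mw n k) * u powi k)"

definition PP :: "'a::real_normed_field \<Rightarrow> 'a" where
  "PP u = (\<Sum>l\<in>I. of_real (p l) * u powi l)"

text \<open>The kernel equation at one power of z: append an arbitrary jump, then remove what falls
  below 0. Falling below 0 is possible only from altitudes less than c.\<close>

lemma mpoly_Suc:
  fixes u :: "'a::real_normed_field"
  assumes u: "u \<noteq> 0"
  shows "mpoly u (Suc n) = PP u * mpoly u n - (\<Sum>k\<in>{0..<int c}. of_real (mw n k) * rneg u k)"
proof -
  let ?K = "{0..int d * int n}"
  have "mpoly u (Suc n) = (\<Sum>j\<in>{0..int d * int (Suc n)}. \<Sum>l\<in>I. of_real (p l * mw n (j - l)) * u powi j)"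
    unfolding mpoly_def by (intro sum.cong refl) (simp add: sum_distrib_right)
  also have "\<dots> = (\<Sum>l\<in>I. \<Sum>j\<in>{0..int d * int (Suc n)}. of_real (p l * mw n (j - l)) * u powi j)"
    by (rule sum.swap)
  also have "\<dots> = (\<Sum>l\<in>I. \<Sum>k\<in>{k\<in>?K. k + l \<ge> 0}. of_real (p l * mw n k) * u powi (k + l))"
  proof (rule sum.cong[OF refl])
    fix l assume l: "l \<in> I"
    have "(\<Sum>j\<in>{0..int d * int (Suc n)}. of_real (p l * mw n (j - l)) * u powi j) =
       (\<Sum>k\<in>{- l..int d * int (Suc n) - l}. of_real (p l * mw n k) * u powi (k + l))"
      by (rule sum.reindex_bij_witness[of _ "\<lambda>k. k + l" "\<lambda>j. j - l"]) auto
    also have "\<dots> = (\<Sum>k\<in>{k\<in>?K. k + l \<ge> 0}. of_real (p l * mw n k) * u powi (k + l))"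
    proof (rule sum.mono_neutral_right)
      show "{k \<in> ?K. k + l \<ge> 0} \<subseteq> {- l..int d * int (Suc n) - l}" using l by (auto simp: algebra_simps)
      show "\<forall>k\<in>{- l..int d * int (Suc n) - l} - {k \<in> ?K. k + l \<ge> 0}. of_real (p l * mw n k) * u powi (k + l) = 0"
      proof
        fix k assume k: "k \<in> {- l..int d * int (Suc n) - l} - {k \<in> ?K. k + l \<ge> 0}"
        hence "k < 0 \<or> k > int d * int n" by auto
        hence "mw n k = 0" using meander_weight_neg mw_above by blast
        thus "of_real (p l * mw n k) * u powi (k + l) = 0" by simp
      qed
    qed simp
    finally show "(\<Sum>j\<in>{0..int d * int (Suc n)}. of_real (p l * mw n (j - l)) * u powi j) =
       (\<Sum>k\<in>{k\<in>?K. k + l \<ge> 0}. of_real (p l * mw n k) * u powi (k + l))" .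
  qed
  also have "\<dots> = (\<Sum>l\<in>I. (\<Sum>k\<in>?K. of_real (p l * mw n k) * u powi (k + l)) - (\<Sum>k\<in>{k\<in>?K. k + l < 0}. of_real (p l * mw n k) * u powi (k + l)))"
  proof (rule sum.cong[OF refl])
    fix l
    have U: "{k\<in>?K. k + l \<ge> 0} \<union> {k\<in>?K. k + l < 0} = ?K" by auto
    have fin: "finite {k\<in>?K. Pr k}" for Pr by (rule finite_subset[of _ ?K]) auto
    have "(\<Sum>k\<in>{k\<in>?K. k + l \<ge> 0} \<union> {k\<in>?K. k + l < 0}. of_real (p l * mw n k) * u powi (k + l)) = (\<Sum>k\<in>{k\<in>?K. k + l \<ge> 0}. of_real (p l * mw n k) * u powi (k + l)) + (\<Sum>k\<in>{k\<in>?K. k + l < 0}. of_real (p l * mw n k) * u powi (k + l))"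
      by (rule sum.union_disjoint[OF fin fin]) auto
    hence "(\<Sum>k\<in>?K. of_real (p l * mw n k) * u powi (k + l)) = (\<Sum>k\<in>{k\<in>?K. k + l \<ge> 0}. of_real (p l * mw n k) * u powi (k + l)) + (\<Sum>k\<in>{k\<in>?K. k + l < 0}. of_real (p l * mw n k) * u powi (k + l))"
      unfolding U .
    thus "(\<Sum>k\<in>{k\<in>?K. k + l \<ge> 0}. of_real (p l * mw n k) * u powi (k + l)) = (\<Sum>k\<in>?K. of_real (p l * mw n k) * u powi (k + l)) - (\<Sum>k\<in>{k\<in>?K. k + l < 0}. of_real (p l * mw n k) * u powi (k + l))"
      by simp
  qed
  also have "\<dots> = PP u * mpoly u n - (\<Sum>l\<in>I. \<Sum>k\<in>{k\<in>?K. k + l < 0}. of_real (p l * mw n k) * u powi (k + l))"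
    unfolding sum_subtractf PP_def mpoly_def sum_product
    using u by (simp add: power_int_add mult_ac)
  also have "(\<Sum>l\<in>I. \<Sum>k\<in>{k\<in>?K. k + l < 0}. of_real (p l * mw n k) * u powi (k + l)) =
     (\<Sum>l\<in>I. \<Sum>k\<in>{k\<in>{0..<int c}. k + l < 0}. of_real (p l * mw n k) * u powi (k + l))"
  proof (rule sum.cong[OF refl])
    fix l assume l: "l \<in> I"
    show "(\<Sum>k\<in>{k\<in>?K. k + l < 0}. of_real (p l * mw n k) * u powi (k + l)) =
       (\<Sum>k\<in>{k\<in>{0..<int c}. k + l < 0}. of_real (p l * mw n k) * u powi (k + l))"
    proof (rule sum.mono_neutral_left)
      show "finite {k\<in>{0..<int c}. k + l < 0}" by (rule finite_subset[of _ "{0..<int c}"]) auto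
      show "{k\<in>?K. k + l < 0} \<subseteq> {k\<in>{0..<int c}. k + l < 0}" using l by auto
      have "mw n k = 0" if "k \<in> {k\<in>{0..<int c}. k + l < 0} - {k\<in>?K. k + l < 0}" for k
        using that by (intro mw_above) auto
      thus "\<forall>k\<in>{k\<in>{0..<int c}. k + l < 0} - {k\<in>?K. k + l < 0}. of_real (p l * mw n k) * u powi (k + l) = 0"
        by (intro ballI) (simp only: mult_zero_right of_real_0 mult_zero_left)
    qed
  qed
  also have "\<dots> = (\<Sum>k\<in>{0..<int c}. \<Sum>l\<in>{l\<in>I. k + l < 0}. of_real (p l * mw n k) * u powi (k + l))"
    by (rule sum.swap_restrict) auto
  also have "\<dots> = (\<Sum>k\<in>{0..<int c}. of_real (mw n k) * rneg u k)"
    unfolding rneg_def sum_distrib_left by (intro sum.cong refl) simp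
  finally show ?thesis .
qed

lemma mpoly_0 [simp]: "mpoly u 0 = 1"
  by (simp add: mpoly_def)

text \<open>The jump polynomial as a Laurent series in w. Power series in z over Laurent series make
  room for the negative altitudes of unrestricted walks, whose weights are the coefficients of the
  powers of \<open>lf\<close>.\<close>

definition lf :: "real fls" where
  "lf = (\<Sum>l\<in>I. fls_const (p l) * fls_X_intpow l)"

lemma lf_mult_nth: "fls_nth (lf * g) i = (\<Sum>l\<in>I. p l * fls_nth g (i - l))"
  unfolding lf_def sum_distrib_right fls_nth_sum
  by (intro sum.cong refl) (simp only: mult.assoc fls_X_intpow_times_conv_shift(1) fls_mult_const_nth fls_shift_nth, simp)

lemma lf_power_nth: "fls_nth (lf ^ j) i = ww j i"
  by (induction j arbitrary: i) (simp_all add: lf_mult_nth fls_one_nth)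

lemma of_nat_mult_fls_nth: "fls_nth (of_nat n * (g :: real fls)) i = real n * fls_nth g i"
  by (simp only: fls_of_nat fls_mult_const_nth)

definition mf :: "nat \<Rightarrow> real fls" where "mf n = Abs_fls (mw n)"

lemma mf_nth: "fls_nth (mf n) i = mw n i"
  unfolding mf_def by (rule nth_Abs_fls_lower_bound[of 0]) (auto simp: meander_weight_neg)

definition pos_part :: "real fls \<Rightarrow> real fls" where
  "pos_part g = Abs_fls (\<lambda>i. if i < 0 then 0 else fls_nth g i)"

lemma pos_part_nth: "fls_nth (pos_part g) i = (if i < 0 then 0 else fls_nth g i)"
  unfolding pos_part_def by (rule nth_Abs_fls_lower_bound[of 0]) auto

lemma fls_mult_nonneg_nth:
  fixes f g :: "real fls"
  assumes "\<And>i. i < 0 \<Longrightarrow> fls_nth f i = 0" "\<And>i. i < 0 \<Longrightarrow> fls_nth g i = 0"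
  shows "fls_nth (f * g) k = (\<Sum>i\<in>{0..k}. fls_nth f i * fls_nth g (k - i))"
proof -
  have "fls_nth (f * g) k = (\<Sum>i=fls_subdegree f..k - fls_subdegree g. fls_nth f i * fls_nth g (k - i))"
    by (rule fls_times_nth)
  also have "\<dots> = (\<Sum>i\<in>{fls_subdegree f..k - fls_subdegree g} \<union> {0..k}. fls_nth f i * fls_nth g (k - i))"
    by (rule sum.mono_neutral_left) (auto simp: not_le)
  also have "\<dots> = (\<Sum>i\<in>{0..k}. fls_nth f i * fls_nth g (k - i))"
    by (rule sum.mono_neutral_right) (auto simp: not_le assms)
  finally show ?thesis .
qed

lemma fls_mult_nonpos_neg:
  fixes f g :: "real fls"
  assumes "\<And>i. i > 0 \<Longrightarrow> fls_nth f i = 0" "\<And>i. i \<ge> 0 \<Longrightarrow> fls_nth g i = 0" "k \<ge> 0"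
  shows "fls_nth (f * g) k = 0"
proof -
  have "fls_nth f i * fls_nth g (k - i) = 0" for i
    using assms by (cases "i > 0") auto
  thus ?thesis unfolding fls_times_nth(2) by (intro sum.neutral) blast
qed

text \<open>With \<open>K = 1 - z P(w)\<close>, \<open>N = M K\<close> and \<open>S = z P/(1 - z P)\<close> split as \<open>S\<^sup>+ + S\<^sup>-\<close> by the sign of the exponent of \<open>w\<close>,
  the series \<open>X = z M' - M S\<^sup>+\<close> satisfies \<open>K X = z N' + N S\<^sup>-\<close>. Since \<open>X\<close> has no negative powers
  of \<open>w\<close> and the right-hand side only negative ones, \<open>X = 0\<close> by comparing successive powers of \<open>z\<close>. This is Spitzer's identity in differentiated form.\<close>

lemma meander_recurrence_fls:
  "of_nat n * mf n = (\<Sum>j=0..n. (if j = 0 then 0 else pos_part (lf ^ j)) * mf (n - j))"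
proof -
  define M where "M = Abs_fps mf"
  define K where "K = 1 - fps_const lf * fps_X"
  define S where "S = Abs_fps (\<lambda>j. if j = 0 then 0 else lf ^ j)"
  define Sp where "Sp = Abs_fps (\<lambda>j. if j = 0 then 0 else pos_part (lf ^ j))"
  define D where "D = (\<lambda>F :: real fls fps. fps_X * fps_deriv F)"
  define N where "N = M * K"
  define X where "X = D M - Sp * M"
  have D_nth: "fps_nth (D F) n = of_nat n * fps_nth F n" for F n by (cases n) (simp_all add: D_def)
  have K_nth: "fps_nth (G * K) n = fps_nth G n - (if n = 0 then 0 else lf * fps_nth G (n - 1))" for G n
    unfolding K_def by (simp add: right_diff_distrib mult.assoc[symmetric] mult.commute[of G])
  have KS: "S * K = fps_const lf * fps_X"
  proof (rule fps_ext)
    fix n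
    show "fps_nth (S * K) n = fps_nth (fps_const lf * fps_X) n"
    proof (cases n)
      case (Suc m)
      thus ?thesis unfolding K_nth by (cases m) (simp_all add: S_def)
    qed (simp add: K_nth S_def)
  qed
  have DK: "D K = - (fps_const lf * fps_X)" unfolding D_def K_def by (simp add: mult.commute)
  have DN: "D N = D M * K + M * D K" unfolding D_def N_def by (simp add: algebra_simps)
  have KX: "X * K = D N + N * (S - Sp)"
  proof -
    have "D M * K = D N + M * (S * K)" unfolding KS using DN DK by (simp add: algebra_simps)
    hence "X * K = D N + M * (S * K) - Sp * (M * K)" by (simp only: X_def left_diff_distrib mult.assoc)
    thus ?thesis by (simp only: N_def right_diff_distrib mult_ac add_diff_eq)
  qed
  \<comment> \<open>The coefficient is M_n - P M_(n-1), and M_n is precisely the part of P M_(n-1)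
    with non-negative exponents.\<close>
  have N_neg: "fls_nth (fps_nth N n) i = 0" if i: "i \<ge> 0" and n: "n > 0" for n i
  proof -
    obtain m where m: "n = Suc m" using n by (cases n) auto
    show ?thesis unfolding N_def K_nth using i by (simp add: M_def m mf_nth lf_mult_nth)
  qed
  have N0: "fps_nth N 0 = 1"
    unfolding N_def K_nth by (simp add: M_def) (rule fls_eqI, simp add: mf_nth fls_one_nth)
  have N_nonpos: "fls_nth (fps_nth N n) i = 0" if "i > 0" for n i
    using N_neg[of i n] N0 that by (cases "n = 0") (auto simp: fls_one_nth)
  have rhs: "fls_nth (fps_nth (D N + N * (S - Sp)) n) i = 0" if "i \<ge> 0" for n i
  proof -
    have "fls_nth (fps_nth (D N) n) i = 0"
    proof (cases "n = 0")
      case False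
      have "fls_nth (of_nat n * fps_nth N n) i = of_nat n * fls_nth (fps_nth N n) i"
        by (simp only: of_nat_mult_fls_nth)
      thus ?thesis using N_neg[of i n] that False by (simp add: D_nth)
    qed (simp add: D_nth)
    moreover have "fls_nth (fps_nth N a * fps_nth (S - Sp) b) i = 0" for a b
    proof (rule fls_mult_nonpos_neg[OF _ _ that])
      show "fls_nth (fps_nth N a) j = 0" if "j > 0" for j by (rule N_nonpos[OF that])
      show "fls_nth (fps_nth (S - Sp) b) j = 0" if "j \<ge> 0" for j using that by (simp add: S_def Sp_def pos_part_nth)
    qed
    ultimately show ?thesis by (simp add: fps_mult_nth fls_nth_sum)
  qed
  have X_nonneg: "fls_nth (fps_nth X n) i = 0" if "i < 0" for n i
  proof -
    have "fls_nth (of_nat n * fps_nth M n) i = of_nat n * fls_nth (fps_nth M n) i"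
      by (simp only: of_nat_mult_fls_nth)
    hence "fls_nth (fps_nth (D M) n) i = 0" using that by (simp add: D_nth M_def mf_nth meander_weight_neg)
    moreover have "fls_nth (fps_nth Sp a * fps_nth M b) i = 0" for a b
      by (subst fls_mult_nonneg_nth) (use that in \<open>auto simp: Sp_def M_def pos_part_nth mf_nth meander_weight_neg\<close>)
    ultimately show ?thesis by (simp add: X_def fps_mult_nth fls_nth_sum)
  qed
  have X0: "fps_nth X n = 0" for n
  proof (induction n)
    case 0
    show ?case by (simp add: X_def D_nth Sp_def)
  next
    case (Suc n)
    \<comment> \<open>K has constant coefficient 1, and the lower coefficients of X vanish by
      induction.\<close>
    have "fps_nth (X * K) (Suc n) = fps_nth X (Suc n)" unfolding K_nth by (simp add: Suc.IH)
    hence "fls_nth (fps_nth X (Suc n)) i = 0" if "i \<ge> 0" for i using rhs[OF that, of "Suc n"] KX by simp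
    thus ?case using X_nonneg by (intro fls_eqI) (metis fls_zero_nth linorder_not_less)
  qed
  have "fps_nth (D M) n = fps_nth (Sp * M) n" using X0[of n] by (simp add: X_def)
  thus ?thesis by (simp add: D_nth fps_mult_nth M_def Sp_def)
qed

lemma meander_recurrence:
  assumes "k \<ge> 0"
  shows "real n * mw n k = (\<Sum>j=1..n. \<Sum>i\<in>{0..k}. ww j i * mw (n - j) (k - i))"
proof -
  have "real n * mw n k = fls_nth (of_nat n * mf n) k"
    by (simp only: of_nat_mult_fls_nth mf_nth)
  also have "\<dots> = (\<Sum>j=0..n. fls_nth ((if j = 0 then 0 else pos_part (lf ^ j)) * mf (n - j)) k)"
    unfolding meander_recurrence_fls fls_nth_sum ..
  also have "\<dots> = (\<Sum>j=1..n. fls_nth (pos_part (lf ^ j) * mf (n - j)) k)"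
    by (rule sum.mono_neutral_cong_right) auto
  also have "\<dots> = (\<Sum>j=1..n. \<Sum>i\<in>{0..k}. ww j i * mw (n - j) (k - i))"
  proof (intro sum.cong refl)
    fix j
    have "fls_nth (pos_part (lf ^ j) * mf (n - j)) k = (\<Sum>i\<in>{0..k}. fls_nth (pos_part (lf ^ j)) i * fls_nth (mf (n - j)) (k - i))"
      by (rule fls_mult_nonneg_nth) (auto simp: pos_part_nth mf_nth meander_weight_neg)
    thus "fls_nth (pos_part (lf ^ j) * mf (n - j)) k = (\<Sum>i\<in>{0..k}. ww j i * mw (n - j) (k - i))"
      by (simp add: pos_part_nth mf_nth lf_power_nth)
  qed
  finally show ?thesis .
qed

definition Mk :: "nat \<Rightarrow> real fps" where "Mk k = Abs_fps (\<lambda>n. mw n (int k))"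
text \<open>The index shift comes from dividing the identity for z M' by z.\<close>

definition Jk :: "nat \<Rightarrow> real fps" where "Jk i = Abs_fps (\<lambda>j. ww (Suc j) (int i))"

lemma Mk_deriv: "fps_deriv (Mk k) = (\<Sum>i\<le>k. Jk i * Mk (k - i))"
proof (rule fps_ext)
  fix n
  have "fps_nth (fps_deriv (Mk k)) n = real (Suc n) * mw (Suc n) (int k)" by (simp add: Mk_def)
  also have "\<dots> = (\<Sum>j=1..Suc n. \<Sum>i\<in>{0..int k}. ww j i * mw (Suc n - j) (int k - i))"
    by (rule meander_recurrence) simp
  also have "\<dots> = (\<Sum>j=0..n. \<Sum>i\<in>{0..int k}. ww (Suc j) i * mw (n - j) (int k - i))"
    by (rule sum.reindex_bij_witness[of _ Suc "\<lambda>j. j - 1"]) auto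
  also have "\<dots> = (\<Sum>j=0..n. \<Sum>i\<le>k. ww (Suc j) (int i) * mw (n - j) (int (k - i)))"
  proof (rule sum.cong[OF refl])
    fix j
    show "(\<Sum>i\<in>{0..int k}. ww (Suc j) i * mw (n - j) (int k - i)) = (\<Sum>i\<le>k. ww (Suc j) (int i) * mw (n - j) (int (k - i)))"
      by (rule sum.reindex_bij_witness[of _ int nat]) (auto simp: of_nat_diff)
  qed
  also have "\<dots> = (\<Sum>i\<le>k. \<Sum>j=0..n. ww (Suc j) (int i) * mw (n - j) (int (k - i)))" by (rule sum.swap)
  also have "\<dots> = fps_nth (\<Sum>i\<le>k. Jk i * Mk (k - i)) n"
    by (simp add: fps_sum_nth fps_mult_nth Jk_def Mk_def)
  finally show "fps_nth (fps_deriv (Mk k)) n = fps_nth (\<Sum>i\<le>k. Jk i * Mk (k - i)) n" .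
qed

end

section \<open>Contour integrals over circles, depending on a parameter\<close>

lemma annulus_residue:
  assumes r: "0 < r" "r < R" and a: "r < norm a" "norm a < R"
    and g: "g holomorphic_on - {0}" and W: "W holomorphic_on - {0}"
    and Wa: "W a = 0" "deriv W a \<noteq> 0" and nz: "\<And>w. r \<le> norm w \<Longrightarrow> norm w \<le> R \<Longrightarrow> w \<noteq> a \<Longrightarrow> W w \<noteq> 0"
  shows "contour_integral (circlepath 0 R) (\<lambda>w. g w / W w) =
     contour_integral (circlepath 0 r) (\<lambda>w. g w / W w) + 2 * pi * \<i> * (g a / deriv W a)"
proof -
  have op: "open (- {0::complex})" by auto
  \<comment> \<open>Dividing out the zero of W and then splitting off the pole leaves an integrand k
    that is holomorphic around the closed annulus. Its integrals over the two circles agree by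
    homotopy, and only the pole term feels the winding number around a, which is 1 for the outer and
    0 for the inner circle.\<close>
  define q where "q = (\<lambda>z. if z = a then deriv W a else (W z - W a) / (z - a))"
  have q: "q holomorphic_on - {0}" unfolding q_def by (intro pole_lemma_open W op)
  define S where "S = - {0} \<inter> {w. q w \<noteq> 0}"
  have S: "open S"
  proof -
    have "continuous_on (- {0}) q" by (rule holomorphic_on_imp_continuous_on[OF q])
    hence "open (- {0} \<inter> q -` (- {0}))" by (rule continuous_open_preimage[OF _ op op])
    moreover have "- {0} \<inter> q -` (- {0}) = S" by (auto simp: S_def)
    ultimately show ?thesis by simp
  qed
  have a0: "a \<noteq> 0" using a r by auto
  have aS: "a \<in> S" using a0 Wa by (simp add: S_def q_def)
  have annS: "w \<in> S" if "r \<le> norm w" "norm w \<le> R" for w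
    using nz[of w] that r aS Wa by (cases "w = a") (auto simp: S_def q_def)
  define w1 where "w1 = (\<lambda>z. g z / q z)"
  have w1: "w1 holomorphic_on S" unfolding w1_def
    by (intro holomorphic_on_divide holomorphic_on_subset[OF g] holomorphic_on_subset[OF q]) (auto simp: S_def)
  define k where "k = (\<lambda>z. if z = a then deriv w1 a else (w1 z - w1 a) / (z - a))"
  have k: "k holomorphic_on S" unfolding k_def by (intro pole_lemma_open w1 S)
  have w1a: "w1 a = g a / deriv W a" by (simp add: w1_def q_def)
  have keq: "g z / W z = k z + w1 a * (1 / (z - a))" if "z \<noteq> a" for z
    using that Wa(1) by (simp add: k_def w1_def q_def diff_divide_distrib)
  have sph: "sphere 0 x \<subseteq> S" if "x = r \<or> x = R" for x using that r by (auto intro!: annS)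
  have int: "contour_integral (circlepath 0 x) (\<lambda>w. g w / W w) =
     contour_integral (circlepath 0 x) k + w1 a * (2 * pi * \<i> * winding_number (circlepath 0 x) a)" if x: "x = r \<or> x = R" for x
  proof -
    have xp: "x > 0" "norm a \<noteq> x" using x r a by auto
    hence api: "a \<notin> path_image (circlepath 0 x)" by simp
    have ki: "k contour_integrable_on circlepath 0 x"
      by (rule contour_integrable_holomorphic_simple[OF k S]) (use sph[OF x] xp in auto)
    have wi: "((\<lambda>w. 1 / (w - a)) has_contour_integral (2 * pi * \<i> * winding_number (circlepath 0 x) a)) (circlepath 0 x)"
      using has_contour_integral_winding_number[OF _ api] by simp
    have "((\<lambda>w. k w + w1 a * (1 / (w - a))) has_contour_integral
       (contour_integral (circlepath 0 x) k + w1 a * (2 * pi * \<i> * winding_number (circlepath 0 x) a))) (circlepath 0 x)"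
      by (intro has_contour_integral_add has_contour_integral_lmul wi has_contour_integral_integral ki)
    hence "((\<lambda>w. g w / W w) has_contour_integral
       (contour_integral (circlepath 0 x) k + w1 a * (2 * pi * \<i> * winding_number (circlepath 0 x) a))) (circlepath 0 x)"
    proof (rule has_contour_integral_eq)
      fix w assume "w \<in> path_image (circlepath 0 x)"
      hence "w \<noteq> a" using api by auto
      thus "k w + w1 a * (1 / (w - a)) = g w / W w" using keq by simp
    qed
    thus ?thesis by (rule contour_integral_unique)
  qed
  have hom: "homotopic_loops S (circlepath 0 r) (circlepath 0 R)"
  proof (rule homotopic_loops_linear)
    fix t :: real
    have cr: "circlepath 0 x t = of_real x * exp (2 * of_real pi * \<i> * of_real t)" for x by (simp add: circlepath)
    have nx: "norm (exp (2 * of_real pi * \<i> * of_real t)) = 1"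
      using norm_exp_i_times[of "2 * pi * t"] by (simp add: mult_ac)
    show "closed_segment (circlepath 0 r t) (circlepath 0 R t) \<subseteq> S"
    proof
      fix x assume "x \<in> closed_segment (circlepath 0 r t) (circlepath 0 R t)"
      then obtain v where v: "0 \<le> v" "v \<le> 1" "x = (1 - v) *\<^sub>R circlepath 0 r t + v *\<^sub>R circlepath 0 R t"
        by (auto simp: in_segment)
      have "x = of_real ((1 - v) * r + v * R) * exp (2 * of_real pi * \<i> * of_real t)"
        unfolding v(3) cr by (simp add: scaleR_conv_of_real algebra_simps)
      hence nrm: "norm x = \<bar>(1 - v) * r + v * R\<bar>" by (simp only: norm_mult nx norm_of_real) simp
      have "(1 - v) * r + v * R = r + v * (R - r)" by (simp add: algebra_simps)
      moreover have "0 \<le> v * (R - r)" "v * (R - r) \<le> 1 * (R - r)" using v r by (auto intro: mult_right_mono)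
      moreover from calculation have "norm x = r + v * (R - r)" using nrm r by simp
      ultimately have "r \<le> norm x" "norm x \<le> R" by simp_all
      thus "x \<in> S" by (rule annS)
    qed
  qed auto
  have "contour_integral (circlepath 0 r) k = contour_integral (circlepath 0 R) k"
    by (rule Cauchy_theorem_homotopic_loops[OF hom S k]) auto
  moreover have "winding_number (circlepath 0 R) a = 1" by (rule winding_number_circlepath) (use a in simp)
  moreover have "winding_number (circlepath 0 r) a = 0"
    by (rule winding_number_zero_outside[of _ "cball 0 r"]) (use a r in auto)
  ultimately show ?thesis using int[of r] int[of R] by (simp add: w1a)
qed

text \<open>In powers of z - z0, the function 1/(1 - z P) is a geometric series whose ratio is
  bounded by q < 1 on the circle, so it can be integrated term by term. At z0 = 0 this identifies
  coefficients; at other z0 it proves holomorphy in z.\<close>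

lemma circle_param_sums:
  fixes G P :: "complex \<Rightarrow> complex"
  assumes r: "r > 0" and G: "continuous_on (sphere 0 r) G" and P: "continuous_on (sphere 0 r) P"
    and m: "m > 0" "\<And>w. norm w = r \<Longrightarrow> m \<le> norm (1 - z0 * P w)" and B: "\<And>w. norm w = r \<Longrightarrow> norm (P w) \<le> B"
    and q: "0 \<le> q" "q < 1" "norm (z - z0) * B \<le> q * m"
  shows "(\<lambda>k. contour_integral (circlepath 0 r) (\<lambda>w. G w * P w ^ k / (1 - z0 * P w) ^ Suc k) * (z - z0) ^ k)
     sums contour_integral (circlepath 0 r) (\<lambda>w. G w / (1 - z * P w))"
proof -
  have path: "path_image (circlepath 0 r) = sphere 0 r" using r by simp
  have nz0: "1 - z0 * P w \<noteq> 0" if "w \<in> sphere 0 r" for w using m(2)[of w] m(1) that by auto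
  define x where "x = (\<lambda>w. (z - z0) * P w / (1 - z0 * P w))"
  have xq: "norm (x w) \<le> q" if "norm w = r" for w
  proof -
    have "norm (x w) = norm (z - z0) * norm (P w) / norm (1 - z0 * P w)" by (simp add: x_def norm_mult norm_divide)
    also have "\<dots> \<le> norm (z - z0) * B / m"
      by (intro frac_le mult_left_mono B m that) (use m in \<open>auto intro!: mult_nonneg_nonneg order_trans[OF norm_ge_zero B[OF that]]\<close>)
    also have "\<dots> \<le> q" using q m by (simp add: pos_divide_le_eq)
    finally show ?thesis .
  qed
  have zx: "1 - z * P w = (1 - z0 * P w) * (1 - x w)" if "w \<in> sphere 0 r" for w
    using nz0[OF that] by (simp add: x_def field_simps)
  have low: "m * (1 - q) \<le> norm (1 - z * P w)" if "w \<in> sphere 0 r" for w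
  proof -
    have "1 - q \<le> norm (1 - x w)" using xq[of w] norm_triangle_ineq2[of 1 "x w"] that by simp
    hence "m * (1 - q) \<le> norm (1 - z0 * P w) * norm (1 - x w)" using m q that by (intro mult_mono) auto
    thus ?thesis using zx[OF that] by (simp add: norm_mult)
  qed
  have nz: "1 - z * P w \<noteq> 0" if "w \<in> sphere 0 r" for w
  proof -
    have "0 < m * (1 - q)" using m q by simp
    thus ?thesis using low[OF that] by auto
  qed
  have xc: "continuous_on (sphere 0 r) x" unfolding x_def by (intro continuous_intros P ballI nz0)
  have Gz: "continuous_on (sphere 0 r) (\<lambda>w. G w / (1 - z * P w))" by (intro continuous_intros G P ballI nz)
  have Gzi: "(\<lambda>w. G w / (1 - z * P w)) contour_integrable_on circlepath 0 r"
    by (rule contour_integrable_continuous_circlepath) (simp only: path Gz)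
  have Gxi: "(\<lambda>w. G w / (1 - z * P w) * x w ^ n) contour_integrable_on circlepath 0 r" for n
    by (rule contour_integrable_continuous_circlepath)
       (unfold path, rule continuous_on_mult[OF Gz continuous_on_power[OF xc]])
  obtain BG where BG: "BG > 0" "\<And>w. norm w = r \<Longrightarrow> norm (G w) \<le> BG"
  proof -
    have "bounded (G ` sphere 0 r)" by (intro compact_imp_bounded compact_continuous_image G) auto
    thus ?thesis using that by (auto simp: bounded_pos)
  qed
  let ?I = "\<lambda>f. contour_integral (circlepath 0 r) f"
  have partial: "(\<Sum>k<n. ?I (\<lambda>w. G w * P w ^ k / (1 - z0 * P w) ^ Suc k) * (z - z0) ^ k) =
     ?I (\<lambda>w. G w / (1 - z * P w)) - ?I (\<lambda>w. G w / (1 - z * P w) * x w ^ n)" for n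
  proof -
    have 1: "((\<lambda>w. G w * P w ^ k / (1 - z0 * P w) ^ Suc k * (z - z0) ^ k) has_contour_integral
        (?I (\<lambda>w. G w * P w ^ k / (1 - z0 * P w) ^ Suc k) * (z - z0) ^ k)) (circlepath 0 r)" for k
      by (intro has_contour_integral_rmul has_contour_integral_integral contour_integrable_continuous_circlepath)
         (unfold path, intro continuous_intros G P, use nz0 in auto)
    have 2: "((\<lambda>w. \<Sum>k<n. G w * P w ^ k / (1 - z0 * P w) ^ Suc k * (z - z0) ^ k) has_contour_integral
        (\<Sum>k<n. ?I (\<lambda>w. G w * P w ^ k / (1 - z0 * P w) ^ Suc k) * (z - z0) ^ k)) (circlepath 0 r)"
      by (intro has_contour_integral_sum 1) auto
    have 3: "((\<lambda>w. G w / (1 - z * P w) - G w / (1 - z * P w) * x w ^ n) has_contour_integral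
        (?I (\<lambda>w. G w / (1 - z * P w)) - ?I (\<lambda>w. G w / (1 - z * P w) * x w ^ n))) (circlepath 0 r)"
      by (intro has_contour_integral_diff has_contour_integral_integral Gzi Gxi)
    have "(\<Sum>k<n. G w * P w ^ k / (1 - z0 * P w) ^ Suc k * (z - z0) ^ k) = G w / (1 - z * P w) - G w / (1 - z * P w) * x w ^ n"
      if w: "w \<in> path_image (circlepath 0 r)" for w
    proof -
      have w': "w \<in> sphere 0 r" using w r by simp
      have x1: "x w \<noteq> 1" using xq[of w] q w' by auto
      have "(\<Sum>k<n. G w * P w ^ k / (1 - z0 * P w) ^ Suc k * (z - z0) ^ k) = G w / (1 - z0 * P w) * (\<Sum>k<n. x w ^ k)"
        unfolding sum_distrib_left x_def by (intro sum.cong refl) (simp add: power_divide power_mult_distrib mult_ac)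
      also have "(\<Sum>k<n. x w ^ k) = (1 - x w ^ n) / (1 - x w)" by (rule sum_gp_strict[THEN trans]) (use x1 in simp)
      also have "G w / (1 - z0 * P w) * ((1 - x w ^ n) / (1 - x w)) = G w / (1 - z * P w) * (1 - x w ^ n)"
        unfolding zx[OF w'] by simp
      finally show ?thesis by (simp add: right_diff_distrib)
    qed
    from has_contour_integral_eq[OF 2 this] 3 show ?thesis by (rule has_contour_integral_unique)
  qed
  have "(\<lambda>n. ?I (\<lambda>w. G w / (1 - z * P w) * x w ^ n)) \<longlonglongrightarrow> 0"
  proof (rule Lim_null_comparison)
    have "(\<lambda>n. BG / (m * (1 - q)) * q ^ n * (2 * pi * r)) \<longlonglongrightarrow> BG / (m * (1 - q)) * 0 * (2 * pi * r)"
      using q by (intro tendsto_intros LIMSEQ_power_zero) auto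
    thus "(\<lambda>n. BG / (m * (1 - q)) * q ^ n * (2 * pi * r)) \<longlonglongrightarrow> 0" by simp
    show "\<forall>\<^sub>F n in sequentially. norm (?I (\<lambda>w. G w / (1 - z * P w) * x w ^ n)) \<le> BG / (m * (1 - q)) * q ^ n * (2 * pi * r)"
    proof (rule always_eventually, rule allI)
      fix n
      show "norm (?I (\<lambda>w. G w / (1 - z * P w) * x w ^ n)) \<le> BG / (m * (1 - q)) * q ^ n * (2 * pi * r)"
      proof (rule has_contour_integral_bound_circlepath)
        show "((\<lambda>w. G w / (1 - z * P w) * x w ^ n) has_contour_integral ?I (\<lambda>w. G w / (1 - z * P w) * x w ^ n)) (circlepath 0 r)"
          by (intro has_contour_integral_integral Gxi)
        fix w :: complex assume w: "norm (w - 0) = r"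
        have "norm (G w / (1 - z * P w)) \<le> BG / (m * (1 - q))"
          unfolding norm_divide using BG w low[of w] m q by (intro frac_le) auto
        moreover have "norm (x w ^ n) \<le> q ^ n" unfolding norm_power using xq[of w] w by (intro power_mono) auto
        ultimately show "norm (G w / (1 - z * P w) * x w ^ n) \<le> BG / (m * (1 - q)) * q ^ n"
          unfolding norm_mult using BG m q by (intro mult_mono) auto
      qed (use r BG m q in auto)
    qed
  qed
  hence "(\<lambda>n. ?I (\<lambda>w. G w / (1 - z * P w)) - ?I (\<lambda>w. G w / (1 - z * P w) * x w ^ n)) \<longlonglongrightarrow> ?I (\<lambda>w. G w / (1 - z * P w)) - 0"
    by (intro tendsto_intros)
  thus ?thesis unfolding sums_def partial by simp
qed

lemma circle_param_holomorphic:
  fixes G P :: "complex \<Rightarrow> complex"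
  assumes r: "r > 0" and G: "continuous_on (sphere 0 r) G" and P: "continuous_on (sphere 0 r) P"
    and nz: "\<And>w. norm w = r \<Longrightarrow> 1 - z0 * P w \<noteq> 0"
  shows "\<exists>e>0. (\<lambda>z. contour_integral (circlepath 0 r) (\<lambda>w. G w / (1 - z * P w))) holomorphic_on ball z0 e"
proof -
  have ne: "sphere (0::complex) r \<noteq> {}" using r by (simp add: sphere_eq_empty)
  have "continuous_on (sphere 0 r) (\<lambda>w. norm (1 - z0 * P w))" by (intro continuous_intros P)
  from continuous_attains_inf[OF compact_sphere ne this] obtain w0 where
    w0: "w0 \<in> sphere 0 r" "\<And>w. w \<in> sphere 0 r \<Longrightarrow> norm (1 - z0 * P w0) \<le> norm (1 - z0 * P w)" by blast
  define m where "m = norm (1 - z0 * P w0)"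
  have m: "m > 0" "\<And>w. norm w = r \<Longrightarrow> m \<le> norm (1 - z0 * P w)" using w0 nz[of w0] by (auto simp: m_def)
  have "bounded (P ` sphere 0 r)" by (intro compact_imp_bounded compact_continuous_image P) auto
  then obtain B where B: "B > 0" "\<And>w. norm w = r \<Longrightarrow> norm (P w) \<le> B" by (auto simp: bounded_pos)
  define e where "e = m / (2 * B)"
  have "(\<lambda>z. contour_integral (circlepath 0 r) (\<lambda>w. G w / (1 - z * P w))) holomorphic_on ball z0 e"
  proof (rule power_series_holomorphic)
    fix z assume z: "z \<in> ball z0 e"
    have "norm (z - z0) \<le> e" using z by (simp add: dist_norm norm_minus_commute)
    hence "norm (z - z0) * B \<le> e * B" using B by (intro mult_right_mono) auto
    hence "norm (z - z0) * B \<le> 1 / 2 * m" using B by (simp add: e_def)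
    thus "(\<lambda>k. contour_integral (circlepath 0 r) (\<lambda>w. G w * P w ^ k / (1 - z0 * P w) ^ Suc k) * (z - z0) ^ k)
        sums contour_integral (circlepath 0 r) (\<lambda>w. G w / (1 - z * P w))"
      by (intro circle_param_sums[OF r G P m B(2), of "1/2"]) auto
  qed
  moreover have "e > 0" using m B by (simp add: e_def)
  ultimately show ?thesis by blast
qed

lemma contour_integral_circle_power_int:
  assumes "r > 0"
  shows "((\<lambda>w. w powi n) has_contour_integral (if n = -1 then 2 * pi * \<i> else 0)) (circlepath 0 r)"
proof (cases "n = -1")
  case True
  have "((\<lambda>w. 1 / (w - 0)) has_contour_integral (2 * of_real pi * \<i> * 1)) (circlepath 0 r)"
    using Cauchy_integral_circlepath_simple[of "\<lambda>_. 1" 0 r 0] assms by simp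
  thus ?thesis using True by (simp add: power_int_minus divide_inverse)
next
  case False
  have "((\<lambda>w. w powi n) has_contour_integral 0) (circlepath 0 r)"
  proof (rule Cauchy_theorem_primitive[of "- {0}" "\<lambda>w. w powi (n + 1) / of_int (n + 1)"])
    fix x :: complex assume x: "x \<in> - {0}"
    have "of_int (n + 1) \<noteq> (0::complex)" using False by (metis add.commute add_eq_0_iff of_int_eq_0_iff)
    thus "((\<lambda>w. w powi (n + 1) / of_int (n + 1)) has_field_derivative x powi n) (at x within - {0})"
      using x by (auto intro!: derivative_eq_intros)
  qed (use assms in auto)
  thus ?thesis using False by simp
qed

subsection \<open>Centred walks\<close>

locale critical_walk = bounded_walk +
  assumes p_sum: "(\<Sum>l\<in>I. p l) = 1" and p_mean: "(\<Sum>l\<in>I. of_int l * p l) = 0"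
    and p_c: "p (- int c) > 0" and p_d: "p (int d) > 0"
    and aper: "\<And>w::complex. norm w = 1 \<Longrightarrow> w \<noteq> 1 \<Longrightarrow> norm (PP w) < 1"
begin

definition PP1 :: "complex \<Rightarrow> complex" where
  "PP1 w = (\<Sum>l\<in>I. of_real (p l) * (of_int l * w powi (l - 1)))"

definition PP2 :: "complex \<Rightarrow> complex" where
  "PP2 w = (\<Sum>l\<in>I. of_real (p l) * (of_int l * (of_int (l - 1) * w powi (l - 2))))"

text \<open>The second derivative of P at 1, which is the step variance because the mean is
  0.\<close>

definition V :: real where "V = (\<Sum>l\<in>I. p l * of_int (l * (l - 1)))"

text \<open>The constant sqrt(2 P/P'') at the saddle point 1, where P = 1.\<close>

definition C :: real where "C = sqrt (2 / V)"

lemma V_pos: "V > 0"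
proof -
  have nn: "p l * of_int (l * (l - 1)) \<ge> 0" for l
  proof -
    have "l * (l - 1) \<ge> 0" by (cases "l \<ge> 1") (auto simp: mult_nonneg_nonneg mult_nonpos_nonpos)
    hence "real_of_int (l * (l - 1)) \<ge> 0" by (simp only: of_int_0_le_iff)
    thus ?thesis using p_nonneg[of l] by (rule mult_nonneg_nonneg[rotated])
  qed
  have "(- int c) * (- int c - 1) > 0" using c_pos by (intro mult_neg_neg) auto
  hence "p (- int c) * of_int ((- int c) * (- int c - 1)) > 0" using p_c by (metis mult_pos_pos of_int_0_less_iff)
  also have "p (- int c) * of_int ((- int c) * (- int c - 1)) \<le> V"
    unfolding V_def by (rule member_le_sum[of "- int c" I "\<lambda>l. p l * of_int (l * (l - 1))"]) (use nn in auto)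
  finally show ?thesis .
qed

lemma C_pos: "C > 0" "V * C\<^sup>2 = 2" "1 / (V * C) = C / 2"
proof -
  show 1: "C > 0" using V_pos by (simp add: C_def)
  show 2: "V * C\<^sup>2 = 2" using V_pos by (simp add: C_def)
  show "1 / (V * C) = C / 2" using 1 2 V_pos by (simp add: field_simps power2_eq_square)
qed

lemma PP_deriv: "w \<noteq> 0 \<Longrightarrow> (PP has_field_derivative PP1 w) (at w)"
  unfolding PP_def[abs_def] PP1_def
  by (auto intro!: derivative_eq_intros sum.cong simp: mult_ac)

lemma PP1_deriv: "w \<noteq> 0 \<Longrightarrow> (PP1 has_field_derivative PP2 w) (at w)"
  unfolding PP1_def[abs_def] PP2_def
  by (auto intro!: derivative_eq_intros sum.cong simp: mult_ac)

lemma PP_holomorphic: "PP holomorphic_on - {0}" "PP1 holomorphic_on - {0}"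
  unfolding holomorphic_on_def field_differentiable_def
  by (auto intro: has_field_derivative_at_within[OF PP_deriv] has_field_derivative_at_within[OF PP1_deriv])

lemma PP_one: "PP 1 = (1::complex)" "PP1 1 = 0" "PP2 1 = of_real V"
proof -
  show "PP 1 = (1::complex)" using arg_cong[OF p_sum, of complex_of_real] by (simp add: PP_def)
  show "PP1 1 = 0" using arg_cong[OF p_mean, of complex_of_real] by (simp add: PP1_def mult_ac)
  show "PP2 1 = of_real V" by (simp add: PP2_def V_def)
qed

lemma norm_PP_le: "norm w = 1 \<Longrightarrow> norm (PP w :: complex) \<le> 1"
  using aper[of w] PP_one(1) by (cases "w = 1") auto

text \<open>The equation (1 - s^2) P(w) = 1 says \<phi>(w) = s^2 with \<phi> = 1 - 1/P. As the drift
  vanishes, \<phi> has a double zero at 1 and is locally the square of an injective function \<psi>.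
  The two roots are the inverse U of \<psi>, taken at s and at -s.\<close>

lemma local_branch:
  obtains \<epsilon> U \<delta> where "\<epsilon> > 0" "\<epsilon> < 1" "U holomorphic_on ball 0 \<epsilon>" "U 0 = 1"
    "(U has_field_derivative - of_real C) (at 0)" "\<delta> > 0"
    "\<forall>s\<in>ball 0 \<epsilon>. U s \<noteq> 0 \<and> (1 - s\<^sup>2) * PP (U s) = 1"
    "\<forall>w\<in>ball 1 \<delta>. \<forall>s\<in>ball 0 \<epsilon>. (1 - s\<^sup>2) * PP w = 1 \<longrightarrow> w = U s \<or> w = U (- s)"
proof -
  have "isCont PP (1::complex)" using PP_deriv[of 1] DERIV_isCont by fastforce
  then obtain e1 where e1: "e1 > 0" "\<And>w. dist 1 w < e1 \<Longrightarrow> PP w \<noteq> (0::complex)"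
    using continuous_at_avoid[of 1 PP "0::complex"] PP_one(1) by auto
  define e0 where "e0 = min e1 (1/2)"
  define B where "B = ball (1::complex) e0"
  have e0: "e0 > 0" using e1 by (simp add: e0_def)
  have B: "open B" "1 \<in> B" "\<And>w. w \<in> B \<Longrightarrow> w \<noteq> 0" "\<And>w. w \<in> B \<Longrightarrow> PP w \<noteq> (0::complex)"
    using e1 by (auto simp: B_def e0_def)
  define \<phi> where "\<phi> = (\<lambda>w::complex. 1 - inverse (PP w))"
  have \<phi>d: "(\<phi> has_field_derivative PP1 w / (PP w)\<^sup>2) (at w)" if "w \<in> B" for w
    unfolding \<phi>_def using B(3,4)[OF that] PP_deriv[of w]
    by (auto intro!: derivative_eq_intros simp: power2_eq_square field_simps)
  have \<phi>h: "\<phi> holomorphic_on B" using \<phi>d B(1) by (auto simp: holomorphic_on_open)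
  have \<phi>1: "\<phi> 1 = 0" "deriv \<phi> 1 = 0" using PP_one DERIV_imp_deriv[OF \<phi>d[OF B(2)]] by (auto simp: \<phi>_def)
  \<comment> \<open>Two successive difference quotients divide out the double zero.\<close>
  define h1 where "h1 = (\<lambda>w. if w = 1 then deriv \<phi> 1 else (\<phi> w - \<phi> 1) / (w - 1))"
  have h1: "h1 holomorphic_on B" unfolding h1_def by (intro pole_lemma_open \<phi>h B(1))
  define h where "h = (\<lambda>w. if w = 1 then deriv h1 1 else (h1 w - h1 1) / (w - 1))"
  have h: "h holomorphic_on B" unfolding h_def by (intro pole_lemma_open h1 B(1))
  have \<phi>eq: "\<phi> w = (w - 1)\<^sup>2 * h w" for w
    using \<phi>1 by (simp add: h_def h1_def power2_eq_square)
  have h_one: "h 1 = of_real (V / 2)"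
  proof -
    have "((\<lambda>y. (\<phi> (y + 1) - \<phi> (0 + 1) - PP1 (0 + 1) / (PP (0 + 1))\<^sup>2 * y) / y\<^sup>2) \<longlongrightarrow> of_real V / 2) (at 0)"
    proof (rule taylor2_tendsto[OF e0])
      fix y :: complex assume "norm y < e0"
      hence "y + 1 \<in> B" by (simp add: B_def dist_norm)
      from \<phi>d[OF this] show "((\<lambda>y. \<phi> (y + 1)) has_field_derivative PP1 (y + 1) / (PP (y + 1))\<^sup>2) (at y)"
        by (simp only: DERIV_shift)
    next
      have "((\<lambda>w. PP1 w / (PP w)\<^sup>2) has_field_derivative of_real V) (at (0 + 1))"
        by (rule DERIV_cong[OF DERIV_divide[OF PP1_deriv DERIV_power[OF PP_deriv]]]) (use PP_one in auto)
      thus "((\<lambda>y. PP1 (y + 1) / (PP (y + 1))\<^sup>2) has_field_derivative of_real V) (at 0)"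
        by (simp only: DERIV_shift)
    qed
    hence "((\<lambda>y. (\<phi> (y + 1)) / y\<^sup>2) \<longlongrightarrow> of_real V / 2) (at 0)" using PP_one \<phi>1 by simp
    moreover have "\<forall>\<^sub>F y in at 0. \<phi> (y + 1) / y\<^sup>2 = h (1 + y)"
      by (auto simp: eventually_at_filter \<phi>eq add.commute)
    ultimately have l1: "((\<lambda>y. h (1 + y)) \<longlongrightarrow> of_real V / 2) (at 0)" by (simp add: tendsto_cong)
    have "isCont h 1" using holomorphic_on_imp_continuous_on[OF h] B by (simp add: continuous_on_eq_continuous_at)
    hence "((\<lambda>y. h (1 + y)) \<longlongrightarrow> h 1) (at 0)" by (simp add: isCont_iff)
    from tendsto_unique[OF _ this l1] show ?thesis by simp
  qed
  obtain e2 where e2: "e2 > 0" "ball 1 e2 \<subseteq> B" "\<And>w. w \<in> ball 1 e2 \<Longrightarrow> Re (h w) > 0"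
  proof -
    have "continuous_on B (\<lambda>w. Re (h w))" by (intro continuous_intros holomorphic_on_imp_continuous_on[OF h])
    hence "open (B \<inter> (\<lambda>w. Re (h w)) -` {0<..})" by (intro continuous_open_preimage B(1)) auto
    moreover have "1 \<in> B \<inter> (\<lambda>w. Re (h w)) -` {0<..}" using B(2) V_pos unfolding h_one by (simp add: h_one)
    ultimately obtain e where "e > 0" "ball 1 e \<subseteq> B \<inter> (\<lambda>w. Re (h w)) -` {0<..}"
      unfolding open_contains_ball by blast
    thus ?thesis by (intro that[of e]) auto
  qed
  \<comment> \<open>The minus sign gives U the slope -C: for small s > 0 the root U(s) is inside the
    unit circle and U(-s) outside.\<close>
  define \<psi> where "\<psi> = (\<lambda>w. - (w - 1) * csqrt (h w))"
  have csh: "(\<lambda>w. csqrt (h w)) holomorphic_on ball 1 e2"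
  proof (intro holomorphic_on_csqrt' holomorphic_on_subset[OF h e2(2)])
    fix w :: complex assume "w \<in> ball 1 e2"
    thus "h w \<notin> \<real>\<^sub>\<le>\<^sub>0" using e2(3)[of w] by (auto simp: complex_nonpos_Reals_iff)
  qed
  have \<psi>h: "\<psi> holomorphic_on ball 1 e2" unfolding \<psi>_def by (intro holomorphic_intros csh)
  have \<psi>sq: "(\<psi> w)\<^sup>2 = \<phi> w" for w unfolding \<psi>_def \<phi>eq by (simp only: power_mult_distrib power2_csqrt power2_minus)
  have d\<psi>: "deriv \<psi> 1 = - of_real (sqrt (V / 2))"
  proof -
    have "((\<lambda>w. csqrt (h w)) has_field_derivative deriv (\<lambda>w. csqrt (h w)) 1) (at 1)"
      by (rule holomorphic_derivI[OF csh open_ball]) (use e2 in simp)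
    moreover have "((\<lambda>w::complex. - (w - 1)) has_field_derivative - 1) (at 1)" by (auto intro!: derivative_eq_intros)
    ultimately have "(\<psi> has_field_derivative - 1 * csqrt (h 1) + deriv (\<lambda>w. csqrt (h w)) 1 * - (1 - 1)) (at 1)"
      unfolding \<psi>_def by (rule DERIV_mult[rotated])
    hence "deriv \<psi> 1 = - csqrt (h 1)" by (simp add: DERIV_imp_deriv)
    also have "csqrt (h 1) = of_real (sqrt (V / 2))" 
      unfolding h_one using V_pos of_real_sqrt[of "V / 2"] by simp
    finally show ?thesis .
  qed
  have nz: "deriv \<psi> 1 \<noteq> 0" using d\<psi> V_pos by simp
  have one2: "(1::complex) \<in> ball 1 e2" using e2 by simp
  obtain \<delta> where \<delta>: "\<delta> > 0" "ball (1::complex) \<delta> \<subseteq> ball 1 e2" "inj_on \<psi> (ball 1 \<delta>)"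
    using has_complex_derivative_locally_injective[OF \<psi>h one2 open_ball nz] by metis
  have \<psi>h': "\<psi> holomorphic_on ball 1 \<delta>" using \<psi>h \<delta>(2) holomorphic_on_subset by blast
  obtain g where g: "g holomorphic_on (\<psi> ` ball 1 \<delta>)" "\<And>z. z \<in> ball 1 \<delta> \<Longrightarrow> deriv \<psi> z * deriv g (\<psi> z) = 1"
    "\<And>z. z \<in> ball 1 \<delta> \<Longrightarrow> g (\<psi> z) = z"
    using holomorphic_has_inverse[OF \<psi>h' open_ball \<delta>(3)] by metis
  have op: "open (\<psi> ` ball 1 \<delta>)" by (rule open_mapping_thm3[OF \<psi>h' open_ball \<delta>(3)])
  have \<psi>1: "\<psi> 1 = 0" by (simp add: \<psi>_def)
  have "0 \<in> \<psi> ` ball 1 \<delta>" using \<delta>(1) \<psi>1 by (metis centre_in_ball image_eqI)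
  then obtain e3 where e3: "e3 > 0" "ball 0 e3 \<subseteq> \<psi> ` ball 1 \<delta>" using op open_contains_ball by metis
  define \<epsilon> where "\<epsilon> = min e3 (1/2)"
  have \<epsilon>: "\<epsilon> > 0" "\<epsilon> < 1" "ball 0 \<epsilon> \<subseteq> \<psi> ` ball 1 \<delta>" using e3 by (auto simp: \<epsilon>_def)
  have g\<psi>: "g s \<in> ball 1 \<delta> \<and> \<psi> (g s) = s" if s: "s \<in> ball 0 \<epsilon>" for s
  proof -
    obtain y where "y \<in> ball 1 \<delta>" "s = \<psi> y" using s \<epsilon>(3) by blast
    thus ?thesis using g(3) by simp
  qed
  have gB: "g s \<in> B" if "s \<in> ball 0 \<epsilon>" for s using g\<psi>[OF that] \<delta>(2) e2(2) by blast
  have gh: "g holomorphic_on ball 0 \<epsilon>" using g(1) \<epsilon>(3) holomorphic_on_subset by blast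
  have sub: "(1 - s\<^sup>2) * PP (g s) = 1" if "s \<in> ball 0 \<epsilon>" for s
  proof -
    have "s\<^sup>2 = 1 - inverse (PP (g s))" using \<psi>sq[of "g s"] g\<psi>[OF that] by (simp add: \<phi>_def)
    thus ?thesis using B(4)[OF gB[OF that]] by simp
  qed
  have g0: "g 0 = 1" using g(3)[of 1] \<psi>1 \<delta>(1) by simp
  have dg: "(g has_field_derivative - of_real C) (at 0)"
  proof -
    have "(g has_field_derivative deriv g 0) (at 0)"
      by (rule holomorphic_derivI[OF gh open_ball]) (use \<epsilon> in simp)
    moreover have "deriv g 0 = - of_real C"
    proof -
      have "deriv \<psi> 1 * deriv g 0 = 1" using g(2)[of 1] \<psi>1 \<delta>(1) by simp
      hence "- (of_real (sqrt (V / 2)) * deriv g 0) = 1" using d\<psi> by simp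
      moreover have "sqrt (V / 2) * C = 1"
        unfolding C_def using V_pos by (simp add: real_sqrt_mult[symmetric])
      hence "of_real (sqrt (V / 2)) * complex_of_real C = 1" by (metis of_real_1 of_real_mult)
      ultimately show ?thesis
        by (metis (no_types, opaque_lifting) minus_mult_right mult.commute mult.left_commute mult.right_neutral mult_cancel_left1 minus_minus)
    qed
    ultimately show ?thesis by simp
  qed
  have uniq: "w = g s \<or> w = g (- s)" if w: "w \<in> ball 1 \<delta>" and s: "s \<in> ball 0 \<epsilon>" and eq: "(1 - s\<^sup>2) * PP w = 1" for w s
  proof -
    have "inverse (PP w) = 1 - s\<^sup>2" using eq by (metis inverse_unique mult.commute)
    hence "(\<psi> w)\<^sup>2 = s\<^sup>2" using \<psi>sq[of w] by (simp add: \<phi>_def)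
    hence "\<psi> w = s \<or> \<psi> w = - s" by (simp add: power2_eq_iff)
    thus ?thesis using g(3)[OF w] by auto
  qed
  show ?thesis
    by (rule that[OF \<epsilon>(1,2) gh g0 dg \<delta>(1)]) (use gB sub B(3) uniq in blast)+
qed

text \<open>In the annulus 1/2 \<le> |w| \<le> 1 without the ball around 1, the set where |P| \<ge>
  1 is compact and misses the unit circle by aperiodicity. Its largest modulus is therefore below
  1.\<close>

lemma PP_small_annulus:
  assumes "\<delta> > 0"
  obtains r0 where "0 < r0" "r0 < 1" "\<And>w::complex. r0 \<le> norm w \<Longrightarrow> norm w \<le> 1 \<Longrightarrow> w \<notin> ball 1 \<delta> \<Longrightarrow> norm (PP w) < 1"
proof -
  define K where "K = (cball (0::complex) 1 - ball 0 (1/2)) - ball 1 \<delta>"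
  have K: "compact K" unfolding K_def by (intro compact_diff) auto
  have "continuous_on K (\<lambda>w. norm (PP w))"
    by (intro continuous_intros holomorphic_on_imp_continuous_on holomorphic_on_subset[OF PP_holomorphic(1)]) (auto simp: K_def)
  hence "closed (K \<inter> (\<lambda>w. norm (PP w)) -` {1..})"
    by (rule continuous_closed_preimage[OF _ compact_imp_closed[OF K]]) auto
  moreover have "K \<inter> (\<lambda>w. norm (PP w)) -` {1..} = {w\<in>K. 1 \<le> norm (PP w)}" by auto
  ultimately have "compact (K \<inter> {w\<in>K. 1 \<le> norm (PP w)})" using K by (intro compact_Int_closed) simp_all
  moreover have "K \<inter> {w\<in>K. 1 \<le> norm (PP w)} = {w\<in>K. 1 \<le> norm (PP w)}" by auto
  ultimately have Z: "compact {w\<in>K. 1 \<le> norm (PP w)}" by simp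
  show ?thesis
  proof (cases "{w\<in>K. 1 \<le> norm (PP w)} = {}")
    case True
    show ?thesis
    proof (rule that[of "1/2"])
      fix w :: complex assume "1/2 \<le> norm w" "norm w \<le> 1" "w \<notin> ball 1 \<delta>"
      hence "w \<in> K" by (auto simp: K_def)
      thus "norm (PP w) < 1" using True by force
    qed auto
  next
    case False
    obtain m where m: "m \<in> {w\<in>K. 1 \<le> norm (PP w)}" "\<And>w. w \<in> {w\<in>K. 1 \<le> norm (PP w)} \<Longrightarrow> norm w \<le> norm m"
      using continuous_attains_sup[OF Z False, of norm] by (auto intro: continuous_intros)
    have m1: "norm m < 1"
    proof (rule ccontr)
      assume "\<not> norm m < 1"
      hence "norm m = 1" "m \<noteq> 1" using m(1) assms by (auto simp: K_def)
      thus False using aper[of m] m(1) by simp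
    qed
    have m2: "norm m \<ge> 1/2" using m(1) by (auto simp: K_def)
    show ?thesis
    proof (rule that[of "(1 + norm m) / 2"])
      fix w :: complex assume w: "(1 + norm m) / 2 \<le> norm w" "norm w \<le> 1" "w \<notin> ball 1 \<delta>"
      show "norm (PP w) < 1"
      proof (rule ccontr)
        assume "\<not> norm (PP w) < 1"
        moreover have "w \<in> K" using w m2 by (auto simp: K_def)
        ultimately have "norm w \<le> norm m" by (intro m(2)) auto
        thus False using w(1) m1 by simp
      qed
    qed (use m1 m2 in auto)
  qed
qed

end

section \<open>Generating functions of unrestricted walks up to the unit circle\<close>

lemma fps_conv_radius_ge_1_of_bounded:
  fixes a :: "complex fps"
  assumes "\<And>n. norm (fps_nth a n) \<le> B"
  shows "fps_conv_radius a \<ge> 1"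
  unfolding fps_conv_radius_def
proof (rule conv_radius_geI_ex')
  fix r :: real assume r: "0 < r" "ereal r < 1"
  have "summable (\<lambda>n. B * r ^ n)" using r by (intro summable_mult summable_geometric) (auto simp: one_ereal_def)
  thus "summable (\<lambda>n. fps_nth a n * of_real r ^ n)"
    by (rule summable_comparison_test') (use assms r in \<open>auto simp: norm_mult norm_power intro!: mult_right_mono\<close>)
qed

context critical_walk
begin

lemma ww_nonneg: "ww n k \<ge> 0"
  by (induction n arbitrary: k) (auto intro!: sum_nonneg mult_nonneg_nonneg p_nonneg)

lemma ww_le_1: "ww n k \<le> 1"
proof (induction n arbitrary: k)
  case (Suc n)
  have "ww (Suc n) k \<le> (\<Sum>l\<in>I. p l * 1)"
    unfolding walk_weight.simps by (intro sum_mono mult_left_mono Suc.IH p_nonneg)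
  thus ?case using p_sum by simp
qed simp

lemma Jk_radius: "fps_conv_radius (cfps (Jk i)) \<ge> 1"
  by (rule fps_conv_radius_ge_1_of_bounded[of _ 1]) (use ww_nonneg ww_le_1 in \<open>simp add: Jk_def del: walk_weight.simps\<close>)

text \<open>Up to 2 pi i, Cauchy's formula for the coefficient of w^i in P/(1 - z P). The radius is
  left free so that the contour can be shrunk.\<close>

definition Jint :: "real \<Rightarrow> nat \<Rightarrow> complex \<Rightarrow> complex" where
  "Jint r i z = contour_integral (circlepath 0 r) (\<lambda>w. (w powi (- int i - 1) * PP w) / (1 - z * PP w))"

lemma PP_continuous: "r > 0 \<Longrightarrow> continuous_on (sphere 0 r) (PP :: complex \<Rightarrow> complex)"
  by (intro holomorphic_on_imp_continuous_on holomorphic_on_subset[OF PP_holomorphic(1)]) auto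

lemma numerator_continuous: "r > 0 \<Longrightarrow> continuous_on (sphere 0 r) (\<lambda>w::complex. w powi k * PP w)"
  by (intro continuous_intros PP_continuous) auto

lemma ww_contour_integral:
  "((\<lambda>w. PP w ^ j * w powi k) has_contour_integral (2 * pi * \<i> * of_real (ww j (- k - 1)))) (circlepath 0 1)"
proof (induction j arbitrary: k)
  case 0
  have "(if k = -1 then 2 * pi * \<i> else 0) = 2 * pi * \<i> * of_real (ww 0 (- k - 1))" by simp
  thus ?case using contour_integral_circle_power_int[of 1 k] by simp
next
  case (Suc j)
  have "((\<lambda>w. \<Sum>l\<in>I. of_real (p l) * (PP w ^ j * w powi (k + l))) has_contour_integral
      (\<Sum>l\<in>I. of_real (p l) * (2 * pi * \<i> * of_real (ww j (- (k + l) - 1))))) (circlepath 0 1)"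
    by (intro has_contour_integral_sum has_contour_integral_lmul Suc.IH) auto
  also have "(\<Sum>l\<in>I. of_real (p l) * (2 * pi * \<i> * of_real (ww j (- (k + l) - 1)))) = 2 * pi * \<i> * of_real (ww (Suc j) (- k - 1))"
  proof -
    have "- (k + l) - 1 = - k - 1 - l" for l by simp
    thus ?thesis by (simp only: walk_weight.simps of_real_sum sum_distrib_left of_real_mult mult_ac)
  qed
  finally show ?case
  proof (rule has_contour_integral_eq)
    fix w :: complex assume "w \<in> path_image (circlepath 0 1)"
    hence w: "w \<noteq> 0" by auto
    have "PP w ^ Suc j * w powi k = PP w * (PP w ^ j * w powi k)" by simp
    also have "\<dots> = (\<Sum>l\<in>I. of_real (p l) * w powi l * (PP w ^ j * w powi k))"
      unfolding PP_def[of w] by (simp only: sum_distrib_right)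
    finally show "(\<Sum>l\<in>I. of_real (p l) * (PP w ^ j * w powi (k + l))) = PP w ^ Suc j * w powi k"
      using w by (simp add: power_int_add mult_ac)
  qed
qed

lemma Jk_eval:
  assumes z: "norm z < 1"
  shows "eval_fps (cfps (Jk i)) z = Jint 1 i z / (2 * pi * \<i>)"
proof -
  have "(\<lambda>k. contour_integral (circlepath 0 1) (\<lambda>w. (w powi (- int i - 1) * PP w) * PP w ^ k / (1 - 0 * PP w) ^ Suc k) * (z - 0) ^ k)
     sums Jint 1 i z"
    unfolding Jint_def
    by (rule circle_param_sums[where m = 1 and B = 1 and q = "norm z"])
       (use z norm_PP_le PP_continuous[of 1] numerator_continuous[of 1] in auto)
  moreover have "contour_integral (circlepath 0 1) (\<lambda>w. (w powi (- int i - 1) * PP w) * PP w ^ k / (1 - 0 * PP w) ^ Suc k) =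
      2 * pi * \<i> * of_real (ww (Suc k) (int i))" for k
  proof -
    have "contour_integral (circlepath 0 1) (\<lambda>w. PP w ^ Suc k * w powi (- int i - 1)) = 2 * pi * \<i> * of_real (ww (Suc k) (- (- int i - 1) - 1))"
      by (rule contour_integral_unique[OF ww_contour_integral])
    thus ?thesis by (simp add: mult_ac del: walk_weight.simps)
  qed
  ultimately have "(\<lambda>k. 2 * pi * \<i> * (of_real (ww (Suc k) (int i)) * z ^ k)) sums Jint 1 i z"
    by (simp add: mult.assoc del: walk_weight.simps)
  hence "(\<lambda>k. (2 * pi * \<i> * (of_real (ww (Suc k) (int i)) * z ^ k)) / (2 * pi * \<i>)) sums (Jint 1 i z / (2 * pi * \<i>))"
    by (rule sums_divide)
  hence "(\<lambda>k. of_real (ww (Suc k) (int i)) * z ^ k) sums (Jint 1 i z / (2 * pi * \<i>))" by (simp del: walk_weight.simps)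
  thus ?thesis by (simp add: eval_fps_def Jk_def sums_iff del: walk_weight.simps)
qed

text \<open>As s tends to 0, the roots U(s) and U(-s) pinch the unit circle at 1. Shrinking the
  circle to radius r crosses U(s) only: the new integral is holomorphic near z = 1, and the residue
  has a simple pole in s, which the factor s cancels. The value at 0 is 1/(V C) = C/2.\<close>

lemma Jk_local_zero:
  "\<exists>e>0. \<exists>H. H holomorphic_on ball 0 e \<and> H 0 = of_real (C / 2) \<and>
     (\<forall>s\<in>ball 0 e \<inter> lens. s * eval_fps (cfps (Jk i)) (1 - s\<^sup>2) = H s)"
proof -
  obtain \<epsilon> U \<delta> where U0: "\<epsilon> > 0" "\<epsilon> < 1" "U holomorphic_on ball 0 \<epsilon>" "U 0 = 1"
    "(U has_field_derivative - of_real C) (at 0)" "\<delta> > 0"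
    "\<forall>s\<in>ball 0 \<epsilon>. U s \<noteq> 0 \<and> (1 - s\<^sup>2) * PP (U s) = 1"
    "\<forall>w\<in>ball 1 \<delta>. \<forall>s\<in>ball 0 \<epsilon>. (1 - s\<^sup>2) * PP w = 1 \<longrightarrow> w = U s \<or> w = U (- s)"
    by (rule local_branch)
  note U = U0(1-6) U0(7)[rule_format] U0(8)[rule_format]
  obtain r0 where r0: "0 < r0" "r0 < 1" "\<And>w::complex. r0 \<le> norm w \<Longrightarrow> norm w \<le> 1 \<Longrightarrow> w \<notin> ball 1 \<delta> \<Longrightarrow> norm (PP w) < 1"
    using PP_small_annulus[OF U(6)] by metis
  define r where "r = (1 + r0) / 2"
  have r: "0 < r" "r < 1" "r0 \<le> r" using r0 by (auto simp: r_def)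
  have nz1: "1 - 1 * PP w \<noteq> 0" if w: "norm w = r" for w :: complex
  proof (cases "w \<in> ball 1 \<delta>")
    case True
    show ?thesis
    proof
      assume "1 - 1 * PP w = 0"
      hence "(1 - 0\<^sup>2) * PP w = 1" by simp
      hence "w = 1" using U(8)[OF True, of 0] U(1,4) by simp
      thus False using w r by simp
    qed
  next
    case False
    hence "norm (PP w) < 1" using r0(3)[of w] w r by simp
    thus ?thesis by auto
  qed
  obtain e1 where e1: "e1 > 0" "Jint r i holomorphic_on ball 1 e1"
    using circle_param_holomorphic[OF r(1) numerator_continuous[OF r(1)] PP_continuous[OF r(1)] nz1] unfolding Jint_def[abs_def] by blast
  have Uc: "isCont U 0" using U(5) DERIV_isCont by blast
  obtain e2 where e2: "e2 > 0" "\<And>s. norm s < e2 \<Longrightarrow> norm (U s - 1) < 1 - r"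
  proof -
    have "\<forall>\<^sub>F s in at 0. dist (U s) (U 0) < 1 - r" using Uc r unfolding isCont_def by (intro tendstoD) auto
    then obtain e where "e > 0" "\<And>s. s \<noteq> 0 \<Longrightarrow> dist s 0 < e \<Longrightarrow> dist (U s) (U 0) < 1 - r" by (auto simp: eventually_at)
    thus ?thesis using r U(4) by (intro that[of e]) (metis dist_norm diff_zero diff_gt_0_iff_gt norm_zero right_minus_eq dist_0_norm dist_commute)+
  qed
  \<comment> \<open>The derivative of P vanishes at U(0) = 1, so P'(U(s)) = s T(s) with T(0) = -V C.
    This supplies the factor s in the denominator of the residue.\<close>
  define T where "T = (\<lambda>s. if s = 0 then deriv (\<lambda>s. PP1 (U s)) 0 else (PP1 (U s) - PP1 (U 0)) / (s - 0))"
  have PU: "(\<lambda>s. PP1 (U s)) holomorphic_on ball 0 \<epsilon>"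
  proof -
    have "U ` ball 0 \<epsilon> \<subseteq> - {0}" by (rule image_subsetI) (use U(7) in simp)
    from holomorphic_on_compose_gen[OF U(3) PP_holomorphic(2) this] show ?thesis by (simp add: o_def)
  qed
  have T: "T holomorphic_on ball 0 \<epsilon>" unfolding T_def by (intro pole_lemma_open PU open_ball)
  have "((\<lambda>s. PP1 (U s)) has_field_derivative PP2 (U 0) * - of_real C) (at 0)"
    by (rule DERIV_chain2[OF PP1_deriv U(5)]) (use U(4) in simp)
  hence T0: "T 0 = - of_real (V * C)" using U(4) PP_one by (simp add: T_def DERIV_imp_deriv)
  have Teq: "PP1 (U s) = s * T s" for s using U(4) PP_one by (simp add: T_def)
  obtain e3 where e3: "e3 > 0" "\<And>s. norm s < e3 \<Longrightarrow> T s \<noteq> 0"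
  proof -
    have "isCont T 0" using holomorphic_on_imp_continuous_on[OF T] U(1) by (simp add: continuous_on_eq_continuous_at)
    moreover have "T 0 \<noteq> 0" using T0 V_pos C_pos by simp
    ultimately show ?thesis using continuous_at_avoid[of 0 T 0] that by (metis dist_0_norm)
  qed
  define e where "e = min (min \<epsilon> (sqrt e1)) (min e2 e3)"
  have e: "e > 0" "e \<le> \<epsilon>" "e \<le> sqrt e1" "e \<le> e2" "e \<le> e3" using U(1) e1 e2 e3 by (auto simp: e_def)
  have zball: "1 - s\<^sup>2 \<in> ball 1 e1" if "norm s < e" for s :: complex
  proof -
    have "(norm s)\<^sup>2 < (sqrt e1)\<^sup>2" using that e by (intro power_strict_mono) auto
    thus ?thesis using e1 by (simp add: dist_norm norm_power)
  qed
  have nz2: "1 - s\<^sup>2 \<noteq> 0" if "norm s < e" for s :: complex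
    using U(7)[of s] that e(2) by auto
  have Uin: "r < norm (U s)" if "norm s < e" for s
  proof -
    have "norm (U s - 1) < 1 - r" using e2(2)[of s] that e by simp
    thus ?thesis using norm_triangle_ineq2[of 1 "1 - U s"] by (simp add: norm_minus_commute)
  qed
  \<comment> \<open>On the unit circle |P| \<le> 1, so no root of (1 - s^2) P(w) = 1 can lie there
    while |1 - s^2| < 1.\<close>
  have Une: "norm (U s) \<noteq> 1" "norm (U (- s)) \<noteq> 1" if s: "s \<in> lens" "norm s < e" for s
  proof -
    have "norm (U x) \<noteq> 1" if x: "x\<^sup>2 = s\<^sup>2" "norm x < e" for x
    proof
      assume "norm (U x) = 1"
      hence "norm (PP (U x)) \<le> 1" by (rule norm_PP_le)
      hence "norm ((1 - x\<^sup>2) * PP (U x)) < 1"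
        using lens_norm[OF s(1)] x(1) mult_right_mono[of "norm (PP (U x))" 1 "norm (1 - s\<^sup>2)"] by (simp add: norm_mult mult.commute)
      thus False using U(7)[of x] x(2) e(2) by simp
    qed
    thus "norm (U s) \<noteq> 1" "norm (U (- s)) \<noteq> 1" using s by auto
  qed
  define Sx where "Sx = lens \<inter> ball 0 e"
  have cSx: "connected Sx" unfolding Sx_def by (intro convex_connected convex_Int convex_lens convex_ball)
  \<comment> \<open>The first-order expansion with slope -C decides at one real point which root is
    inside. The answer carries over to all of Sx by connectedness, since neither modulus can pass
    through 1.\<close>
  obtain x0 where x0: "0 < x0" "of_real x0 \<in> Sx" "norm (U (of_real x0)) < 1" "norm (U (- of_real x0)) > 1"
  proof -
    have "((\<lambda>h. (U (0 + h) - U 0) / h) \<longlongrightarrow> - of_real C) (at 0)" using U(5) by (simp add: DERIV_def)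
    from LIM_D[OF this, of "C / 2"] C_pos(1) obtain e4 where e4: "e4 > 0"
      "\<And>h. h \<noteq> 0 \<Longrightarrow> norm h < e4 \<Longrightarrow> norm ((U h - 1) / h + of_real C) < C / 2" using U(4) by auto
    define x where "x = min (min (e / 2) (e4 / 2)) (min (1/2) (1 / (2 * C)))"
    have x: "x > 0" "x < e" "x < e4" "x < 1" "C * x \<le> 1/2"
    proof -
      show "x > 0" "x < e" "x < e4" "x < 1" using e(1) e4(1) C_pos(1) by (auto simp: x_def)
      have "x \<le> 1 / (2 * C)" by (simp add: x_def)
      thus "C * x \<le> 1/2" using C_pos(1) by (simp add: field_simps)
    qed
    have key: "norm (U h - 1 + of_real C * h) \<le> C / 2 * x" if h: "norm h = x" for h
    proof -
      have h0: "h \<noteq> 0" using h x by auto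
      have "U h - 1 + of_real C * h = ((U h - 1) / h + of_real C) * h" using h0 by (simp add: field_simps)
      moreover have "norm ((U h - 1) / h + of_real C) \<le> C / 2" using e4(2)[OF h0] h x by simp
      ultimately show ?thesis using h x by (simp add: norm_mult mult_right_mono)
    qed
    have 1: "norm (U (of_real x)) < 1"
    proof -
      have "norm (U (of_real x)) \<le> norm (U (of_real x) - 1 + of_real C * of_real x) + norm (1 - of_real C * complex_of_real x)"
        using norm_triangle_ineq[of "U (of_real x) - 1 + of_real C * of_real x" "1 - of_real C * complex_of_real x"] by simp
      also have "norm (1 - of_real C * complex_of_real x) = 1 - C * x"
        using x(5) norm_of_real[of "1 - C * x", where 'a = complex] by simp
      finally show ?thesis using key[of "of_real x"] x C_pos(1) by (simp add: field_simps) (smt (verit) mult_pos_pos)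
    qed
    have 2: "norm (U (- of_real x)) > 1"
    proof -
      have "norm (1 + of_real C * complex_of_real x) \<le> norm (U (- of_real x)) + norm (U (- of_real x) - 1 + of_real C * - of_real x)"
        using norm_triangle_ineq4[of "U (- of_real x)" "U (- of_real x) - 1 + of_real C * - of_real x"] by simp
      moreover have "norm (1 + of_real C * complex_of_real x) = 1 + C * x"
        using x C_pos(1) norm_of_real[of "1 + C * x", where 'a = complex] by simp
      moreover have "norm (U (- of_real x) - 1 + of_real C * - of_real x) \<le> C / 2 * x" using key[of "- of_real x"] x by simp
      moreover have "C * x > 0" using x C_pos by simp
      ultimately show ?thesis by linarith
    qed
    show ?thesis by (rule that[OF x(1) _ 1 2]) (use x lens_real in \<open>auto simp: Sx_def\<close>)
  qed
  have Uc': "continuous_on (ball 0 \<epsilon>) U" by (rule holomorphic_on_imp_continuous_on[OF U(3)])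
  have side: "norm (U s) < 1 \<and> norm (U (- s)) > 1" if s: "s \<in> Sx" for s
  proof -
    have sub: "Sx \<subseteq> ball 0 \<epsilon>" "uminus ` Sx \<subseteq> ball 0 \<epsilon>" using e(2) by (auto simp: Sx_def)
    have c1: "continuous_on Sx (\<lambda>s. norm (U s))" by (intro continuous_intros continuous_on_subset[OF Uc' sub(1)])
    have c2: "continuous_on Sx (\<lambda>s. norm (U (- s)))"
      by (intro continuous_on_norm continuous_on_compose2[OF Uc', of Sx uminus] continuous_intros) (use sub in auto)
    have "norm (U s) < 1"
    proof (rule ccontr)
      assume "\<not> norm (U s) < 1"
      hence "norm (U (of_real x0)) \<le> 1" "1 \<le> norm (U s)" using x0 by auto
      from connectedD_interval[OF connected_continuous_image[OF c1 cSx], of "norm (U (of_real x0))" "norm (U s)" 1] this s x0(2)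
      have "1 \<in> (\<lambda>s. norm (U s)) ` Sx" by blast
      thus False using Une(1) by (auto simp: Sx_def)
    qed
    moreover have "norm (U (- s)) > 1"
    proof (rule ccontr)
      assume "\<not> norm (U (- s)) > 1"
      hence "norm (U (- s)) \<le> 1" "1 \<le> norm (U (- of_real x0))" using x0 by auto
      from connectedD_interval[OF connected_continuous_image[OF c2 cSx], of "norm (U (- s))" "norm (U (- of_real x0))" 1] this s x0(2)
      have "1 \<in> (\<lambda>s. norm (U (- s))) ` Sx" by blast
      thus False using Une(2) by (auto simp: Sx_def)
    qed
    ultimately show ?thesis by blast
  qed
  define H where "H = (\<lambda>s. s * (Jint r i (1 - s\<^sup>2) / (2 * pi * \<i>)) - U s powi (- int i - 1) * PP (U s) / ((1 - s\<^sup>2) * T s))"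
  have "H holomorphic_on ball 0 e"
  proof -
    have b: "ball 0 e \<subseteq> ball (0::complex) \<epsilon>" using e by auto
    have Uh: "U holomorphic_on ball 0 e" by (rule holomorphic_on_subset[OF U(3) b])
    have Unz: "U s \<noteq> 0" if "s \<in> ball 0 e" for s using U(7)[of s] that b by blast
    have "(Jint r i \<circ> (\<lambda>s. 1 - s\<^sup>2)) holomorphic_on ball 0 e"
      by (rule holomorphic_on_compose_gen[OF _ e1(2)]) (use zball in \<open>auto intro!: holomorphic_intros\<close>)
    hence 1: "(\<lambda>s. Jint r i (1 - s\<^sup>2)) holomorphic_on ball 0 e" by (simp add: o_def)
    have "(PP \<circ> U) holomorphic_on ball 0 e"
      by (rule holomorphic_on_compose_gen[OF Uh PP_holomorphic(1)]) (use Unz in auto)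
    hence 2: "(\<lambda>s. PP (U s)) holomorphic_on ball 0 e" by (simp add: o_def)
    show ?thesis unfolding H_def
      by (intro holomorphic_intros 1 2 Uh holomorphic_on_subset[OF T b]) (use Unz nz2 e3(2) e(5) in auto)
  qed
  moreover have "H 0 = of_real (C / 2)"
  proof -
    have "H 0 = 1 / of_real (V * C)" using U(4) PP_one T0 by (simp add: H_def)
    also have "\<dots> = of_real (1 / (V * C))" by simp
    finally show ?thesis unfolding C_pos(3) .
  qed
  moreover have "s * eval_fps (cfps (Jk i)) (1 - s\<^sup>2) = H s" if s: "s \<in> ball 0 e \<inter> lens" for s
  proof -
    define z where "z = 1 - s\<^sup>2"
    have s': "s \<in> Sx" "norm s < e" "s \<noteq> 0" using s zero_notin_lens by (auto simp: Sx_def)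
    have z: "norm z < 1" using lens_norm s by (auto simp: z_def)
    have s\<epsilon>: "s \<in> ball 0 \<epsilon>" using s' e by simp
    have Us: "(1 - s\<^sup>2) * PP (U s) = 1" "U s \<noteq> 0" using U(7)[OF s\<epsilon>] by auto
    define W where "W = (\<lambda>w. 1 - z * PP w)"
    have dW: "deriv W (U s) = - (z * PP1 (U s))"
      unfolding W_def using PP_deriv[OF Us(2)] by (intro DERIV_imp_deriv) (auto intro!: derivative_eq_intros)
    have dWnz: "deriv W (U s) \<noteq> 0"
      unfolding dW Teq z_def using nz2[OF s'(2)] s'(3) e3(2)[of s] s'(2) e(5) by simp
    have res: "contour_integral (circlepath 0 1) (\<lambda>w. (w powi (- int i - 1) * PP w) / W w) =
       contour_integral (circlepath 0 r) (\<lambda>w. (w powi (- int i - 1) * PP w) / W w) + 2 * pi * \<i> * ((U s powi (- int i - 1) * PP (U s)) / deriv W (U s))"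
    proof (rule annulus_residue[OF r(1,2) Uin[OF s'(2)]])
      show "norm (U s) < 1" using side[OF s'(1)] by blast
      show "(\<lambda>w. w powi (- int i - 1) * PP w) holomorphic_on - {0}" by (intro holomorphic_intros PP_holomorphic) auto
      show "W holomorphic_on - {0}" unfolding W_def by (intro holomorphic_intros PP_holomorphic)
      show "W (U s) = 0" using Us by (simp add: W_def z_def)
      fix w assume w: "r \<le> norm w" "norm w \<le> 1" "w \<noteq> U s"
      show "W w \<noteq> 0"
      proof (cases "w \<in> ball 1 \<delta>")
        case True
        show ?thesis
        proof
          assume "W w = 0"
          hence "(1 - s\<^sup>2) * PP w = 1" by (simp add: W_def z_def)
          hence "w = U (- s)" using U(8)[OF True s\<epsilon>] w(3) by blast
          thus False using side[OF s'(1)] w(2) by simp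
        qed
      next
        case False
        hence "norm (PP w) < 1" using r0(3)[of w] w r by simp
        hence "norm (z * PP w) < 1" 
          using z mult_right_mono[of "norm z" 1 "norm (PP w)"] by (simp add: norm_mult)
        thus ?thesis by (auto simp: W_def)
      qed
    qed (use dWnz in auto)
    have J1: "Jint 1 i z = Jint r i z + 2 * pi * \<i> * ((U s powi (- int i - 1) * PP (U s)) / - (z * (s * T s)))"
      using res unfolding dW Teq unfolding Jint_def W_def .
    have "(a + 2 * pi * \<i> * x) / (2 * pi * \<i>) = a / (2 * pi * \<i>) + x" for a x :: complex
      by (simp add: add_divide_distrib)
    hence "eval_fps (cfps (Jk i)) z = Jint r i z / (2 * pi * \<i>) + (U s powi (- int i - 1) * PP (U s)) / - (z * (s * T s))"
      unfolding Jk_eval[OF z] J1 by blast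
    hence "s * eval_fps (cfps (Jk i)) z = s * (Jint r i z / (2 * pi * \<i>)) + s * ((U s powi (- int i - 1) * PP (U s)) / - (z * (s * T s)))"
      by (simp only: distrib_left)
    also have "s * ((U s powi (- int i - 1) * PP (U s)) / - (z * (s * T s))) = - (U s powi (- int i - 1) * PP (U s) / (z * T s))"
      using s'(3) by (simp add: divide_simps)
    finally show ?thesis by (simp add: H_def z_def)
  qed
  ultimately show ?thesis using e(1) by blast
qed

text \<open>Away from s = 0, the point z0 = 1 - x^2 differs from 1, and aperiodicity keeps 1 - z0
  P(w) from vanishing on the unit circle; the Cauchy integral itself then continues across the
  boundary.\<close>

lemma Jk_analytic_upto: "analytic_upto lens (\<lambda>s. s * eval_fps (cfps (Jk i)) (1 - s\<^sup>2))"
proof (rule analytic_uptoI)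
  fix x assume x: "x \<in> closure lens"
  show "\<exists>e>0. \<exists>g. g holomorphic_on ball x e \<and> (\<forall>s\<in>ball x e \<inter> lens. s * eval_fps (cfps (Jk i)) (1 - s\<^sup>2) = g s)"
  proof (cases "x = 0")
    case True
    thus ?thesis using Jk_local_zero[of i] by blast
  next
    case False
    define z0 where "z0 = 1 - x\<^sup>2"
    have z0: "norm z0 \<le> 1" "z0 \<noteq> 1" using closure_lensD[OF x] False by (auto simp: z0_def)
    have nz: "1 - z0 * PP w \<noteq> 0" if w: "norm w = 1" for w :: complex
    proof (cases "w = 1")
      case True
      thus ?thesis using z0 PP_one by simp
    next
      case False
      hence "norm (PP w) < 1" using aper w by blast
      hence "norm (z0 * PP w) < 1" using z0(1) mult_right_mono[of "norm z0" 1 "norm (PP w)"] by (simp add: norm_mult)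
      thus ?thesis by auto
    qed
    obtain e where e: "e > 0" "Jint 1 i holomorphic_on ball z0 e"
      using circle_param_holomorphic[OF _ numerator_continuous[of 1] PP_continuous[of 1] nz] unfolding Jint_def[abs_def] by auto
    have "isCont (\<lambda>s::complex. 1 - s\<^sup>2) x" by (intro continuous_intros)
    then obtain d where d: "d > 0" "\<And>s. dist s x < d \<Longrightarrow> dist (1 - s\<^sup>2) z0 < e"
      using e(1) unfolding continuous_at_eps_delta z0_def by blast
    have "(Jint 1 i \<circ> (\<lambda>s. 1 - s\<^sup>2)) holomorphic_on ball x d"
      by (rule holomorphic_on_compose_gen[OF _ e(2)]) (use d(2) in \<open>auto intro!: holomorphic_intros simp: dist_commute\<close>)
    hence "(\<lambda>s. s * (Jint 1 i (1 - s\<^sup>2) / (2 * pi * \<i>))) holomorphic_on ball x d"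
      by (intro holomorphic_intros) (auto simp: o_def)
    thus ?thesis using d(1) Jk_eval lens_norm by (intro exI[of _ d] conjI exI) auto
  qed
qed

lemma Jk_limit: "((\<lambda>s. s * eval_fps (cfps (Jk i)) (1 - s\<^sup>2)) \<longlongrightarrow> of_real (C / 2)) (at 0 within lens)"
proof -
  obtain e H where H: "e > 0" "H holomorphic_on ball 0 e" "H 0 = of_real (C / 2)"
    "\<And>s. s \<in> ball 0 e \<inter> lens \<Longrightarrow> s * eval_fps (cfps (Jk i)) (1 - s\<^sup>2) = H s" using Jk_local_zero[of i] by blast
  have "isCont H 0" using holomorphic_on_imp_continuous_on[OF H(2)] H(1) by (simp add: continuous_on_eq_continuous_at)
  hence "(H \<longlongrightarrow> H 0) (at 0 within lens)" by (simp add: continuous_at_imp_continuous_at_within continuous_within[symmetric])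
  moreover have "\<forall>\<^sub>F s in at 0 within lens. H s = s * eval_fps (cfps (Jk i)) (1 - s\<^sup>2)"
    unfolding eventually_at using H by (intro exI[of _ e]) auto
  ultimately show ?thesis using H(3) by (simp add: tendsto_cong)
qed

end

section \<open>Square root expansions of the meander series\<close>

lemma cfps_sum: "cfps (\<Sum>i\<in>A. a i) = (\<Sum>i\<in>A. cfps (a i))"
  by (rule fps_ext) (simp add: fps_sum_nth)

lemma filterlim_of_real_lens: "filterlim complex_of_real (at 0 within lens) (at_right 0)"
  unfolding filterlim_at
proof (intro conjI)
  have "(complex_of_real \<longlongrightarrow> of_real 0) (at_right 0)" by (intro tendsto_intros)
  thus "(complex_of_real \<longlongrightarrow> 0) (at_right 0)" by simp
  show "\<forall>\<^sub>F x in at_right 0. complex_of_real x \<in> lens \<and> complex_of_real x \<noteq> 0"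
    using eventually_at_right_real[of 0 1] by (auto elim!: eventually_mono intro: lens_real)
qed

text \<open>On [0,1) the function is real and increasing, so a and b are real and b \<le> 0.
  Non-negative coefficients also give a converse of Abel's theorem: boundedness near 1 forces
  convergence at 1.\<close>

lemma sqrt_expansion_nonneg:
  assumes nn: "\<And>n. fps_nth f n \<ge> 0" and A: "sqrt_expansion (cfps f) a b"
  shows "\<exists>l \<eta>. a = of_real l \<and> b = - of_real \<eta> \<and> \<eta> \<ge> 0 \<and> fps_nth f sums l"
proof -
  note rad = sqrt_expansion_analytic(1)[OF A]
  have sm: "summable (\<lambda>n. fps_nth f n * y ^ n)" if "0 \<le> y" "y < 1" for y
  proof -
    have "ereal (norm y) < fps_conv_radius f"
      using norm_less_radius[of "fps_conv_radius f" "complex_of_real y"] rad that by (simp add: fps_conv_radius_cfps)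
    thus ?thesis unfolding fps_conv_radius_def by (rule summable_in_conv_radius)
  qed
  have ev: "eval_fps (cfps f) (1 - (of_real x)\<^sup>2) = of_real (eval_fps f (1 - x\<^sup>2))" if x: "0 < x" "x < 1" for x
  proof -
    have y: "0 < 1 - x\<^sup>2" "1 - x\<^sup>2 < 1" using x by (auto simp: power_less_one_iff)
    have "ereal \<bar>1 - x\<^sup>2\<bar> < fps_conv_radius f"
      using norm_less_radius[of "fps_conv_radius f" "complex_of_real (1 - x\<^sup>2)"] rad y
      by (simp only: fps_conv_radius_cfps norm_of_real)
    from eval_cfps_of_real[OF this] show ?thesis by simp
  qed
  have lim: "((\<lambda>x. complex_of_real (eval_fps f (1 - x\<^sup>2))) \<longlongrightarrow> a) (at_right 0)"
  proof -
    have "((\<lambda>x. eval_fps (cfps f) (1 - (complex_of_real x)\<^sup>2)) \<longlongrightarrow> a) (at_right 0)"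
      by (rule filterlim_compose[OF sqrt_expansion_limits(1)[OF A] filterlim_of_real_lens])
    moreover have "\<forall>\<^sub>F x in at_right 0. eval_fps (cfps f) (1 - (complex_of_real x)\<^sup>2) = of_real (eval_fps f (1 - x\<^sup>2))"
      using eventually_at_right_real[of 0 1] by (auto elim!: eventually_mono intro: ev)
    ultimately show ?thesis by (simp add: tendsto_cong)
  qed
  define l where "l = Re a"
  have al: "a = of_real l"
  proof -
    from tendsto_Im[OF lim] have "((\<lambda>x::real. 0::real) \<longlongrightarrow> Im a) (at_right 0)" by simp
    hence "Im a = 0" using tendsto_unique[OF _ _ tendsto_const] trivial_limit_at_right_real by metis
    thus ?thesis by (simp add: l_def complex_eq_iff)
  qed
  have rlim: "((\<lambda>x. eval_fps f (1 - x\<^sup>2)) \<longlongrightarrow> l) (at_right 0)"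
    using tendsto_Re[OF lim] by (simp add: l_def)
  have mono: "eval_fps f y \<le> eval_fps f y'" if "0 \<le> y" "y \<le> y'" "y' < 1" for y y'
    unfolding eval_fps_def using that nn
    by (intro suminf_le sm mult_left_mono power_mono) auto
  have le: "eval_fps f y \<le> l" if y: "0 \<le> y" "y < 1" for y
  proof (rule tendsto_lowerbound[OF rlim])
    have "0 < sqrt (1 - y)" using y by simp
    from eventually_at_right_real[OF this] show "\<forall>\<^sub>F x in at_right 0. eval_fps f y \<le> eval_fps f (1 - x\<^sup>2)"
    proof eventually_elim
      case (elim x)
      have "x\<^sup>2 < (sqrt (1 - y))\<^sup>2" using elim by (intro power_strict_mono) auto
      hence "y \<le> 1 - x\<^sup>2" "1 - x\<^sup>2 < 1" using y elim by auto
      thus ?case using mono[of y "1 - x\<^sup>2"] y by simp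
    qed
  qed simp
  have part: "(\<Sum>n<N. fps_nth f n) \<le> l" for N
  proof -
    have "((\<lambda>y. \<Sum>n<N. fps_nth f n * y ^ n) \<longlongrightarrow> (\<Sum>n<N. fps_nth f n * 1 ^ n)) (at_left 1)" by (intro tendsto_intros)
    moreover have "\<forall>\<^sub>F y in at_left (1::real). (\<Sum>n<N. fps_nth f n * y ^ n) \<le> l"
      using eventually_at_left_real[OF zero_less_one]
    proof eventually_elim
      case (elim y)
      have "(\<Sum>n<N. fps_nth f n * y ^ n) \<le> eval_fps f y" unfolding eval_fps_def
        using elim nn by (intro sum_le_suminf sm) auto
      also have "\<dots> \<le> l" using le[of y] elim by simp
      finally show ?case .
    qed
    ultimately show ?thesis using tendsto_upperbound[of _ _ "at_left (1::real)" l] by fastforce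
  qed
  have summ: "summable (fps_nth f)" by (rule summableI_nonneg_bounded[OF nn part])
  have S1: "suminf (fps_nth f) \<le> l" using part suminf_le_const[OF summ] by blast
  have S2: "l \<le> suminf (fps_nth f)"
  proof (rule tendsto_upperbound[OF rlim])
    show "\<forall>\<^sub>F x in at_right 0. eval_fps f (1 - x\<^sup>2) \<le> suminf (fps_nth f)"
      using eventually_at_right_real[OF zero_less_one]
    proof eventually_elim
      case (elim x)
      have y: "0 < 1 - x\<^sup>2" "1 - x\<^sup>2 < 1" using elim by (auto simp: power_less_one_iff)
      have "fps_nth f n * (1 - x\<^sup>2) ^ n \<le> fps_nth f n" for n
        using y nn[of n] by (intro mult_left_le power_le_one) auto
      thus ?case unfolding eval_fps_def using y summ by (intro suminf_le sm) auto
    qed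
  qed simp
  have lim2: "((\<lambda>x. complex_of_real ((eval_fps f (1 - x\<^sup>2) - l) / x)) \<longlongrightarrow> b) (at_right 0)"
  proof -
    have "((\<lambda>x. (eval_fps (cfps f) (1 - (complex_of_real x)\<^sup>2) - a) / of_real x) \<longlongrightarrow> b) (at_right 0)"
      by (rule filterlim_compose[OF sqrt_expansion_limits(2)[OF A] filterlim_of_real_lens])
    moreover have "\<forall>\<^sub>F x in at_right 0. (eval_fps (cfps f) (1 - (complex_of_real x)\<^sup>2) - a) / of_real x = of_real ((eval_fps f (1 - x\<^sup>2) - l) / x)"
      using eventually_at_right_real[OF zero_less_one] by eventually_elim (simp add: ev al)
    ultimately show ?thesis by (simp add: tendsto_cong)
  qed
  have b1: "b = of_real (Re b)"
  proof -
    from tendsto_Im[OF lim2] have "((\<lambda>x::real. 0::real) \<longlongrightarrow> Im b) (at_right 0)" by simp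
    hence "Im b = 0" using tendsto_unique[OF _ _ tendsto_const] trivial_limit_at_right_real by metis
    thus ?thesis by (simp add: complex_eq_iff)
  qed
  have b2: "Re b \<le> 0"
  proof (rule tendsto_upperbound)
    show "((\<lambda>x. (eval_fps f (1 - x\<^sup>2) - l) / x) \<longlongrightarrow> Re b) (at_right 0)" using tendsto_Re[OF lim2] by simp
    show "\<forall>\<^sub>F x in at_right 0. (eval_fps f (1 - x\<^sup>2) - l) / x \<le> 0"
      using eventually_at_right_real[OF zero_less_one]
    proof eventually_elim
      case (elim x)
      have "0 \<le> 1 - x\<^sup>2" "1 - x\<^sup>2 < 1" using elim by (auto simp: power_le_one)
      thus ?case using le[of "1 - x\<^sup>2"] elim by (simp add: divide_nonpos_pos)
    qed
  qed simp
  have "fps_nth f sums l" using summ S1 S2 by (simp add: sums_iff)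
  thus ?thesis using al b1 b2 by (intro exI[of _ l] exI[of _ "- Re b"]) simp
qed

context critical_walk
begin

lemma mw_le_1: "mw n k \<le> 1"
proof (induction n arbitrary: k)
  case (Suc n)
  have "(\<Sum>l\<in>I. p l * mw n (k - l)) \<le> (\<Sum>l\<in>I. p l * 1)"
    by (intro sum_mono mult_left_mono Suc.IH p_nonneg)
  thus ?case using p_sum by simp
qed simp

lemma Mk_radius: "fps_conv_radius (cfps (Mk k)) \<ge> 1"
  by (rule fps_conv_radius_ge_1_of_bounded[of _ 1]) (use mw_nonneg mw_le_1 in \<open>simp add: Mk_def\<close>)

text \<open>Substituting z = 1 - s^2 multiplies the derivative by -2 s, and this factor turns the
  singular series \<open>Jk i\<close> into functions that are analytic up to the boundary.\<close>

lemma Mk_ode: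
  assumes s: "s \<in> lens"
  shows "((\<lambda>s. eval_fps (cfps (Mk k)) (1 - s\<^sup>2)) has_field_derivative
     (\<Sum>i\<le>k. - 2 * (s * eval_fps (cfps (Jk i)) (1 - s\<^sup>2)) * eval_fps (cfps (Mk (k - i))) (1 - s\<^sup>2))) (at s)"
proof -
  have "cfps (fps_deriv (Mk k)) = (\<Sum>i\<le>k. cfps (Jk i) * cfps (Mk (k - i)))"
    by (simp add: Mk_deriv cfps_sum cfps_mult)
  moreover have ev: "eval_fps (\<Sum>i\<in>X. cfps (Jk i) * cfps (Mk (k - i))) (1 - s\<^sup>2) =
      (\<Sum>i\<in>X. eval_fps (cfps (Jk i)) (1 - s\<^sup>2) * eval_fps (cfps (Mk (k - i))) (1 - s\<^sup>2)) \<and>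
      fps_conv_radius (\<Sum>i\<in>X. cfps (Jk i) * cfps (Mk (k - i))) \<ge> 1" if "finite X" for X
    using that
  proof (induction X rule: finite_induct)
    case (insert i X)
    have r1: "fps_conv_radius (cfps (Jk i) * cfps (Mk (k - i))) \<ge> 1"
      using fps_conv_radius_mult[of "cfps (Jk i)" "cfps (Mk (k - i))"] Jk_radius[of i] Mk_radius[of "k - i"]
      by (simp add: min_def split: if_splits)
    show ?case using insert r1 norm_less_radius[OF _ lens_norm[OF s]] Jk_radius[of i] Mk_radius[of "k - i"]
      by (simp add: eval_fps_add eval_fps_mult fps_conv_radius_add_ge)
  qed simp
  ultimately have "eval_fps (fps_deriv (cfps (Mk k))) (1 - s\<^sup>2) =
      (\<Sum>i\<le>k. eval_fps (cfps (Jk i)) (1 - s\<^sup>2) * eval_fps (cfps (Mk (k - i))) (1 - s\<^sup>2))"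
    by (simp add: cfps_deriv)
  hence "- 2 * s * eval_fps (fps_deriv (cfps (Mk k))) (1 - s\<^sup>2) =
     (\<Sum>i\<le>k. - 2 * (s * eval_fps (cfps (Jk i)) (1 - s\<^sup>2)) * eval_fps (cfps (Mk (k - i))) (1 - s\<^sup>2))"
    by (simp only: sum_distrib_left mult.assoc)
  thus ?thesis using eval_fps_lens_deriv[OF Mk_radius[of k] s] by simp
qed

lemma Mk_analytic: "analytic_upto lens (\<lambda>s. eval_fps (cfps (Mk k)) (1 - s\<^sup>2))"
proof (induction k rule: less_induct)
  case (less k)
  let ?J = "\<lambda>i s. s * eval_fps (cfps (Jk i)) (1 - s\<^sup>2)"
  let ?M = "\<lambda>i s. eval_fps (cfps (Mk i)) (1 - s\<^sup>2)"
  show ?case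
  proof (rule analytic_upto_linear_ode[OF open_lens convex_lens])
    show "analytic_upto lens (\<lambda>s. - 2 * ?J 0 s)" by (intro analytic_upto_mult analytic_upto_const Jk_analytic_upto)
    show "analytic_upto lens (\<lambda>s. \<Sum>i\<in>{1..k}. - 2 * ?J i s * ?M (k - i) s)"
      by (intro analytic_upto_sum analytic_upto_mult analytic_upto_const Jk_analytic_upto less.IH) auto
    fix s assume s: "s \<in> lens"
    have "{..k} = insert 0 {1..k}" by auto
    hence "(\<Sum>i\<le>k. - 2 * ?J i s * ?M (k - i) s) = - 2 * ?J 0 s * ?M k s + (\<Sum>i\<in>{1..k}. - 2 * ?J i s * ?M (k - i) s)"
      by simp
    thus "((\<lambda>s. ?M k s) has_field_derivative (- 2 * ?J 0 s * ?M k s + (\<Sum>i\<in>{1..k}. - 2 * ?J i s * ?M (k - i) s))) (at s)"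
      using Mk_ode[OF s, of k] by simp
  qed
qed

text \<open>The coefficient b of s is found by letting s tend to 0 in the differential equation for
  \<open>Mk 0\<close>: the left side tends to b, the right side to -2 (C/2) E1.\<close>

lemma E_expansion: "\<exists>E1\<ge>1. sqrt_expansion (cfps (Mk 0)) (of_real E1) (- of_real (E1 * C)) \<and> fps_nth (Mk 0) sums E1"
proof -
  obtain a b where ab: "sqrt_expansion (cfps (Mk 0)) a b" using sqrt_expansion_exists[OF Mk_radius Mk_analytic] by blast
  obtain l \<eta> where l: "a = of_real l" "b = - of_real \<eta>" "fps_nth (Mk 0) sums l"
    using sqrt_expansion_nonneg[OF _ ab] mw_nonneg by (auto simp: Mk_def)
  obtain G where G: "analytic_upto lens G" "\<And>s. s \<in> lens \<Longrightarrow> eval_fps (cfps (Mk 0)) (1 - s\<^sup>2) = a + b * s + s\<^sup>2 * G s"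
    using ab unfolding sqrt_expansion_def by blast
  have d: "b + s * (2 * G s + s * deriv G s) = - 2 * (s * eval_fps (cfps (Jk 0)) (1 - s\<^sup>2)) * eval_fps (cfps (Mk 0)) (1 - s\<^sup>2)" if s: "s \<in> lens" for s
  proof -
    have "(G has_field_derivative deriv G s) (at s)"
      using analytic_upto_imp_holomorphic[OF G(1) open_lens] s by (simp add: holomorphic_derivI open_lens)
    hence "((\<lambda>s. a + b * s + s\<^sup>2 * G s) has_field_derivative b + s * (2 * G s + s * deriv G s)) (at s)"
      by (auto intro!: derivative_eq_intros simp: power2_eq_square algebra_simps)
    hence "((\<lambda>s. eval_fps (cfps (Mk 0)) (1 - s\<^sup>2)) has_field_derivative b + s * (2 * G s + s * deriv G s)) (at s)"
      by (rule has_field_derivative_transform_within_open[OF _ open_lens s]) (simp add: G)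
    with Mk_ode[OF s, of 0] show ?thesis using DERIV_unique by fastforce
  qed
  have "((\<lambda>s. b + s * (2 * G s + s * deriv G s)) \<longlongrightarrow> b + 0) (at 0 within lens)"
    by (intro tendsto_add tendsto_const analytic_upto_mult_tendsto_zero analytic_upto_add analytic_upto_mult
        analytic_upto_const analytic_upto_ident G analytic_upto_deriv open_lens)
  moreover have "((\<lambda>s. - 2 * (s * eval_fps (cfps (Jk 0)) (1 - s\<^sup>2)) * eval_fps (cfps (Mk 0)) (1 - s\<^sup>2)) \<longlongrightarrow> - 2 * of_real (C / 2) * a) (at 0 within lens)"
    by (intro tendsto_mult tendsto_const Jk_limit sqrt_expansion_limits(1)[OF ab])
  moreover have "\<forall>\<^sub>F s in at 0 within lens. b + s * (2 * G s + s * deriv G s) = - 2 * (s * eval_fps (cfps (Jk 0)) (1 - s\<^sup>2)) * eval_fps (cfps (Mk 0)) (1 - s\<^sup>2)"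
    by (auto simp: eventually_at_filter d intro!: always_eventually)
  ultimately have "b = - 2 * of_real (C / 2) * a"
    using tendsto_unique[OF at_zero_lens_nontrivial] by (simp add: tendsto_cong)
  hence b: "b = - of_real (l * C)" using l by simp
  have "(\<Sum>n\<in>{0}. fps_nth (Mk 0) n) \<le> l"
    using sum_le_suminf[OF sums_summable[OF l(3)], of "{0}"] l(3) mw_nonneg by (simp add: sums_iff Mk_def)
  hence "l \<ge> 1" by (simp add: Mk_def)
  thus ?thesis using ab[unfolded l(1) b] l(3) by (intro exI[of _ l] conjI)
qed

text \<open>Bernoulli's inequality gives u^l \<ge> 1 + l (u - 1), strictly for l < 0. Averaged over
  the jumps, the right side is 1 because the mean is 0.\<close>

lemma PP_real_gt:
  fixes u :: real
  assumes "u > 0" "u \<noteq> 1"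
  shows "PP u > 1"
proof -
  have bern: "u powi l \<ge> 1 + of_int l * (u - 1)" "l < 0 \<Longrightarrow> u powi l > 1 + of_int l * (u - 1)" for l :: int
  proof -
    have A: "u powi l \<ge> 1 + of_int l * (u - 1)" if l: "l \<ge> 0"
      using Bernoulli_inequality[of "u - 1" "nat l"] assms l by (simp add: power_int_def)
    have B: "u powi l > 1 + of_int l * (u - 1)" if l: "l < 0"
    proof -
      have inv: "1 / u - 1 > - (u - 1)"
      proof -
        have "(u - 1)\<^sup>2 > 0" using assms by simp
        hence "1 / u + u - 2 > 0" using assms by (simp add: field_simps power2_eq_square)
        thus ?thesis by simp
      qed
      have "1 + of_int l * (u - 1) = 1 + real (nat (- l)) * (- (u - 1))" using l by (simp add: algebra_simps)
      also have "\<dots> < 1 + real (nat (- l)) * (1 / u - 1)" using inv l by (intro add_strict_left_mono mult_strict_left_mono) auto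
      also have "\<dots> \<le> (1 + (1 / u - 1)) ^ nat (- l)" using assms by (intro Bernoulli_inequality) simp
      also have "\<dots> = u powi l" using l by (simp add: power_int_def divide_inverse)
      finally show ?thesis .
    qed
    show "u powi l \<ge> 1 + of_int l * (u - 1)" "l < 0 \<Longrightarrow> u powi l > 1 + of_int l * (u - 1)" using A B by (cases "l < 0"; fastforce)+
  qed
  have "(\<Sum>l\<in>I. p l * (1 + of_int l * (u - 1))) < (\<Sum>l\<in>I. p l * u powi l)"
  proof (rule sum_strict_mono_ex1)
    show "\<forall>l\<in>I. p l * (1 + of_int l * (u - 1)) \<le> p l * u powi l" using bern p_nonneg by (auto intro!: mult_left_mono)
    show "\<exists>l\<in>I. p l * (1 + of_int l * (u - 1)) < p l * u powi l"
      using bern(2)[of "- int c"] p_c c_pos by (intro bexI[of _ "- int c"]) auto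
  qed auto
  moreover have "(\<Sum>l\<in>I. p l * (1 + of_int l * (u - 1))) = (\<Sum>l\<in>I. p l) + (u - 1) * (\<Sum>l\<in>I. of_int l * p l)"
    by (simp add: algebra_simps sum.distrib sum_subtractf sum_distrib_left)
  ultimately show ?thesis using p_sum p_mean by (simp add: PP_def)
qed

definition Mu :: "real \<Rightarrow> real fps" where "Mu u = Abs_fps (mpoly u)"

lemma Mu_kernel:
  assumes "u > 0"
  shows "Mu u * (1 - fps_const (PP u) * fps_X) = 1 - fps_X * (\<Sum>k<c. fps_const (rneg u (int k)) * Mk k)"
proof (rule fps_ext)
  fix n
  show "fps_nth (Mu u * (1 - fps_const (PP u) * fps_X)) n = fps_nth (1 - fps_X * (\<Sum>k<c. fps_const (rneg u (int k)) * Mk k)) n"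
  proof (cases n)
    case (Suc m)
    have "(\<Sum>k\<in>{0..<int c}. mw m k * rneg u k) = (\<Sum>k<c. rneg u (int k) * mw m (int k))"
      by (rule sum.reindex_bij_witness[of _ int nat]) auto
    thus ?thesis using mpoly_Suc[of u m] assms Suc
      by (simp add: right_diff_distrib mult.assoc[symmetric] mult.commute[of "Mu u"] fps_sum_nth Mu_def Mk_def)
  qed (simp add: Mu_def fps_mult_nth)
qed

lemma mpoly_le_1:
  assumes "0 < u" "u \<le> (1::real)"
  shows "mpoly u n \<le> 1" "mpoly u n \<ge> 0"
proof -
  have r0: "rneg (1::real) k \<ge> 0" for k unfolding rneg_def by (intro sum_nonneg) (use p_nonneg in auto)
  have "mpoly (1::real) n \<le> 1" for n
  proof (induction n)
    case (Suc n)
    have "(\<Sum>k\<in>{0..<int c}. of_real (mw n k) * rneg (1::real) k) \<ge> 0"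
      by (intro sum_nonneg mult_nonneg_nonneg r0) (use mw_nonneg in auto)
    moreover have "PP (1::real) = 1" using p_sum by (simp add: PP_def)
    ultimately show ?case using mpoly_Suc[of "1::real" n] Suc by simp
  qed simp
  moreover have "mpoly u n \<le> mpoly 1 n" unfolding mpoly_def
  proof (intro sum_mono)
    fix k assume k: "k \<in> {0..int d * int n}"
    have "u powi k \<le> 1" using k assms by (simp add: power_int_def power_le_one)
    thus "of_real (mw n k) * u powi k \<le> of_real (mw n k) * 1 powi k" using mw_nonneg by (simp add: mult_left_le)
  qed
  ultimately show "mpoly u n \<le> 1" using order_trans by blast
  show "mpoly u n \<ge> 0" unfolding mpoly_def using mw_nonneg assms by (intro sum_nonneg) auto
qed

text \<open>By the kernel equation, M(z,u) is a quotient with denominator 1 - z P(u). As P(u) > 1,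
  the denominator vanishes only inside the unit disc, where the power series is its own
  continuation; the quotient is used on the unit circle alone.\<close>

lemma Mu_expansion:
  assumes u: "0 < u" "u < 1"
  shows "\<exists>a b. sqrt_expansion (cfps (Mu u)) a b"
proof (rule sqrt_expansion_exists)
  show rad: "fps_conv_radius (cfps (Mu u)) \<ge> 1"
    by (rule fps_conv_radius_ge_1_of_bounded[of _ 1]) (use mpoly_le_1[of u] u in \<open>simp add: Mu_def\<close>)
  define S where "S = (\<Sum>k<c. fps_const (of_real (rneg u (int k))) * cfps (Mk k))"
  have "\<forall>k. \<exists>ab. sqrt_expansion (cfps (Mk k)) (fst ab) (snd ab)"
  proof
    fix k
    obtain a b where "sqrt_expansion (cfps (Mk k)) a b" using sqrt_expansion_exists[OF Mk_radius Mk_analytic] by blast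
    thus "\<exists>ab. sqrt_expansion (cfps (Mk k)) (fst ab) (snd ab)" by (intro exI[of _ "(a, b)"]) simp
  qed
  from choice[OF this] obtain ab where ab: "\<And>k. sqrt_expansion (cfps (Mk k)) (fst (ab k)) (snd (ab k))" by blast
  define A B where "A = (\<lambda>k. fst (ab k))" and "B = (\<lambda>k. snd (ab k))"
  have AB: "sqrt_expansion (cfps (Mk k)) (A k) (B k)" for k using ab by (simp add: A_def B_def)
  have S: "sqrt_expansion S (\<Sum>k<c. of_real (rneg u (int k)) * A k) (\<Sum>k<c. of_real (rneg u (int k)) * B k)"
    unfolding S_def by (intro sqrt_expansion_sum sqrt_expansion_cmult AB)
  have N: "analytic_upto lens (\<lambda>s. 1 - (1 - s\<^sup>2) * eval_fps S (1 - s\<^sup>2))"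
    by (intro analytic_upto_diff analytic_upto_mult analytic_upto_power analytic_upto_const analytic_upto_ident sqrt_expansion_analytic(2)[OF S])
  have "cfps (Mu u) * cfps (1 - fps_const (PP u) * fps_X) = cfps (1 - fps_X * (\<Sum>k<c. fps_const (rneg u (int k)) * Mk k))"
    unfolding cfps_mult[symmetric] Mu_kernel[OF u(1)] ..
  moreover have "cfps (1 - fps_const (PP u) * fps_X) = 1 - fps_const (of_real (PP u)) * fps_X"
    by (rule fps_ext) simp
  moreover have "cfps (1 - fps_X * (\<Sum>k<c. fps_const (rneg u (int k)) * Mk k)) = 1 - fps_X * S"
    unfolding S_def by (rule fps_ext) (simp add: fps_sum_nth)
  ultimately have ker: "cfps (Mu u) * (1 - fps_const (of_real (PP u)) * fps_X) = 1 - fps_X * S" by simp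
  have kev: "eval_fps (cfps (Mu u)) (1 - s\<^sup>2) * (1 - of_real (PP u) * (1 - s\<^sup>2)) = 1 - (1 - s\<^sup>2) * eval_fps S (1 - s\<^sup>2)" if s: "s \<in> lens" for s
  proof -
    note z = norm_less_radius[OF rad lens_norm[OF s]] norm_less_radius[OF sqrt_expansion_analytic(1)[OF S] lens_norm[OF s]]
    have r1: "fps_conv_radius (fps_const (complex_of_real (PP u)) * fps_X) = \<infinity>"
      using fps_conv_radius_mult[of "fps_const (complex_of_real (PP u))" fps_X] by simp
    have r2: "fps_conv_radius (1 - fps_const (complex_of_real (PP u)) * fps_X) = \<infinity>"
      using fps_conv_radius_diff[of 1 "fps_const (complex_of_real (PP u)) * fps_X"] r1 by simp
    have r3: "ereal (norm (1 - s\<^sup>2)) < fps_conv_radius (fps_X * S)"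
      using fps_conv_radius_mult[of fps_X S] z(2) by (simp add: min_def split: if_splits)
    have "eval_fps (cfps (Mu u) * (1 - fps_const (of_real (PP u)) * fps_X)) (1 - s\<^sup>2) = eval_fps (1 - fps_X * S) (1 - s\<^sup>2)"
      unfolding ker ..
    thus ?thesis using z r1 r2 r3 by (simp add: eval_fps_mult eval_fps_diff)
  qed
  show "analytic_upto lens (\<lambda>s. eval_fps (cfps (Mu u)) (1 - s\<^sup>2))"
  proof (rule analytic_uptoI)
    fix x assume x: "x \<in> closure lens"
    define z0 where "z0 = 1 - x\<^sup>2"
    have z0: "norm z0 \<le> 1" using closure_lensD[OF x] by (simp add: z0_def)
    have ic: "isCont (\<lambda>s::complex. 1 - s\<^sup>2) x" by (intro continuous_intros)
    show "\<exists>e>0. \<exists>g. g holomorphic_on ball x e \<and> (\<forall>s\<in>ball x e \<inter> lens. eval_fps (cfps (Mu u)) (1 - s\<^sup>2) = g s)"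
    proof (cases "norm z0 < 1")
      case True
      obtain d where d: "d > 0" "\<And>s. dist s x < d \<Longrightarrow> dist (1 - s\<^sup>2) z0 < 1 - norm z0"
        using ic True unfolding continuous_at_eps_delta z0_def by (metis diff_gt_0_iff_gt)
      have "norm (1 - s\<^sup>2) < 1" if "s \<in> ball x d" for s
      proof -
        have "dist (1 - s\<^sup>2) z0 < 1 - norm z0" using d(2) that by (simp add: dist_commute)
        thus ?thesis using norm_triangle_ineq[of "1 - s\<^sup>2 - z0" z0] by (simp add: dist_norm)
      qed
      hence "(\<lambda>s. 1 - s\<^sup>2) ` ball x d \<subseteq> eball 0 (fps_conv_radius (cfps (Mu u)))"
        by (intro image_subsetI) (simp only: in_eball_iff dist_0_norm norm_less_radius[OF rad])
      hence "(eval_fps (cfps (Mu u)) \<circ> (\<lambda>s. 1 - s\<^sup>2)) holomorphic_on ball x d"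
        by (intro holomorphic_on_compose_gen[OF _ holomorphic_on_eval_fps[OF order_refl]] holomorphic_intros)
      thus ?thesis using d(1) by (intro exI[of _ d] conjI exI) (auto simp: o_def)
    next
      case False
      hence z1: "norm z0 = 1" using z0 by simp
      have "norm (of_real (PP u) * z0) > 1" using PP_real_gt[of u] u z1 by (simp add: norm_mult)
      hence nz: "1 - of_real (PP u) * z0 \<noteq> 0" by auto
      have "isCont (\<lambda>s::complex. 1 - of_real (PP u) * (1 - s\<^sup>2)) x" by (intro continuous_intros)
      then obtain d where d: "d > 0" "\<And>s. dist x s < d \<Longrightarrow> 1 - of_real (PP u) * (1 - s\<^sup>2) \<noteq> 0"
        using continuous_at_avoid[of x "\<lambda>s::complex. 1 - of_real (PP u) * (1 - s\<^sup>2)" 0] nz unfolding z0_def by blast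
      obtain e g where eg: "e > 0" "g holomorphic_on ball x e" "\<And>s. s \<in> ball x e \<Longrightarrow> s \<in> lens \<Longrightarrow> 1 - (1 - s\<^sup>2) * eval_fps S (1 - s\<^sup>2) = g s"
        using analytic_uptoD[OF N x] by metis
      have "(\<lambda>s. g s / (1 - of_real (PP u) * (1 - s\<^sup>2))) holomorphic_on ball x (min e d)"
        using eg d(2) by (intro holomorphic_intros) (auto intro: holomorphic_on_subset)
      moreover have "eval_fps (cfps (Mu u)) (1 - s\<^sup>2) = g s / (1 - of_real (PP u) * (1 - s\<^sup>2))" if "s \<in> ball x (min e d) \<inter> lens" for s
        using kev[of s] eg(3)[of s] d(2)[of s] that by (simp add: nonzero_eq_divide_eq)
      ultimately show ?thesis using eg(1) d(1) by (intro exI[of _ "min e d"] conjI exI) auto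
    qed
  qed
qed

end

subsection \<open>Walks with catastrophes\<close>

locale catastrophe_walk =
  fixes c d :: nat and p :: "int \<Rightarrow> real" and q :: real
  assumes c1: "c \<ge> 1" and d1: "d \<ge> 1" and p_nn: "\<forall>i. p i \<ge> 0"
    and p_supp: "\<forall>i. i < - int c \<or> i > int d \<longrightarrow> p i = 0"
    and p_cnz: "p (- int c) \<noteq> 0" and p_dnz: "p (int d) \<noteq> 0"
    and aperiodic: "aperiodic p" and q_pos: "q > 0"
begin

sublocale bounded_walk c d p
  by unfold_locales (use c1 d1 p_nn in auto)

lemma p_c_pos: "p (- int c) > 0" and p_d_pos: "p (int d) > 0"
  using p_nn p_cnz p_dnz by (auto simp: order_less_le)

lemma p_nonzero_in_I: "p l \<noteq> 0 \<Longrightarrow> l \<in> I"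
proof (rule ccontr)
  assume l: "p l \<noteq> 0" "l \<notin> I"
  hence "l < - int c \<or> l > int d" by auto
  thus False using p_supp l(1) by blast
qed

abbreviation t0 :: real where "t0 \<equiv> tau c d p"
abbreviation r0 :: real where "r0 \<equiv> rho c d p"

lemma jump_poly_eq: "jump_poly c d p u = PP u"
  by (simp add: jump_poly_def PP_def)

definition D1 :: "real \<Rightarrow> real" where
  "D1 u = (\<Sum>l\<in>I. p l * (of_int l * u powi (l - 1)))"

definition D2 :: "real \<Rightarrow> real" where
  "D2 u = (\<Sum>l\<in>I. p l * (of_int l * (of_int (l - 1) * u powi (l - 2))))"

lemma PP_D1: "u \<noteq> 0 \<Longrightarrow> (PP has_field_derivative D1 u) (at u)"
  unfolding PP_def[abs_def] D1_def
  by (auto intro!: derivative_eq_intros sum.cong simp: mult_ac)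

lemma D1_D2: "u \<noteq> 0 \<Longrightarrow> (D1 has_field_derivative D2 u) (at u)"
  unfolding D1_def[abs_def] D2_def
  by (auto intro!: derivative_eq_intros sum.cong simp: mult_ac)

lemma deriv_jump_poly: "u \<noteq> 0 \<Longrightarrow> deriv (jump_poly c d p) u = D1 u"
  using DERIV_imp_deriv[OF PP_D1] by (simp add: jump_poly_eq[abs_def])

lemma deriv2_jump_poly: "u \<noteq> 0 \<Longrightarrow> deriv (deriv (jump_poly c d p)) u = D2 u"
proof -
  assume u: "u \<noteq> 0"
  have "(deriv (jump_poly c d p) has_field_derivative D2 u) (at u)"
    by (rule has_field_derivative_transform_within_open[OF D1_D2[OF u], of "- {0}"])
       (use u in \<open>auto simp: deriv_jump_poly\<close>)
  thus ?thesis by (rule DERIV_imp_deriv)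
qed

lemma D2_pos: "u > 0 \<Longrightarrow> D2 u > 0"
proof -
  assume u: "u > 0"
  have nn: "p l * (of_int l * (of_int (l - 1) * u powi (l - 2))) \<ge> 0" for l
  proof -
    have "l * (l - 1) \<ge> 0" by (cases "l \<ge> 1") (auto simp: mult_nonneg_nonneg mult_nonpos_nonpos)
    hence "real_of_int (l * (l - 1)) \<ge> 0" by (simp only: of_int_0_le_iff)
    hence "p l * (real_of_int (l * (l - 1)) * u powi (l - 2)) \<ge> 0" using p_nn u by (intro mult_nonneg_nonneg) auto
    thus ?thesis by (simp add: mult.assoc)
  qed
  have "(- int c) * (- int c - 1) > 0" using c1 by (intro mult_neg_neg) auto
  hence "real_of_int ((- int c) * (- int c - 1)) > 0" by (simp only: of_int_0_less_iff)
  hence "p (- int c) * (real_of_int ((- int c) * (- int c - 1)) * u powi (- int c - 2)) > 0"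
    using p_c_pos u by (intro mult_pos_pos) auto
  hence "0 < p (- int c) * (of_int (- int c) * (of_int (- int c - 1) * u powi (- int c - 2)))" by (simp add: mult.assoc)
  also have "\<dots> \<le> D2 u" unfolding D2_def
    by (rule member_le_sum[of "- int c" I "\<lambda>l. p l * (of_int l * (of_int (l - 1) * u powi (l - 2)))"]) (use nn in auto)
  finally show ?thesis .
qed

lemma D1_strict_mono: "0 < u \<Longrightarrow> u < v \<Longrightarrow> D1 u < D1 v"
proof (rule DERIV_pos_imp_increasing[of u v D1])
  fix x assume "0 < u" "u < v" "u \<le> x" "x \<le> v"
  hence "x > 0" by simp
  thus "\<exists>y. DERIV D1 x :> y \<and> y > 0" using D1_D2[of x] D2_pos[of x] by auto
qed

lemma PP_pos: "u > 0 \<Longrightarrow> PP u > (0::real)"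
proof -
  assume u: "u > 0"
  have "0 < p (- int c) * u powi (- int c)" using p_c_pos u by simp
  also have "\<dots> \<le> PP u" unfolding PP_def
    using member_le_sum[of "- int c" I "\<lambda>l. p l * u powi l"] p_nn u by simp
  finally show ?thesis .
qed

text \<open>An intermediate value argument: for large t the jump d outweighs all negative jumps, for
  small t the jump -c outweighs all positive ones. With W the total weight, the opposing parts of t
  P'(t) are at most c W and d W.\<close>

lemma D1_root: "\<exists>t>0. D1 t = 0"
proof -
  define W where "W = (\<Sum>l\<in>I. p l)"
  have W: "W > 0" using PP_pos[of 1] by (simp add: W_def PP_def)
  have tD: "t * D1 t = (\<Sum>l\<in>I. of_int l * p l * t powi l)" if "t > 0" for t
    unfolding D1_def sum_distrib_left
    using that by (intro sum.cong refl) (simp add: power_int_diff field_simps)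
  have up: "D1 t \<ge> 0" if t: "t \<ge> 1" "t \<ge> real c * W / p (int d)" for t
  proof -
    have "of_int l * p l * t powi l \<ge> (if l = int d then p (int d) * t else 0) - real c * p l" if l: "l \<in> I" for l
    proof (cases "l > 0")
      case True
      have "t powi l \<ge> t powi 1" using True t by (intro power_int_increasing) auto
      moreover have "of_int l * (p l * t powi l) \<ge> 1 * (p l * t powi l)"
        using True p_nn t by (intro mult_right_mono mult_nonneg_nonneg) auto
      ultimately have "of_int l * p l * t powi l \<ge> p l * t"
        using p_nn mult_left_mono[of t "t powi l" "p l"] by (simp add: mult.assoc)
      moreover have "p l * t \<ge> (if l = int d then p (int d) * t else 0)" using p_nn t by auto
      moreover have "real c * p l \<ge> 0" using p_nn by simp
      ultimately show ?thesis by linarith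
    next
      case False
      have "t powi l \<le> t powi 0" using False t by (intro power_int_increasing) auto
      hence "p l * t powi l \<le> p l" using p_nn by (simp add: mult_left_le)
      hence "of_int (- l) * (p l * t powi l) \<le> real c * p l"
        using False l p_nn t by (intro mult_mono) (auto intro!: mult_nonneg_nonneg)
      moreover have "l \<noteq> int d" using False d1 by auto
      ultimately show ?thesis by (simp add: mult.assoc)
    qed
    hence "t * D1 t \<ge> (\<Sum>l\<in>I. (if l = int d then p (int d) * t else 0) - real c * p l)"
      unfolding tD[OF less_le_trans[OF zero_less_one t(1)]] by (rule sum_mono)
    also have "(\<Sum>l\<in>I. (if l = int d then p (int d) * t else 0) - real c * p l) = p (int d) * t - real c * W"
      by (simp add: sum_subtractf W_def sum_distrib_left)
    finally have "t * D1 t \<ge> p (int d) * t - real c * W" .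
    moreover have "p (int d) * t \<ge> real c * W" using t(2) p_d_pos by (simp add: field_simps)
    ultimately have "0 \<le> t * D1 t" by linarith
    thus ?thesis using t(1) by (simp add: zero_le_mult_iff)
  qed
  have down: "D1 t \<le> 0" if t: "0 < t" "t \<le> 1" "t * (real d * W) \<le> p (- int c)" for t
  proof -
    have "of_int l * p l * t powi l \<le> real d * p l - (if l = - int c then p (- int c) / t else 0)" if l: "l \<in> I" for l
    proof (cases "l > 0")
      case True
      have "t powi l \<le> 1" using True t by (simp add: power_int_def power_le_one)
      hence "p l * t powi l \<le> p l" using p_nn by (simp add: mult_left_le)
      hence "of_int l * (p l * t powi l) \<le> real d * p l"
        using True l p_nn t by (intro mult_mono) (auto intro!: mult_nonneg_nonneg)
      thus ?thesis using True by (simp add: mult.assoc)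
    next
      case False
      have *: "of_int l * (p l * t powi l) \<le> 0" using False p_nn t by (intro mult_nonpos_nonneg mult_nonneg_nonneg) auto
      show ?thesis
      proof (cases "l = - int c")
        case True
        have "t powi (- int c) = (1 / t) ^ c" by (simp add: power_int_minus power_inverse divide_inverse)
        also have "(1 / t) ^ c \<ge> (1 / t) ^ 1" using t c1 by (intro power_increasing) auto
        finally have "t powi (- int c) \<ge> 1 / t" by simp
        hence "p l * (1 / t) \<le> p l * t powi l" using True p_nn by (intro mult_left_mono) auto
        moreover have "1 * (p l * t powi l) \<le> real c * (p l * t powi l)" using c1 p_nn t by (intro mult_right_mono mult_nonneg_nonneg) auto
        ultimately have "p l / t \<le> real c * (p l * t powi l)" by simp
        moreover have "real d * p l \<ge> 0" using p_nn by simp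
        ultimately show ?thesis using True by (simp add: mult.assoc)
      next
        case False
        have "real d * p l \<ge> 0" using p_nn by simp
        thus ?thesis using * False by (simp add: mult.assoc)
      qed
    qed
    hence "t * D1 t \<le> (\<Sum>l\<in>I. real d * p l - (if l = - int c then p (- int c) / t else 0))"
      unfolding tD[OF t(1)] by (rule sum_mono)
    also have "\<dots> = real d * W - p (- int c) / t" by (simp add: sum_subtractf W_def sum_distrib_left)
    also have "\<dots> \<le> 0" using t by (simp add: field_simps)
    finally show ?thesis using t(1) by (simp add: mult_le_0_iff)
  qed
  define b where "b = max 1 (real c * W / p (int d))"
  define a where "a = min 1 (p (- int c) / (real d * W))"
  have a: "0 < a" "a \<le> 1" "a * (real d * W) \<le> p (- int c)"
  proof -
    show "0 < a" "a \<le> 1" using p_c_pos W d1 by (auto simp: a_def)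
    have "a \<le> p (- int c) / (real d * W)" by (simp add: a_def)
    thus "a * (real d * W) \<le> p (- int c)" using W d1 by (simp add: pos_le_divide_eq)
  qed
  have b: "b \<ge> 1" "b \<ge> real c * W / p (int d)" by (auto simp: b_def)
  have "\<exists>t\<ge>a. t \<le> b \<and> D1 t = 0"
  proof (rule IVT')
    show "D1 a \<le> 0" by (rule down[OF a])
    show "0 \<le> D1 b" by (rule up[OF b])
    show "a \<le> b" using a b by simp
    have "isCont D1 x" if "x \<in> {a..b}" for x
      by (rule DERIV_isCont[OF D1_D2]) (use that a in auto)
    thus "continuous_on {a..b} D1" by (intro continuous_at_imp_continuous_on) auto
  qed
  thus ?thesis using a(1) by (meson order_less_le_trans)
qed

text \<open>P' is strictly increasing on the positive axis, so its root there is unique, hence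
  minimal, and the definite description is proper.\<close>

lemma tau_props: "t0 > 0" "D1 t0 = 0"
proof -
  obtain t where t: "t > 0" "D1 t = 0" using D1_root by blast
  have "t0 = t" unfolding tau_def
  proof (rule the_equality)
    show "0 < t \<and> deriv (jump_poly c d p) t = 0 \<and> (\<forall>s. 0 < s \<and> s < t \<longrightarrow> deriv (jump_poly c d p) s \<noteq> 0)"
    proof -
      have "D1 s \<noteq> 0" if "0 < s" "s < t" for s using D1_strict_mono[OF that] t by simp
      thus ?thesis using t by (auto simp: deriv_jump_poly)
    qed
    fix s assume s: "0 < s \<and> deriv (jump_poly c d p) s = 0 \<and> (\<forall>r. 0 < r \<and> r < s \<longrightarrow> deriv (jump_poly c d p) r \<noteq> 0)"
    hence "D1 s = 0" by (auto simp: deriv_jump_poly)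
    thus "s = t" using t s D1_strict_mono[of s t] D1_strict_mono[of t s] by (cases s t rule: linorder_cases) auto
  qed
  thus "t0 > 0" "D1 t0 = 0" using t by auto
qed

lemma rho_props: "r0 > 0" "r0 = 1 / PP t0"
  using PP_pos[OF tau_props(1)] by (auto simp: rho_def jump_poly_eq)

lemma D1_one_neg_imp_tau_gt: "D1 1 < 0 \<Longrightarrow> t0 > 1"
  using D1_strict_mono[of t0 1] tau_props by (cases t0 "1::real" rule: linorder_cases) auto

lemma PP_one_ge: "PP (1::real) \<ge> PP t0"
proof (cases t0 "1::real" rule: linorder_cases)
  case less
  have "PP t0 \<le> PP (1::real)"
  proof (rule DERIV_nonneg_imp_nondecreasing[of t0 1 PP])
    fix x assume x: "t0 \<le> x" "x \<le> 1"
    have "D1 x \<ge> 0" using D1_strict_mono[of t0 x] tau_props x by (cases "x = t0") auto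
    thus "\<exists>y. DERIV PP x :> y \<and> 0 \<le> y" using PP_D1[of x] x tau_props by auto
  qed (use less in auto)
  thus ?thesis .
next
  case greater
  show ?thesis
  proof (rule DERIV_nonpos_imp_nonincreasing[of 1 t0 PP])
    fix x assume x: "1 \<le> x" "x \<le> t0"
    have "D1 x \<le> 0" using D1_strict_mono[of x t0] tau_props x by (cases "x = t0") auto
    thus "\<exists>y. DERIV PP x :> y \<and> y \<le> 0" using PP_D1[of x] x by auto
  qed (use greater in auto)
qed simp

definition pn :: "int \<Rightarrow> real" where "pn l = p l * t0 powi l * r0"

lemma pn_props: "pn l \<ge> 0" "pn l \<noteq> 0 \<longleftrightarrow> p l \<noteq> 0"
  using p_nn tau_props rho_props by (auto simp: pn_def)

lemma pn_sum: "(\<Sum>l\<in>I. pn l) = 1"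
proof -
  have "(\<Sum>l\<in>I. pn l) = PP t0 * r0" by (simp add: pn_def PP_def sum_distrib_right)
  thus ?thesis using rho_props PP_pos[OF tau_props(1)] by simp
qed

lemma pn_mean: "(\<Sum>l\<in>I. of_int l * pn l) = 0"
proof -
  have "(\<Sum>l\<in>I. of_int l * pn l) = r0 * t0 * D1 t0"
    unfolding D1_def sum_distrib_left using tau_props(1)
    by (intro sum.cong refl) (simp add: pn_def power_int_diff field_simps)
  thus ?thesis using tau_props by simp
qed

text \<open>Equality in the triangle inequality forces \<^term>\<open>w powi l\<close> to be constant on the jump set, so that the jumps
  lie in a coset of the subgroup of exponents killing \<^term>\<open>w\<close>.\<close>

lemma pn_aperiodic:
  fixes w :: complex
  assumes w: "norm w = 1" "w \<noteq> 1"
  shows "norm (\<Sum>l\<in>I. of_real (pn l) * w powi l) < 1"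
proof (rule ccontr)
  define S where "S = (\<Sum>l\<in>I. of_real (pn l) * w powi l)"
  assume "\<not> ?thesis"
  hence S1: "norm S \<ge> 1" by (simp add: S_def)
  have w0: "w \<noteq> 0" using w by auto
  have nw: "norm (w powi l) = 1" for l using w by (simp add: norm_power_int)
  have nS: "norm S = 1"
  proof -
    have "norm S \<le> (\<Sum>l\<in>I. pn l)" unfolding S_def
      by (rule order_trans[OF norm_sum]) (simp add: norm_mult nw pn_props)
    thus ?thesis using S1 pn_sum by simp
  qed
  have SS: "S * cnj S = 1" using complex_norm_square[of S] nS by simp
  \<comment> \<open>The average of Re (cnj S * w^l) is Re (cnj S * S) = 1, while no term exceeds
    1.\<close>
  have "(\<Sum>l\<in>I. pn l * (1 - Re (cnj S * w powi l))) = 0"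
  proof -
    have "(\<Sum>l\<in>I. pn l * Re (cnj S * w powi l)) = Re (cnj S * S)"
      unfolding S_def sum_distrib_left Re_sum by (intro sum.cong refl) (simp add: algebra_simps)
    also have "cnj S * S = 1" using SS by (simp only: mult.commute)
    finally show ?thesis using pn_sum by (simp add: right_diff_distrib sum_subtractf)
  qed
  moreover have le: "Re (cnj S * w powi l) \<le> 1" for l
    using complex_Re_le_cmod[of "cnj S * w powi l"] nS nw by (simp add: norm_mult)
  ultimately have "\<forall>l\<in>I. pn l * (1 - Re (cnj S * w powi l)) = 0"
    by (subst (asm) sum_nonneg_eq_0_iff) (auto simp: pn_props)
  hence re1: "Re (cnj S * w powi l) = 1" if "l \<in> I" "p l \<noteq> 0" for l using that pn_props(2)[of l] by auto
  have eqS: "w powi l = S" if "l \<in> I" "p l \<noteq> 0" for l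
  proof -
    have n1: "norm (cnj S * w powi l) = 1" using nS nw by (simp add: norm_mult)
    have "(Re (cnj S * w powi l))\<^sup>2 + (Im (cnj S * w powi l))\<^sup>2 = 1" using cmod_power2[of "cnj S * w powi l"] n1 by simp
    hence "cnj S * w powi l = 1" using re1[OF that] by (simp add: complex_eq_iff)
    hence "S * (cnj S * w powi l) = S" by simp
    thus ?thesis using SS by (simp add: mult.assoc[symmetric])
  qed
  have diff: "w powi (l + int c) = 1" if "p l \<noteq> 0" for l
  proof -
    have lI: "l \<in> I" by (rule p_nonzero_in_I[OF that])
    have "w powi l = w powi (- int c)" using eqS[OF lI that] eqS[of "- int c"] p_cnz by simp
    thus ?thesis using w0 by (simp add: power_int_add power_int_minus)
  qed
  define per where "per = int (LEAST n. n > 0 \<and> w ^ n = 1)"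
  \<comment> \<open>The extreme jumps -c and d both satisfy w^l = S, whence w^(c + d) = 1 and w is a
    root of unity.\<close>
  have ex: "\<exists>n>0. w ^ n = 1"
  proof (intro exI conjI)
    show "d + c > 0" using d1 by simp
    show "w ^ (d + c) = 1" using diff[OF p_dnz] power_int_of_nat[of w "d + c"] by simp
  qed
  have per0: "(LEAST n. n > 0 \<and> w ^ n = 1) > 0 \<and> w ^ (LEAST n. n > 0 \<and> w ^ n = 1) = 1"
    using LeastI_ex[OF ex] .
  have wper: "w powi per = 1" "per > 0" using per0 by (auto simp: per_def)
  have per2: "per \<ge> 2"
  proof -
    have "per \<noteq> 1" using wper(1) w(2) by auto
    thus ?thesis using wper(2) by linarith
  qed
  have dvd: "per dvd k" if "w powi k = 1" for k
  proof -
    have "w powi k = w powi (per * (k div per) + k mod per)" by simp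
    also have "\<dots> = w powi (per * (k div per)) * w powi (k mod per)" by (rule power_int_add) (use w0 in simp)
    also have "w powi (per * (k div per)) = (w powi per) powi (k div per)" by (rule power_int_mult)
    finally have "w powi (k mod per) = 1" using wper(1) that by simp
    moreover have "0 \<le> k mod per" "k mod per < per" using wper(2) by auto
    ultimately have "w ^ nat (k mod per) = 1" "nat (k mod per) < (LEAST n. n > 0 \<and> w ^ n = 1)"
      by (auto simp: per_def power_int_def)
    hence "nat (k mod per) = 0" using not_less_Least[of "nat (k mod per)" "\<lambda>n. n > 0 \<and> w ^ n = 1"] by simp
    hence "k mod per = 0" using \<open>0 \<le> k mod per\<close> by simp
    thus ?thesis by (simp add: dvd_eq_mod_eq_0)
  qed
  define h where "h = (\<lambda>j. p (- int c + per * j))"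
  have "finite {j. h j \<noteq> 0}"
  proof (rule finite_subset)
    have inj: "inj (\<lambda>j. - int c + per * j)" using wper(2) by (auto simp: inj_def)
    show "{j. h j \<noteq> 0} \<subseteq> (\<lambda>j. - int c + per * j) -` I"
      unfolding h_def by (intro subsetI vimageI2 p_nonzero_in_I) simp
    show "finite ((\<lambda>j. - int c + per * j) -` I)" by (rule finite_vimageI[OF _ inj]) simp
  qed
  moreover have "p i = (if per dvd (i - (- int c)) then h ((i - (- int c)) div per) else 0)" for i
  proof (cases "per dvd (i - (- int c))")
    case True
    thus ?thesis by (auto simp: h_def)
  next
    case False
    hence "p i = 0" using diff[of i] dvd[of "i + int c"] by auto
    thus ?thesis using False by simp
  qed
  ultimately have "\<not> aperiodic p" unfolding aperiodic_def using per2 by blast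
  thus False using aperiodic by blast
qed

sublocale N: critical_walk c d pn
proof
  show "c \<ge> 1" "d \<ge> 1" by (fact c1 d1)+
  show "pn l \<ge> 0" for l by (rule pn_props)
  show "(\<Sum>l\<in>I. pn l) = 1" by (rule pn_sum)
  show "(\<Sum>l\<in>I. of_int l * pn l) = 0" by (rule pn_mean)
  show "pn (- int c) > 0" "pn (int d) > 0"
    using pn_props(1)[of "- int c"] pn_props(2)[of "- int c"] pn_props(1)[of "int d"] pn_props(2)[of "int d"] p_cnz p_dnz
    by (auto simp: order_less_le)
  show "norm (bounded_walk.PP c d pn w) < 1" if "norm w = 1" "w \<noteq> 1" for w :: complex
    using pn_aperiodic[OF that] bounded_walk.PP_def[of c d pn w] c1 d1 pn_props(1) by (simp add: bounded_walk_def)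
qed

end

section \<open>Roots, monotonicity and radii of real power series\<close>

lemma power_series_root:
  fixes f :: "real fps"
  assumes nn: "\<And>n. fps_nth f n \<ge> 0" and f0: "fps_nth f 0 = 0"
    and R: "R > 0" "ereal R \<le> fps_conv_radius f" and N: "(\<Sum>n<N. fps_nth f n * R ^ n) > 1"
  shows "\<exists>r. 0 < r \<and> r < R \<and> eval_fps f r = 1"
proof -
  \<comment> \<open>The series may diverge at R, where just a partial sum is known to exceed 1. By
    continuity the partial sum still does so slightly to the left of R, inside the disc of
    convergence.\<close>
  have "((\<lambda>z. \<Sum>n<N. fps_nth f n * z ^ n) \<longlongrightarrow> (\<Sum>n<N. fps_nth f n * R ^ n)) (at_left R)"
    by (intro tendsto_intros)
  hence "eventually (\<lambda>z. (\<Sum>n<N. fps_nth f n * z ^ n) > 1) (at_left R)" using N by (rule order_tendstoD)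
  moreover have "eventually (\<lambda>z. z \<in> {0<..<R}) (at_left R)" by (rule eventually_at_left_real[OF R(1)])
  ultimately have "eventually (\<lambda>z. (\<Sum>n<N. fps_nth f n * z ^ n) > 1 \<and> z \<in> {0<..<R}) (at_left R)" by (rule eventually_conj)
  then obtain z where z: "(\<Sum>n<N. fps_nth f n * z ^ n) > 1" "0 < z" "z < R"
    using eventually_happens'[of "at_left R"] by fastforce
  have zr: "ereal z < fps_conv_radius f" using z(3) R(2) less_le_trans[of "ereal z" "ereal R"] by simp
  have "summable (\<lambda>n. fps_nth f n * z ^ n)" by (rule summable_fps) (use zr z in simp)
  hence "(\<Sum>n<N. fps_nth f n * z ^ n) \<le> eval_fps f z"
    unfolding eval_fps_def by (rule sum_le_suminf) (use nn z in auto)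
  hence ez: "eval_fps f z > 1" using z by linarith
  have "\<exists>r\<ge>0. r \<le> z \<and> eval_fps f r = 1"
  proof (rule IVT')
    have "eval_fps f 0 = 0" using f0 by (simp add: eval_fps_at_0)
    thus "eval_fps f 0 \<le> 1" by simp
    show "1 \<le> eval_fps f z" "0 \<le> z" using z ez by auto
    show "continuous_on {0..z} (eval_fps f)"
    proof (rule continuous_on_subset[OF continuous_on_eval_fps])
      show "{0..z} \<subseteq> eball 0 (fps_conv_radius f)"
      proof
        fix x assume "x \<in> {0..z}"
        hence "ereal (norm x) \<le> ereal z" by simp
        also have "\<dots> < fps_conv_radius f" by (rule zr)
        finally show "x \<in> eball 0 (fps_conv_radius f)" by (simp add: in_eball_iff)
      qed
    qed
  qed
  then obtain r where r: "r \<ge> 0" "r \<le> z" "eval_fps f r = 1" by blast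
  have "r \<noteq> 0" using r(3) f0 by (auto simp: eval_fps_at_0)
  thus ?thesis using r z by (intro exI[of _ r]) auto
qed

lemma eval_fps_strict_mono:
  fixes f :: "real fps"
  assumes nn: "\<And>n. fps_nth f n \<ge> 0" and m: "fps_nth f m > 0" "m > 0"
    and xy: "0 \<le> x" "x < y" "summable (\<lambda>n. fps_nth f n * y ^ n)"
  shows "eval_fps f x < eval_fps f y"
proof -
  have le: "fps_nth f n * x ^ n \<le> fps_nth f n * y ^ n" for n
    using nn xy by (intro mult_left_mono power_mono) auto
  have sx: "summable (\<lambda>n. fps_nth f n * x ^ n)"
    by (rule summable_comparison_test'[OF xy(3), of 0]) (use le nn xy in auto)
  have "0 < (\<Sum>n. fps_nth f n * y ^ n - fps_nth f n * x ^ n)"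
  proof (rule suminf_pos2[of _ m])
    show "summable (\<lambda>n. fps_nth f n * y ^ n - fps_nth f n * x ^ n)" by (rule summable_diff[OF xy(3) sx])
    show "0 \<le> fps_nth f n * y ^ n - fps_nth f n * x ^ n" for n using le by simp
    have "x ^ m < y ^ m" using xy m by (intro power_strict_mono) auto
    thus "0 < fps_nth f m * y ^ m - fps_nth f m * x ^ m" using m by simp
  qed
  also have "\<dots> = eval_fps f y - eval_fps f x" unfolding eval_fps_def by (rule suminf_diff[OF xy(3) sx, symmetric])
  finally show ?thesis by simp
qed

lemma conv_radius_ge_of_bounded:
  fixes f :: "nat \<Rightarrow> real"
  assumes R: "R > 0" and b: "\<And>n. \<bar>f n\<bar> * R ^ n \<le> B"
  shows "conv_radius f \<ge> ereal R"
proof (rule conv_radius_geI_ex)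
  fix r :: real assume r: "0 < r" "ereal r < ereal R"
  show "\<exists>z. norm z = r \<and> summable (\<lambda>n. f n * z ^ n)"
  proof (intro exI conjI)
    show "norm r = r" using r by simp
    have "summable (\<lambda>n. B * (r / R) ^ n)" using r R by (intro summable_mult summable_geometric) auto
    thus "summable (\<lambda>n. f n * r ^ n)"
    proof (rule summable_comparison_test'[of _ 0])
      fix n :: nat
      have "norm (f n * r ^ n) = \<bar>f n\<bar> * R ^ n * (r / R) ^ n" using r R by (simp add: abs_mult power_divide)
      also have "\<dots> \<le> B * (r / R) ^ n" using b r R by (intro mult_right_mono) auto
      finally show "norm (f n * r ^ n) \<le> B * (r / R) ^ n" .
    qed
  qed
qed

section \<open>Coefficients of Q, and the regime \<tau> \<le> 1\<close>

context catastrophe_walk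
begin

lemma jump_set_I: "jump_set p \<subseteq> I"
  using p_nonzero_in_I by (auto simp: jump_set_def)

lemma Mtot_eq: "Mtot p n = mpoly 1 n"
proof -
  have J: "finite (jump_set p)" by (rule finite_subset[OF jump_set_I]) simp
  have fin: "finite (meanders p n)" by (rule finite_meanders[OF J])
  let ?T = "sum_list ` meanders p n \<union> {0..int d * int n}"
  have "Mtot p n = (\<Sum>k\<in>?T. \<Sum>xs\<in>{xs\<in>meanders p n. sum_list xs = k}. prod_list (map p xs))"
    unfolding Mtot_def by (rule sum.group[symmetric]) (use fin in auto)
  also have "\<dots> = (\<Sum>k\<in>?T. mw n k)" by (intro sum.cong refl meander_sum_eq jump_set_I) simp
  also have "\<dots> = (\<Sum>k\<in>{0..int d * int n}. mw n k)"
  proof (rule sum.mono_neutral_right)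
    show "\<forall>k\<in>?T - {0..int d * int n}. mw n k = 0"
      using meander_weight_neg mw_above by (auto simp: not_le)
  qed (use fin in auto)
  finally show ?thesis by (simp add: mpoly_def)
qed

lemma mcoef_mw: "mcoef p n k = mw n (int k)"
  by (rule mcoef_eq[OF _ jump_set_I]) simp

lemma Ecoef_eq: "Ecoef p n = mw n 0"
  by (simp add: Ecoef_def mcoef_mw)

text \<open>The positive altitudes from which a direct step to 0 is an ordinary jump and hence not a
  catastrophe.\<close>

definition JN :: "nat set" where "JN = {j. j > 0 \<and> - int j \<in> jump_set p}"

lemma JN_sub: "JN \<subseteq> {1..c}"
proof
  fix j assume "j \<in> JN"
  hence "j > 0" "- int j \<in> I" using jump_set_I by (auto simp: JN_def)
  thus "j \<in> {1..c}" by auto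
qed

lemma JN_finite: "finite JN"
  by (rule finite_subset[OF JN_sub]) simp

lemma Qcoef_0: "Qcoef p q 0 = 0"
  by (simp add: Qcoef_def)

lemma Qcoef_Suc: "Qcoef p q (Suc m) = q * (mpoly 1 m - mw m 0 - (\<Sum>j\<in>JN. mw m (int j)))"
  unfolding Qcoef_def JN_def by (simp add: Mtot_eq Ecoef_eq mcoef_mw)

lemma mpoly_1: "mpoly (1::real) n = (\<Sum>k\<in>{0..int d * int n}. mw n k)"
  by (simp add: mpoly_def)

text \<open>Writing the coefficient without subtractions makes its sign visible. The range of
  altitudes is enlarged by c so that it contains the removed ones even for small m.\<close>

lemma Qcoef_Suc_sum:
  "Qcoef p q (Suc m) = q * (\<Sum>k\<in>{0..int d * int m + int c} - insert 0 (int ` JN). mw m k)"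
proof -
  let ?U = "{0..int d * int m + int c}" and ?K = "insert 0 (int ` JN)"
  have 1: "mpoly 1 m = (\<Sum>k\<in>?U. mw m k)"
    unfolding mpoly_1
  proof (rule sum.mono_neutral_left)
    show "\<forall>k\<in>?U - {0..int d * int m}. mw m k = 0" using mw_above by auto
  qed auto
  have K: "?K \<subseteq> ?U"
  proof
    fix k assume "k \<in> ?K"
    hence "0 \<le> k" "k \<le> int c" using JN_sub by auto
    thus "k \<in> ?U" by (auto intro: order_trans[of _ "int c"])
  qed
  have "(\<Sum>k\<in>?K. mw m k) = mw m 0 + (\<Sum>k\<in>int ` JN. mw m k)"
    by (rule sum.insert) (use JN_finite in \<open>auto simp: JN_def\<close>)
  also have "(\<Sum>k\<in>int ` JN. mw m k) = (\<Sum>j\<in>JN. mw m (int j))"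
    by (subst sum.reindex) (auto simp: inj_on_def)
  finally have 2: "(\<Sum>k\<in>?K. mw m k) = mw m 0 + (\<Sum>j\<in>JN. mw m (int j))" .
  have "(\<Sum>k\<in>?U - ?K. mw m k) = (\<Sum>k\<in>?U. mw m k) - (\<Sum>k\<in>?K. mw m k)"
    by (rule sum_diff[OF _ K]) simp
  thus ?thesis unfolding Qcoef_Suc 1 2 by simp
qed

lemma Qcoef_nonneg: "Qcoef p q n \<ge> 0"
  by (cases n) (auto simp: Qcoef_0 Qcoef_Suc_sum intro!: mult_nonneg_nonneg sum_nonneg mw_nonneg less_imp_le[OF q_pos])

text \<open>Above altitude c, every direct step to 0 is a catastrophe.\<close>

lemma Qcoef_Suc_ge: "k > int c \<Longrightarrow> Qcoef p q (Suc m) \<ge> q * mw m k"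
proof (cases "k \<le> int d * int m")
  case True
  assume k: "k > int c"
  have "k \<in> {0..int d * int m + int c} - insert 0 (int ` JN)" using k True JN_sub by auto
  hence "mw m k \<le> (\<Sum>k\<in>{0..int d * int m + int c} - insert 0 (int ` JN). mw m k)"
    by (intro member_le_sum) (auto simp: mw_nonneg)
  thus ?thesis unfolding Qcoef_Suc_sum using q_pos by simp
next
  case False
  hence "mw m k = 0" using mw_above by auto
  thus ?thesis using Qcoef_nonneg by simp
qed

lemma height_above: "m > c \<Longrightarrow> int (d * m) > int c"
proof -
  assume "m > c"
  moreover have "1 * m \<le> d * m" using d1 by (intro mult_right_mono) auto
  ultimately have "c < d * m" by linarith
  thus ?thesis by (simp only: of_nat_less_iff)
qed

lemma Qcoef_pos: "n \<ge> c + 2 \<Longrightarrow> Qcoef p q n > 0"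
proof -
  assume n: "n \<ge> c + 2"
  define m where "m = n - 1"
  have m: "n = Suc m" "m > c" using n by (auto simp: m_def)
  have "0 < p (int d) ^ m * mw 0 0" using p_d_pos by simp
  also have "\<dots> \<le> mw (0 + m) (int (d * m))" by (rule mw_up)
  finally have "0 < q * mw m (int (d * m))" using q_pos by simp
  also have "\<dots> \<le> Qcoef p q n" unfolding m(1) by (rule Qcoef_Suc_ge[OF height_above[OF m(2)]])
  finally show ?thesis .
qed

text \<open>An excursion followed by c + 1 jumps d ends above altitude c, where a catastrophe is
  possible. This domination of E by Q is what later forces \<eta> > 0.\<close>

lemma Qcoef_ge_E: "Qcoef p q (n + (c + 2)) \<ge> q * p (int d) ^ (c + 1) * mw n 0"
proof -
  have "q * (p (int d) ^ (c + 1) * mw n 0) \<le> q * mw (n + (c + 1)) (int (d * (c + 1)))"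
    using q_pos mw_up[of "c + 1" n] by (intro mult_left_mono) auto
  also have "\<dots> \<le> Qcoef p q (Suc (n + (c + 1)))" by (rule Qcoef_Suc_ge[OF height_above]) simp
  finally show ?thesis by (simp add: mult.assoc)
qed

lemma Qfun_eval: "Qfun p q = eval_fps (Qfps p q)"
  by (simp add: fun_eq_iff Qfun_def Qfps_def eval_fps_def)

text \<open>Q is strictly increasing on [0,r], so a root at r is automatically the first
  one.\<close>

lemma is_rho0I:
  assumes r: "0 < r" "r \<le> r0" "Qfun p q r = 1" "summable (\<lambda>n. Qcoef p q n * r ^ n)"
  shows "is_rho0 c d p q r"
proof -
  have "eval_fps (Qfps p q) y < eval_fps (Qfps p q) r" if "0 < y" "y < r" for y
    by (rule eval_fps_strict_mono[of _ "c + 2"]) (use that r Qcoef_pos[of "c + 2"] in \<open>auto simp: Qfps_def Qcoef_nonneg\<close>)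
  thus ?thesis unfolding is_rho0_def using r by (fastforce simp: Qfun_eval)
qed

text \<open>The zero of the kernel 1 - z P(u) at u = 1.\<close>

definition R1 :: real where "R1 = 1 / PP 1"

lemma R1_pos: "R1 > 0" and R1_le: "R1 \<le> r0"
  using PP_pos[of 1] PP_pos[OF tau_props(1)] PP_one_ge rho_props(2)
  by (auto simp: R1_def intro!: frac_le)

lemma finite_below: "finite {l\<in>I. k + l < 0}"
  by (rule finite_subset[of _ I]) auto

lemma rneg_1_ge: "k \<in> {0..<int c} \<Longrightarrow> rneg (1::real) k \<ge> p (- int c)"
  unfolding rneg_def using member_le_sum[OF _ _ finite_below, of "- int c" k p] p_nn by simp

lemma mpoly_1_nonneg: "mpoly (1::real) n \<ge> 0"
  unfolding mpoly_1 by (intro sum_nonneg mw_nonneg)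

lemma mpoly_Suc_scaled:
  "v \<noteq> 0 \<Longrightarrow> mpoly v (Suc n) * R1 ^ Suc n =
     R1 * PP v * (mpoly v n * R1 ^ n) - R1 * (\<Sum>k\<in>{0..<int c}. rneg v k * (mw n k * R1 ^ n))"
proof -
  assume v: "v \<noteq> 0"
  have "(\<Sum>k\<in>{0..<int c}. rneg v k * (mw n k * R1 ^ n)) = (\<Sum>k\<in>{0..<int c}. mw n k * rneg v k) * R1 ^ n"
    unfolding sum_distrib_right by (intro sum.cong refl) simp
  moreover have "mpoly v (Suc n) = PP v * mpoly v n - (\<Sum>k\<in>{0..<int c}. mw n k * rneg v k)"
    using mpoly_Suc[OF v, of n] by simp
  ultimately show ?thesis by (simp only: power_Suc left_diff_distrib right_diff_distrib mult_ac)
qed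

lemma mpoly_1_Suc_scaled:
  "mpoly 1 (Suc n) * R1 ^ Suc n = mpoly 1 n * R1 ^ n - R1 * (\<Sum>k\<in>{0..<int c}. rneg 1 k * (mw n k * R1 ^ n))"
proof -
  have "R1 * PP 1 = 1" using PP_pos[of 1] by (simp add: R1_def)
  thus ?thesis using mpoly_Suc_scaled[of 1 n] by simp
qed

lemma mpoly_1_scaled_le_1: "mpoly 1 n * R1 ^ n \<le> 1"
proof (induction n)
  case (Suc n)
  have "(\<Sum>k\<in>{0..<int c}. rneg 1 k * (mw n k * R1 ^ n)) \<ge> 0"
  proof (rule sum_nonneg)
    fix k assume k: "k \<in> {0..<int c}"
    show "0 \<le> rneg 1 k * (mw n k * R1 ^ n)"
      using rneg_1_ge[OF k] p_c_pos R1_pos mw_nonneg by (intro mult_nonneg_nonneg) auto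
  qed
  hence "R1 * (\<Sum>k\<in>{0..<int c}. rneg 1 k * (mw n k * R1 ^ n)) \<ge> 0" using R1_pos by (intro mult_nonneg_nonneg) auto
  thus ?case using Suc.IH unfolding mpoly_1_Suc_scaled by linarith
qed simp

text \<open>At z = R1 the kernel factor is 1, so in each step the scaled total mass loses at least
  R1 p(-c) times the scaled mass at a given altitude below c. The losses telescope to at most 1.
  Altitude c is reduced to altitude 0 by one more jump -c.\<close>

lemma mw_R1_summable:
  assumes k: "k \<in> {0..int c}"
  shows "summable (\<lambda>n. mw n k * R1 ^ n)"
proof -
  have less: "summable (\<lambda>n. mw n k * R1 ^ n)" if k: "k \<in> {0..<int c}" for k
  proof (rule summableI_nonneg_bounded)
    fix N
    have step: "R1 * p (- int c) * (mw n k * R1 ^ n) \<le> mpoly 1 n * R1 ^ n - mpoly 1 (Suc n) * R1 ^ Suc n" for n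
    proof -
      have nn: "rneg 1 j * (mw n j * R1 ^ n) \<ge> 0" if "j \<in> {0..<int c}" for j
        using rneg_1_ge[OF that] p_c_pos R1_pos mw_nonneg by (intro mult_nonneg_nonneg) auto
      have "p (- int c) * (mw n k * R1 ^ n) \<le> rneg 1 k * (mw n k * R1 ^ n)"
        using rneg_1_ge[OF k] R1_pos mw_nonneg by (intro mult_right_mono mult_nonneg_nonneg) auto
      also have "\<dots> \<le> (\<Sum>k\<in>{0..<int c}. rneg 1 k * (mw n k * R1 ^ n))"
        by (rule member_le_sum[of k "{0..<int c}" "\<lambda>k. rneg 1 k * (mw n k * R1 ^ n)"]) (use k nn in auto)
      finally have "R1 * (p (- int c) * (mw n k * R1 ^ n)) \<le> R1 * (\<Sum>k\<in>{0..<int c}. rneg 1 k * (mw n k * R1 ^ n))"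
        using R1_pos by (intro mult_left_mono) auto
      thus ?thesis using mpoly_1_Suc_scaled[of n] by (simp only: mult.assoc)
    qed
    have "R1 * p (- int c) * (\<Sum>n<N. mw n k * R1 ^ n) \<le> (\<Sum>n<N. mpoly 1 n * R1 ^ n - mpoly 1 (Suc n) * R1 ^ Suc n)"
      unfolding sum_distrib_left by (rule sum_mono) (rule step)
    also have "\<dots> = mpoly 1 0 * R1 ^ 0 - mpoly 1 N * R1 ^ N" by (rule sum_lessThan_telescope')
    also have "\<dots> \<le> 1" using mpoly_1_nonneg[of N] R1_pos by simp
    finally show "(\<Sum>n<N. mw n k * R1 ^ n) \<le> 1 / (R1 * p (- int c))"
      using R1_pos p_c_pos by (simp add: field_simps)
  next
    show "0 \<le> mw n k * R1 ^ n" for n using mw_nonneg R1_pos by simp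
  qed
  show ?thesis
  proof (cases "k = int c")
    case True
    have "summable (\<lambda>n. mw (Suc n) 0 * R1 ^ Suc n)" using less[of 0] c1 by (subst summable_Suc_iff) auto
    hence s: "summable (\<lambda>n. mw (Suc n) 0 * R1 ^ Suc n / (p (- int c) * R1))" by (rule summable_divide)
    show ?thesis
    proof (rule summable_comparison_test'[OF s, of 0])
      fix n :: nat
      have "p (- int c) * mw n (int c) \<le> mw (Suc n) 0"
        using member_le_sum[of "- int c" I "\<lambda>l. p l * mw n (0 - l)"] mw_nonneg p_nn by simp
      hence "p (- int c) * mw n (int c) * R1 ^ Suc n \<le> mw (Suc n) 0 * R1 ^ Suc n"
        using R1_pos by (intro mult_right_mono) auto
      hence "mw n (int c) * R1 ^ n \<le> mw (Suc n) 0 * R1 ^ Suc n / (p (- int c) * R1)"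
        using p_c_pos R1_pos by (simp add: pos_le_divide_eq mult_ac del: meander_weight.simps)
      thus "norm (mw n k * R1 ^ n) \<le> mw (Suc n) 0 * R1 ^ Suc n / (p (- int c) * R1)"
        using True mw_nonneg R1_pos by (simp add: abs_mult del: meander_weight.simps)
    qed
  qed (use k less in auto)
qed

text \<open>Summability at the kernel point would bound the slope of the jump polynomial at 1 away from 0.\<close>

lemma summable_imp_tau_gt_1:
  assumes S: "summable (\<lambda>n. mpoly 1 n * R1 ^ n)"
  shows "t0 > 1"
proof -
  define m where "m = (\<lambda>k. \<Sum>n. mw n k * R1 ^ n)"
  define T where "T = (\<lambda>v. \<Sum>n. mpoly v n * R1 ^ n)"
  have sm: "summable (\<lambda>n. mw n k * R1 ^ n)" if "k \<in> {0..<int c}" for k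
    by (rule mw_R1_summable) (use that in auto)
  have le: "mpoly v n \<le> mpoly 1 n" "mpoly v n \<ge> 0" if v: "0 < v" "v \<le> 1" for v :: real and n
  proof -
    have "mw n k * v powi k \<le> mw n k" if "k \<in> {0..int d * int n}" for k
      using v that mw_nonneg by (intro mult_left_le) (auto simp: power_int_def power_le_one)
    thus "mpoly v n \<le> mpoly 1 n" unfolding mpoly_1 unfolding mpoly_def by (auto intro!: sum_mono)
    show "mpoly v n \<ge> 0" unfolding mpoly_def using v mw_nonneg by (auto intro!: sum_nonneg mult_nonneg_nonneg)
  qed
  have sv: "summable (\<lambda>n. mpoly v n * R1 ^ n)" if v: "0 < v" "v \<le> 1" for v :: real
    by (rule summable_comparison_test'[OF S, of 0])
       (use le[OF v] R1_pos in \<open>auto simp: abs_mult intro!: mult_right_mono\<close>)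
  \<comment> \<open>The kernel equation summed at z = R1, where the series at v = 1 dominates those
    for v in (0,1].\<close>
  have kern: "T v * (1 - R1 * PP v) = 1 - R1 * (\<Sum>k\<in>{0..<int c}. rneg v k * m k)" if v: "0 < v" "v \<le> 1" for v
  proof -
    have a: "(\<lambda>n. mpoly v n * R1 ^ n) sums T v" unfolding T_def by (rule summable_sums[OF sv[OF v]])
    have 1: "(\<lambda>n. mpoly v (Suc n) * R1 ^ Suc n) sums (T v - 1)"
      using a sums_Suc_iff[of "\<lambda>n. mpoly v n * R1 ^ n" "T v - 1"] by simp
    have b: "(\<lambda>n. \<Sum>k\<in>{0..<int c}. rneg v k * (mw n k * R1 ^ n)) sums (\<Sum>k\<in>{0..<int c}. rneg v k * m k)"
      unfolding m_def by (intro sums_sum sums_mult summable_sums sm)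
    have 2: "(\<lambda>n. R1 * PP v * (mpoly v n * R1 ^ n) - R1 * (\<Sum>k\<in>{0..<int c}. rneg v k * (mw n k * R1 ^ n)))
       sums (R1 * PP v * T v - R1 * (\<Sum>k\<in>{0..<int c}. rneg v k * m k))"
      by (intro sums_diff sums_mult a b)
    have "mpoly v (Suc n) * R1 ^ Suc n = R1 * PP v * (mpoly v n * R1 ^ n) - R1 * (\<Sum>k\<in>{0..<int c}. rneg v k * (mw n k * R1 ^ n))" for n
      by (rule mpoly_Suc_scaled) (use v in simp)
    hence "T v - 1 = R1 * PP v * T v - R1 * (\<Sum>k\<in>{0..<int c}. rneg v k * m k)"
      using sums_unique2[OF 1] 2 by simp
    thus ?thesis by (simp add: algebra_simps)
  qed
  have m_nn: "m k \<ge> 0" if "k \<in> {0..<int c}" for k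
    unfolding m_def by (rule suminf_nonneg[OF sm[OF that]]) (use mw_nonneg R1_pos in auto)
  have m0: "m 0 \<ge> 1"
  proof -
    have "(\<Sum>n\<in>{0}. mw n 0 * R1 ^ n) \<le> m 0" unfolding m_def
      by (rule sum_le_suminf[OF sm]) (use c1 mw_nonneg R1_pos in auto)
    thus ?thesis by simp
  qed
  \<comment> \<open>For v \<le> 1 each negative power of v is at least 1/v \<ge> 2 - v, so lowering
    v raises all escaping weights; at k = 0 the jump -c alone raises them by p(-c) (1 - v).\<close>
  have rneg_diff: "rneg v k - rneg 1 k \<ge> (if k = 0 then p (- int c) * (1 - v) else 0)" if v: "0 < v" "v \<le> 1" and k: "k \<in> {0..<int c}" for v :: real and k
  proof -
    have t: "v powi (k + l) - 1 \<ge> 1 - v" if "k + l < 0" for l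
    proof -
      have "v powi (k + l) = (1 / v) ^ nat (- (k + l))" using that by (simp add: power_int_def power_inverse divide_inverse)
      also have "(1 / v) ^ nat (- (k + l)) \<ge> (1 / v) ^ 1" using v that by (intro power_increasing) auto
      finally have "v powi (k + l) \<ge> 1 / v" by simp
      moreover have "1 / v \<ge> 2 - v"
      proof -
        have "v * (2 - v) \<le> 1" using zero_le_power2[of "1 - v"] by (simp add: power2_eq_square algebra_simps)
        thus ?thesis using v by (simp add: field_simps)
      qed
      ultimately show ?thesis by linarith
    qed
    have eq: "rneg v k - rneg 1 k = (\<Sum>l\<in>{l\<in>I. k + l < 0}. p l * (v powi (k + l) - 1))"
      unfolding rneg_def by (simp add: sum_subtractf right_diff_distrib)
    have nn: "p l * (v powi (k + l) - 1) \<ge> 0" if "k + l < 0" for l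
      using t[OF that] p_nn v by (intro mult_nonneg_nonneg) auto
    show ?thesis
    proof (cases "k = 0")
      case True
      have "p (- int c) * (1 - v) \<le> p (- int c) * (v powi (k + - int c) - 1)"
        using t[of "- int c"] True c1 p_nn by (intro mult_left_mono) auto
      also have "\<dots> \<le> (\<Sum>l\<in>{l\<in>I. k + l < 0}. p l * (v powi (k + l) - 1))"
        by (rule member_le_sum[of "- int c" "{l\<in>I. k + l < 0}" "\<lambda>l. p l * (v powi (k + l) - 1)"])
            (use True c1 nn finite_below[of k] in auto)
      finally show ?thesis using True eq by simp
    next
      case False
      show ?thesis unfolding eq using False nn by (auto intro!: sum_nonneg)
    qed
  qed
  have T1: "T 1 \<ge> 1"
  proof -
    have "(\<Sum>n\<in>{0}. mpoly 1 n * R1 ^ n) \<le> T 1" unfolding T_def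
      by (rule sum_le_suminf[OF S]) (use mpoly_1_nonneg R1_pos in auto)
    thus ?thesis by simp
  qed
  \<comment> \<open>At 1 the left side of \<open>kern\<close> vanishes. Comparing with
    \<open>kern\<close> at v isolates P(v) - P(1), and T v \<le> T 1 makes the bound independent of
    v.\<close>
  have slope: "(PP v - PP 1) / (v - 1) \<le> - p (- int c) / T 1" if v: "0 < v" "v < 1" for v :: real
  proof -
    have Rp: "R1 * PP 1 = 1" using PP_pos[of 1] by (simp add: R1_def)
    have k1: "1 = R1 * (\<Sum>k\<in>{0..<int c}. rneg 1 k * m k)" using kern[of 1] Rp by simp
    have "R1 * (T v * (PP v - PP 1)) = - (T v * (1 - R1 * PP v))" using Rp by (simp add: algebra_simps)
    also have "\<dots> = R1 * (\<Sum>k\<in>{0..<int c}. rneg v k * m k) - 1" using kern[of v] v by simp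
    also have "\<dots> = R1 * (\<Sum>k\<in>{0..<int c}. (rneg v k - rneg 1 k) * m k)"
      by (subst k1) (simp add: sum_subtractf left_diff_distrib right_diff_distrib)
    finally have "T v * (PP v - PP 1) = (\<Sum>k\<in>{0..<int c}. (rneg v k - rneg 1 k) * m k)" using R1_pos by simp
    also have "\<dots> \<ge> (rneg v 0 - rneg 1 0) * m 0"
    proof (rule member_le_sum[of 0 "{0..<int c}" "\<lambda>k. (rneg v k - rneg 1 k) * m k"])
      fix k assume "k \<in> {0..<int c} - {0}"
      thus "0 \<le> (rneg v k - rneg 1 k) * m k" using rneg_diff[of v k] v m_nn[of k] by (intro mult_nonneg_nonneg) auto
    qed (use c1 in auto)
    also have "(rneg v 0 - rneg 1 0) * m 0 \<ge> p (- int c) * (1 - v) * 1"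
    proof (rule mult_mono)
      show *: "p (- int c) * (1 - v) \<le> rneg v 0 - rneg 1 0" using rneg_diff[of v 0] v c1 by simp
      have "0 \<le> p (- int c) * (1 - v)" using p_nn v by simp
      thus "0 \<le> rneg v 0 - rneg 1 0" using * by linarith
    qed (use m0 in auto)
    finally have A: "p (- int c) * (1 - v) \<le> T v * (PP v - PP 1)" by simp
    have Tv: "T v \<le> T 1" "T v \<ge> 0"
    proof -
      show "T v \<le> T 1" unfolding T_def
        by (rule suminf_le[OF _ sv sv]) (use v le[of v] R1_pos in \<open>auto intro!: mult_right_mono\<close>)
      show "T v \<ge> 0" unfolding T_def by (rule suminf_nonneg[OF sv]) (use v le[of v] R1_pos in auto)
    qed
    have "0 < p (- int c) * (1 - v)" using p_c_pos v by simp
    hence "0 < T v * (PP v - PP 1)" using A by linarith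
    hence "PP v - PP 1 > 0" using Tv(2) by (simp add: zero_less_mult_iff)
    hence "T v * (PP v - PP 1) \<le> T 1 * (PP v - PP 1)" using Tv by (intro mult_right_mono) auto
    hence "p (- int c) * (1 - v) \<le> T 1 * (PP v - PP 1)" using A by linarith
    thus ?thesis using T1 v by (simp add: field_simps)
  qed
  have "((\<lambda>v. (PP v - PP 1) / (v - 1)) \<longlongrightarrow> D1 1) (at_left 1)"
    using has_field_derivative_at_within[OF PP_D1[of 1], of "{..<1}"] unfolding has_field_derivative_iff by simp
  moreover have "eventually (\<lambda>v. (PP v - PP 1) / (v - 1) \<le> - p (- int c) / T 1) (at_left (1::real))"
  proof (rule eventually_mono)
    show "eventually (\<lambda>v. v \<in> {0<..<1}) (at_left (1::real))" by (rule eventually_at_left_real) simp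
  qed (use slope in simp)
  ultimately have "D1 1 \<le> - p (- int c) / T 1" by (rule tendsto_upperbound) simp
  also have "\<dots> < 0" using p_c_pos T1 by simp
  finally show ?thesis by (rule D1_one_neg_imp_tau_gt)
qed

lemma Qcoef_Suc_le: "Qcoef p q (Suc m) \<le> q * mpoly 1 m"
proof -
  have "(\<Sum>j\<in>JN. mw m (int j)) \<ge> 0" by (intro sum_nonneg mw_nonneg)
  hence "mpoly 1 m - mw m 0 - (\<Sum>j\<in>JN. mw m (int j)) \<le> mpoly 1 m" using mw_nonneg[of m 0] by linarith
  thus ?thesis unfolding Qcoef_Suc using q_pos by (intro mult_left_mono) auto
qed

lemma Qcoef_R1_bound: "Qcoef p q n * R1 ^ n \<le> q * R1"
proof (cases n)
  case 0
  thus ?thesis using q_pos R1_pos by (simp add: Qcoef_0)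
next
  case (Suc m)
  have "Qcoef p q (Suc m) * R1 ^ Suc m \<le> q * mpoly 1 m * R1 ^ Suc m"
    using Qcoef_Suc_le R1_pos by (intro mult_right_mono) auto
  also have "\<dots> = q * R1 * (mpoly 1 m * R1 ^ m)" by (simp add: mult_ac)
  also have "\<dots> \<le> q * R1" using mpoly_1_scaled_le_1[of m] q_pos R1_pos by (simp add: mult_left_le)
  finally show ?thesis using Suc by simp
qed

lemma Q_radius_R1: "fps_conv_radius (Qfps p q) \<ge> R1"
  unfolding fps_conv_radius_def Qfps_def
  by (rule conv_radius_ge_of_bounded[of _ _ "q * R1"]) (use R1_pos Qcoef_R1_bound Qcoef_nonneg in auto)

text \<open>Q differs from q z M(z,1) by finitely many series, all convergent at R1, so Q converges
  there only if M(z,1) does. Otherwise the partial sums of Q at R1 exceed 1, which places the root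
  to the left of R1.\<close>

lemma rho0_of_tau_le_1:
  assumes t: "t0 \<le> 1"
  shows "\<exists>r<R1. is_rho0 c d p q r" "is_rho0 c d p q r \<Longrightarrow> r < R1"
proof -
  have ns: "\<not> summable (\<lambda>n. Qcoef p q n * R1 ^ n)"
  proof
    assume "summable (\<lambda>n. Qcoef p q n * R1 ^ n)"
    hence "summable (\<lambda>n. Qcoef p q (Suc n) * R1 ^ Suc n)" by (subst summable_Suc_iff)
    hence s: "summable (\<lambda>n. Qcoef p q (Suc n) * R1 ^ Suc n / (q * R1))" by (rule summable_divide)
    have "summable (\<lambda>n. Qcoef p q (Suc n) * R1 ^ Suc n / (q * R1) + mw n 0 * R1 ^ n + (\<Sum>j\<in>JN. mw n (int j) * R1 ^ n))"
      by (intro summable_add s summable_sum mw_R1_summable) (use JN_sub in auto)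
    also have "(\<lambda>n. Qcoef p q (Suc n) * R1 ^ Suc n / (q * R1) + mw n 0 * R1 ^ n + (\<Sum>j\<in>JN. mw n (int j) * R1 ^ n)) = (\<lambda>n. mpoly 1 n * R1 ^ n)"
    proof
      fix n
      have "Qcoef p q (Suc n) * R1 ^ Suc n / (q * R1) = (mpoly 1 n - mw n 0 - (\<Sum>j\<in>JN. mw n (int j))) * R1 ^ n"
        using q_pos R1_pos unfolding Qcoef_Suc by simp
      thus "Qcoef p q (Suc n) * R1 ^ Suc n / (q * R1) + mw n 0 * R1 ^ n + (\<Sum>j\<in>JN. mw n (int j) * R1 ^ n) = mpoly 1 n * R1 ^ n"
        by (simp only: left_diff_distrib sum_distrib_right)
    qed
    finally show False using summable_imp_tau_gt_1 t by simp
  qed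
  have "\<exists>N. (\<Sum>n<N. Qcoef p q n * R1 ^ n) > 1"
  proof (rule ccontr)
    assume "\<not> ?thesis"
    hence "summable (\<lambda>n. Qcoef p q n * R1 ^ n)"
      using Qcoef_nonneg R1_pos by (intro summableI_nonneg_bounded[of _ 1]) (auto simp: not_less)
    thus False using ns by blast
  qed
  then obtain N where N: "(\<Sum>n<N. Qcoef p q n * R1 ^ n) > 1" by blast
  have nn: "fps_nth (Qfps p q) n \<ge> 0" for n by (simp add: Qfps_def Qcoef_nonneg)
  obtain r where r: "0 < r" "r < R1" "eval_fps (Qfps p q) r = 1"
    using power_series_root[OF nn _ R1_pos Q_radius_R1] N by (auto simp: Qfps_def Qcoef_0)
  have "summable (\<lambda>n. Qcoef p q n * r ^ n)"
    using summable_fps[of r "Qfps p q"] less_le_trans[of "ereal r" "ereal R1", OF _ Q_radius_R1] r by (simp add: Qfps_def)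
  hence "is_rho0 c d p q r" using is_rho0I[of r] r R1_le by (simp add: Qfun_eval)
  thus "\<exists>r<R1. is_rho0 c d p q r" using r by (intro exI[of _ r]) auto
  show "r < R1" if "is_rho0 c d p q r" for r
  proof -
    obtain s where s: "0 < s" "s < R1" "Qfun p q s = 1" using r by (auto simp: Qfun_eval)
    hence "\<not> s < r" using that by (auto simp: is_rho0_def)
    thus ?thesis using s by simp
  qed
qed

end

section \<open>Rescaling of the variable z\<close>

definition fps_scale :: "real \<Rightarrow> real fps \<Rightarrow> real fps" where
  "fps_scale t f = f oo (fps_const t * fps_X)"

lemma fps_scale_nth [simp]: "fps_nth (fps_scale t f) n = t ^ n * fps_nth f n"
  by (simp add: fps_scale_def)

text \<open>Both coefficients pick up the same factor t^n, so the probabilities may be computed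
  after moving the relevant point to 1.\<close>

lemma fps_scale_quotient:
  assumes t: "t \<noteq> 0" and f0: "fps_nth f 0 = 0"
  shows "fps_nth (e * f ^ k) n / fps_nth (e * inverse (1 - f)) n =
    fps_nth (fps_scale t e * fps_scale t f ^ k) n / fps_nth (fps_scale t e * inverse (1 - fps_scale t f)) n"
proof -
  have X0: "fps_nth (fps_const t * fps_X) 0 = 0" by simp
  have "fps_scale t (e * f ^ k) = fps_scale t e * fps_scale t f ^ k"
    unfolding fps_scale_def fps_compose_mult_distrib[OF X0] fps_compose_power[OF X0] ..
  moreover have "fps_scale t (e * inverse (1 - f)) = fps_scale t e * inverse (1 - fps_scale t f)"
    unfolding fps_scale_def fps_compose_mult_distrib[OF X0]
    by (subst fps_inverse_compose[OF X0]) (use f0 in \<open>simp_all add: fps_compose_sub_distrib\<close>)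
  ultimately show ?thesis
    using t fps_scale_nth[of t "e * f ^ k" n] fps_scale_nth[of t "e * inverse (1 - f)" n] by simp
qed

lemma eval_fps_scale: "eval_fps (fps_scale t f) z = eval_fps f (t * z)"
  by (simp add: eval_fps_def power_mult_distrib mult_ac)

lemma fps_scale_deriv: "fps_deriv (fps_scale t f) = fps_const t * fps_scale t (fps_deriv f)"
  by (rule fps_ext) simp

lemma fps_conv_radius_scale_gt_1:
  assumes t: "t > 0" and r: "ereal t < fps_conv_radius f"
  shows "fps_conv_radius (fps_scale t f) > 1"
proof -
  obtain s where s: "ereal t < s" "s < fps_conv_radius f" using dense[OF r] by blast
  then obtain s' where s': "s = ereal s'" by (cases s) auto
  have ss: "summable (\<lambda>n. fps_nth f n * s' ^ n)" by (rule summable_fps) (use s s' t in auto)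
  have "summable (\<lambda>n. fps_nth (fps_scale t f) n * (s' / t) ^ n)"
    using ss t by (simp add: power_divide)
  hence "conv_radius (fps_nth (fps_scale t f)) \<ge> ereal (norm (s' / t))" by (rule conv_radius_geI)
  moreover have "1 < ereal (norm (s' / t))" using s s' t by simp
  ultimately show ?thesis unfolding fps_conv_radius_def by (rule less_le_trans[rotated])
qed

lemma eval_fps_const_mult:
  fixes f :: "real fps"
  assumes "ereal (norm z) < fps_conv_radius f"
  shows "eval_fps (fps_const a * f) z = a * eval_fps f z"
  using assms by (simp add: eval_fps_mult)

lemma cfps_const: "cfps (fps_const a) = fps_const (of_real a)"
  by (rule fps_ext) simp

lemma cfps_X: "cfps fps_X = fps_X"
  by (rule fps_ext) simp

section \<open>The tilted walk and the three regimes\<close>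

context catastrophe_walk
begin

lemma cat_prob_scale:
  "t \<noteq> 0 \<Longrightarrow> cat_prob p q n k =
     fps_nth (fps_scale t (Efps p) * fps_scale t (Qfps p q) ^ k) n
     / fps_nth (fps_scale t (Efps p) * inverse (1 - fps_scale t (Qfps p q))) n"
  unfolding cat_prob_def by (rule fps_scale_quotient) (simp_all add: Qfps_def Qcoef_0)

lemma N_mw: "N.mw n k = mw n k * r0 ^ n * t0 powi k"
proof -
  have "pn = (\<lambda>l. p l * t0 powi l * r0)" by (simp add: pn_def fun_eq_iff)
  thus ?thesis using meander_weight_scale[of t0 p r0 I n k] tau_props by simp
qed

text \<open>Total weights, which are values at u = 1, become values at u = 1/\<tau> of the tilted
  walk. This is where the comparison of \<tau> with 1 enters, as \<open>N.Mu_expansion\<close> is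
  about u < 1.\<close>

lemma N_mpoly: "N.mpoly (1 / t0) n = mpoly 1 n * r0 ^ n"
proof -
  have "t0 powi k * (1 / t0) powi k = 1" for k
    using tau_props by (simp add: power_int_divide_distrib)
  hence "N.mw n k * (1 / t0) powi k = mw n k * r0 ^ n" for k by (simp add: N_mw mult.assoc)
  thus ?thesis unfolding N.mpoly_def mpoly_1 by (simp add: sum_distrib_right)
qed

definition Qn :: "real fps" where "Qn = fps_scale r0 (Qfps p q)"

lemma E_scaled: "fps_scale r0 (Efps p) = N.Mk 0"
  by (rule fps_ext) (simp add: Efps_def Ecoef_eq N.Mk_def N_mw)

lemma Q_scaled:
  "Qn = fps_const (q * r0) * (fps_X * (N.Mu (1 / t0) - N.Mk 0 - (\<Sum>j\<in>JN. fps_const ((1 / t0) ^ j) * N.Mk j)))"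
proof (rule fps_ext)
  fix n
  show "fps_nth Qn n = fps_nth (fps_const (q * r0) * (fps_X * (N.Mu (1 / t0) - N.Mk 0 - (\<Sum>j\<in>JN. fps_const ((1 / t0) ^ j) * N.Mk j)))) n"
  proof (cases n)
    case 0
    thus ?thesis by (simp add: Qn_def Qfps_def Qcoef_0)
  next
    case (Suc m)
    have j: "(1 / t0) ^ j * N.mw m (int j) = mw m (int j) * r0 ^ m" for j
      using tau_props by (simp add: N_mw power_divide)
    have "fps_nth Qn (Suc m) = r0 ^ Suc m * (q * (mpoly 1 m - mw m 0 - (\<Sum>j\<in>JN. mw m (int j))))"
      by (simp add: Qn_def Qfps_def Qcoef_Suc)
    also have "\<dots> = q * r0 * (mpoly 1 m * r0 ^ m - mw m 0 * r0 ^ m - (\<Sum>j\<in>JN. mw m (int j) * r0 ^ m))"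
      unfolding sum_distrib_right[symmetric] by (simp only: power_Suc left_diff_distrib right_diff_distrib mult_ac)
    also have "\<dots> = q * r0 * (N.mpoly (1 / t0) m - N.mw m 0 - (\<Sum>j\<in>JN. (1 / t0) ^ j * N.mw m (int j)))"
      unfolding j N_mpoly by (simp add: N_mw)
    finally show ?thesis by (simp add: Suc fps_sum_nth N.Mu_def N.Mk_def)
  qed
qed

lemma Qn_nth: "fps_nth Qn = (\<lambda>n. Qcoef p q n * r0 ^ n)"
  by (simp add: fun_eq_iff Qn_def Qfps_def)

lemma Qn_nonneg: "fps_nth Qn n \<ge> 0"
  using Qcoef_nonneg rho_props by (simp add: Qn_def Qfps_def)

lemma Qn_pos: "n \<ge> c + 2 \<Longrightarrow> fps_nth Qn n > 0"
  using Qcoef_pos rho_props by (simp add: Qn_def Qfps_def)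

lemma Qn_0: "fps_nth Qn 0 = 0"
  by (simp add: Qn_def Qfps_def Qcoef_0)

lemma Q_radius:
  assumes "t0 > 1"
  shows "fps_conv_radius (Qfps p q) \<ge> r0"
  unfolding fps_conv_radius_def Qfps_def
proof (rule conv_radius_ge_of_bounded[of _ _ "q * r0"])
  fix n
  have "Qcoef p q n * r0 ^ n \<le> q * r0"
  proof (cases n)
    case 0
    thus ?thesis using q_pos rho_props by (simp add: Qcoef_0)
  next
    case (Suc m)
    have "N.mpoly (1 / t0) m \<le> 1" using assms by (intro N.mpoly_le_1) auto
    hence "mpoly 1 m * r0 ^ m \<le> 1" by (simp add: N_mpoly)
    hence "q * r0 * (mpoly 1 m * r0 ^ m) \<le> q * r0" using q_pos rho_props(1) by (intro mult_left_le) auto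
    moreover have "Qcoef p q (Suc m) * r0 ^ Suc m \<le> q * mpoly 1 m * r0 ^ Suc m"
      using Qcoef_Suc_le rho_props by (intro mult_right_mono) auto
    ultimately show ?thesis using Suc by (simp add: mult_ac)
  qed
  thus "\<bar>fps_nth (Abs_fps (Qcoef p q)) n\<bar> * r0 ^ n \<le> q * r0" using Qcoef_nonneg by simp
qed (use rho_props in auto)

lemma E_radius: "fps_conv_radius (Efps p) \<ge> r0"
  unfolding fps_conv_radius_def Efps_def
proof (rule conv_radius_ge_of_bounded[of _ _ 1])
  fix n
  have "mw n 0 * r0 ^ n \<le> 1" using N.mw_le_1[of n 0] by (simp add: N_mw)
  thus "\<bar>fps_nth (Abs_fps (Ecoef p)) n\<bar> * r0 ^ n \<le> 1" using mw_nonneg[of n 0] by (simp add: Ecoef_eq)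
qed (use rho_props in auto)

lemma Qn_expansion:
  assumes t: "t0 > 1"
  shows "\<exists>\<eta>>0. sqrt_expansion (cfps Qn) (of_real (Qfun p q r0)) (- of_real \<eta>) \<and> fps_nth Qn sums Qfun p q r0"
proof -
  obtain a b where ab: "sqrt_expansion (cfps (N.Mu (1 / t0))) a b" using N.Mu_expansion[of "1 / t0"] t by auto
  have "\<forall>k. \<exists>ab. sqrt_expansion (cfps (N.Mk k)) (fst ab) (snd ab)"
  proof
    fix k
    obtain a b where "sqrt_expansion (cfps (N.Mk k)) a b" using sqrt_expansion_exists[OF N.Mk_radius N.Mk_analytic] by blast
    thus "\<exists>ab. sqrt_expansion (cfps (N.Mk k)) (fst ab) (snd ab)" by (intro exI[of _ "(a, b)"]) simp
  qed
  from choice[OF this] obtain g where g: "\<And>k. sqrt_expansion (cfps (N.Mk k)) (fst (g k)) (snd (g k))" by blast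
  have "cfps Qn = fps_const (of_real (q * r0)) * (fps_X * (cfps (N.Mu (1 / t0)) - cfps (N.Mk 0)
      - (\<Sum>j\<in>JN. fps_const (of_real ((1 / t0) ^ j)) * cfps (N.Mk j))))"
    unfolding Q_scaled cfps_mult cfps_diff cfps_sum cfps_const cfps_X ..
  moreover have "\<exists>a b. sqrt_expansion (fps_const (of_real (q * r0)) * (fps_X * (cfps (N.Mu (1 / t0)) - cfps (N.Mk 0)
      - (\<Sum>j\<in>JN. fps_const (of_real ((1 / t0) ^ j)) * cfps (N.Mk j))))) a b"
    by (intro exI) (rule sqrt_expansion_cmult sqrt_expansion_mult sqrt_expansion_X sqrt_expansion_diff sqrt_expansion_sum ab g)+
  ultimately obtain a' b' where ab': "sqrt_expansion (cfps Qn) a' b'" by auto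
  then obtain l \<eta> where l: "a' = of_real l" "b' = - of_real \<eta>" "fps_nth Qn sums l"
    using sqrt_expansion_nonneg[OF Qn_nonneg ab'] by blast
  have "l = Qfun p q r0" using l(3) unfolding Qn_nth by (simp add: Qfun_def sums_iff)
  \<comment> \<open>So far only \<eta> \<ge> 0 is available. Subtracting a small multiple of z^(c+2)
    E from Q leaves non-negative coefficients, so the coefficient of s stays \<le> 0; hence \<eta>
    is at least that multiple of the corresponding positive quantity E1 C of E.\<close>
  moreover have "\<eta> > 0"
  proof -
    obtain E1 where E1: "E1 \<ge> 1" "sqrt_expansion (cfps (N.Mk 0)) (of_real E1) (- of_real (E1 * N.C))"
      using N.E_expansion by blast
    define a where "a = q * p (int d) ^ (c + 1) * r0 ^ (c + 2)"
    have a: "a > 0" using q_pos p_d_pos rho_props by (simp add: a_def)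
    define F where "F = Qn - fps_const a * (fps_X ^ (c + 2) * N.Mk 0)"
    have Fn: "fps_nth F n \<ge> 0" for n
    proof (cases "n < c + 2")
      case True
      thus ?thesis using Qn_nonneg[of n] by (simp add: F_def fps_X_power_mult_nth del: power_Suc add_2_eq_Suc')
    next
      case False
      then obtain m where m: "n = m + (c + 2)" by (metis add.commute le_Suc_ex not_less)
      have "q * p (int d) ^ (c + 1) * mw m 0 * r0 ^ n \<le> Qcoef p q n * r0 ^ n"
        using Qcoef_ge_E[of m] rho_props m by (intro mult_right_mono) auto
      also have "q * p (int d) ^ (c + 1) * mw m 0 * r0 ^ n = a * (mw m 0 * r0 ^ m)"
        unfolding m a_def power_add[of r0 m] by (simp only: mult_ac)
      finally show ?thesis
        by (simp add: F_def fps_X_power_mult_nth m N.Mk_def N_mw Qn_nth del: power_Suc add_2_eq_Suc')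
    qed
    have "cfps F = cfps Qn - fps_const (of_real a) * (fps_X ^ (c + 2) * cfps (N.Mk 0))"
      unfolding F_def cfps_mult cfps_diff cfps_const cfps_power cfps_X ..
    moreover have "sqrt_expansion (cfps Qn - fps_const (of_real a) * (fps_X ^ (c + 2) * cfps (N.Mk 0)))
      (of_real l - of_real a * (1 ^ (c + 2) * of_real E1))
      (- of_real \<eta> - of_real a * (1 ^ (c + 2) * - of_real (E1 * N.C) + (of_nat (c + 2) * 1 ^ (c + 2 - 1) * 0) * of_real E1))"
      by (intro sqrt_expansion_diff sqrt_expansion_cmult sqrt_expansion_mult sqrt_expansion_power sqrt_expansion_X E1(2) ab'[unfolded l])
    ultimately have "sqrt_expansion (cfps F) (of_real l - of_real a * of_real E1) (- of_real (\<eta> - a * (E1 * N.C)))" by simp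
    from sqrt_expansion_nonneg[OF Fn this] obtain \<eta>' where
      "- complex_of_real (\<eta> - a * (E1 * N.C)) = - of_real \<eta>'" "\<eta>' \<ge> 0" by blast
    hence "\<eta> \<ge> a * (E1 * N.C)" by (simp only: neg_equal_iff_equal of_real_eq_iff)
    moreover have "a * (E1 * N.C) > 0" using a E1 N.C_pos by simp
    ultimately show ?thesis by linarith
  qed
  ultimately show ?thesis using ab' l by auto
qed

text \<open>On the real axis the expansion in s is the required Puiseux expansion, because its
  remainder factor is bounded. For uniqueness, (e - \<eta>) sqrt(1 - z/\<rho>) = O(1 - z/\<rho>)
  forces e = \<eta>.\<close>

lemma eta_eq:
  assumes A: "sqrt_expansion (cfps Qn) (of_real (Qfun p q r0)) (- of_real \<eta>)"
  shows "eta c d p q = \<eta>"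
  unfolding eta_def
proof (rule the_equality)
  have r0: "r0 > 0" by (rule rho_props)
  have ev: "eventually (\<lambda>z. z \<in> {0<..<r0}) (at_left r0)" by (rule eventually_at_left_real[OF r0])
  obtain G where G: "analytic_upto lens G"
    "\<forall>s\<in>lens. eval_fps (cfps Qn) (1 - s\<^sup>2) = of_real (Qfun p q r0) + - of_real \<eta> * s + s\<^sup>2 * G s"
    and rad: "fps_conv_radius (cfps Qn) \<ge> 1"
    using A unfolding sqrt_expansion_def by blast
  obtain B where B: "\<forall>s\<in>lens. norm (G s) \<le> B" using analytic_upto_bounded[OF G(1) bounded_lens] by blast
  show mem: "(\<lambda>z. Qfun p q z - (Qfun p q r0 - \<eta> * sqrt (1 - z / r0))) \<in> O[at_left r0](\<lambda>z. 1 - z / r0)"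
  proof (rule bigoI[of _ B])
    show "\<forall>\<^sub>F z in at_left r0. norm (Qfun p q z - (Qfun p q r0 - \<eta> * sqrt (1 - z / r0))) \<le> B * norm (1 - z / r0)"
      using ev
    proof (rule eventually_mono)
      fix z assume z: "z \<in> {0<..<r0}"
      define s where "s = sqrt (1 - z / r0)"
      have s: "0 < s" "s < 1" "s\<^sup>2 = 1 - z / r0" using z by (auto simp: s_def)
      have sl: "complex_of_real s \<in> lens" by (rule lens_real[OF s(1,2)])
      have zz: "1 - (complex_of_real s)\<^sup>2 = of_real (z / r0)" 
      proof -
        have "complex_of_real (1 - s\<^sup>2) = of_real (z / r0)" unfolding s(3) by simp
        thus ?thesis by simp
      qed
      have "ereal \<bar>z / r0\<bar> < fps_conv_radius Qn"
        using norm_less_radius[of "fps_conv_radius Qn" "complex_of_real (z / r0)"] rad z r0 by (simp add: fps_conv_radius_cfps norm_divide)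
      hence "eval_fps (cfps Qn) (of_real (z / r0)) = of_real (eval_fps Qn (z / r0))" by (rule eval_cfps_of_real)
      also have "eval_fps Qn (z / r0) = Qfun p q z" using r0 by (simp add: Qn_def eval_fps_scale Qfun_eval)
      finally have "of_real (Qfun p q z) = of_real (Qfun p q r0) + - of_real \<eta> * of_real s + (of_real s)\<^sup>2 * G (of_real s)"
        using bspec[OF G(2) sl] unfolding zz by (simp only:)
      hence "complex_of_real (Qfun p q z - (Qfun p q r0 - \<eta> * s)) = (of_real s)\<^sup>2 * G (of_real s)" by simp
      hence "norm (complex_of_real (Qfun p q z - (Qfun p q r0 - \<eta> * s))) = norm ((of_real s)\<^sup>2 * G (of_real s))" by (simp only:)
      hence "\<bar>Qfun p q z - (Qfun p q r0 - \<eta> * s)\<bar> = s\<^sup>2 * norm (G (of_real s))"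
        by (simp only: norm_of_real norm_mult norm_power power2_abs)
      also have "\<dots> \<le> s\<^sup>2 * B" using B sl by (intro mult_left_mono) auto
      finally show "norm (Qfun p q z - (Qfun p q r0 - \<eta> * sqrt (1 - z / r0))) \<le> B * norm (1 - z / r0)"
        using z r0 unfolding s(3) by (simp add: s_def mult.commute)
    qed
  qed
  fix e assume e: "(\<lambda>z. Qfun p q z - (Qfun p q r0 - e * sqrt (1 - z / r0))) \<in> O[at_left r0](\<lambda>z. 1 - z / r0)"
  from sum_in_bigo(2)[OF e mem] have "(\<lambda>z. (e - \<eta>) * sqrt (1 - z / r0)) \<in> O[at_left r0](\<lambda>z. 1 - z / r0)"
    by (simp add: algebra_simps)
  then obtain K where K: "\<forall>\<^sub>F z in at_left r0. norm ((e - \<eta>) * sqrt (1 - z / r0)) \<le> K * norm (1 - z / r0)"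
    by (rule landau_o.bigE)
  have "\<forall>\<^sub>F z in at_left r0. \<bar>e - \<eta>\<bar> \<le> K * sqrt (1 - z / r0)"
    using eventually_conj[OF K ev]
  proof (rule eventually_mono, elim conjE)
    fix z assume z: "z \<in> {0<..<r0}" and k: "norm ((e - \<eta>) * sqrt (1 - z / r0)) \<le> K * norm (1 - z / r0)"
    have pos: "1 - z / r0 > 0" using z by simp
    hence "\<bar>e - \<eta>\<bar> * sqrt (1 - z / r0) \<le> K * sqrt (1 - z / r0) * sqrt (1 - z / r0)"
      using k by (simp add: abs_mult mult.assoc)
    thus "\<bar>e - \<eta>\<bar> \<le> K * sqrt (1 - z / r0)" using pos by (simp del: real_sqrt_mult_self)
  qed
  moreover have "((\<lambda>z. K * sqrt (1 - z / r0)) \<longlongrightarrow> K * sqrt (1 - r0 / r0)) (at_left r0)"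
    using r0 by (intro tendsto_intros) auto
  ultimately have "\<bar>e - \<eta>\<bar> \<le> K * sqrt (1 - r0 / r0)"
    by (intro tendsto_lowerbound[of "\<lambda>z. K * sqrt (1 - z / r0)" _ "at_left r0"]) simp_all
  thus "e = \<eta>" using r0 by simp
qed

text \<open>The tilted step variance is \<rho> \<tau>^2 P''(\<tau>) with \<rho> = 1/P(\<tau>). This
  is the origin of the quotient C/\<tau> in the subcritical law.\<close>

lemma NC_eq: "sqrt (2 * jump_poly c d p t0 / deriv (deriv (jump_poly c d p)) t0) / t0 = N.C"
proof -
  have t: "t0 > 0" by (rule tau_props)
  have "N.V = r0 * t0\<^sup>2 * D2 t0" unfolding N.V_def D2_def sum_distrib_left
    using t by (intro sum.cong refl) (simp add: pn_def power_int_diff field_simps power2_eq_square)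
  hence "2 / N.V = 2 * PP t0 / D2 t0 / t0\<^sup>2" using rho_props PP_pos[OF t] by simp
  hence "N.C = sqrt (2 * PP t0 / D2 t0 / t0\<^sup>2)" by (simp only: N.C_def)
  also have "\<dots> = sqrt (2 * PP t0 / D2 t0) / t0" using t by (subst real_sqrt_divide) simp
  finally show ?thesis using t by (simp add: deriv2_jump_poly jump_poly_eq)
qed

text \<open>If Q(\<rho>) were 1, then \<rho> itself would be the root; if it were larger, a partial
  sum at \<rho> would exceed 1 and produce a smaller root.\<close>

lemma no_rho0:
  assumes n: "\<nexists>r. is_rho0 c d p q r"
  shows "t0 > 1" "0 < Qfun p q r0" "Qfun p q r0 < 1"
proof -
  show t: "t0 > 1" using rho0_of_tau_le_1(1) n by (meson not_le)
  obtain \<eta> where "fps_nth Qn sums Qfun p q r0" using Qn_expansion[OF t] by blast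
  hence s: "(\<lambda>n. Qcoef p q n * r0 ^ n) sums Qfun p q r0" by (simp only: Qn_nth)
  have "0 < (\<Sum>n. Qcoef p q n * r0 ^ n)"
    by (rule suminf_pos2[of _ "c + 2"]) (use s Qcoef_nonneg Qcoef_pos[of "c + 2"] rho_props in \<open>auto simp: sums_iff\<close>)
  thus "0 < Qfun p q r0" by (simp add: Qfun_def)
  show "Qfun p q r0 < 1"
  proof (rule ccontr)
    assume "\<not> Qfun p q r0 < 1"
    then consider "Qfun p q r0 = 1" | "Qfun p q r0 > 1" by linarith
    thus False
    proof cases
      case 1
      have "is_rho0 c d p q r0" by (rule is_rho0I) (use 1 s rho_props in \<open>auto simp: sums_iff\<close>)
      thus False using n by blast
    next
      case 2
      have "eventually (\<lambda>N. (\<Sum>n<N. Qcoef p q n * r0 ^ n) > 1) sequentially"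
        using s 2 unfolding sums_def by (rule order_tendstoD)
      then obtain N where N: "(\<Sum>n<N. Qcoef p q n * r0 ^ n) > 1" using eventually_happens'[OF sequentially_bot] by blast
      obtain r where r: "0 < r" "r < r0" "eval_fps (Qfps p q) r = 1"
        using power_series_root[of "Qfps p q" r0 N] N rho_props Q_radius[OF t] Qcoef_nonneg by (auto simp: Qfps_def Qcoef_0)
      have "summable (\<lambda>n. Qcoef p q n * r ^ n)"
        using summable_fps[of r "Qfps p q"] less_le_trans[of "ereal r" "ereal r0", OF _ Q_radius[OF t]] r by (simp add: Qfps_def)
      hence "is_rho0 c d p q r" using r by (intro is_rho0I) (auto simp: Qfun_eval)
      thus False using n by blast
    qed
  qed
qed

theorem subcritical:
  assumes n: "\<nexists>r. is_rho0 c d p q r"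
    and lam: "lam = Qfun p q r0" and Drho: "Drho = 1 / (1 - Qfun p q r0)"
    and Cc: "Cc = sqrt (2 * jump_poly c d p t0 / deriv (deriv (jump_poly c d p)) t0)"
  shows "\<exists>g. g \<in> O(\<lambda>n. 1 / real n) \<and> (\<forall>\<^sub>F n in at_top. cat_prob p q n k =
     (real k * eta c d p q / lam + Cc / t0) * lam ^ k / (eta c d p q * Drho\<^sup>2 + (Cc / t0) * Drho) * (1 + g n))"
proof -
  note l = no_rho0[OF n]
  obtain \<eta> where \<eta>: "\<eta> > 0" "sqrt_expansion (cfps Qn) (of_real (Qfun p q r0)) (- of_real \<eta>)" "fps_nth Qn sums Qfun p q r0"
    using Qn_expansion[OF l(1)] by blast
  obtain E1 where E1: "E1 \<ge> 1" "sqrt_expansion (cfps (N.Mk 0)) (of_real E1) (- of_real (E1 * N.C))"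
    using N.E_expansion by blast
  have "\<exists>g. g \<in> O(\<lambda>n. 1 / real n) \<and> (\<forall>\<^sub>F n in at_top.
     fps_nth (N.Mk 0 * Qn ^ k) n / fps_nth (N.Mk 0 * inverse (1 - Qn)) n =
       (real k * \<eta> / lam + N.C) * lam ^ k / (\<eta> * Drho\<^sup>2 + N.C * Drho) * (1 + g n))"
    unfolding lam
    by (rule subcritical_composition[OF E1(2) _ N.C_pos(1) \<eta>(2) l(2,3) _ Qn_nonneg \<eta>(3) Qn_0 Drho]) (use E1 \<eta> in auto)
  thus ?thesis using cat_prob_scale[of r0 _ k] rho_props(1)
    by (simp add: Cc NC_eq eta_eq[OF \<eta>(2)] E_scaled Qn_def)
qed

theorem critical:
  assumes r: "is_rho0 c d p q r0"
  shows "\<forall>x\<ge>0. (\<lambda>n. \<Sum>k\<in>{k. k \<le> n \<and> real k / (sqrt 2 / eta c d p q * sqrt (real n)) \<le> x}. cat_prob p q n k)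
           \<longlonglongrightarrow> 1 - exp (- x\<^sup>2 / 2)"
    and "(\<lambda>n. \<Sum>k\<le>n. real k * cat_prob p q n k) \<sim>[at_top] (\<lambda>n. sqrt (pi * real n) / eta c d p q)"
proof -
  \<comment> \<open>For \<tau> \<le> 1 any root would lie below R1 \<le> \<rho>, contrary to the
    root being \<rho>.\<close>
  have t: "t0 > 1" using rho0_of_tau_le_1(2)[of r0] r R1_le by (meson not_le)
  have l: "Qfun p q r0 = 1" using r by (simp add: is_rho0_def)
  obtain \<eta> where \<eta>: "\<eta> > 0" "sqrt_expansion (cfps Qn) (of_real (Qfun p q r0)) (- of_real \<eta>)" "fps_nth Qn sums Qfun p q r0"
    using Qn_expansion[OF t] by blast
  obtain E1 where E1: "E1 \<ge> 1" "sqrt_expansion (cfps (N.Mk 0)) (of_real E1) (- of_real (E1 * N.C))"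
    using N.E_expansion by blast
  interpret K: critical_composition "N.Mk 0" Qn E1 \<eta> "- of_real (E1 * N.C)" "c + 2"
    by unfold_locales (use E1 \<eta> l Qn_nonneg Qn_0 Qn_pos N.mw_nonneg in \<open>auto simp: N.Mk_def\<close>)
  have pr: "K.pr n k = cat_prob p q n k" for n k
    unfolding K.pr_def using cat_prob_scale[of r0 n k] rho_props(1) by (simp add: E_scaled Qn_def)
  show "\<forall>x\<ge>0. (\<lambda>n. \<Sum>k\<in>{k. k \<le> n \<and> real k / (sqrt 2 / eta c d p q * sqrt (real n)) \<le> x}. cat_prob p q n k)
           \<longlonglongrightarrow> 1 - exp (- x\<^sup>2 / 2)"
    using K.rayleigh_limit unfolding pr eta_eq[OF \<eta>(2)] by blast
  show "(\<lambda>n. \<Sum>k\<le>n. real k * cat_prob p q n k) \<sim>[at_top] (\<lambda>n. sqrt (pi * real n) / eta c d p q)"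
    using K.mean_asymp unfolding pr eta_eq[OF \<eta>(2)] .
qed

theorem supercritical:
  assumes r: "is_rho0 c d p q r" "r < r0"
    and Q1: "Q1 = deriv (Qfun p q) r" and Q2: "Q2 = deriv (deriv (Qfun p q)) r"
  shows "(\<lambda>n. \<Sum>k\<in>{k. k \<le> n \<and> (real k - 1 / (r * Q1) * real n)
              / (sqrt ((r * Q2 + Q1 - r * Q1\<^sup>2) / (r\<^sup>2 * Q1 ^ 3)) * sqrt (real n)) \<le> x}. cat_prob p q n k)
           \<longlonglongrightarrow> std_gauss_cdf x"
proof -
  have r0: "r > 0" "Qfun p q r = 1" using r by (auto simp: is_rho0_def)
  \<comment> \<open>For \<tau> \<le> 1 convergence is known only up to R1, but then the root lies
    below R1 as well.\<close>
  have rad: "ereal r < fps_conv_radius (Qfps p q)"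
  proof (cases "t0 > 1")
    case True
    show ?thesis using less_le_trans[OF _ Q_radius[OF True], of "ereal r"] r by simp
  next
    case False
    thus ?thesis using less_le_trans[OF _ Q_radius_R1, of "ereal r"] rho0_of_tau_le_1(2)[OF _ r(1)] by simp
  qed
  have radE: "ereal r < fps_conv_radius (Efps p)" using less_le_trans[OF _ E_radius, of "ereal r"] r by simp
  have sm: "summable (\<lambda>n. Qcoef p q n * r ^ n)" using summable_fps[of r "Qfps p q"] rad r0 by (simp add: Qfps_def)
  interpret S: supercritical_composition "fps_scale r (Efps p)" "fps_scale r (Qfps p q)" "c + 2"
  proof
    show "fps_nth (fps_scale r (Efps p)) n \<ge> 0" for n using r0 mw_nonneg by (simp add: Efps_def Ecoef_eq)
    show "fps_nth (fps_scale r (Efps p)) 0 > 0" by (simp add: Efps_def Ecoef_eq)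
    show "fps_nth (fps_scale r (Qfps p q)) n \<ge> 0" for n using r0 Qcoef_nonneg by (simp add: Qfps_def)
    show "fps_nth (fps_scale r (Qfps p q)) sums 1"
    proof -
      have "fps_nth (fps_scale r (Qfps p q)) = (\<lambda>n. Qcoef p q n * r ^ n)" by (simp add: fun_eq_iff Qfps_def)
      thus ?thesis using sm r0 by (simp add: Qfun_def sums_iff)
    qed
    show "fps_nth (fps_scale r (Qfps p q)) 0 = 0" by (simp add: Qfps_def Qcoef_0)
    show "fps_nth (fps_scale r (Qfps p q)) n > 0" if "n \<ge> c + 2" for n using Qcoef_pos[OF that] r0 by (simp add: Qfps_def)
    show "fps_conv_radius (fps_scale r (Efps p)) > 1" by (rule fps_conv_radius_scale_gt_1[OF r0(1) radE])
    show "fps_conv_radius (fps_scale r (Qfps p q)) > 1" by (rule fps_conv_radius_scale_gt_1[OF r0(1) rad])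
  qed
  let ?F = "Qfps p q"
  have rad1: "ereal r < fps_conv_radius (fps_deriv ?F)" by (rule less_le_trans[OF rad fps_conv_radius_deriv])
  have rad2: "ereal r < fps_conv_radius (fps_deriv (fps_deriv ?F))" by (rule less_le_trans[OF rad1 fps_conv_radius_deriv])
  have d1: "eval_fps (fps_deriv ?F) r = Q1" unfolding Q1 Qfun_eval by (rule eval_fps_deriv) (use rad r0 in simp)
  have d2: "eval_fps (fps_deriv (fps_deriv ?F)) r = Q2"
  proof -
    have "eventually (\<lambda>z. z \<in> eball 0 (fps_conv_radius ?F)) (nhds r)"
      by (rule eventually_nhds_in_open) (use rad r0 in \<open>auto simp: in_eball_iff\<close>)
    hence "eventually (\<lambda>z. deriv (Qfun p q) z = eval_fps (fps_deriv ?F) z) (nhds r)"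
      by (rule eventually_mono) (simp add: Qfun_eval eval_fps_deriv in_eball_iff)
    hence "Q2 = deriv (eval_fps (fps_deriv ?F)) r" unfolding Q2 by (rule deriv_cong_ev) simp
    thus ?thesis using eval_fps_deriv[of r "fps_deriv ?F"] rad1 r0 by simp
  qed
  have sc1: "fps_conv_radius (fps_scale r (fps_deriv ?F)) > 1" by (rule fps_conv_radius_scale_gt_1[OF r0(1) rad1])
  have sc2: "fps_conv_radius (fps_scale r (fps_deriv (fps_deriv ?F))) > 1" by (rule fps_conv_radius_scale_gt_1[OF r0(1) rad2])
  have S1: "S.Q1 = r * Q1"
    unfolding S.Q1_def fps_scale_deriv
    by (subst eval_fps_const_mult) (use sc1 d1 in \<open>simp_all add: eval_fps_scale one_ereal_def\<close>)
  have S2: "S.Q2 = r\<^sup>2 * Q2"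
  proof -
    have "fps_deriv (fps_deriv (fps_scale r ?F)) = fps_const (r\<^sup>2) * fps_scale r (fps_deriv (fps_deriv ?F))"
      by (rule fps_ext) (simp add: power2_eq_square)
    thus ?thesis unfolding S.Q2_def
      by (simp only:) (subst eval_fps_const_mult, use sc2 d2 in \<open>simp_all add: eval_fps_scale one_ereal_def\<close>)
  qed
  \<comment> \<open>With the rescaled derivatives r Q1 and r^2 Q2, one factor r cancels between
    numerator and denominator.\<close>
  have "S.sig = sqrt ((r * Q2 + Q1 - r * Q1\<^sup>2) / (r\<^sup>2 * Q1 ^ 3))"
  proof -
    have "(r\<^sup>2 * Q2 + r * Q1 - (r * Q1)\<^sup>2) / (r * Q1) ^ 3 = (r * (r * Q2 + Q1 - r * Q1\<^sup>2)) / (r * (r\<^sup>2 * Q1 ^ 3))"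
      by (simp add: power2_eq_square power3_eq_cube algebra_simps)
    thus ?thesis unfolding S.sig_def S1 S2 using r0 by simp
  qed
  moreover have "S.pr n k = cat_prob p q n k" for n k
    unfolding S.pr_def using cat_prob_scale[of r n k] r0 by simp
  moreover have "cdf std_normal_distribution x = std_gauss_cdf x" by (simp add: cdf_def std_gauss_cdf_def)
  ultimately show ?thesis using S.gaussian_limit[of x] by (simp only: S1)
qed

end

theorem theorem4p12:
  fixes c d :: nat and p :: "int \<Rightarrow> real" and q :: real
  assumes c_pos: "c \<ge> 1" and d_pos: "d \<ge> 1"
    and p_nonneg: "\<forall>i. p i \<ge> 0"
    and p_supp: "\<forall>i. i < - int c \<or> i > int d \<longrightarrow> p i = 0"
    and p_c: "p (- int c) \<noteq> 0" and p_d: "p (int d) \<noteq> 0"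
    and aper: "aperiodic p"
    and q_pos: "q > 0"
  shows
    "(\<forall>r0. is_rho0 c d p q r0 \<and> r0 < rho c d p \<longrightarrow>
       (let Q = Qfun p q; Q1 = deriv Q r0; Q2 = deriv (deriv Q) r0;
            \<mu> = 1 / (r0 * Q1);
            \<sigma> = sqrt ((r0 * Q2 + Q1 - r0 * Q1\<^sup>2) / (r0\<^sup>2 * Q1 ^ 3))
        in \<forall>x::real. (\<lambda>n. \<Sum>k\<in>{k. k \<le> n \<and> (real k - \<mu> * real n) / (\<sigma> * sqrt (real n)) \<le> x}.
                              cat_prob p q n k)
                      \<longlonglongrightarrow> std_gauss_cdf x))
   \<and> (is_rho0 c d p q (rho c d p) \<longrightarrow>
       (let \<eta> = eta c d p q; theta = sqrt 2 / \<eta>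
        in (\<forall>x::real. x \<ge> 0 \<longrightarrow>
              (\<lambda>n. \<Sum>k\<in>{k. k \<le> n \<and> real k / (theta * sqrt (real n)) \<le> x}. cat_prob p q n k)
                \<longlonglongrightarrow> 1 - exp (- x\<^sup>2 / 2))
         \<and> (\<lambda>n. \<Sum>k\<le>n. real k * cat_prob p q n k) \<sim>[at_top] (\<lambda>n. sqrt (pi * real n) / \<eta>)))
   \<and> ((\<nexists>r0. is_rho0 c d p q r0) \<longrightarrow>
       (let \<eta> = eta c d p q; \<rho> = rho c d p; \<tau> = tau c d p; lam = Qfun p q \<rho>;
            Cc = sqrt (2 * jump_poly c d p \<tau> / deriv (deriv (jump_poly c d p)) \<tau>);
            Drho = 1 / (1 - Qfun p q \<rho>)
        in \<forall>k::nat. \<exists>g. g \<in> O(\<lambda>n. 1 / real n) \<and>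
             (\<forall>\<^sub>F n in at_top. cat_prob p q n k =
                (real k * \<eta> / lam + Cc / \<tau>) * lam ^ k / (\<eta> * Drho\<^sup>2 + (Cc / \<tau>) * Drho)
                * (1 + g n))))"
proof -
  interpret catastrophe_walk c d p q by unfold_locales (fact assms)+
  show ?thesis
    unfolding Let_def using supercritical critical subcritical by (intro conjI allI impI) auto
qed

end
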